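(* Let $\mathbf 0$ be the empty configuration and $\mathbf 1$ the configuration that is full in $\Lambda^-$ and empty in $\Lambda\setminus\Lambda^-$. For any $\epsilon>0$, $$\lim_{\beta\to\infty}\mathbb P_{\mathbf 0}\big(e^{\beta(\Gamma^{\text{K-Hex}}-\epsilon)}<\tau_{\mathbf 1}<e^{\beta(\Gamma^{\text{K-Hex}}+\epsilon)}\big)=1,\qquad \lim_{\beta\to\infty}\frac1\beta\log\mathbb E_{\mathbf 0}\tau_{\mathbf 1}=\Gamma^{\text{K-Hex}}.$$ Moreover, letting $T_\beta:=\inf\{n\ge1:\mathbb P_{\mathbf 0}(\tau_{\mathbf 1}\le n)\ge1-e^{-1}\}$, for every $t>0$ $$\lim_{\beta\to\infty}\mathbb P_{\mathbf 0}(\tau_{\mathbf 1}>tT_\beta)=e^{-t},\qquad\text{and}\qquad \lim_{\beta\to\infty}\frac{\mathbb E_{\mathbf 0}\tau_{\mathbf 1}}{T_\beta}=1.$$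
   Context: Model. $\mathbb H^2$ is the discrete hexagonal lattice, with dual the triangular lattice $\mathbb T^2$; each site of $\mathbb H^2$ is the center of a triangular face of $\mathbb T^2$ (edge length of $\mathbb{T}^2$ taken as unit of length), two sites are nearest neighbors if they share an edge of $\mathbb H^2$, and $|x-y|$ is the lattice distance. Fix an integer $L\ge 1$ and a regular hexagon of radius (side length) $L$ with sides along $\mathbb T^2$; it contains $6L^2$ sites. $\Lambda\subset\mathbb H^2$ is the union of this hexagon and all sites not in it at lattice distance one from it. Put $\partial^-\Lambda=\{x\in\Lambda:\exists y\notin\Lambda,\ |y-x|=1\}$ and $\Lambda^-=\Lambda\setminus\partial^-\Lambda$ (so $\Lambda^-$ is the hexagon of radius $L$). Configurations: $\eta\in\mathcal X=\{0,1\}^\Lambda$ ($\eta(x)=1$: occupied by a particle). Hamiltonian: $H(\eta)=-U\sum_{\{x,y\}}\eta(x)\eta(y)+\Delta\sum_{x\in\Lambda}\eta(x)$, the first sum over unordered nearest-neighbor pairs in $\Lambda^-$. Kawasaki dynamics. Let $\bar\Lambda^{*,orie}$ be the set of oriented nearest-neighbor bonds $(x\to y)$ with $x,y\in\Lambda$, or $x\in\partial^-\Lambda,y\notin\Lambda$, or $x\notin\Lambda,y\in\partial^-\Lambda$. $T_b\eta$ is obtained from $\eta$ by exchanging the values at $x,y$ (first case), setting $\eta(x)=0$ (second case), setting $\eta(y)=1$ (third case). The discrete-time Markov chain $(\eta_t)_{t\in\mathbb N}$ has, for $\eta\ne\eta'$, $P(\eta,\eta')=|\bar\Lambda^{*,orie}|^{-1}e^{-\beta[H(\eta')-H(\eta)]_+}$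 if $\eta'=T_b\eta$ for some $b\in\bar\Lambda^{*,orie}$, and $0$ otherwise; $P(\eta,\eta)=1-\sum_{\eta'\ne\eta}P(\eta,\eta')$. Here $\beta>0$ is the inverse temperature. $\mathbb P_\eta,\mathbb E_\eta$ denote law and expectation of the chain started at $\eta$; $\tau_{\mathcal A}=\min\{t\ge0:\eta_t\in\mathcal A\}$ and $\tau_\eta=\tau_{\{\eta\}}$. Standing assumptions. $U>0$, $\Delta\in(U,\frac32U)$, $3U-2\Delta\ll U$ (it is enough that $3U-2\Delta\le U/100$), $\frac{U}{2(3U-2\Delta)}-\frac12$ is not an integer. The critical radius is $r^*=\lfloor\frac{U}{2(3U-2\Delta)}-\frac12\rfloor$ and $\delta\in(0,1)$ is the fractional part of $\frac{U}{2(3U-2\Delta)}-\frac12$; $\delta\neq\frac12$. The volume $\Lambda$ is fixed and large: $L>2r^*+3$. $\Gamma^{\text{K-Hex}}=\Gamma_1^*$ if $\delta\in(0,\frac12)$ and $\Gamma_2^*$ if $\delta\in(\frac12,1)$, where $\Gamma_1^*=-3(3(r^* )^2-r^* )U+6(r^* )^2\Delta+5(2r^*+1)\Delta-(15r^*+4)U+\Delta$ and $\Gamma_2^*=-3(3(r^*+1)^2-(r^*+1))U+6(r^*+1)^2\Delta+(2r^*+3)\Delta-3(r^*+1)U+\Delta$. *)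

theory Defs
  imports "HOL-Probability.Probability"
begin

section \<open>The lattice and the box\<close>

text \<open>
  A vertex \<open>a e\<^sub>1 + b e\<^sub>2\<close> of the triangular lattice, with \<open>e\<^sub>1 = (1, 0)\<close> and
  \<open>e\<^sub>2 = (1/2, sqrt 3 / 2)\<close>, is represented by the pair \<open>(a, b)\<close>. A site of the hexagonal
  lattice is represented by the triangular face of which it is the center.
\<close>

datatype site = Up int int | Down int int

fun corners :: "site \<Rightarrow> (int \<times> int) set" where
  "corners (Up a b) = {(a, b), (a + 1, b), (a, b + 1)}"
| "corners (Down a b) = {(a + 1, b), (a, b + 1), (a + 1, b + 1)}"

text \<open>
  Two sites are nearest neighbors (i.e. at lattice distance one) iff they are joined by an edge of
  the hexagonal lattice, i.e. iff the two faces have a common side.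
\<close>

definition nn :: "site \<Rightarrow> site \<Rightarrow> bool" where
  "nn x y \<longleftrightarrow> x \<noteq> y \<and> card (corners x \<inter> corners y) = 2"

text \<open>
  The regular hexagon of side length \<open>L\<close> centered at the origin with sides along the triangular
  lattice is cut out by \<open>\<bar>a\<bar> \<le> L\<close>, \<open>\<bar>b\<bar> \<le> L\<close>, \<open>\<bar>a + b\<bar> \<le> L\<close>; its sides have directions
  \<open>e\<^sub>2\<close>, \<open>e\<^sub>1\<close> and \<open>e\<^sub>2 - e\<^sub>1\<close> respectively. By convexity it contains a face iff it contains the
  corners of the face.
\<close>

definition hexagon :: "nat \<Rightarrow> site set" where
  "hexagon L =
     {x. \<forall>(a, b) \<in> corners x. \<bar>a\<bar> \<le> int L \<and> \<bar>b\<bar> \<le> int L \<and> \<bar>a + b\<bar> \<le> int L}"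

definition vol :: "nat \<Rightarrow> site set" where
  "vol L = hexagon L \<union> {x. x \<notin> hexagon L \<and> (\<exists>y\<in>hexagon L. nn x y)}"

definition inner_bdry :: "nat \<Rightarrow> site set" where
  "inner_bdry L = {x \<in> vol L. \<exists>y. y \<notin> vol L \<and> nn y x}"

definition vol_minus :: "nat \<Rightarrow> site set" where
  "vol_minus L = vol L - inner_bdry L"

section \<open>Configurations and Hamiltonian\<close>

type_synonym config = "site \<Rightarrow> nat"

definition configs :: "nat \<Rightarrow> config set" where
  "configs L = vol L \<rightarrow>\<^sub>E {0, 1}"

definition empty_config :: "nat \<Rightarrow> config" where
  "empty_config L = (\<lambda>x\<in>vol L. 0)"

definition full_config :: "nat \<Rightarrow> config" where
  "full_config L = (\<lambda>x\<in>vol L. if x \<in> vol_minus L then 1 else 0)"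

text \<open>Unordered bonds are two-element sets \<open>{x, y}\<close>, so the product over such a bond is
  \<open>\<eta> x * \<eta> y\<close>.\<close>

definition hamiltonian :: "nat \<Rightarrow> real \<Rightarrow> real \<Rightarrow> config \<Rightarrow> real" where
  "hamiltonian L U \<Delta> \<eta> =
     - U * (\<Sum>e \<in> {{x, y} | x y. x \<in> vol_minus L \<and> y \<in> vol_minus L \<and> nn x y}.
              \<Prod>z\<in>e. real (\<eta> z))
     + \<Delta> * (\<Sum>x\<in>vol L. real (\<eta> x))"

section \<open>Kawasaki dynamics\<close>

definition obonds :: "nat \<Rightarrow> (site \<times> site) set" where
  "obonds L = {(x, y). nn x y \<and>
     (x \<in> vol L \<and> y \<in> vol L \<or> x \<in> inner_bdry L \<and> y \<notin> vol L \<or>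
      x \<notin> vol L \<and> y \<in> inner_bdry L)}"

definition bond_move :: "nat \<Rightarrow> site \<times> site \<Rightarrow> config \<Rightarrow> config" where
  "bond_move L b \<eta> = (case b of (x, y) \<Rightarrow>
     if x \<in> vol L \<and> y \<in> vol L then \<eta>(x := \<eta> y, y := \<eta> x)
     else if x \<in> vol L then \<eta>(x := 0)
     else \<eta>(y := 1))"

definition kawasaki_rate :: "nat \<Rightarrow> real \<Rightarrow> real \<Rightarrow> real \<Rightarrow> config \<Rightarrow> config \<Rightarrow> real" where
  "kawasaki_rate L U \<Delta> \<beta> \<eta> \<eta>' =
     (if \<exists>b\<in>obonds L. \<eta>' = bond_move L b \<eta>
      then exp (- \<beta> * max 0 (hamiltonian L U \<Delta> \<eta>' - hamiltonian L U \<Delta> \<eta>)) / real (card (obonds L))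
      else 0)"

definition kawasaki_P :: "nat \<Rightarrow> real \<Rightarrow> real \<Rightarrow> real \<Rightarrow> config \<Rightarrow> config \<Rightarrow> real" where
  "kawasaki_P L U \<Delta> \<beta> \<eta> \<eta>' =
     (if \<eta>' \<noteq> \<eta> then kawasaki_rate L U \<Delta> \<beta> \<eta> \<eta>'
      else 1 - (\<Sum>\<zeta> \<in> configs L - {\<eta>}. kawasaki_rate L U \<Delta> \<beta> \<eta> \<zeta>))"

section \<open>Markov chains and hitting times\<close>

definition markov_chain ::
    "'s set \<Rightarrow> ('s \<Rightarrow> 's \<Rightarrow> real) \<Rightarrow> 's \<Rightarrow> 'w measure \<Rightarrow> (nat \<Rightarrow> 'w \<Rightarrow> 's) \<Rightarrow> bool" where
  "markov_chain S p s M X \<longleftrightarrow>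
     prob_space M \<and>
     (\<forall>t. X t \<in> M \<rightarrow>\<^sub>M count_space S) \<and>
     (AE \<omega> in M. X 0 \<omega> = s) \<and>
     (\<forall>t u. \<forall>y\<in>S. \<P>(\<omega> in M. \<forall>i\<le>t. X i \<omega> = u i) > 0 \<longrightarrow>
        \<P>(\<omega> in M. X (Suc t) \<omega> = y \<bar> \<forall>i\<le>t. X i \<omega> = u i) = p (u t) y)"

text \<open>The infimum of the empty set is \<open>\<infinity>\<close>.\<close>

definition hitting_time :: "(nat \<Rightarrow> 'w \<Rightarrow> 's) \<Rightarrow> 's set \<Rightarrow> 'w \<Rightarrow> enat" where
  "hitting_time X A \<omega> = Inf (enat ` {t. X t \<omega> \<in> A})"

section \<open>Critical radius and energy barrier\<close>

definition r_arg :: "real \<Rightarrow> real \<Rightarrow> real" where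
  "r_arg U \<Delta> = U / (2 * (3 * U - 2 * \<Delta>)) - 1 / 2"

definition r_star :: "real \<Rightarrow> real \<Rightarrow> int" where
  "r_star U \<Delta> = \<lfloor>r_arg U \<Delta>\<rfloor>"

definition \<delta>_frac :: "real \<Rightarrow> real \<Rightarrow> real" where
  "\<delta>_frac U \<Delta> = frac (r_arg U \<Delta>)"

definition \<Gamma>1 :: "real \<Rightarrow> real \<Rightarrow> real" where
  "\<Gamma>1 U \<Delta> = (let r = real_of_int (r_star U \<Delta>) in
     - 3 * (3 * r^2 - r) * U + 6 * r^2 * \<Delta> + 5 * (2 * r + 1) * \<Delta> - (15 * r + 4) * U + \<Delta>)"

definition \<Gamma>2 :: "real \<Rightarrow> real \<Rightarrow> real" where
  "\<Gamma>2 U \<Delta> = (let r = real_of_int (r_star U \<Delta>) in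
     - 3 * (3 * (r + 1)^2 - (r + 1)) * U + 6 * (r + 1)^2 * \<Delta> + (2 * r + 3) * \<Delta>
     - 3 * (r + 1) * U + \<Delta>)"

definition \<Gamma>_KHex :: "real \<Rightarrow> real \<Rightarrow> real" where
  "\<Gamma>_KHex U \<Delta> = (if \<delta>_frac U \<Delta> < 1 / 2 then \<Gamma>1 U \<Delta> else \<Gamma>2 U \<Delta>)"

section \<open>Sanity checks\<close>

text \<open>
  The interior of the volume is the hexagon, the transition matrix is stochastic, and the chain
  has a realization.
\<close>

lemma nn_simps:
  "\<not> nn (Up a b) (Up c d)" "\<not> nn (Down a b) (Down c d)"
  "nn (Up a b) (Down c d) \<longleftrightarrow> (c = a \<and> d = b) \<or> (c = a - 1 \<and> d = b) \<or> (c = a \<and> d = b - 1)"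
  "nn (Down c d) (Up a b) \<longleftrightarrow> (c = a \<and> d = b) \<or> (c = a - 1 \<and> d = b) \<or> (c = a \<and> d = b - 1)"
proof -
  have card2: "card (A \<inter> {p, q, r}) =
      (if p \<in> A then 1 else 0) + (if q \<in> A then 1 else 0) + (if r \<in> A then 1 else 0)"
    if "p \<noteq> q" "p \<noteq> r" "q \<noteq> r" for A and p q r :: "int \<times> int"
    using that by (simp add: Int_insert_right)
  show "\<not> nn (Up a b) (Up c d)"
    unfolding nn_def corners.simps by (subst card2) auto
  show "\<not> nn (Down a b) (Down c d)"
    unfolding nn_def corners.simps by (subst card2) auto
  show *: "nn (Up a b) (Down c d) \<longleftrightarrow> (c = a \<and> d = b) \<or> (c = a - 1 \<and> d = b) \<or> (c = a \<and> d = b - 1)"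
    unfolding nn_def corners.simps by (subst card2) auto
  show "nn (Down c d) (Up a b) \<longleftrightarrow> (c = a \<and> d = b) \<or> (c = a - 1 \<and> d = b) \<or> (c = a \<and> d = b - 1)"
    using * by (auto simp: nn_def Int_commute)
qed

lemma vol_minus_eq_hexagon: "vol_minus L = hexagon L"
proof -
  have hex: "Up a b \<in> hexagon L \<longleftrightarrow> - int L \<le> a \<and> a < int L \<and> - int L \<le> b \<and> b < int L \<and>
               - int L \<le> a + b \<and> a + b < int L"
    "Down a b \<in> hexagon L \<longleftrightarrow> - int L \<le> a \<and> a < int L \<and> - int L \<le> b \<and> b < int L \<and>
               - int L \<le> a + b + 1 \<and> a + b + 1 < int L" for a b
    by (auto simp: hexagon_def)
  have Bex_nn: "(\<exists>y. P y \<and> nn (Up a b) y) \<longleftrightarrow> P (Down a b) \<or> P (Down (a - 1) b) \<or> P (Down a (b - 1))"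
    "(\<exists>y. P y \<and> nn (Down a b) y) \<longleftrightarrow> P (Up a b) \<or> P (Up (a + 1) b) \<or> P (Up a (b + 1))" for P a b
  proof -
    have ex: "(\<exists>y. Q y) \<longleftrightarrow> (\<exists>c d. Q (Up c d)) \<or> (\<exists>c d. Q (Down c d))" for Q
      by (metis site.exhaust)
    show "(\<exists>y. P y \<and> nn (Up a b) y) \<longleftrightarrow> P (Down a b) \<or> P (Down (a - 1) b) \<or> P (Down a (b - 1))"
      unfolding ex by (auto simp: nn_simps)
    show "(\<exists>y. P y \<and> nn (Down a b) y) \<longleftrightarrow> P (Up a b) \<or> P (Up (a + 1) b) \<or> P (Up a (b + 1))"
      unfolding ex by (auto simp: nn_simps) (metis add_diff_cancel_right')+
  qed
  have sym: "nn x y \<longleftrightarrow> nn y x" for x y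
    by (auto simp: nn_def Int_commute)
  have vol: "x \<in> vol L \<longleftrightarrow> x \<in> hexagon L \<or> (\<exists>y. y \<in> hexagon L \<and> nn x y)" for x
    by (auto simp: vol_def)
  have minus: "x \<in> vol_minus L \<longleftrightarrow> x \<in> vol L \<and> \<not> (\<exists>y. y \<notin> vol L \<and> nn x y)" for x
    by (auto simp: vol_minus_def inner_bdry_def sym)
  have "x \<in> vol_minus L" if "x \<in> hexagon L" for x
    using that sym by (auto simp: minus vol)
  moreover have "x \<in> hexagon L" if "x \<in> vol_minus L" for x
  proof (rule ccontr)
    assume neg: "x \<notin> hexagon L"
    show False
    proof (cases x)
      case (Up a b)
      then have "Down a b \<in> hexagon L \<or> Down (a - 1) b \<in> hexagon L \<or> Down a (b - 1) \<in> hexagon L"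
        "Down a b \<in> vol L" "Down (a - 1) b \<in> vol L" "Down a (b - 1) \<in> vol L"
        using that neg unfolding minus vol[of x] by (auto simp: Bex_nn)
      then show False
        using neg unfolding Up vol Bex_nn hex by (smt (verit))
    next
      case (Down a b)
      then have "Up a b \<in> hexagon L \<or> Up (a + 1) b \<in> hexagon L \<or> Up a (b + 1) \<in> hexagon L"
        "Up a b \<in> vol L" "Up (a + 1) b \<in> vol L" "Up a (b + 1) \<in> vol L"
        using that neg unfolding minus vol[of x] by (auto simp: Bex_nn)
      then show False
        using neg unfolding Down vol Bex_nn hex by (smt (verit))
    qed
  qed
  ultimately show ?thesis by blast
qed

lemma finite_nn_ball:
  "finite {x. \<exists>(a, b) \<in> corners x. \<bar>a\<bar> \<le> K \<and> \<bar>b\<bar> \<le> K}"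
proof (rule finite_subset)
  show "{x. \<exists>(a, b) \<in> corners x. \<bar>a\<bar> \<le> K \<and> \<bar>b\<bar> \<le> K}
    \<subseteq> (\<lambda>(a, b). Up a b) ` ({- K - 1..K + 1} \<times> {- K - 1..K + 1})
      \<union> (\<lambda>(a, b). Down a b) ` ({- K - 1..K + 1} \<times> {- K - 1..K + 1})"
  proof
    fix x assume "x \<in> {x. \<exists>(a, b) \<in> corners x. \<bar>a\<bar> \<le> K \<and> \<bar>b\<bar> \<le> K}"
    then show "x \<in> (\<lambda>(a, b). Up a b) ` ({- K - 1..K + 1} \<times> {- K - 1..K + 1})
      \<union> (\<lambda>(a, b). Down a b) ` ({- K - 1..K + 1} \<times> {- K - 1..K + 1})"
      by (cases x) (auto simp: image_iff)
  qed
qed simp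

lemma finite_neighbors: "finite {x. nn x y}"
proof (cases y)
  case (Up a b)
  have "{x. nn x y} \<subseteq> {Down a b, Down (a - 1) b, Down a (b - 1)}"
  proof
    fix x assume "x \<in> {x. nn x y}"
    then show "x \<in> {Down a b, Down (a - 1) b, Down a (b - 1)}"
      by (cases x) (auto simp: nn_simps Up)
  qed
  then show ?thesis by (rule finite_subset) simp
next
  case (Down a b)
  have "{x. nn x y} \<subseteq> {Up a b, Up (a + 1) b, Up a (b + 1)}"
  proof
    fix x assume "x \<in> {x. nn x y}"
    then show "x \<in> {Up a b, Up (a + 1) b, Up a (b + 1)}"
      by (cases x) (auto simp: nn_simps Down)
  qed
  then show ?thesis by (rule finite_subset) simp
qed

lemma finite_vol: "finite (vol L)"
proof -
  have "hexagon L \<subseteq> {x. \<exists>(a, b) \<in> corners x. \<bar>a\<bar> \<le> int L \<and> \<bar>b\<bar> \<le> int L}"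
  proof
    fix x assume "x \<in> hexagon L"
    then show "x \<in> {x. \<exists>(a, b) \<in> corners x. \<bar>a\<bar> \<le> int L \<and> \<bar>b\<bar> \<le> int L}"
      by (cases x) (auto simp: hexagon_def)
  qed
  then have fin: "finite (hexagon L)"
    using finite_nn_ball by (rule finite_subset)
  have "vol L \<subseteq> hexagon L \<union> (\<Union>y\<in>hexagon L. {x. nn x y})"
    by (auto simp: vol_def)
  then show ?thesis
    by (rule finite_subset) (simp add: fin finite_neighbors)
qed

lemma finite_configs: "finite (configs L)"
  unfolding configs_def by (intro finite_PiE finite_vol) auto

lemma finite_obonds: "finite (obonds L)"
proof (rule finite_subset)
  let ?N = "vol L \<union> (\<Union>y\<in>vol L. {x. nn x y})"
  have "nn x y \<longleftrightarrow> nn y x" for x y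
    by (auto simp: nn_def Int_commute)
  then show "obonds L \<subseteq> ?N \<times> ?N"
    by (auto simp: obonds_def inner_bdry_def)
  show "finite (?N \<times> ?N)"
    by (simp add: finite_vol finite_neighbors)
qed

lemma kawasaki_P_stochastic:
  assumes "\<beta> > 0" "\<eta> \<in> configs L"
  shows "kawasaki_P L U \<Delta> \<beta> \<eta> \<eta>' \<ge> 0" "(\<Sum>\<zeta>\<in>configs L. kawasaki_P L U \<Delta> \<beta> \<eta> \<zeta>) = 1"
proof -
  let ?R = "kawasaki_rate L U \<Delta> \<beta> \<eta>" and ?B = "(\<lambda>b. bond_move L b \<eta>) ` obonds L"
  have R0: "?R \<zeta> \<ge> 0" for \<zeta>
    by (simp add: kawasaki_rate_def)
  have R1: "?R \<zeta> \<le> (if \<zeta> \<in> ?B then 1 / real (card (obonds L)) else 0)" for \<zeta>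
    using assms(1) by (auto simp: kawasaki_rate_def intro!: divide_right_mono)
  have "(\<Sum>\<zeta>\<in>configs L - {\<eta>}. ?R \<zeta>)
      \<le> (\<Sum>\<zeta>\<in>configs L - {\<eta>}. if \<zeta> \<in> ?B then 1 / real (card (obonds L)) else 0)"
    by (intro sum_mono R1)
  also have "\<dots> = real (card ((configs L - {\<eta>}) \<inter> ?B)) / real (card (obonds L))"
    by (simp add: sum.If_cases finite_configs Int_def)
  also have "\<dots> \<le> real (card (obonds L)) / real (card (obonds L))"
  proof (intro divide_right_mono)
    have "card ((configs L - {\<eta>}) \<inter> ?B) \<le> card ?B"
      by (intro card_mono) (auto simp: finite_obonds)
    also have "\<dots> \<le> card (obonds L)"
      by (rule card_image_le) (rule finite_obonds)
    finally show "real (card ((configs L - {\<eta>}) \<inter> ?B)) \<le> real (card (obonds L))" by simp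
  qed simp
  also have "\<dots> \<le> 1" by simp
  finally have le1: "(\<Sum>\<zeta>\<in>configs L - {\<eta>}. ?R \<zeta>) \<le> 1" .
  show "kawasaki_P L U \<Delta> \<beta> \<eta> \<eta>' \<ge> 0"
    using R0 le1 by (auto simp: kawasaki_P_def)
  have "(\<Sum>\<zeta>\<in>configs L. kawasaki_P L U \<Delta> \<beta> \<eta> \<zeta>)
      = kawasaki_P L U \<Delta> \<beta> \<eta> \<eta> + (\<Sum>\<zeta>\<in>configs L - {\<eta>}. kawasaki_P L U \<Delta> \<beta> \<eta> \<zeta>)"
    by (rule sum.remove) (use assms finite_configs in auto)
  also have "(\<Sum>\<zeta>\<in>configs L - {\<eta>}. kawasaki_P L U \<Delta> \<beta> \<eta> \<zeta>) = (\<Sum>\<zeta>\<in>configs L - {\<eta>}. ?R \<zeta>)"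
    by (intro sum.cong) (auto simp: kawasaki_P_def)
  finally show "(\<Sum>\<zeta>\<in>configs L. kawasaki_P L U \<Delta> \<beta> \<eta> \<zeta>) = 1"
    by (simp add: kawasaki_P_def)
qed

text \<open>Realization of a finite Markov chain by independent, identically distributed random maps.\<close>

lemma markov_chain_exists:
  fixes p :: "'s \<Rightarrow> 's \<Rightarrow> real"
  assumes fin: "finite S" and s: "s \<in> S"
    and nonneg: "\<And>x y. x \<in> S \<Longrightarrow> y \<in> S \<Longrightarrow> p x y \<ge> 0"
    and sum1: "\<And>x. x \<in> S \<Longrightarrow> (\<Sum>y\<in>S. p x y) = 1"
  shows "\<exists>(M :: (nat \<Rightarrow> 's \<Rightarrow> 's) measure) X. markov_chain S p s M X"
proof -
  have "\<exists>q. set_pmf q \<subseteq> S \<and> (\<forall>y\<in>S. pmf q y = p x y)" if x: "x \<in> S" for x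
  proof -
    let ?f = "\<lambda>y. if y \<in> S then p x y else 0"
    have nn: "\<And>y. ?f y \<ge> 0" using nonneg x by auto
    have "(\<integral>\<^sup>+y. ennreal (?f y) \<partial>count_space UNIV) = (\<Sum>y\<in>S. ennreal (?f y))"
      by (rule nn_integral_count_space') (use fin in auto)
    also have "\<dots> = ennreal (\<Sum>y\<in>S. ?f y)"
      by (rule sum_ennreal) (rule nn)
    also have "(\<Sum>y\<in>S. ?f y) = 1" using sum1[OF x] by simp
    finally have *: "(\<integral>\<^sup>+y. ennreal (?f y) \<partial>count_space UNIV) = 1" by simp
    have "pmf (embed_pmf ?f) y = ?f y" for y
      by (rule pmf_embed_pmf) (use nn * in auto)
    then show ?thesis
      by (intro exI[of _ "embed_pmf ?f"]) (auto simp: set_pmf_eq)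
  qed
  then obtain K where K: "\<And>x. x \<in> S \<Longrightarrow> set_pmf (K x) \<subseteq> S"
    "\<And>x y. x \<in> S \<Longrightarrow> y \<in> S \<Longrightarrow> pmf (K x) y = p x y"
    by metis
  define D where "D = Pi_pmf S undefined K"
  define M where "M = Pi\<^sub>M (UNIV :: nat set) (\<lambda>_. measure_pmf D)"
  define X where "X t \<omega> = rec_nat s (\<lambda>n x. if \<omega> n x \<in> S then \<omega> n x else s) t"
    for t and \<omega> :: "nat \<Rightarrow> 's \<Rightarrow> 's"
  have X_simps: "X 0 \<omega> = s" "X (Suc t) \<omega> = (if \<omega> t (X t \<omega>) \<in> S then \<omega> t (X t \<omega>) else s)" for t \<omega>
    by (simp_all add: X_def)
  have X_S: "X t \<omega> \<in> S" for t \<omega>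
    by (cases t) (auto simp: X_simps s)
  interpret product_prob_space "\<lambda>_. measure_pmf D" "UNIV :: nat set"
    by standard
  have "prob_space M" unfolding M_def by (rule prob_space_PiM) (rule measure_pmf.prob_space_axioms)
  then interpret M: prob_space M .
  have space_M: "space M = UNIV" by (simp add: M_def space_PiM)
  have coord: "{\<omega>. \<omega> t \<in> A} \<in> sets M" for t A
  proof -
    have "(\<lambda>\<omega>. \<omega> t) \<in> M \<rightarrow>\<^sub>M measure_pmf D"
      unfolding M_def by (rule measurable_component_singleton) simp
    from measurable_sets[OF this, of A] show ?thesis
      by (simp add: space_M vimage_def)
  qed
  have ev: "{\<omega>. X t \<omega> = y} \<in> sets M" for t y
  proof (induction t arbitrary: y)
    case 0
    show ?case by (cases "y = s") (use sets.top[of M] in \<open>auto simp: X_simps space_M\<close>)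
  next
    case (Suc t)
    have "{\<omega>. X (Suc t) \<omega> = y} =
        (\<Union>x\<in>S. {\<omega>. X t \<omega> = x} \<inter> {\<omega>. \<omega> t \<in> {f. (if f x \<in> S then f x else s) = y}})"
      using X_S by (auto simp: X_simps)
    also have "\<dots> \<in> sets M"
      by (intro sets.finite_UN fin sets.Int Suc coord)
    finally show ?case .
  qed
  have meas: "X t \<in> M \<rightarrow>\<^sub>M count_space S" for t
    by (rule measurable_count_space_eq2[THEN iffD2])
      (use fin X_S ev in \<open>auto simp: space_M vimage_def\<close>)
  have path: "\<P>(\<omega> in M. \<forall>i\<le>t. X i \<omega> = u i) = (\<Prod>i<t. p (u i) (u (Suc i)))"
    if u0: "u 0 = s" and uS: "\<And>i. i \<le> t \<Longrightarrow> u i \<in> S" for t u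
  proof -
    define A where "A i = {f. (if f (u i) \<in> S then f (u i) else s) = u (Suc i)}" for i
    have eq: "(\<forall>i\<le>t'. X i \<omega> = u i) \<longleftrightarrow> (\<forall>i<t'. \<omega> i \<in> A i)" for t' \<omega>
    proof (induction t')
      case 0 show ?case by (simp add: X_simps u0)
    next
      case (Suc t')
      have "(\<forall>i\<le>Suc t'. X i \<omega> = u i) \<longleftrightarrow> (\<forall>i\<le>t'. X i \<omega> = u i) \<and> X (Suc t') \<omega> = u (Suc t')"
        by (auto simp: le_Suc_eq)
      also have "\<dots> \<longleftrightarrow> (\<forall>i\<le>t'. X i \<omega> = u i) \<and> \<omega> t' \<in> A t'"
        by (auto simp: X_simps A_def)
      also have "\<dots> \<longleftrightarrow> (\<forall>i<Suc t'. \<omega> i \<in> A i)"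
        using Suc by (auto simp: less_Suc_eq)
      finally show ?case .
    qed
    have "{\<omega> \<in> space M. \<forall>i\<le>t. X i \<omega> = u i} = prod_emb UNIV (\<lambda>_. measure_pmf D) {..<t} (Pi\<^sub>E {..<t} A)"
      unfolding eq by (rule set_eqI) (simp add: prod_emb_iff space_M PiE_iff Ball_def)
    then have "\<P>(\<omega> in M. \<forall>i\<le>t. X i \<omega> = u i) = (\<Prod>i<t. measure_pmf.prob D (A i))"
      unfolding M_def by (simp only:) (rule measure_PiM_emb, auto)
    also have "\<dots> = (\<Prod>i<t. p (u i) (u (Suc i)))"
    proof (rule prod.cong)
      fix i assume "i \<in> {..<t}"
      then have ui: "u i \<in> S" "u (Suc i) \<in> S" using uS by auto
      have "K (u i) = map_pmf (\<lambda>f. f (u i)) D"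
        unfolding D_def using fin ui by (simp add: Pi_pmf_component)
      then have "measure_pmf.prob D (A i)
          = measure_pmf.prob (K (u i)) {z. (if z \<in> S then z else s) = u (Suc i)}"
        by (simp add: vimage_def A_def)
      also have "\<dots> = measure_pmf.prob (K (u i)) {u (Suc i)}"
        by (rule measure_pmf.finite_measure_eq_AE)
          (use K(1)[OF ui(1)] in \<open>auto simp: AE_measure_pmf_iff\<close>)
      also have "\<dots> = p (u i) (u (Suc i))"
        using K(2)[OF ui] by (simp add: measure_pmf_single)
      finally show "measure_pmf.prob D (A i) = p (u i) (u (Suc i))" .
    qed simp
    finally show ?thesis .
  qed
  have "markov_chain S p s M X"
    unfolding markov_chain_def
  proof (intro conjI allI ballI impI)
    show "prob_space M" by fact
    show "X t \<in> M \<rightarrow>\<^sub>M count_space S" for t by (rule meas)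
    show "AE \<omega> in M. X 0 \<omega> = s" by (simp add: X_simps)
    fix t u y
    assume y: "y \<in> S" and pos: "\<P>(\<omega> in M. \<forall>i\<le>t. X i \<omega> = u i) > 0"
    then have "{\<omega> \<in> space M. \<forall>i\<le>t. X i \<omega> = u i} \<noteq> {}" by (metis measure_empty less_irrefl)
    then obtain \<omega> where w: "\<forall>i\<le>t. X i \<omega> = u i" by auto
    have u0: "u 0 = s" and uS: "\<And>i. i \<le> t \<Longrightarrow> u i \<in> S"
      using w X_S X_simps(1) by (metis le0, metis)
    define v where "v = u(Suc t := y)"
    have v: "v 0 = s" "\<And>i. i \<le> Suc t \<Longrightarrow> v i \<in> S"
      using u0 uS y by (auto simp: v_def le_Suc_eq)
    have "(X (Suc t) \<omega> = y \<and> (\<forall>i\<le>t. X i \<omega> = u i)) \<longleftrightarrow> (\<forall>i\<le>Suc t. X i \<omega> = v i)" for \<omega>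
      by (auto simp: v_def le_Suc_eq)
    then have "\<P>(\<omega> in M. X (Suc t) \<omega> = y \<and> (\<forall>i\<le>t. X i \<omega> = u i)) = (\<Prod>i<Suc t. p (v i) (v (Suc i)))"
      using path[of v "Suc t"] v by simp
    also have "\<dots> = (\<Prod>i<t. p (u i) (u (Suc i))) * p (u t) y"
      by (simp add: v_def)
    also have "(\<Prod>i<t. p (u i) (u (Suc i))) = \<P>(\<omega> in M. \<forall>i\<le>t. X i \<omega> = u i)"
      using path[of u t] u0 uS by simp
    finally show "\<P>(\<omega> in M. X (Suc t) \<omega> = y \<bar> \<forall>i\<le>t. X i \<omega> = u i) = p (u t) y"
      using pos by (simp add: cond_prob_def)
  qed
  then show ?thesis by blast
qed

lemma kawasaki_chain_exists:
  assumes "\<beta> > 0"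
  shows "\<exists>(M :: (nat \<Rightarrow> config \<Rightarrow> config) measure) \<eta>.
    markov_chain (configs L) (kawasaki_P L U \<Delta> \<beta>) (empty_config L) M \<eta>"
proof (rule markov_chain_exists)
  show "finite (configs L)" by (rule finite_configs)
  show "empty_config L \<in> configs L" by (auto simp: empty_config_def configs_def)
  show "kawasaki_P L U \<Delta> \<beta> x y \<ge> 0" if "x \<in> configs L" for x y
    using assms that by (rule kawasaki_P_stochastic)
  show "(\<Sum>y\<in>configs L. kawasaki_P L U \<Delta> \<beta> x y) = 1" if "x \<in> configs L" for x
    using assms that by (rule kawasaki_P_stochastic)
qed

end

theory Submission imports Defs begin

text \<open>Let \<open>f \<beta> n\<close> be the probability that the chain started at the empty configuration has not reached
  the full one by time \<open>n\<close>. A Dirichlet form estimate shows that if from every state one can go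
  downhill in energy across barriers of height at most \<open>V\<close>, except from the target set, then the expected
  time to reach the target set is at most of order \<open>exp (\<beta> V)\<close>; reversibility shows that the communication
  height \<open>\<Gamma>\<close> between the empty and the full configuration bounds \<open>f\<close> from below. If all other states have
  barriers at most \<open>V < \<Gamma>\<close>, the chain returns to the empty configuration or exits on a time scale
  that is negligible compared to \<open>exp (\<beta> \<Gamma>)\<close>, so \<open>f\<close> is nearly multiplicative and hence
  asymptotically exponential.

  The communication height is bounded below by the isoperimetric inequality on the hexagonal lattice,
  used at one critical number of particles, and above by filling concentric hexagons row by row. For
  the other states, a small cluster that is held together by few bonds can be removed. Otherwise
  there is a hexagon of side 32 containing at least 64 particles; growing a hexagonal droplet
  on top of these particles is cheaper than growing it from nothing, because the energy is submodular.\<close>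

section \<open>Reversible dynamics at low temperature\<close>


text \<open>Everything turns on a margin between two heights. The energy
  \<open>hW x = 3 x U - 3 x^2 \<epsilon>\<close> of a hexagon of radius \<open>x\<close>, with
  \<open>\<epsilon> = 3 U - 2 \<Delta>\<close>, has maximum
  \<open>M = 3 U^2 / (4 \<epsilon>)\<close>, and \<Gamma> is at least \<open>M + 2.4 U\<close>. The
  obstacle is the conservation of particles: a site can be filled only by a particle brought in from
  the boundary. The exact height \<Gamma> is therefore computed on one path only, where each new
  site is joined to the boundary by vacant sites, so that the transport costs just \<Delta>. From an
  arbitrary configuration vacancies are pushed outwards at an extra cost of \<open>5 U\<close>.
  Droplet growth may then cost at most \<open>M - 2.7 U\<close>, and \<open>M + 2.3 U\<close> does
  not exceed \<open>\<Gamma> - U / 10\<close>. For radii below 32 the saving comes from the distance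
  of \<open>hW\<close> to its maximum, and from then on from the energy of the particles already
  present: 64 of them have perimeter at least 20. The condition
  \<open>\<epsilon> \<le> U / 100\<close> makes \<open>M\<close> at least \<open>75 U\<close>, so
  that removing small clusters at cost \<open>53 U\<close> is cheap as well.\<close>

locale metropolis =
  fixes S :: "'s set" and H :: "'s \<Rightarrow> real" and E :: "'s \<Rightarrow> 's \<Rightarrow> bool" and c :: real
    and p :: "real \<Rightarrow> 's \<Rightarrow> 's \<Rightarrow> real"
  assumes finite_S: "finite S" and c_pos: "c > 0"
    and E_sym: "\<And>x y. x \<in> S \<Longrightarrow> y \<in> S \<Longrightarrow> E x y \<Longrightarrow> E y x"
    and p_off_diagonal: "\<And>\<beta> x y. \<beta> > 0 \<Longrightarrow> x \<in> S \<Longrightarrow> y \<in> S \<Longrightarrow> x \<noteq> y \<Longrightarrow>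
      p \<beta> x y = (if E x y then c * exp (- \<beta> * max 0 (H y - H x)) else 0)"
    and p_nonneg: "\<And>\<beta> x y. \<beta> > 0 \<Longrightarrow> x \<in> S \<Longrightarrow> y \<in> S \<Longrightarrow> p \<beta> x y \<ge> 0"
    and p_sum: "\<And>\<beta> x. \<beta> > 0 \<Longrightarrow> x \<in> S \<Longrightarrow> (\<Sum>y\<in>S. p \<beta> x y) = 1"
begin

text \<open>The energy bound is attached to the steps, so the path without steps is admissible at
  every level, even below \<open>H x\<close>.\<close>

definition reach :: "real \<Rightarrow> 's \<Rightarrow> 's \<Rightarrow> bool" where
  "reach h = (\<lambda>x y. x \<in> S \<and> y \<in> S \<and> E x y \<and> H x \<le> h \<and> H y \<le> h)\<^sup>*\<^sup>*"

text \<open>Probability that the chain from \<open>x\<close> stays in \<open>D\<close> at all times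
  up to \<open>n\<close>, given by the backward recursion so that the estimates can do without a
  probability space.\<close>

primrec surv :: "'s set \<Rightarrow> real \<Rightarrow> nat \<Rightarrow> 's \<Rightarrow> real" where
  "surv D \<beta> 0 x = (if x \<in> D then 1 else 0)"
| "surv D \<beta> (Suc n) x = (if x \<in> D then (\<Sum>y\<in>S. p \<beta> x y * surv D \<beta> n y) else 0)"

definition mu :: "real \<Rightarrow> 's \<Rightarrow> real" where "mu \<beta> x = exp (- \<beta> * H x)"

text \<open>Twice the usual Dirichlet form, since each unordered pair occurs twice.\<close>

definition dirichlet :: "real \<Rightarrow> ('s \<Rightarrow> real) \<Rightarrow> real" where
  "dirichlet \<beta> f = (\<Sum>x\<in>S. \<Sum>y\<in>S. mu \<beta> x * p \<beta> x y * (f x - f y)\<^sup>2)"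

lemma mu_pos: "mu \<beta> x > 0"
  by (simp add: mu_def)

text \<open>The conductance depends on the higher endpoint only; both reversibility and the barrier
  estimates rest on this.\<close>

lemma mu_p:
  assumes "\<beta> > 0" "x \<in> S" "y \<in> S" "x \<noteq> y"
  shows "mu \<beta> x * p \<beta> x y = (if E x y then c * exp (- \<beta> * max (H x) (H y)) else 0)"
proof (cases "E x y")
  case True
  have "- \<beta> * max (H x) (H y) = - \<beta> * H x + - \<beta> * max 0 (H y - H x)"
    by (simp add: max_def algebra_simps)
  then have "exp (- \<beta> * max (H x) (H y)) = exp (- \<beta> * H x) * exp (- \<beta> * max 0 (H y - H x))"
    by (simp only: exp_add)
  then show ?thesis
    unfolding mu_def p_off_diagonal[OF assms] using True by (simp only: if_True mult.left_commute)
next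
  case False
  then show ?thesis unfolding p_off_diagonal[OF assms] by (simp only: if_False mult_zero_right)
qed

lemma detailed_balance:
  assumes "\<beta> > 0" "x \<in> S" "y \<in> S"
  shows "mu \<beta> x * p \<beta> x y = mu \<beta> y * p \<beta> y x"
proof (cases "x = y")
  case False
  have "E x y \<longleftrightarrow> E y x" using E_sym assms by blast
  then show ?thesis using mu_p[of \<beta> x y] mu_p[of \<beta> y x] assms False
    by (simp add: max.commute)
qed simp

lemma dirichlet_nonneg: "\<beta> > 0 \<Longrightarrow> dirichlet \<beta> f \<ge> 0"
  unfolding dirichlet_def
  by (intro sum_nonneg mult_nonneg_nonneg p_nonneg) (auto simp: less_imp_le[OF mu_pos])

lemma dirichlet_edge:
  assumes "\<beta> > 0" "x \<in> S" "y \<in> S" "E x y" "H x \<le> h" "H y \<le> h"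
  shows "(f x - f y)\<^sup>2 \<le> 1 / c * exp (\<beta> * h) * dirichlet \<beta> f"
proof (cases "x = y")
  case True
  then show ?thesis using dirichlet_nonneg assms c_pos by simp
next
  case False
  have *: "0 \<le> mu \<beta> x * p \<beta> x y * (f x - f y)\<^sup>2" if "x \<in> S" "y \<in> S" for x y
    using assms that by (intro mult_nonneg_nonneg p_nonneg) (auto simp: less_imp_le[OF mu_pos])
  have "c * exp (- \<beta> * h) * (f x - f y)\<^sup>2 \<le> mu \<beta> x * p \<beta> x y * (f x - f y)\<^sup>2"
    using assms False c_pos by (intro mult_right_mono) (auto simp: mu_p)
  also have "\<dots> \<le> (\<Sum>y\<in>S. mu \<beta> x * p \<beta> x y * (f x - f y)\<^sup>2)"
    by (rule member_le_sum) (use assms * finite_S in auto)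
  also have "\<dots> \<le> dirichlet \<beta> f"
    unfolding dirichlet_def
    by (rule member_le_sum[where f = "\<lambda>x. \<Sum>y\<in>S. mu \<beta> x * p \<beta> x y * (f x - f y)\<^sup>2"])
      (use assms * finite_S in \<open>auto intro!: sum_nonneg\<close>)
  finally show ?thesis
    using c_pos by (simp add: field_simps exp_minus)
qed

text \<open>The constant depends on the path alone, not on \<beta> or \<open>f\<close>: each step
  doubles it and adds \<open>2 / c\<close>.\<close>

lemma dirichlet_reach:
  assumes "reach h x y"
  shows "\<exists>C\<ge>0. \<forall>\<beta>>0. \<forall>f. (f x - f y)\<^sup>2 \<le> C * exp (\<beta> * h) * dirichlet \<beta> f"
  using assms unfolding reach_def
proof (induction rule: rtranclp_induct)
  case base
  then show ?case by (intro exI[of _ 0]) auto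
next
  case (step y z)
  then obtain C where C: "C \<ge> 0" "\<And>\<beta> f. \<beta> > 0 \<Longrightarrow> (f x - f y)\<^sup>2 \<le> C * exp (\<beta> * h) * dirichlet \<beta> f"
    by blast
  show ?case
  proof (intro exI[of _ "2 * C + 2 / c"] conjI allI impI)
    show "0 \<le> 2 * C + 2 / c" using C c_pos by simp
    fix \<beta> :: real and f :: "'s \<Rightarrow> real" assume b: "\<beta> > 0"
    have "(f x - f z)\<^sup>2 \<le> 2 * (f x - f y)\<^sup>2 + 2 * (f y - f z)\<^sup>2"
      using zero_le_power2[of "(f x - f y) - (f y - f z)"]
      by (simp add: power2_eq_square algebra_simps)
    also have "\<dots> \<le> 2 * (C * exp (\<beta> * h) * dirichlet \<beta> f) + 2 * (1 / c * exp (\<beta> * h) * dirichlet \<beta> f)"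
      using C(2)[OF b, of f] dirichlet_edge[OF b, of y z h f] step.hyps by (intro add_mono mult_left_mono) auto
    finally show "(f x - f z)\<^sup>2 \<le> (2 * C + 2 / c) * exp (\<beta> * h) * dirichlet \<beta> f"
      by (simp add: algebra_simps)
  qed
qed

text \<open>Summation by parts: after expanding the square, unit row sums and detailed balance make
  both square terms equal.\<close>

lemma green_identity:
  assumes "\<beta> > 0"
  shows "(\<Sum>x\<in>S. mu \<beta> x * f x * (f x - (\<Sum>y\<in>S. p \<beta> x y * f y))) = dirichlet \<beta> f / 2"
proof -
  let ?w = "\<lambda>x y. mu \<beta> x * p \<beta> x y"
  have sq: "(\<Sum>x\<in>S. \<Sum>y\<in>S. ?w x y * (f x)\<^sup>2) = (\<Sum>x\<in>S. mu \<beta> x * (f x)\<^sup>2)"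
  proof (rule sum.cong)
    fix x assume "x \<in> S"
    have "(\<Sum>y\<in>S. ?w x y * (f x)\<^sup>2) = mu \<beta> x * (f x)\<^sup>2 * (\<Sum>y\<in>S. p \<beta> x y)"
      unfolding sum_distrib_left by (intro sum.cong) (auto simp: mult_ac)
    then show "(\<Sum>y\<in>S. ?w x y * (f x)\<^sup>2) = mu \<beta> x * (f x)\<^sup>2"
      using p_sum assms \<open>x \<in> S\<close> by simp
  qed simp
  have "(\<Sum>x\<in>S. \<Sum>y\<in>S. ?w x y * (f y)\<^sup>2) = (\<Sum>y\<in>S. \<Sum>x\<in>S. ?w x y * (f y)\<^sup>2)"
    by (rule sum.swap)
  also have "\<dots> = (\<Sum>y\<in>S. \<Sum>x\<in>S. ?w y x * (f y)\<^sup>2)"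
    using detailed_balance[OF assms] by (intro sum.cong) auto
  finally have sq': "(\<Sum>x\<in>S. \<Sum>y\<in>S. ?w x y * (f y)\<^sup>2) = (\<Sum>x\<in>S. mu \<beta> x * (f x)\<^sup>2)"
    using sq by simp
  have "dirichlet \<beta> f = (\<Sum>x\<in>S. \<Sum>y\<in>S. ?w x y * (f x)\<^sup>2 + ?w x y * (f y)\<^sup>2 - 2 * (?w x y * f x * f y))"
    unfolding dirichlet_def by (intro sum.cong refl) (simp add: power2_eq_square algebra_simps)
  also have "\<dots> = 2 * (\<Sum>x\<in>S. mu \<beta> x * (f x)\<^sup>2) - 2 * (\<Sum>x\<in>S. \<Sum>y\<in>S. ?w x y * f x * f y)"
    by (simp add: sum.distrib sum_subtractf sq sq' flip: sum_distrib_left)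
  finally have "dirichlet \<beta> f / 2 = (\<Sum>x\<in>S. mu \<beta> x * (f x)\<^sup>2 - (\<Sum>y\<in>S. ?w x y * f x * f y))"
    by (simp add: sum_subtractf)
  also have "\<dots> = (\<Sum>x\<in>S. mu \<beta> x * f x * (f x - (\<Sum>y\<in>S. p \<beta> x y * f y)))"
  proof (rule sum.cong)
    fix x
    have "(\<Sum>y\<in>S. ?w x y * f x * f y) = mu \<beta> x * f x * (\<Sum>y\<in>S. p \<beta> x y * f y)"
      unfolding sum_distrib_left by (intro sum.cong) (auto simp: mult_ac)
    then show "mu \<beta> x * (f x)\<^sup>2 - (\<Sum>y\<in>S. ?w x y * f x * f y)
        = mu \<beta> x * f x * (f x - (\<Sum>y\<in>S. p \<beta> x y * f y))"
      by (simp only:) (simp add: right_diff_distrib power2_eq_square)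
  qed simp
  finally show ?thesis ..
qed

lemma surv_outside [simp]: "x \<notin> D \<Longrightarrow> surv D \<beta> n x = 0"
  by (cases n) auto

lemma surv_bounds:
  assumes "\<beta> > 0" "x \<in> S"
  shows "0 \<le> surv D \<beta> n x" "surv D \<beta> n x \<le> 1"
proof -
  have "0 \<le> surv D \<beta> n x \<and> surv D \<beta> n x \<le> 1"
    using assms(2)
  proof (induction n arbitrary: x)
    case (Suc n)
    have "(\<Sum>y\<in>S. p \<beta> x y * surv D \<beta> n y) \<le> (\<Sum>y\<in>S. p \<beta> x y * 1)"
      using Suc p_nonneg[OF assms(1)] by (intro sum_mono mult_left_mono) auto
    moreover have "0 \<le> (\<Sum>y\<in>S. p \<beta> x y * surv D \<beta> n y)"
      using Suc p_nonneg[OF assms(1)] by (intro sum_nonneg mult_nonneg_nonneg) auto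
    ultimately show ?case using Suc.prems p_sum[OF assms(1)] by simp
  qed simp
  then show "0 \<le> surv D \<beta> n x" "surv D \<beta> n x \<le> 1" by auto
qed

lemma surv_Suc_le:
  assumes "\<beta> > 0" "x \<in> S"
  shows "surv D \<beta> (Suc n) x \<le> surv D \<beta> n x"
  using assms(2)
proof (induction n arbitrary: x)
  case 0
  then show ?case using surv_bounds(2)[OF assms(1), of x D "Suc 0"] by (cases "x \<in> D") auto
next
  case (Suc n)
  have "(\<Sum>y\<in>S. p \<beta> x y * surv D \<beta> (Suc n) y) \<le> (\<Sum>y\<in>S. p \<beta> x y * surv D \<beta> n y)"
    using Suc p_nonneg[OF assms(1)] by (intro sum_mono mult_left_mono) auto
  then show ?case by (cases "x \<in> D") auto
qed

lemma surv_antimono: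
  assumes "\<beta> > 0" "x \<in> S" "m \<le> n"
  shows "surv D \<beta> n x \<le> surv D \<beta> m x"
  by (rule lift_Suc_antimono_le[of "\<lambda>n. surv D \<beta> n x", OF surv_Suc_le[OF assms(1,2)] assms(3)])

lemma surv_subset:
  assumes "\<beta> > 0" "x \<in> S" "C \<subseteq> D"
  shows "surv C \<beta> n x \<le> surv D \<beta> n x"
  using assms(2)
proof (induction n arbitrary: x)
  case 0
  then show ?case using assms(3) by auto
next
  case (Suc n)
  have "(\<Sum>y\<in>S. p \<beta> x y * surv C \<beta> n y) \<le> (\<Sum>y\<in>S. p \<beta> x y * surv D \<beta> n y)"
    using Suc p_nonneg[OF assms(1)] by (intro sum_mono mult_left_mono) auto
  moreover have "0 \<le> (\<Sum>y\<in>S. p \<beta> x y * surv D \<beta> n y)"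
    using Suc.prems p_nonneg[OF assms(1)] surv_bounds(1)[OF assms(1)]
    by (intro sum_nonneg mult_nonneg_nonneg) auto
  ultimately show ?case using assms(3) by auto
qed

lemma sum_p_surv_sum:
  assumes "x \<in> D"
  shows "(\<Sum>k<n. surv D \<beta> (Suc k) x) = (\<Sum>y\<in>S. p \<beta> x y * (\<Sum>k<n. surv D \<beta> k y))"
proof -
  have "(\<Sum>k<n. surv D \<beta> (Suc k) x) = (\<Sum>k<n. \<Sum>y\<in>S. p \<beta> x y * surv D \<beta> k y)"
    using assms by simp
  also have "\<dots> = (\<Sum>y\<in>S. \<Sum>k<n. p \<beta> x y * surv D \<beta> k y)"
    by (rule sum.swap)
  finally show ?thesis by (simp add: sum_distrib_left)
qed

text \<open>The truncated Green function \<open>G\<close> of \<open>D\<close> satisfies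
  \<open>G - P G \<le> 1\<close> on \<open>D\<close>, so summation by parts bounds its Dirichlet
  form by its \<open>mu\<close>-weighted sum. Conversely the path to the exit bounds each
  \<open>mu y * (G y)^2\<close> by that form, and Cauchy-Schwarz closes the circle. Minimality of
  \<open>H x0\<close> makes the total weight of \<open>D\<close> comparable to that of
  \<open>x0\<close>, so dividing by the latter costs no exponential factor.\<close>

lemma occupation_bound_level:
  assumes "D \<subseteq> S" "x0 \<in> D" and level: "\<And>y. y \<in> D \<Longrightarrow> H x0 \<le> H y"
    and exit: "\<And>y. y \<in> D \<Longrightarrow> \<exists>z\<in>S - D. reach (H y + V) y z"
  shows "\<exists>K\<ge>0. \<forall>\<beta>>0. \<forall>n. (\<Sum>k<n. surv D \<beta> k x0) \<le> K * exp (\<beta> * V)"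
proof -
  have "\<exists>C\<ge>0. \<forall>\<beta>>0. \<forall>f. (\<forall>z. z \<notin> D \<longrightarrow> f z = 0) \<longrightarrow> mu \<beta> y * (f y)\<^sup>2 \<le> C * exp (\<beta> * V) * dirichlet \<beta> f"
    if y: "y \<in> D" for y
  proof -
    obtain z where z: "z \<in> S - D" "reach (H y + V) y z" using exit[OF y] by blast
    obtain C where C: "C \<ge> 0" "\<And>\<beta> f. \<beta> > 0 \<Longrightarrow> (f y - f z)\<^sup>2 \<le> C * exp (\<beta> * (H y + V)) * dirichlet \<beta> f"
      using dirichlet_reach[OF z(2)] by blast
    have "mu \<beta> y * (f y)\<^sup>2 \<le> C * exp (\<beta> * V) * dirichlet \<beta> f" if "\<beta> > 0" "\<forall>z. z \<notin> D \<longrightarrow> f z = 0" for \<beta> f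
    proof -
      have "mu \<beta> y * (f y)\<^sup>2 \<le> mu \<beta> y * (C * exp (\<beta> * (H y + V)) * dirichlet \<beta> f)"
      proof (rule mult_left_mono)
        have "f z = 0" using that(2) z(1) by blast
        then show "(f y)\<^sup>2 \<le> C * exp (\<beta> * (H y + V)) * dirichlet \<beta> f"
          using C(2)[OF that(1), of f] by simp
      qed (rule less_imp_le[OF mu_pos])
      also have "\<dots> = C * exp (\<beta> * V) * dirichlet \<beta> f"
        by (simp add: mu_def algebra_simps exp_add exp_minus)
      finally show ?thesis .
    qed
    then show ?thesis using C(1) by blast
  qed
  then obtain C where C: "\<And>y. y \<in> D \<Longrightarrow> C y \<ge> 0"
    "\<And>y \<beta> f. y \<in> D \<Longrightarrow> \<beta> > 0 \<Longrightarrow> (\<And>z. z \<notin> D \<Longrightarrow> f z = 0) \<Longrightarrow>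
       mu \<beta> y * (f y)\<^sup>2 \<le> C y * exp (\<beta> * V) * dirichlet \<beta> f"
    by metis
  define K where "K = 2 * (\<Sum>y\<in>D. C y)"
  have finD: "finite D" using assms(1) finite_S finite_subset by blast
  have K0: "K \<ge> 0" unfolding K_def using C(1) by (simp add: sum_nonneg)
  have "(\<Sum>k<n. surv D \<beta> k x0) \<le> K * sqrt (card D) * exp (\<beta> * V)" if b: "\<beta> > 0" for \<beta> n
  proof -
    define G where "G y = (\<Sum>k<n. surv D \<beta> k y)" for y
    have G0: "G y \<ge> 0" if "y \<in> S" for y
      unfolding G_def using surv_bounds(1)[OF b that] by (intro sum_nonneg)
    have Gout: "G z = 0" if "z \<notin> D" for z using that by (simp add: G_def)
    have GD: "G y - (\<Sum>z\<in>S. p \<beta> y z * G z) \<le> 1" if y: "y \<in> D" for y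
    proof -
      have yS: "y \<in> S" using y assms(1) by blast
      have "(\<Sum>z\<in>S. p \<beta> y z * G z) = (\<Sum>k<n. surv D \<beta> (Suc k) y)"
        unfolding G_def using sum_p_surv_sum[OF y] by simp
      also have "G y - \<dots> = surv D \<beta> 0 y - surv D \<beta> n y"
        unfolding G_def sum_subtractf[symmetric] by (induction n) auto
      finally show ?thesis using surv_bounds[OF b yS, of D n] y by simp
    qed
    \<comment> \<open>The norm of \<open>G\<close> with weight \<open>mu\<close>; the aim is an
      inequality of the form \<open>q * q \<le> const * q\<close>.\<close>
    define q where "q = sqrt (\<Sum>y\<in>D. mu \<beta> y * (G y)\<^sup>2)"
    have q2: "q\<^sup>2 = (\<Sum>y\<in>D. mu \<beta> y * (G y)\<^sup>2)" unfolding q_def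
      by (intro real_sqrt_pow2 sum_nonneg mult_nonneg_nonneg) (auto simp: less_imp_le[OF mu_pos])
    have "dirichlet \<beta> G / 2 = (\<Sum>x\<in>S. mu \<beta> x * G x * (G x - (\<Sum>y\<in>S. p \<beta> x y * G y)))"
      using green_identity[OF b] by simp
    also have "\<dots> = (\<Sum>x\<in>D. mu \<beta> x * G x * (G x - (\<Sum>y\<in>S. p \<beta> x y * G y)))"
      by (rule sum.mono_neutral_right) (use assms(1) finite_S Gout in auto)
    also have "\<dots> \<le> (\<Sum>x\<in>D. mu \<beta> x * G x * 1)"
      by (intro sum_mono mult_left_mono GD mult_nonneg_nonneg G0)
        (use assms(1) in \<open>auto simp: less_imp_le[OF mu_pos]\<close>)
    also have "\<dots> = (\<Sum>x\<in>D. sqrt (mu \<beta> x) * (sqrt (mu \<beta> x) * G x))"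
      by (intro sum.cong) (auto simp: less_imp_le[OF mu_pos] simp flip: mult.assoc)
    also have "\<dots> \<le> sqrt (\<Sum>x\<in>D. (sqrt (mu \<beta> x))\<^sup>2) * sqrt (\<Sum>x\<in>D. (sqrt (mu \<beta> x) * G x)\<^sup>2)"
      using L2_set_mult_ineq[of "\<lambda>x. sqrt (mu \<beta> x)" "\<lambda>x. sqrt (mu \<beta> x) * G x" D]
      unfolding L2_set_def
      by (rule order_trans[rotated], intro sum_mono)
        (metis abs_ge_self abs_mult)
    also have "\<dots> = sqrt (\<Sum>x\<in>D. mu \<beta> x) * q"
      unfolding q_def by (simp add: power_mult_distrib less_imp_le[OF mu_pos])
    finally have dir: "dirichlet \<beta> G \<le> 2 * (sqrt (\<Sum>x\<in>D. mu \<beta> x) * q)" by simp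
    have "q\<^sup>2 \<le> (\<Sum>y\<in>D. C y * exp (\<beta> * V) * dirichlet \<beta> G)"
      unfolding q2 by (intro sum_mono C(2) b Gout)
    also have "\<dots> = (K / 2 * exp (\<beta> * V)) * dirichlet \<beta> G"
      by (simp add: K_def sum_distrib_right)
    also have "\<dots> \<le> (K / 2 * exp (\<beta> * V)) * (2 * (sqrt (\<Sum>x\<in>D. mu \<beta> x) * q))"
      using dir K0 by (intro mult_left_mono) auto
    finally have "q * q \<le> K * exp (\<beta> * V) * sqrt (\<Sum>x\<in>D. mu \<beta> x) * q"
      by (simp add: power2_eq_square)
    moreover have "q \<ge> 0" unfolding q_def
      by (intro real_sqrt_ge_zero sum_nonneg mult_nonneg_nonneg) (auto simp: less_imp_le[OF mu_pos])
    moreover have "K * exp (\<beta> * V) * sqrt (\<Sum>x\<in>D. mu \<beta> x) \<ge> 0"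
      using K0 by (intro mult_nonneg_nonneg real_sqrt_ge_zero sum_nonneg) (auto simp: less_imp_le[OF mu_pos])
    ultimately have qle: "q \<le> K * exp (\<beta> * V) * sqrt (\<Sum>x\<in>D. mu \<beta> x)"
      by (cases "q = 0") auto
    have "sqrt (\<Sum>x\<in>D. mu \<beta> x) \<le> sqrt (\<Sum>x\<in>D. mu \<beta> x0)"
      using level b by (intro real_sqrt_le_mono sum_mono) (auto simp: mu_def)
    also have "\<dots> = sqrt (card D) * sqrt (mu \<beta> x0)" by (simp add: real_sqrt_mult)
    finally have "q \<le> K * exp (\<beta> * V) * (sqrt (card D) * sqrt (mu \<beta> x0))"
      using qle K0 by (meson exp_ge_zero mult_left_mono mult_nonneg_nonneg order_trans)
    moreover have "sqrt (mu \<beta> x0) * G x0 \<le> q"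
    proof -
      have "mu \<beta> x0 * (G x0)\<^sup>2 \<le> (\<Sum>y\<in>D. mu \<beta> y * (G y)\<^sup>2)"
        by (rule member_le_sum[of x0 D "\<lambda>y. mu \<beta> y * (G y)\<^sup>2"])
          (use assms(2) finD in \<open>auto simp: less_imp_le[OF mu_pos]\<close>)
      from real_sqrt_le_mono[OF this] show ?thesis
        unfolding q_def using G0[of x0] assms(1,2) by (auto simp: real_sqrt_mult)
    qed
    ultimately have "sqrt (mu \<beta> x0) * G x0 \<le> sqrt (mu \<beta> x0) * (K * sqrt (card D) * exp (\<beta> * V))"
      by (simp add: mult_ac)
    then show ?thesis using mu_pos[of \<beta> x0] by (simp add: G_def)
  qed
  then show ?thesis using K0 by (intro exI[of _ "K * sqrt (card D)"]) auto
qed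

text \<open>Going down one energy level at a time keeps the reversible weights on each level comparable,
  so that no factor exponential in the energy of the starting point is lost.\<close>

lemma occupation_bound:
  assumes down: "\<And>x. x \<in> S \<Longrightarrow> x \<notin> B \<Longrightarrow> \<exists>y\<in>S. reach (H x + V) x y \<and> (y \<in> B \<or> H y < H x)"
  shows "\<exists>K\<ge>0. \<forall>\<beta>>0. \<forall>x\<in>S. \<forall>n. (\<Sum>k<n. surv (S - B) \<beta> k x) \<le> K * exp (\<beta> * V)"
proof -
  have finlow: "finite {y\<in>S. H y < h}" for h using finite_S by simp
  \<comment> \<open>Descents are concatenated until the level \<open>h\<close> is passed. Their
    barriers are measured from lower and lower states, so the initial bound \<open>H y + V\<close>
    serves for the whole path.\<close>
  have exit: "\<exists>z\<in>S. reach (H y + V) y z \<and> (z \<in> B \<or> H z < h)" if "y \<in> S" for y h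
    using that
  proof (induction "card {z\<in>S. H z < H y}" arbitrary: y rule: less_induct)
    case less
    show ?case
    proof (cases "y \<in> B \<or> H y < h")
      case True
      then show ?thesis using less.prems by (auto simp: reach_def)
    next
      case False
      then obtain z where z: "z \<in> S" "reach (H y + V) y z" "z \<in> B \<or> H z < H y"
        using down less.prems by blast
      show ?thesis
      proof (cases "z \<in> B")
        case True
        then show ?thesis using z by blast
      next
        case False
        then have lt: "H z < H y" using z by blast
        have "card {w\<in>S. H w < H z} < card {w\<in>S. H w < H y}"
          using finlow lt z(1) by (intro psubset_card_mono) auto
        then obtain w where w: "w \<in> S" "reach (H z + V) z w" "w \<in> B \<or> H w < h"
          using less.hyps z(1) by blast
        have "reach (H y + V) z w"
          using w(2) lt unfolding reach_def by (rule_tac rtranclp_mono[THEN predicate2D, rotated]) auto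
        then show ?thesis using z(2) w unfolding reach_def by (blast intro: rtranclp_trans)
      qed
    qed
  qed
  have "\<exists>K\<ge>0. \<forall>\<beta>>0. \<forall>n. (\<Sum>k<n. surv (S - B) \<beta> k x) \<le> K * exp (\<beta> * V)" if "x \<in> S" for x
    using that
  proof (induction "card {z\<in>S. H z < H x}" arbitrary: x rule: less_induct)
    case less
    show ?case
    proof (cases "x \<in> B")
      case True
      then show ?thesis by (intro exI[of _ 0]) auto
    next
      case False
      define D where "D = {y\<in>S. H x \<le> H y} - B"
      have "\<exists>K\<ge>0. \<forall>\<beta>>0. \<forall>n. (\<Sum>k<n. surv D \<beta> k x) \<le> K * exp (\<beta> * V)"
      proof (rule occupation_bound_level)
        show "D \<subseteq> S" "x \<in> D" using False less.prems by (auto simp: D_def)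
        show "\<And>y. y \<in> D \<Longrightarrow> H x \<le> H y" by (auto simp: D_def)
        show "\<exists>z\<in>S - D. reach (H y + V) y z" if "y \<in> D" for y
          using exit[of y "H x"] that by (force simp: D_def)
      qed
      then obtain K1 where K1: "K1 \<ge> 0" "\<And>\<beta> n. \<beta> > 0 \<Longrightarrow> (\<Sum>k<n. surv D \<beta> k x) \<le> K1 * exp (\<beta> * V)"
        by blast
      have low: "\<exists>K\<ge>0. \<forall>\<beta>>0. \<forall>n. (\<Sum>k<n. surv (S - B) \<beta> k z) \<le> K * exp (\<beta> * V)"
        if "z \<in> S - D" for z
      proof (cases "z \<in> B")
        case True
        then show ?thesis by (intro exI[of _ 0]) auto
      next
        case False
        then have lt: "H z < H x" using that by (auto simp: D_def)
        then have "card {w\<in>S. H w < H z} < card {w\<in>S. H w < H x}"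
          using finlow that by (intro psubset_card_mono) auto
        then show ?thesis using less.hyps that by blast
      qed
      then obtain L where L: "\<And>z. z \<in> S - D \<Longrightarrow> L z \<ge> 0"
        "\<And>z \<beta> n. z \<in> S - D \<Longrightarrow> \<beta> > 0 \<Longrightarrow> (\<Sum>k<n. surv (S - B) \<beta> k z) \<le> L z * exp (\<beta> * V)"
        by metis
      define K2 where "K2 = (\<Sum>z\<in>S - D. L z)"
      have K2: "K2 \<ge> 0" unfolding K2_def using L(1) by (intro sum_nonneg)
      have LK2: "L z \<le> K2" if "z \<in> S - D" for z
        unfolding K2_def by (rule member_le_sum) (use that L(1) finite_S in auto)
      \<comment> \<open>Once out of \<open>D\<close> the chain is in \<open>B\<close> or strictly
        below \<open>H x\<close>, where the induction hypothesis bounds the remaining time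
        uniformly.\<close>
      have main: "(\<Sum>k<n. surv (S - B) \<beta> k y) \<le> (\<Sum>k<n. surv D \<beta> k y) + K2 * exp (\<beta> * V)"
        if b: "\<beta> > 0" and y: "y \<in> S" for \<beta> n y
        using y
      proof (induction n arbitrary: y)
        case 0
        then show ?case using K2 by simp
      next
        case (Suc n)
        show ?case
        proof (cases "y \<in> D")
          case False
          then have "(\<Sum>k<Suc n. surv (S - B) \<beta> k y) \<le> L y * exp (\<beta> * V)"
            using L(2) Suc.prems b by blast
          also have "\<dots> \<le> K2 * exp (\<beta> * V)" using LK2 False Suc.prems by auto
          finally show ?thesis using False by simp
        next
          case True
          then have yB: "y \<in> S - B" by (auto simp: D_def)
          have "(\<Sum>k<Suc n. surv (S - B) \<beta> k y) = 1 + (\<Sum>z\<in>S. p \<beta> y z * (\<Sum>k<n. surv (S - B) \<beta> k z))"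
            unfolding sum.lessThan_Suc_shift sum_p_surv_sum[OF yB] using yB by simp
          also have "\<dots> \<le> 1 + (\<Sum>z\<in>S. p \<beta> y z * ((\<Sum>k<n. surv D \<beta> k z) + K2 * exp (\<beta> * V)))"
            by (intro add_left_mono sum_mono mult_left_mono Suc.IH p_nonneg b Suc.prems)
          also have "\<dots> = 1 + (\<Sum>z\<in>S. p \<beta> y z * (\<Sum>k<n. surv D \<beta> k z)) + K2 * exp (\<beta> * V)"
            using p_sum[OF b Suc.prems]
            by (simp add: distrib_left sum.distrib flip: sum_distrib_right)
          also have "\<dots> = (\<Sum>k<Suc n. surv D \<beta> k y) + K2 * exp (\<beta> * V)"
            unfolding sum.lessThan_Suc_shift sum_p_surv_sum[OF True] using True by simp
          finally show ?thesis .
        qed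
      qed
      show ?thesis
      proof (intro exI[of _ "K1 + K2"] conjI allI impI)
        show "0 \<le> K1 + K2" using K1 K2 by simp
        fix \<beta> :: real and n assume b: "\<beta> > 0"
        show "(\<Sum>k<n. surv (S - B) \<beta> k x) \<le> (K1 + K2) * exp (\<beta> * V)"
          using main[OF b less.prems, of n] K1(2)[OF b, of n] by (simp add: algebra_simps)
      qed
    qed
  qed
  then obtain K where K: "\<And>x. x \<in> S \<Longrightarrow> K x \<ge> 0"
    "\<And>x \<beta> n. x \<in> S \<Longrightarrow> \<beta> > 0 \<Longrightarrow> (\<Sum>k<n. surv (S - B) \<beta> k x) \<le> K x * exp (\<beta> * V)"
    by metis
  show ?thesis
  proof (intro exI[of _ "\<Sum>x\<in>S. K x"] conjI allI impI ballI)
    show "0 \<le> (\<Sum>x\<in>S. K x)" using K by (intro sum_nonneg)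
    fix \<beta> :: real and x n assume b: "\<beta> > 0" and x: "x \<in> S"
    have "K x \<le> (\<Sum>x\<in>S. K x)" by (rule member_le_sum) (use x K(1) finite_S in auto)
    then have "K x * exp (\<beta> * V) \<le> (\<Sum>x\<in>S. K x) * exp (\<beta> * V)" by simp
    then show "(\<Sum>k<n. surv (S - B) \<beta> k x) \<le> (\<Sum>x\<in>S. K x) * exp (\<beta> * V)"
      using K(2)[OF x b, of n] by linarith
  qed
qed

text \<open>Survival decreases in time, so each of the \<open>n\<close> summands is at least the
  last value.\<close>

lemma surv_bound_time:
  assumes "\<beta> > 0" "x \<in> S" "\<And>n. (\<Sum>k<n. surv D \<beta> k x) \<le> c'"
  shows "real n * surv D \<beta> n x \<le> c'"
proof -
  have "real n * surv D \<beta> n x = (\<Sum>k<n. surv D \<beta> n x)" by simp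
  also have "\<dots> \<le> (\<Sum>k<n. surv D \<beta> k x)"
    by (intro sum_mono surv_antimono assms) auto
  finally show ?thesis using assms(3)[of n] by simp
qed

text \<open>By reversibility, the mass leaving the component of \<open>s\<close> below level \<open>\<Gamma>\<close> in one step is at most
  the equilibrium flux through its boundary.\<close>

lemma surv_lower:
  assumes "s \<in> S" "g \<in> S" "H s = 0" "\<Gamma> > 0"
    and barrier: "\<And>h. reach h s g \<Longrightarrow> \<Gamma> \<le> h"
    and b: "\<beta> > 0"
  shows "1 - surv (S - {g}) \<beta> n s \<le> real n * (c * (real (card S))\<^sup>2 * exp (- \<beta> * \<Gamma>))"
proof -
  define A where "A = {x\<in>S. \<exists>h<\<Gamma>. reach h s x}"
  have AS: "A \<subseteq> S" by (auto simp: A_def)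
  have Ag: "A \<subseteq> S - {g}" using barrier by (force simp: A_def)
  have sA: "s \<in> A" using assms by (auto simp: A_def reach_def intro!: exI[of _ 0])
  define F where "F = c * (real (card S))\<^sup>2 * exp (- \<beta> * \<Gamma>)"
  have HA: "H x < \<Gamma>" if "x \<in> A" for x
  proof -
    obtain h where h: "h < \<Gamma>" "reach h s x" using \<open>x \<in> A\<close> by (auto simp: A_def)
    from h(2) show ?thesis unfolding reach_def
      by (cases rule: rtranclp.cases) (use h assms in auto)
  qed
  have exitH: "\<Gamma> \<le> H y" if "x \<in> A" "y \<in> S - A" "E x y" for x y
  proof (rule ccontr)
    assume "\<not> \<Gamma> \<le> H y"
    obtain h where h: "h < \<Gamma>" "reach h s x" using \<open>x \<in> A\<close> by (auto simp: A_def)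
    define h' where "h' = max h (max (H x) (H y))"
    have "h' < \<Gamma>" using h HA[OF that(1)] \<open>\<not> \<Gamma> \<le> H y\<close> by (auto simp: h'_def)
    moreover have "reach h' s x" using h(2) unfolding reach_def h'_def
      by (rule_tac rtranclp_mono[THEN predicate2D, rotated]) auto
    then have "reach h' s y"
      unfolding reach_def by (rule rtranclp.rtrancl_into_rtrancl) (use that AS in \<open>auto simp: h'_def\<close>)
    ultimately show False using that(2) by (auto simp: A_def)
  qed
  \<comment> \<open>The mass that has not left \<open>A\<close> by time \<open>n\<close> when the
    chain starts from \<open>mu\<close> restricted to \<open>A\<close>.\<close>
  define m where "m n = (\<Sum>x\<in>A. mu \<beta> x * surv A \<beta> n x)" for n
  have flux: "(\<Sum>y\<in>A. \<Sum>x\<in>S - A. mu \<beta> y * p \<beta> y x) \<le> F"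
  proof -
    have "mu \<beta> y * p \<beta> y x \<le> c * exp (- \<beta> * \<Gamma>)" if "y \<in> A" "x \<in> S - A" for x y
    proof -
      have xy: "y \<in> S" "x \<in> S" "y \<noteq> x" using that AS by auto
      show ?thesis
      proof (cases "E y x")
        case True
        then have "\<Gamma> \<le> max (H y) (H x)" using exitH that by fastforce
        then show ?thesis unfolding mu_p[OF b xy] using True b c_pos by simp
      next
        case False
        then show ?thesis unfolding mu_p[OF b xy] using c_pos by simp
      qed
    qed
    then have "(\<Sum>y\<in>A. \<Sum>x\<in>S - A. mu \<beta> y * p \<beta> y x) \<le> (\<Sum>y\<in>A. \<Sum>x\<in>S - A. c * exp (- \<beta> * \<Gamma>))"
      by (intro sum_mono)
    also have "\<dots> = real (card A) * real (card (S - A)) * (c * exp (- \<beta> * \<Gamma>))" by simp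
    also have "\<dots> \<le> real (card S) * real (card S) * (c * exp (- \<beta> * \<Gamma>))"
      using c_pos AS finite_S by (intro mult_right_mono mult_mono) (auto intro: card_mono)
    finally show ?thesis by (simp add: F_def power2_eq_square mult_ac)
  qed
  have step: "m n - m (Suc n) \<le> F" for n
  proof -
    have "m (Suc n) = (\<Sum>x\<in>A. \<Sum>y\<in>S. mu \<beta> x * p \<beta> x y * surv A \<beta> n y)"
      by (simp add: m_def sum_distrib_left mult_ac)
    also have "\<dots> = (\<Sum>x\<in>A. \<Sum>y\<in>A. mu \<beta> x * p \<beta> x y * surv A \<beta> n y)"
      by (intro sum.cong refl sum.mono_neutral_right) (use AS finite_S in auto)
    also have "\<dots> = (\<Sum>y\<in>A. \<Sum>x\<in>A. mu \<beta> x * p \<beta> x y * surv A \<beta> n y)"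
      by (rule sum.swap)
    also have "\<dots> = (\<Sum>y\<in>A. \<Sum>x\<in>A. mu \<beta> y * p \<beta> y x * surv A \<beta> n y)"
      using detailed_balance[OF b] AS by (intro sum.cong refl) auto
    finally have mS: "m (Suc n) = (\<Sum>y\<in>A. \<Sum>x\<in>A. mu \<beta> y * p \<beta> y x * surv A \<beta> n y)" .
    have "m n = (\<Sum>y\<in>A. \<Sum>x\<in>S. mu \<beta> y * p \<beta> y x * surv A \<beta> n y)"
      unfolding m_def
    proof (rule sum.cong)
      fix y assume "y \<in> A"
      then show "mu \<beta> y * surv A \<beta> n y = (\<Sum>x\<in>S. mu \<beta> y * p \<beta> y x * surv A \<beta> n y)"
        using p_sum[OF b, of y] AS by (auto simp flip: sum_distrib_right sum_distrib_left)
    qed simp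
    also have "\<dots> = (\<Sum>y\<in>A. (\<Sum>x\<in>A. mu \<beta> y * p \<beta> y x * surv A \<beta> n y) + (\<Sum>x\<in>S - A. mu \<beta> y * p \<beta> y x * surv A \<beta> n y))"
      using sum.subset_diff[OF AS finite_S] by (intro sum.cong refl) (simp add: add.commute)
    also have "\<dots> = m (Suc n) + (\<Sum>y\<in>A. \<Sum>x\<in>S - A. mu \<beta> y * p \<beta> y x * surv A \<beta> n y)"
      by (simp add: mS sum.distrib)
    finally have "m n - m (Suc n) = (\<Sum>y\<in>A. \<Sum>x\<in>S - A. mu \<beta> y * p \<beta> y x * surv A \<beta> n y)" by simp
    also have "\<dots> \<le> (\<Sum>y\<in>A. \<Sum>x\<in>S - A. mu \<beta> y * p \<beta> y x)"
      using AS surv_bounds[OF b] p_nonneg[OF b] mu_pos[THEN less_imp_le]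
      by (intro sum_mono) (auto intro!: mult_right_le_one_le mult_nonneg_nonneg)
    finally show ?thesis using flux by simp
  qed
  have tele: "m 0 - m n \<le> real n * F"
  proof (induction n)
    case (Suc n)
    then show ?case using step[of n] by (simp add: algebra_simps)
  qed simp
  \<comment> \<open>Because of \<open>H s = 0\<close> the state \<open>s\<close> has weight one, so
    its loss is a single term of the total loss.\<close>
  have "1 - surv A \<beta> n s = mu \<beta> s * (surv A \<beta> 0 s - surv A \<beta> n s)" using assms(3) sA by (simp add: mu_def)
  also have "\<dots> \<le> (\<Sum>x\<in>A. mu \<beta> x * (surv A \<beta> 0 x - surv A \<beta> n x))"
    by (rule member_le_sum[of s A "\<lambda>x. mu \<beta> x * (surv A \<beta> 0 x - surv A \<beta> n x)"])
      (use sA AS finite_S surv_antimono[OF b, of _ 0 n A] in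
        \<open>auto intro!: mult_nonneg_nonneg simp: less_imp_le[OF mu_pos] finite_subset surv_bounds[OF b]
          subset_iff\<close>)
  also have "\<dots> = m 0 - m n" by (simp add: m_def right_diff_distrib sum_subtractf)
  also have "\<dots> \<le> real n * F" by (rule tele)
  finally have "1 - surv A \<beta> n s \<le> real n * F" .
  then show ?thesis using surv_subset[OF b assms(1) Ag, of n] by (simp add: F_def)
qed

end

section \<open>From trajectories of a Markov chain to survival functions\<close>

text \<open>The events up to time \<open>n\<close> are decomposed into the finitely many possible trajectories, because
  the definition of a Markov chain only conditions on complete trajectories.\<close>

lemma markov_chain_stay_step:
  assumes mc: "markov_chain S p s M X" and fin: "finite S" and D: "D \<subseteq> S" and x: "x \<in> D" and y: "y \<in> S"
  shows "\<P>(\<omega> in M. (\<forall>i\<le>n. X i \<omega> \<in> D) \<and> X n \<omega> = x \<and> X (Suc n) \<omega> = y)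
    = p x y * \<P>(\<omega> in M. (\<forall>i\<le>n. X i \<omega> \<in> D) \<and> X n \<omega> = x)"
proof -
  interpret prob_space M using mc by (simp add: markov_chain_def)
  have meas[measurable]: "\<And>t. X t \<in> M \<rightarrow>\<^sub>M count_space S" using mc by (simp add: markov_chain_def)
  have ev: "{\<omega> \<in> space M. X t \<omega> = z} \<in> sets M" if "z \<in> S" for t z
  proof -
    have "{\<omega> \<in> space M. X t \<omega> = z} = X t -` {z} \<inter> space M" by auto
    then show ?thesis using measurable_sets[OF meas[of t], of "{z}"] that by simp
  qed
  define F where "F = {u \<in> {..n} \<rightarrow>\<^sub>E D. u n = x}"
  have finF: "finite F" unfolding F_def
    using finite_PiE[of "{..n}" "\<lambda>_. D"] finite_subset[OF D fin] by simp
  let ?P = "\<lambda>u. {\<omega> \<in> space M. \<forall>i\<le>n. X i \<omega> = u i}"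
  let ?Q = "\<lambda>u. {\<omega> \<in> space M. X (Suc n) \<omega> = y \<and> (\<forall>i\<le>n. X i \<omega> = u i)}"
  have Pm: "?P u \<in> sets M" if "u \<in> F" for u
  proof -
    have "?P u = (\<Inter>i\<in>{..n}. {\<omega> \<in> space M. X i \<omega> = u i})" by auto
    also have "\<dots> \<in> sets M"
      using that D by (intro sets.finite_INT ev) (auto simp: F_def)
    finally show ?thesis .
  qed
  have Qm: "?Q u \<in> sets M" if "u \<in> F" for u
  proof -
    have "?Q u = ?P u \<inter> {\<omega> \<in> space M. X (Suc n) \<omega> = y}" by auto
    also have "\<dots> \<in> sets M" by (intro sets.Int Pm[OF that] ev[OF y])
    finally show ?thesis .
  qed
  have step: "prob (?Q u) = p x y * prob (?P u)" if u: "u \<in> F" for u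
  proof (cases "prob (?P u) > 0")
    case True
    have "\<P>(\<omega> in M. X (Suc n) \<omega> = y \<bar> \<forall>i\<le>n. X i \<omega> = u i) = p (u n) y"
      using mc y True unfolding markov_chain_def by blast
    moreover have "u n = x" using u by (simp add: F_def)
    ultimately show ?thesis using True by (simp add: cond_prob_def field_simps)
  next
    case False
    then have z: "prob (?P u) = 0" by (meson measure_nonneg order.antisym not_less)
    have "prob (?Q u) \<le> prob (?P u)" by (rule finite_measure_mono) (use Pm[OF u] in auto)
    then show ?thesis using z by (simp add: measure_le_0_iff)
  qed
  have disj: "disjoint_family_on ?P F" "disjoint_family_on ?Q F"
    unfolding disjoint_family_on_def
  proof (safe, goal_cases)
    case (1 u v \<omega>)
    then have "u i = v i" for i by (cases "i \<le> n") (auto simp: F_def PiE_iff extensional_def)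
    then show ?case using 1 by blast
  next
    case (2 u v \<omega>)
    then have "u i = v i" for i by (cases "i \<le> n") (auto simp: F_def PiE_iff extensional_def)
    then show ?case using 2 by blast
  qed
  have unP: "{\<omega> \<in> space M. (\<forall>i\<le>n. X i \<omega> \<in> D) \<and> X n \<omega> = x} = (\<Union>u\<in>F. ?P u)"
  proof (safe, goal_cases)
    case (1 \<omega>)
    have "(\<lambda>i\<in>{..n}. X i \<omega>) \<in> F" using 1 by (auto simp: F_def)
    then show ?case using 1 by (intro UN_I[of "\<lambda>i\<in>{..n}. X i \<omega>"]) auto
  qed (auto simp: F_def)
  have unQ: "{\<omega> \<in> space M. (\<forall>i\<le>n. X i \<omega> \<in> D) \<and> X n \<omega> = x \<and> X (Suc n) \<omega> = y} = (\<Union>u\<in>F. ?Q u)"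
  proof (safe, goal_cases)
    case (1 \<omega>)
    have "(\<lambda>i\<in>{..n}. X i \<omega>) \<in> F" using 1 by (auto simp: F_def)
    then show ?case using 1 by (intro UN_I[of "\<lambda>i\<in>{..n}. X i \<omega>"]) auto
  qed (auto simp: F_def)
  have "prob (\<Union>u\<in>F. ?Q u) = (\<Sum>u\<in>F. prob (?Q u))"
    using finF Qm disj(2) by (intro finite_measure_finite_Union) auto
  also have "\<dots> = p x y * (\<Sum>u\<in>F. prob (?P u))"
    using step by (simp add: sum_distrib_left)
  also have "(\<Sum>u\<in>F. prob (?P u)) = prob (\<Union>u\<in>F. ?P u)"
    using finF Pm disj(1) by (intro finite_measure_finite_Union[symmetric]) auto
  finally show ?thesis unfolding unP unQ .
qed

text \<open>\<open>F\<close> is any solution of the backward recursion, while the chain yields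
  forward weights \<open>a n x\<close> of the trajectories that stay in \<open>D\<close> and end at
  \<open>x\<close>. In the pairing of \<open>a m\<close> with \<open>F (k + n)\<close> steps can be
  traded one by one from \<open>F\<close> to \<open>a\<close>; when all are traded, the pairing is
  the probability of staying.\<close>

lemma markov_chain_stay:
  assumes mc: "markov_chain S p s M X" and fin: "finite S" and D: "D \<subseteq> S" and s: "s \<in> S"
    and F0: "\<And>x. F 0 x = (if x \<in> D then 1 else (0::real))"
    and FS: "\<And>n x. F (Suc n) x = (if x \<in> D then (\<Sum>y\<in>S. p x y * F n y) else 0)"
  shows "\<P>(\<omega> in M. \<forall>i\<le>n. X i \<omega> \<in> D) = F n s"
proof -
  interpret prob_space M using mc by (simp add: markov_chain_def)
  have meas: "\<And>t. X t \<in> M \<rightarrow>\<^sub>M count_space S" using mc by (simp add: markov_chain_def)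
  have ev: "{\<omega> \<in> space M. X t \<omega> \<in> A} \<in> sets M" if "A \<subseteq> S" for t A
  proof -
    have "{\<omega> \<in> space M. X t \<omega> \<in> A} = X t -` A \<inter> space M" by auto
    then show ?thesis using measurable_sets[OF meas[of t], of A] that by simp
  qed
  have X0: "AE \<omega> in M. X 0 \<omega> = s" using mc by (simp add: markov_chain_def)
  define a where "a n x = \<P>(\<omega> in M. (\<forall>i\<le>n. X i \<omega> \<in> D) \<and> X n \<omega> = x)" for n x
  have am: "{\<omega> \<in> space M. (\<forall>i\<le>n. X i \<omega> \<in> D) \<and> X n \<omega> \<in> A} \<in> sets M" if "A \<subseteq> S" for n A
  proof -
    have "{\<omega> \<in> space M. (\<forall>i\<le>n. X i \<omega> \<in> D) \<and> X n \<omega> \<in> A} =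
      (\<Inter>i\<in>{..n}. {\<omega> \<in> space M. X i \<omega> \<in> D}) \<inter> {\<omega> \<in> space M. X n \<omega> \<in> A}" by auto
    also have "\<dots> \<in> sets M" using that D by (intro sets.Int sets.finite_INT ev) auto
    finally show ?thesis .
  qed
  have finD: "finite D" using D fin finite_subset by blast
  have aS: "a (Suc n) y = (\<Sum>x\<in>D. a n x * p x y)" if y: "y \<in> D" for n y
  proof -
    let ?E = "\<lambda>x. {\<omega> \<in> space M. (\<forall>i\<le>n. X i \<omega> \<in> D) \<and> X n \<omega> = x \<and> X (Suc n) \<omega> = y}"
    have "{\<omega> \<in> space M. (\<forall>i\<le>Suc n. X i \<omega> \<in> D) \<and> X (Suc n) \<omega> = y} = (\<Union>x\<in>D. ?E x)"
      using y by (auto simp: le_Suc_eq)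
    moreover have "prob (\<Union>x\<in>D. ?E x) = (\<Sum>x\<in>D. prob (?E x))"
    proof (rule finite_measure_finite_Union)
      show "?E ` D \<subseteq> sets M"
      proof (rule image_subsetI)
        fix x assume x: "x \<in> D"
        have "?E x = {\<omega> \<in> space M. (\<forall>i\<le>n. X i \<omega> \<in> D) \<and> X n \<omega> \<in> {x}} \<inter> {\<omega> \<in> space M. X (Suc n) \<omega> \<in> {y}}"
          by auto
        also have "\<dots> \<in> sets M" using x y D by (intro sets.Int am ev) auto
        finally show "?E x \<in> sets M" .
      qed
    qed (auto simp: finD disjoint_family_on_def)
    moreover have "prob (?E x) = a n x * p x y" if "x \<in> D" for x
      using markov_chain_stay_step[OF mc fin D that, of y n] y D by (auto simp: a_def mult.commute)
    ultimately show ?thesis unfolding a_def by simp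
  qed
  have inv: "(\<Sum>x\<in>D. a m x * F (k + n) x) = (\<Sum>x\<in>D. a (m + k) x * F n x)" for m k n
  proof (induction k arbitrary: m)
    case (Suc k)
    have "(\<Sum>x\<in>D. a m x * F (Suc k + n) x) = (\<Sum>x\<in>D. \<Sum>y\<in>S. a m x * (p x y * F (k + n) y))"
      by (simp add: FS sum_distrib_left)
    also have "\<dots> = (\<Sum>x\<in>D. \<Sum>y\<in>D. a m x * (p x y * F (k + n) y))"
    proof (rule sum.cong[OF refl], rule sum.mono_neutral_right)
      fix x
      show "\<forall>y\<in>S - D. a m x * (p x y * F (k + n) y) = 0"
        by (cases "k + n") (auto simp: F0 FS)
    qed (use fin D in auto)
    also have "\<dots> = (\<Sum>y\<in>D. \<Sum>x\<in>D. a m x * (p x y * F (k + n) y))"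
      by (rule sum.swap)
    also have "\<dots> = (\<Sum>y\<in>D. a (Suc m) y * F (k + n) y)"
      by (intro sum.cong refl) (simp add: aS sum_distrib_right mult.assoc)
    also have "\<dots> = (\<Sum>y\<in>D. a (Suc m + k) y * F n y)" by (rule Suc)
    finally show ?case by simp
  qed simp
  have a0: "a 0 x = (if x = s then 1 else 0)" if "x \<in> D" for x
  proof (cases "x = s")
    case True
    have "prob {\<omega> \<in> space M. (\<forall>i\<le>0. X i \<omega> \<in> D) \<and> X 0 \<omega> \<in> {s}} = 1"
      by (rule prob_eq_1[THEN iffD2, rotated]) (use X0 True that am[of "{s}" 0] s in \<open>auto elim!: eventually_mono\<close>)
    then show ?thesis using True by (simp add: a_def)
  next
    case False
    have "prob {\<omega> \<in> space M. (\<forall>i\<le>0. X i \<omega> \<in> D) \<and> X 0 \<omega> \<in> {x}} = 0"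
      by (rule prob_eq_0[THEN iffD2, rotated]) (use X0 False that am[of "{x}" 0] D in \<open>auto elim!: eventually_mono\<close>)
    then show ?thesis using False by (simp add: a_def)
  qed
  have "F n s = (\<Sum>x\<in>D. a 0 x * F (n + 0) x)"
  proof (cases "s \<in> D")
    case True
    have "(\<Sum>x\<in>D. a 0 x * F (n + 0) x) = (\<Sum>x\<in>D. if x = s then F n x else 0)"
      by (intro sum.cong) (auto simp: a0)
    then show ?thesis using True finD by simp
  next
    case False
    then have "(\<Sum>x\<in>D. a 0 x * F (n + 0) x) = 0" by (intro sum.neutral) (auto simp: a0)
    then show ?thesis using False by (cases n) (simp_all add: F0 FS)
  qed
  also have "\<dots> = (\<Sum>x\<in>D. a n x)" unfolding inv by (simp add: F0)
  also have "\<dots> = (\<Sum>x\<in>D. prob {\<omega> \<in> space M. (\<forall>i\<le>n. X i \<omega> \<in> D) \<and> X n \<omega> \<in> {x}})"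
    by (simp add: a_def)
  also have "\<dots> = prob (\<Union>x\<in>D. {\<omega> \<in> space M. (\<forall>i\<le>n. X i \<omega> \<in> D) \<and> X n \<omega> \<in> {x}})"
  proof (intro finite_measure_finite_Union[symmetric] image_subsetI am finD)
    show "{x} \<subseteq> S" if "x \<in> D" for x using that D by blast
  qed (auto simp: disjoint_family_on_def)
  also have "(\<Union>x\<in>D. {\<omega> \<in> space M. (\<forall>i\<le>n. X i \<omega> \<in> D) \<and> X n \<omega> \<in> {x}}) = {\<omega> \<in> space M. \<forall>i\<le>n. X i \<omega> \<in> D}"
    by auto
  finally show ?thesis ..
qed

lemma hitting_time_gt_iff: "enat n < hitting_time X A \<omega> \<longleftrightarrow> (\<forall>i\<le>n. X i \<omega> \<notin> A)"
proof -
  have "enat n < hitting_time X A \<omega> \<longleftrightarrow> \<not> (\<exists>t. X t \<omega> \<in> A \<and> t \<le> n)"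
  proof (cases "{t. X t \<omega> \<in> A} = {}")
    case True
    then show ?thesis by (simp add: hitting_time_def top_enat_def)
  next
    case False
    then have "Inf (enat ` {t. X t \<omega> \<in> A}) \<in> enat ` {t. X t \<omega> \<in> A}"
      by (metis image_is_empty wellorder_InfI ex_in_conv)
    then obtain t where t: "X t \<omega> \<in> A" "hitting_time X A \<omega> = enat t" by (auto simp: hitting_time_def)
    have "hitting_time X A \<omega> \<le> enat t'" if "X t' \<omega> \<in> A" for t'
      unfolding hitting_time_def by (rule Inf_lower) (use that in auto)
    then have "\<not> enat n < hitting_time X A \<omega>" if "X t' \<omega> \<in> A" "t' \<le> n" for t'
      using that by (meson enat_ord_simps(1) not_less order_trans)
    then show ?thesis using t by auto
  qed
  then show ?thesis by auto
qed

text \<open>\<open>enat\<close> is countable, so singletons suffice, and each is built from events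
  \<open>enat n < hitting_time X {g} \<omega>\<close>.\<close>

lemma hitting_time_measurable:
  assumes "\<And>t. X t \<in> M \<rightarrow>\<^sub>M count_space S"
  shows "hitting_time X {g} \<in> M \<rightarrow>\<^sub>M count_space UNIV"
proof -
  have "{\<omega> \<in> space M. X t \<omega> \<noteq> g} \<in> sets M" for t
  proof -
    have "{\<omega> \<in> space M. X t \<omega> \<noteq> g} = X t -` (S - {g}) \<inter> space M"
      using measurable_space[OF assms[of t]] by auto
    then show ?thesis using measurable_sets[OF assms[of t], of "S - {g}"] by simp
  qed
  then have gt: "{\<omega> \<in> space M. enat n < hitting_time X {g} \<omega>} \<in> sets M" for n
  proof -
    have "{\<omega> \<in> space M. enat n < hitting_time X {g} \<omega>} = (\<Inter>i\<in>{..n}. {\<omega> \<in> space M. X i \<omega> \<noteq> g})"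
      by (auto simp: hitting_time_gt_iff)
    also have "\<dots> \<in> sets M" using \<open>\<And>t. {\<omega> \<in> space M. X t \<omega> \<noteq> g} \<in> sets M\<close>
      by (intro sets.finite_INT) auto
    finally show ?thesis .
  qed
  have "hitting_time X {g} -` {x} \<inter> space M \<in> sets M" for x
  proof (cases x)
    case (enat n)
    have "hitting_time X {g} -` {x} \<inter> space M =
      (if n = 0 then space M else {\<omega> \<in> space M. enat (n - 1) < hitting_time X {g} \<omega>})
       - {\<omega> \<in> space M. enat n < hitting_time X {g} \<omega>}"
    proof -
      have "y = enat n \<longleftrightarrow> (n = 0 \<or> enat (n - 1) < y) \<and> \<not> enat n < y" for y
        by (cases y) auto
      from this[of "hitting_time X {g} _"] show ?thesis using enat by auto
    qed
    then show ?thesis using gt by (auto split: if_splits)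
  next
    case infinity
    have "hitting_time X {g} -` {x} \<inter> space M = (\<Inter>n. {\<omega> \<in> space M. enat n < hitting_time X {g} \<omega>})"
    proof -
      have "y = \<infinity> \<longleftrightarrow> (\<forall>n. enat n < y)" for y by (cases y) auto
      from this[of "hitting_time X {g} _"] show ?thesis using infinity by auto
    qed
    also have "\<dots> \<in> sets M" by (intro sets.countable_INT) (use gt in auto)
    finally show ?thesis .
  qed
  then show ?thesis by (subst measurable_count_space_eq2_countable) auto
qed

section \<open>Asymptotically exponential survival functions\<close>

text \<open>\<open>f\<close> is a survival function on the time scale \<open>T\<close>,
  \<open>R\<close> a time within which the past is forgotten, and \<open>e\<close> a common error.
  The errors are uniform in the times, so that any fixed number of them still vanishes.\<close>

locale almost_memoryless =
  fixes f :: "real \<Rightarrow> nat \<Rightarrow> real" and e :: "real \<Rightarrow> real" and R T :: "real \<Rightarrow> nat"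
  assumes f0: "\<forall>\<^sub>F \<beta> in at_top. f \<beta> 0 = 1"
    and f_nonneg: "\<forall>\<^sub>F \<beta> in at_top. \<forall>n. 0 \<le> f \<beta> n"
    and f_antimono: "\<forall>\<^sub>F \<beta> in at_top. \<forall>m n. m \<le> n \<longrightarrow> f \<beta> n \<le> f \<beta> m"
    and f_mult: "\<forall>\<^sub>F \<beta> in at_top. \<forall>m n. \<bar>f \<beta> (m + n) - f \<beta> m * f \<beta> n\<bar> \<le> e \<beta>"
    and f_shift: "\<forall>\<^sub>F \<beta> in at_top. \<forall>m. f \<beta> m - f \<beta> (m + R \<beta>) \<le> e \<beta>"
    and e_lim: "(e \<longlongrightarrow> 0) at_top"
    and R_lim: "filterlim R at_top at_top"
    and T_lim: "filterlim T at_top at_top"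
    and fT_lim: "((\<lambda>\<beta>. f \<beta> (T \<beta>)) \<longlongrightarrow> exp (-1)) at_top"
begin

text \<open>Since \<open>f\<close> takes values between 0 and 1, the errors of successive factors
  add up without amplification.\<close>

lemma f_power: "\<forall>\<^sub>F \<beta> in at_top. \<forall>n. \<bar>f \<beta> (j * n) - f \<beta> n ^ j\<bar> \<le> real j * e \<beta>"
proof (induction j)
  case 0
  show ?case using f0 by eventually_elim simp
next
  case (Suc j)
  show ?case using Suc f_mult f0 f_antimono f_nonneg
  proof eventually_elim
    case (elim \<beta>)
    show ?case
    proof
      fix n
      have fn: "0 \<le> f \<beta> n" "f \<beta> n \<le> 1" using elim by (blast, metis le0)
      have "f \<beta> (Suc j * n) - f \<beta> n ^ Suc j =
          (f \<beta> (n + j * n) - f \<beta> n * f \<beta> (j * n)) + f \<beta> n * (f \<beta> (j * n) - f \<beta> n ^ j)"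
        by (simp add: algebra_simps)
      also have "\<bar>\<dots>\<bar> \<le> \<bar>f \<beta> (n + j * n) - f \<beta> n * f \<beta> (j * n)\<bar> + \<bar>f \<beta> n\<bar> * \<bar>f \<beta> (j * n) - f \<beta> n ^ j\<bar>"
        by (metis abs_mult abs_triangle_ineq)
      also have "\<dots> \<le> e \<beta> + 1 * (real j * e \<beta>)"
        using elim fn by (intro add_mono mult_mono) auto
      finally show "\<bar>f \<beta> (Suc j * n) - f \<beta> n ^ Suc j\<bar> \<le> real (Suc j) * e \<beta>"
        by (simp add: algebra_simps)
    qed
  qed
qed

lemma f_power_lim:
  assumes "((\<lambda>\<beta>. f \<beta> (n \<beta>)) \<longlongrightarrow> c) at_top"
  shows "((\<lambda>\<beta>. f \<beta> (j * n \<beta>)) \<longlongrightarrow> c ^ j) at_top"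
proof -
  have "((\<lambda>\<beta>. f \<beta> (j * n \<beta>) - f \<beta> (n \<beta>) ^ j) \<longlongrightarrow> 0) at_top"
  proof (rule Lim_null_comparison)
    show "\<forall>\<^sub>F \<beta> in at_top. norm (f \<beta> (j * n \<beta>) - f \<beta> (n \<beta>) ^ j) \<le> real j * e \<beta>"
      using f_power[of j] by eventually_elim auto
    show "((\<lambda>\<beta>. real j * e \<beta>) \<longlongrightarrow> 0) at_top" using tendsto_mult_left[OF e_lim, of "real j"] by simp
  qed
  from tendsto_add[OF this tendsto_power[OF assms, of j]] show ?thesis by simp
qed

text \<open>Rounding in \<open>T div k\<close> loses fewer than \<open>k \<le> R\<close> steps,
  which \<open>f_shift\<close> makes harmless; the limit for one block is then the
  \<open>k\<close>-th root of the limit at \<open>T\<close>.\<close>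

lemma f_block_lim:
  assumes k: "k > 0"
  shows "((\<lambda>\<beta>. f \<beta> (j * (T \<beta> div k))) \<longlongrightarrow> exp (- (real j / real k))) at_top"
proof -
  have "((\<lambda>\<beta>. f \<beta> (k * (T \<beta> div k)) - f \<beta> (T \<beta>)) \<longlongrightarrow> 0) at_top"
  proof (rule Lim_null_comparison[OF _ e_lim])
    have "\<forall>\<^sub>F \<beta> in at_top. k \<le> R \<beta>" using R_lim by (simp add: filterlim_at_top)
    then show "\<forall>\<^sub>F \<beta> in at_top. norm (f \<beta> (k * (T \<beta> div k)) - f \<beta> (T \<beta>)) \<le> e \<beta>"
      using f_shift f_antimono
    proof eventually_elim
      case (elim \<beta>)
      let ?n = "k * (T \<beta> div k)"
      have "?n \<le> T \<beta>" "T \<beta> \<le> ?n + R \<beta>"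
        using elim(1) k mod_less_divisor[OF k, of "T \<beta>"] mult_div_mod_eq[of k "T \<beta>"] by linarith+
      then have "f \<beta> (T \<beta>) \<le> f \<beta> ?n" "f \<beta> (?n + R \<beta>) \<le> f \<beta> (T \<beta>)" using elim(3) by auto
      then show ?case using elim(2)[rule_format, of ?n] by simp
    qed
  qed
  then have fk: "((\<lambda>\<beta>. f \<beta> (k * (T \<beta> div k))) \<longlongrightarrow> exp (-1)) at_top"
    using tendsto_add[OF fT_lim] by fastforce
  have "((\<lambda>\<beta>. f \<beta> (k * (T \<beta> div k)) - f \<beta> (T \<beta> div k) ^ k) \<longlongrightarrow> 0) at_top"
  proof (rule Lim_null_comparison)
    show "\<forall>\<^sub>F \<beta> in at_top. norm (f \<beta> (k * (T \<beta> div k)) - f \<beta> (T \<beta> div k) ^ k) \<le> real k * e \<beta>"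
      using f_power[of k] by eventually_elim auto
    show "((\<lambda>\<beta>. real k * e \<beta>) \<longlongrightarrow> 0) at_top" using tendsto_mult_left[OF e_lim, of "real k"] by simp
  qed
  from tendsto_diff[OF fk this] have "((\<lambda>\<beta>. f \<beta> (T \<beta> div k) ^ k) \<longlongrightarrow> exp (-1)) at_top" by simp
  then have "((\<lambda>\<beta>. root k (f \<beta> (T \<beta> div k) ^ k)) \<longlongrightarrow> root k (exp (-1))) at_top"
    by (rule tendsto_real_root)
  moreover have "root k (exp (-1)) = exp (- (1 / real k))"
    by (rule real_root_pos_unique) (use k in \<open>auto simp flip: exp_of_nat_mult\<close>)
  moreover have "\<forall>\<^sub>F \<beta> in at_top. root k (f \<beta> (T \<beta> div k) ^ k) = f \<beta> (T \<beta> div k)"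
    using f_nonneg by eventually_elim (use k in \<open>simp add: real_root_power_cancel\<close>)
  ultimately have "((\<lambda>\<beta>. f \<beta> (T \<beta> div k)) \<longlongrightarrow> exp (- (1 / real k))) at_top"
    by (simp add: tendsto_cong)
  from f_power_lim[OF this, of j] show ?thesis
    by (simp flip: exp_of_nat_mult)
qed

text \<open>Rational multiples of \<open>T\<close> are covered by blocks; monotonicity in time
  squeezes a real \<open>t\<close> between rationals.\<close>

lemma f_exp_lim:
  assumes t: "t > 0"
  shows "((\<lambda>\<beta>. f \<beta> (nat \<lfloor>t * real (T \<beta>)\<rfloor>)) \<longlongrightarrow> exp (- t)) at_top"
proof (rule order_tendstoI)
  fix a assume a: "exp (- t) < a"
  then have "- ln a < t" using ln_less_cancel_iff[of "exp (- t)" a] by (simp add: order.strict_trans[of 0 "exp (-t)"])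
  then obtain q where q: "q \<in> \<rat>" "max 0 (- ln a) < q" "q < t"
    using Rats_dense_in_real[of "max 0 (- ln a)" t] t by auto
  then obtain j k where jk: "k \<noteq> 0" "q = real j / real k"
    using Rats_abs_nat_div_natE[OF q(1)] by (metis abs_of_nonneg max_less_iff_conj less_imp_le)
  have "exp (- q) < a"
    using q(2) a by (metis exp_gt_zero exp_less_cancel_iff exp_ln max_less_iff_conj minus_less_iff order.strict_trans)
  then have "\<forall>\<^sub>F \<beta> in at_top. f \<beta> (j * (T \<beta> div k)) < a"
    using f_block_lim[of k j] jk by (simp add: order_tendstoD(2))
  then show "\<forall>\<^sub>F \<beta> in at_top. f \<beta> (nat \<lfloor>t * real (T \<beta>)\<rfloor>) < a"
    using f_antimono
  proof eventually_elim
    case (elim \<beta>)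
    have "real (j * (T \<beta> div k)) \<le> q * real (T \<beta>)"
    proof -
      have "real k * real (T \<beta> div k) \<le> real (T \<beta>)"
        by (metis of_nat_le_iff of_nat_mult times_div_less_eq_dividend)
      from mult_left_mono[OF this, of q] q(2) jk show ?thesis by simp
    qed
    also have "\<dots> \<le> t * real (T \<beta>)" using q by (intro mult_right_mono) auto
    finally have "j * (T \<beta> div k) \<le> nat \<lfloor>t * real (T \<beta>)\<rfloor>" by linarith
    then show ?case using elim by (meson le_less_trans)
  qed
next
  fix a assume a: "a < exp (- t)"
  obtain q where q: "q \<in> \<rat>" "t < q" "a < exp (- q)"
  proof (cases "a > 0")
    case True
    then have "t < - ln a" using a ln_less_cancel_iff[of a "exp (- t)"] by simp
    then obtain q where "q \<in> \<rat>" "t < q" "q < - ln a" using Rats_dense_in_real by blast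
    then show ?thesis using that[of q] True by (metis exp_less_cancel_iff exp_ln less_minus_iff)
  next
    case False
    obtain q where "q \<in> \<rat>" "t < q" "q < t + 1" using Rats_dense_in_real[of t "t + 1"] by auto
    then show ?thesis using that[of q] False by (meson exp_gt_zero not_less order.strict_trans2 le_less_trans)
  qed
  then obtain j k where jk: "k \<noteq> 0" "q = real j / real k"
    using Rats_abs_nat_div_natE[OF q(1)] t by (metis abs_of_nonneg less_imp_le order.strict_trans)
  have "\<forall>\<^sub>F \<beta> in at_top. a < f \<beta> (j * (T \<beta> div k))"
    using f_block_lim[of k j] jk q(3) by (simp add: order_tendstoD(1))
  \<comment> \<open>Rounding \<open>T div k\<close> down loses at most \<open>j\<close> steps in
    total, which the gap \<open>(q - t) * T\<close> absorbs once \<open>T\<close> is this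
    large.\<close>
  moreover have "\<forall>\<^sub>F \<beta> in at_top. nat \<lceil>real j / (q - t)\<rceil> \<le> T \<beta>"
    using T_lim unfolding filterlim_at_top by blast
  ultimately show "\<forall>\<^sub>F \<beta> in at_top. a < f \<beta> (nat \<lfloor>t * real (T \<beta>)\<rfloor>)"
    using f_antimono
  proof eventually_elim
    case (elim \<beta>)
    have "real j / (q - t) \<le> real (T \<beta>)" using elim(2) by linarith
    then have "real j \<le> (q - t) * real (T \<beta>)" using q(2) by (simp add: field_simps)
    then have "t * real (T \<beta>) \<le> real j * (real (T \<beta>) / real k - 1)"
      using jk by (simp add: algebra_simps)
    also have "\<dots> \<le> real j * real (T \<beta> div k)"
    proof (rule mult_left_mono)
      have "T \<beta> \<le> k * (T \<beta> div k) + k"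
        using mod_less_divisor[of k "T \<beta>"] mult_div_mod_eq[of k "T \<beta>"] jk(1) by linarith
      then have "real (T \<beta>) \<le> real k * real (T \<beta> div k) + real k"
        by (metis of_nat_add of_nat_le_iff of_nat_mult)
      then show "real (T \<beta>) / real k - 1 \<le> real (T \<beta> div k)"
        using jk(1) by (simp add: field_simps)
    qed simp
    finally have "nat \<lfloor>t * real (T \<beta>)\<rfloor> \<le> j * (T \<beta> div k)"
      by (simp add: nat_le_iff floor_le_iff)
    then show ?case using elim by (meson less_le_trans)
  qed
qed

text \<open>As \<open>exp (-1) < 1 / 2\<close>, a waiting time \<open>R\<close> for forgetting and a
  time \<open>T\<close> for decay, together at most \<open>2 * T\<close>, halve the survival from
  any time on. The resulting geometric tail is uniform in \<beta> and dominates the sum for the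
  mean.\<close>

lemma f_halving: "\<forall>\<^sub>F \<beta> in at_top. \<forall>m. f \<beta> (m + 2 * T \<beta>) \<le> f \<beta> m / 2"
  if tail: "\<forall>\<^sub>F \<beta> in at_top. \<forall>m n. f \<beta> (m + R \<beta> + n) \<le> f \<beta> m * (f \<beta> n + e \<beta>)"
    and RT: "\<forall>\<^sub>F \<beta> in at_top. R \<beta> \<le> T \<beta>"
proof -
  have "exp (-1) < (1/2 :: real)"
    using exp_lower_Taylor_quadratic[of 1] by (simp add: exp_minus field_simps)
  moreover have "((\<lambda>\<beta>. f \<beta> (T \<beta>) + e \<beta>) \<longlongrightarrow> exp (-1)) at_top"
    using tendsto_add[OF fT_lim e_lim] by simp
  ultimately have "\<forall>\<^sub>F \<beta> in at_top. f \<beta> (T \<beta>) + e \<beta> < 1 / 2"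
    by (intro order_tendstoD(2))
  then show ?thesis using tail RT f_antimono f_nonneg
  proof eventually_elim
    case (elim \<beta>)
    show ?case
    proof
      fix m
      have "f \<beta> (m + 2 * T \<beta>) \<le> f \<beta> (m + R \<beta> + T \<beta>)" using elim by auto
      also have "\<dots> \<le> f \<beta> m * (f \<beta> (T \<beta>) + e \<beta>)" using elim by auto
      also have "\<dots> \<le> f \<beta> m * (1 / 2)" using elim by (intro mult_left_mono) auto
      finally show "f \<beta> (m + 2 * T \<beta>) \<le> f \<beta> m / 2" by simp
    qed
  qed
qed

text \<open>The normalised sum is the integral of a step function, to which dominated convergence applies.\<close>

lemma f_sum_lim:
  assumes halving: "\<forall>\<^sub>F \<beta> in at_top. \<forall>m. f \<beta> (m + 2 * T \<beta>) \<le> f \<beta> m / 2"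
    and summable: "\<forall>\<^sub>F \<beta> in at_top. summable (f \<beta>)"
  shows "((\<lambda>\<beta>. (\<Sum>n. f \<beta> n) / real (T \<beta>)) \<longlongrightarrow> 1) at_top"
proof -
  define h where "h \<beta> x = indicator {0..} x * f \<beta> (nat \<lfloor>x * real (T \<beta>)\<rfloor>)" for \<beta> x
  have T0: "\<forall>\<^sub>F \<beta> in at_top. T \<beta> \<ge> 1" using T_lim by (simp add: filterlim_at_top)
  have hm: "h \<beta> \<in> borel_measurable lborel" for \<beta> unfolding h_def by measurable
  have I_exp: "has_bochner_integral lborel (\<lambda>x. indicator {0..} x *\<^sub>R (exp (- (c * x)))) (1 / c)" if "c > 0" for c :: real
  proof -
    have "has_bochner_integral lborel (\<lambda>x. c * exp (- x * c) * indicator {0..} x) 1"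
    proof -
      have "(\<integral>\<^sup>+x. ennreal (exponential_density c x) \<partial>lborel) = 1"
        using prob_space.emeasure_space_1[OF prob_space_exponential_density[OF that]] that
        by (simp add: emeasure_density)
      then have "has_bochner_integral lborel (exponential_density c) 1"
        using that by (intro has_bochner_integral_nn_integral) (auto simp: exponential_density_nonneg)
      also have "exponential_density c = (\<lambda>x. c * exp (- x * c) * indicator {0..} x)"
        by (auto simp: exponential_density_def erlang_density_def indicator_def)
      finally show ?thesis .
    qed
    from has_bochner_integral_mult_right[OF this, of "1 / c"] that show ?thesis
      by (simp add: mult_ac)
  qed
  \<comment> \<open>The rate of halving once per two units of time; the factor 2 in the dominating
    function pays for rounding \<open>x / 2\<close> down.\<close>
  let ?c = "ln 2 / 2 :: real"
  have lim: "((\<lambda>\<beta>. integral\<^sup>L lborel (h \<beta>)) \<longlongrightarrow> integral\<^sup>L lborel (\<lambda>x. indicator {0..} x * exp (- x))) at_top"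
  proof (rule integral_dominated_convergence_at_top)
    show "integrable lborel (\<lambda>x. 2 * (indicator {0..} x *\<^sub>R (exp (- (?c * x)))))"
      using I_exp[of ?c] by (auto simp: has_bochner_integral_iff)
    show "AE x in lborel. ((\<lambda>i. h i x) \<longlongrightarrow> indicator {0..} x * exp (- x)) at_top"
    proof (rule AE_I2)
      fix x :: real
      consider "x < 0" | "x = 0" | "x > 0" by linarith
      then show "((\<lambda>i. h i x) \<longlongrightarrow> indicator {0..} x * exp (- x)) at_top"
      proof cases
        case 2
        have "((\<lambda>i. f i 0) \<longlongrightarrow> 1) at_top" by (rule tendsto_eventually) (rule f0)
        then show ?thesis using 2 by (simp add: h_def)
      qed (use f_exp_lim[of x] in \<open>auto simp: h_def\<close>)
    qed
    show "\<forall>\<^sub>F i in at_top. AE x in lborel. norm (h i x) \<le> 2 * (indicator {0..} x *\<^sub>R (exp (- (?c * x))))"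
      using halving f0 f_nonneg f_antimono T0
    proof eventually_elim
      case (elim \<beta>)
      have pow: "f \<beta> (j * (2 * T \<beta>)) \<le> (1/2) ^ j" for j
      proof (induction j)
        case (Suc j)
        have "f \<beta> (Suc j * (2 * T \<beta>)) \<le> f \<beta> (j * (2 * T \<beta>)) / 2"
          using elim(1)[rule_format, of "j * (2 * T \<beta>)"] by (simp only: mult_Suc add.commute)
        then show ?case using Suc by simp
      qed (use elim in simp)
      have "f \<beta> (nat \<lfloor>x * real (T \<beta>)\<rfloor>) \<le> 2 * exp (- (?c * x))" if "x \<ge> 0" for x
      proof -
        define j where "j = nat \<lfloor>x / 2\<rfloor>"
        have j: "real j \<le> x / 2" "x / 2 < real j + 1" using that unfolding j_def by linarith+
        have "real (j * (2 * T \<beta>)) \<le> x * real (T \<beta>)"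
          using mult_right_mono[OF j(1), of "2 * real (T \<beta>)"] by (simp add: mult_ac)
        then have "j * (2 * T \<beta>) \<le> nat \<lfloor>x * real (T \<beta>)\<rfloor>" by linarith
        then have "f \<beta> (nat \<lfloor>x * real (T \<beta>)\<rfloor>) \<le> (1/2) ^ j"
          using elim(4) pow by (meson order_trans)
        also have "(1/2 :: real) ^ j = exp (- (ln 2 * real j))"
          by (simp add: exp_minus exp_of_nat2_mult power_one_over inverse_eq_divide)
        also have "\<dots> \<le> exp (ln 2 + - (?c * x))"
          using mult_left_mono[OF less_imp_le[OF j(2)], of "ln 2"] by (simp add: algebra_simps)
        also have "\<dots> = 2 * exp (- (?c * x))" by (simp only: exp_add) simp
        finally show ?thesis .
      qed
      then show ?case using elim by (intro AE_I2) (auto simp: h_def indicator_def)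
    qed
  qed (use hm in auto)
  have "integral\<^sup>L lborel (\<lambda>x. indicator {0..} x * exp (- x)) = (1 :: real)"
    using I_exp[of 1] by (auto simp: has_bochner_integral_iff)
  moreover have "\<forall>\<^sub>F \<beta> in at_top. integral\<^sup>L lborel (h \<beta>) = (\<Sum>n. f \<beta> n) / real (T \<beta>)"
    using summable f_nonneg T0
  proof eventually_elim
    case (elim \<beta>)
    \<comment> \<open>On \<open>?J n\<close> the step function has the constant value
      \<open>f \<beta> n\<close>.\<close>
    let ?J = "\<lambda>n. {real n / real (T \<beta>)..<(real n + 1) / real (T \<beta>)}"
    have Tpos: "real (T \<beta>) > 0" using elim by simp
    have mem: "x \<in> ?J n \<longleftrightarrow> x \<ge> 0 \<and> n = nat \<lfloor>x * real (T \<beta>)\<rfloor>" for x n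
    proof -
      have "x \<in> ?J n \<longleftrightarrow> real n \<le> x * real (T \<beta>) \<and> x * real (T \<beta>) < real n + 1"
        using Tpos by (auto simp: field_simps)
      also have "\<dots> \<longleftrightarrow> \<lfloor>x * real (T \<beta>)\<rfloor> = int n" by linarith
      also have "\<dots> \<longleftrightarrow> x \<ge> 0 \<and> n = nat \<lfloor>x * real (T \<beta>)\<rfloor>"
      proof -
        have "x \<ge> 0 \<longleftrightarrow> \<lfloor>x * real (T \<beta>)\<rfloor> \<ge> 0"
          using Tpos by (simp add: zero_le_mult_iff del: zero_le_floor) (simp add: zero_le_mult_iff)
        then show ?thesis by (metis int_nat_eq nat_int of_nat_0_le_iff)
      qed
      finally show ?thesis .
    qed
    have pt: "ennreal (h \<beta> x) = (\<Sum>n. ennreal (f \<beta> n) * indicator (?J n) x)" for x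
    proof -
      have "(\<lambda>n. ennreal (f \<beta> n) * indicator (?J n) x) =
        (\<lambda>n. if n = nat \<lfloor>x * real (T \<beta>)\<rfloor> then ennreal (h \<beta> x) else 0)"
        using mem[of x] by (auto simp: h_def indicator_def fun_eq_iff)
      also have "\<dots> sums ennreal (h \<beta> x)" by (rule sums_single)
      finally show ?thesis by (simp add: sums_unique)
    qed
    have "(\<integral>\<^sup>+x. ennreal (h \<beta> x) \<partial>lborel) = (\<Sum>n. ennreal (f \<beta> n) * emeasure lborel (?J n))"
      unfolding pt by (subst nn_integral_suminf) (auto simp: nn_integral_cmult_indicator)
    also have "\<dots> = (\<Sum>n. ennreal (f \<beta> n / real (T \<beta>)))"
      using Tpos elim(2) by (simp add: divide_right_mono diff_divide_distrib[symmetric] flip: ennreal_mult')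
    also have "\<dots> = ennreal (\<Sum>n. f \<beta> n / real (T \<beta>))"
      using elim by (intro suminf_ennreal2 summable_divide) auto
    finally have nn: "(\<integral>\<^sup>+x. ennreal (h \<beta> x) \<partial>lborel) = ennreal (\<Sum>n. f \<beta> n / real (T \<beta>))" .
    have "integral\<^sup>L lborel (h \<beta>) = enn2real (\<integral>\<^sup>+x. ennreal (h \<beta> x) \<partial>lborel)"
      using hm elim by (intro integral_eq_nn_integral AE_I2) (auto simp: h_def)
    also have "\<dots> = (\<Sum>n. f \<beta> n / real (T \<beta>))"
      unfolding nn using elim by (intro enn2real_ennreal suminf_nonneg summable_divide) auto
    also have "\<dots> = (\<Sum>n. f \<beta> n) / real (T \<beta>)" using elim by (simp add: suminf_divide)
    finally show ?case .
  qed
  ultimately show ?thesis using lim tendsto_cong by fastforce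
qed

end

section \<open>The exit time of a metastable reversible chain\<close>

text \<open>\<open>descent\<close> concerns every state but \<open>g\<close> and yields the time
  scale of absorption; \<open>descent_V\<close> excludes \<open>s\<close> as well and says that no
  other state is a trap of depth above \<open>V\<close>.\<close>

locale metastable = metropolis +
  fixes s g and \<Gamma> V :: real
  assumes sS: "s \<in> S" and gS: "g \<in> S" and sg: "s \<noteq> g" and Hs: "H s = 0"
    and V0: "0 \<le> V" and V\<Gamma>: "V < \<Gamma>"
    and barrier: "\<And>h. reach h s g \<Longrightarrow> \<Gamma> \<le> h"
    and descent: "\<And>x. x \<in> S \<Longrightarrow> x \<noteq> g \<Longrightarrow> \<exists>y\<in>S. reach (H x + \<Gamma>) x y \<and> (y = g \<or> H y < H x)"
    and descent_V: "\<And>x. x \<in> S \<Longrightarrow> x \<noteq> s \<Longrightarrow> x \<noteq> g \<Longrightarrow>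
      \<exists>y\<in>S. reach (H x + V) x y \<and> (y = s \<or> y = g \<or> H y < H x)"
begin

definition f :: "real \<Rightarrow> nat \<Rightarrow> real" where "f \<beta> n = surv (S - {g}) \<beta> n s"

lemma f_0: "f \<beta> 0 = 1"
  using sS sg by (simp add: f_def)

lemma f_bounds: "\<beta> > 0 \<Longrightarrow> 0 \<le> f \<beta> n" "\<beta> > 0 \<Longrightarrow> f \<beta> n \<le> 1"
  unfolding f_def using surv_bounds sS by auto

lemma f_antimono: "\<beta> > 0 \<Longrightarrow> m \<le> n \<Longrightarrow> f \<beta> n \<le> f \<beta> m"
  unfolding f_def using surv_antimono sS by auto

text \<open>The Markov property at time \<open>m\<close>, extracted from the recursion
  alone.\<close>

lemma surv_prepend_le:
  assumes b: "\<beta> > 0" and x: "x \<in> S" and le: "\<And>y. y \<in> S \<Longrightarrow> surv D \<beta> k y \<le> a"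
  shows "surv D \<beta> (m + k) x \<le> surv D \<beta> m x * a"
  using x
proof (induction m arbitrary: x)
  case 0
  then show ?case using le[of x] by auto
next
  case (Suc m)
  have "(\<Sum>y\<in>S. p \<beta> x y * surv D \<beta> (m + k) y) \<le> (\<Sum>y\<in>S. p \<beta> x y * (surv D \<beta> m y * a))"
    using Suc p_nonneg[OF b] by (intro sum_mono mult_left_mono) auto
  then show ?case by (simp add: sum_distrib_right mult.assoc)
qed

lemma surv_prepend_ge:
  assumes b: "\<beta> > 0" and x: "x \<in> S"
    and ge: "\<And>y. y \<in> S \<Longrightarrow> y \<in> D \<Longrightarrow> a * (surv D \<beta> k' y - e) \<le> surv D \<beta> k y"
  shows "a * (surv D \<beta> (m + k') x - e * surv D \<beta> m x) \<le> surv D \<beta> (m + k) x"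
  using x
proof (induction m arbitrary: x)
  case 0
  then show ?case using ge[of x] by (cases "x \<in> D") auto
next
  case (Suc m)
  have "(\<Sum>y\<in>S. p \<beta> x y * (a * (surv D \<beta> (m + k') y - e * surv D \<beta> m y)))
      \<le> (\<Sum>y\<in>S. p \<beta> x y * surv D \<beta> (m + k) y)"
    using Suc p_nonneg[OF b] by (intro sum_mono mult_left_mono) auto
  also have "(\<Sum>y\<in>S. p \<beta> x y * (a * (surv D \<beta> (m + k') y - e * surv D \<beta> m y)))
      = a * ((\<Sum>y\<in>S. p \<beta> x y * surv D \<beta> (m + k') y) - e * (\<Sum>y\<in>S. p \<beta> x y * surv D \<beta> m y))"
    by (simp add: sum_distrib_left right_diff_distrib sum_subtractf mult_ac)
  finally show ?case by auto
qed

text \<open>Up to time \<open>R\<close> the chain avoids both \<open>s\<close> and \<open>g\<close>,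
  or is absorbed in \<open>g\<close>, or passes through \<open>s\<close> with at least
  \<open>n\<close> steps left to survive.\<close>

lemma surv_return_upper:
  assumes b: "\<beta> > 0" and x: "x \<in> S"
  shows "surv (S - {g}) \<beta> (R + n) x \<le> surv (S - {s, g}) \<beta> R x + f \<beta> n"
  using x
proof (induction R arbitrary: x)
  case 0
  then show ?case using surv_bounds[OF b, of x "S - {g}" n] f_bounds[OF b, of n]
    by (cases "x = s"; cases "x = g") (auto simp: f_def)
next
  case (Suc R)
  show ?case
  proof (cases "x \<in> {s, g}")
    case True
    then show ?thesis
      using surv_antimono[OF b sS, of n "Suc R + n" "S - {g}"] f_bounds[OF b, of n]
      by (auto simp: f_def simp del: surv.simps)
  next
    case False
    have "(\<Sum>y\<in>S. p \<beta> x y * surv (S - {g}) \<beta> (R + n) y)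
        \<le> (\<Sum>y\<in>S. p \<beta> x y * (surv (S - {s, g}) \<beta> R y + f \<beta> n))"
      using Suc p_nonneg[OF b] by (intro sum_mono mult_left_mono) auto
    also have "\<dots> = (\<Sum>y\<in>S. p \<beta> x y * surv (S - {s, g}) \<beta> R y) + f \<beta> n"
      using p_sum[OF b Suc.prems] by (simp add: distrib_left sum.distrib flip: sum_distrib_right)
    finally show ?thesis using False Suc.prems by simp
  qed
qed

text \<open>The difference is the probability to have visited \<open>s\<close> but not
  \<open>g\<close> by time \<open>R\<close>. From the visit on, surviving \<open>n\<close> more
  steps has probability \<open>f \<beta> n\<close> and covers all times up to
  \<open>n\<close>.\<close>

lemma surv_return_lower:
  assumes b: "\<beta> > 0" and x: "x \<in> S"
  shows "f \<beta> n * (surv (S - {g}) \<beta> R x - surv (S - {s, g}) \<beta> R x) \<le> surv (S - {g}) \<beta> n x"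
  using x
proof (induction R arbitrary: x n)
  case 0
  then show ?case using surv_bounds[OF b, of x "S - {g}" n]
    by (cases "x = s"; cases "x = g") (auto simp: f_def)
next
  case (Suc R)
  let ?d = "\<lambda>n x. surv (S - {g}) \<beta> n x - surv (S - {s, g}) \<beta> n x"
  have fn: "0 \<le> f \<beta> n" "f \<beta> n \<le> 1" using f_bounds[OF b] by auto
  have d1: "?d (Suc R) x \<le> 1"
    using surv_bounds[OF b Suc.prems, of "S - {g}" "Suc R"] surv_bounds[OF b Suc.prems, of "S - {s, g}" "Suc R"]
    by linarith
  consider "x = g" | "x = s" | "x \<noteq> s" "x \<noteq> g" "n = 0" | n' where "x \<noteq> s" "x \<noteq> g" "n = Suc n'"
    by (cases n) auto
  then show ?case
  proof cases
    case 1
    then show ?thesis by (simp del: surv.simps)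
  next
    case 2
    then show ?thesis using mult_left_mono[OF d1 fn(1)] by (simp add: f_def del: surv.simps)
  next
    case 3
    then show ?thesis using d1 fn Suc.prems by (simp add: f_0 del: surv.simps(2))
  next
    case 4
    have "f \<beta> n * ?d (Suc R) x = (\<Sum>y\<in>S. p \<beta> x y * (f \<beta> n * ?d R y))"
      using 4 Suc.prems by (simp add: sum_subtractf right_diff_distrib sum_distrib_left mult_ac)
    also have "\<dots> \<le> (\<Sum>y\<in>S. p \<beta> x y * surv (S - {g}) \<beta> n y)"
      using Suc.IH p_nonneg[OF b Suc.prems] by (intro sum_mono mult_left_mono) auto
    also have "\<dots> \<le> (\<Sum>y\<in>S. p \<beta> x y * surv (S - {g}) \<beta> n' y)"
      using p_nonneg[OF b Suc.prems] surv_antimono[OF b, of _ n' n "S - {g}"] 4(3)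
      by (intro sum_mono mult_left_mono) (auto simp del: surv.simps)
    also have "\<dots> = surv (S - {g}) \<beta> n x" using 4 Suc.prems by simp
    finally show ?thesis .
  qed
qed

definition F :: real where "F = c * (real (card S))\<^sup>2"

lemma F_pos: "F > 0"
proof -
  have "card S > 0" using finite_S sS by (auto simp: card_gt_0_iff)
  then show ?thesis using c_pos by (simp add: F_def)
qed

lemma f_lower: "\<beta> > 0 \<Longrightarrow> 1 - f \<beta> n \<le> real n * (F * exp (- \<beta> * \<Gamma>))"
  unfolding f_def F_def by (rule surv_lower) (use sS gS Hs V0 V\<Gamma> barrier in auto)

lemma f_sum_bound: "\<exists>K>0. \<forall>\<beta>>0. \<forall>n. (\<Sum>k<n. f \<beta> k) \<le> K * exp (\<beta> * \<Gamma>)"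
proof -
  have "\<exists>y\<in>S. reach (H x + \<Gamma>) x y \<and> (y \<in> {g} \<or> H y < H x)" if "x \<in> S" "x \<notin> {g}" for x
    using descent[of x] that by auto
  from occupation_bound[of "{g}" \<Gamma>, OF this] obtain K where K: "K \<ge> 0"
    "\<And>\<beta> n. \<beta> > 0 \<Longrightarrow> (\<Sum>k<n. f \<beta> k) \<le> K * exp (\<beta> * \<Gamma>)"
    using sS unfolding f_def by blast
  have "(\<Sum>k<n. f \<beta> k) \<le> (K + 1) * exp (\<beta> * \<Gamma>)" if "\<beta> > 0" for \<beta> n
    using K(2)[OF that, of n] by (simp add: distrib_right add_increasing2)
  then show ?thesis using K(1) by (intro exI[of _ "K + 1"]) auto
qed

text \<open>Half the gap puts \<open>R\<close>, up to rounding, at the geometric mean of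
  \<open>exp (\<beta> * V)\<close> and \<open>exp (\<beta> * \<Gamma>)\<close>: long enough to
  return to \<open>s\<close>, too short to exit.\<close>

definition \<kappa> :: real where "\<kappa> = (\<Gamma> - V) / 2"

definition R :: "real \<Rightarrow> nat" where "R \<beta> = nat \<lceil>exp (\<beta> * (V + \<kappa>))\<rceil>"

lemma R_bounds:
  assumes "\<beta> > 0"
  shows "exp (\<beta> * (V + \<kappa>)) \<le> real (R \<beta>)" "real (R \<beta>) \<le> 2 * exp (\<beta> * (V + \<kappa>))" "R \<beta> \<ge> 1"
proof -
  have "exp (\<beta> * (V + \<kappa>)) \<ge> 1" using assms V0 V\<Gamma> by (simp add: \<kappa>_def)
  moreover have "real (R \<beta>) = real_of_int \<lceil>exp (\<beta> * (V + \<kappa>))\<rceil>"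
    unfolding R_def using calculation by (intro of_nat_nat) linarith
  ultimately show "exp (\<beta> * (V + \<kappa>)) \<le> real (R \<beta>)" "real (R \<beta>) \<le> 2 * exp (\<beta> * (V + \<kappa>))" "R \<beta> \<ge> 1"
    by linarith+
qed

text \<open>Failing to return within \<open>R\<close> is controlled by the occupation bound at depth
  \<open>V\<close>, exiting within \<open>2 * R\<close> by the flux bound at height \<Gamma>; in
  both cases the ratio of time scales is of order \<open>exp (- \<beta> * \<kappa>)\<close>.\<close>

lemma error_bounds:
  obtains K' where "K' > 0"
    "\<And>\<beta> x. \<beta> > 0 \<Longrightarrow> x \<in> S \<Longrightarrow> surv (S - {s, g}) \<beta> (R \<beta>) x + (1 - f \<beta> (2 * R \<beta>)) \<le> K' * exp (- \<beta> * \<kappa>)"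
proof -
  have "\<exists>y\<in>S. reach (H x + V) x y \<and> (y \<in> {s, g} \<or> H y < H x)" if "x \<in> S" "x \<notin> {s, g}" for x
    using descent_V[of x] that by auto
  from occupation_bound[of "{s, g}" V, OF this] obtain K where K: "K \<ge> 0"
    "\<And>\<beta> x n. \<beta> > 0 \<Longrightarrow> x \<in> S \<Longrightarrow> (\<Sum>k<n. surv (S - {s, g}) \<beta> k x) \<le> K * exp (\<beta> * V)"
    by blast
  have "surv (S - {s, g}) \<beta> (R \<beta>) x + (1 - f \<beta> (2 * R \<beta>)) \<le> (K + 4 * F) * exp (- \<beta> * \<kappa>)"
    if b: "\<beta> > 0" and x: "x \<in> S" for \<beta> x
  proof -
    let ?v = "surv (S - {s, g}) \<beta> (R \<beta>) x"
    have "exp (\<beta> * (V + \<kappa>)) * ?v \<le> real (R \<beta>) * ?v"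
      using R_bounds[OF b] surv_bounds[OF b x] by (intro mult_right_mono) auto
    also have "\<dots> \<le> K * exp (\<beta> * V)" by (rule surv_bound_time) (use b x K in auto)
    also have "\<dots> = exp (\<beta> * (V + \<kappa>)) * (K * exp (- \<beta> * \<kappa>))"
      by (simp add: distrib_left exp_add exp_minus)
    finally have 1: "?v \<le> K * exp (- \<beta> * \<kappa>)" by simp
    have "1 - f \<beta> (2 * R \<beta>) \<le> 2 * real (R \<beta>) * (F * exp (- \<beta> * \<Gamma>))"
      using f_lower[OF b, of "2 * R \<beta>"] by simp
    also have "\<dots> \<le> 2 * (2 * exp (\<beta> * (V + \<kappa>))) * (F * exp (- \<beta> * \<Gamma>))"
      using R_bounds[OF b] F_pos by (intro mult_right_mono mult_left_mono) auto
    also have "\<dots> = 4 * F * (exp (\<beta> * (V + \<kappa>)) * exp (- \<beta> * \<Gamma>))" by simp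
    also have "exp (\<beta> * (V + \<kappa>)) * exp (- \<beta> * \<Gamma>) = exp (- \<beta> * \<kappa>)"
      by (simp add: \<kappa>_def mult_exp_exp field_simps)
    finally show ?thesis using 1 by (simp add: algebra_simps)
  qed
  then show ?thesis using K(1) F_pos by (intro that[of "K + 4 * F"]) auto
qed

text \<open>The comparisons pass through a return to \<open>s\<close> during an inserted period of
  \<open>R\<close> steps; the second bound removes this period again, which doubles the error in the
  third.\<close>

lemma memory_loss:
  assumes b: "\<beta> > 0"
    and err: "\<And>x. x \<in> S \<Longrightarrow> surv (S - {s, g}) \<beta> (R \<beta>) x + (1 - f \<beta> (2 * R \<beta>)) \<le> e"
  shows "f \<beta> (m + R \<beta> + n) \<le> f \<beta> m * (f \<beta> n + e)" "f \<beta> m - f \<beta> (m + R \<beta>) \<le> e"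
    "\<bar>f \<beta> (m + n) - f \<beta> m * f \<beta> n\<bar> \<le> 2 * e"
proof -
  have err1: "surv (S - {s, g}) \<beta> (R \<beta>) x \<le> e" if "x \<in> S" for x
    using err[OF that] f_bounds(2)[OF b, of "2 * R \<beta>"] by linarith
  have e0: "0 \<le> e" using err1[OF sS] surv_bounds[OF b sS] by (meson order_trans)
  have upper: "f \<beta> (m + R \<beta> + n) \<le> f \<beta> m * (f \<beta> n + e)" for m n
  proof -
    have "surv (S - {g}) \<beta> (m + (R \<beta> + n)) s \<le> surv (S - {g}) \<beta> m s * (f \<beta> n + e)"
    proof (rule surv_prepend_le[OF b sS])
      show "surv (S - {g}) \<beta> (R \<beta> + n) y \<le> f \<beta> n + e" if "y \<in> S" for y
        using surv_return_upper[OF b that, of "R \<beta>" n] err1[OF that] by linarith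
    qed
    then show ?thesis by (simp add: f_def add.assoc)
  qed
  have lower: "f \<beta> n * (f \<beta> (m + R \<beta>) - e) \<le> f \<beta> (m + n)" for m n
  proof -
    have "f \<beta> n * (surv (S - {g}) \<beta> (m + R \<beta>) s - e * surv (S - {g}) \<beta> m s) \<le> surv (S - {g}) \<beta> (m + n) s"
    proof (rule surv_prepend_ge[OF b sS])
      fix y assume "y \<in> S" "y \<in> S - {g}"
      have "f \<beta> n * (surv (S - {g}) \<beta> (R \<beta>) y - e)
          \<le> f \<beta> n * (surv (S - {g}) \<beta> (R \<beta>) y - surv (S - {s, g}) \<beta> (R \<beta>) y)"
        using err1[OF \<open>y \<in> S\<close>] f_bounds[OF b] by (intro mult_left_mono) auto
      then show "f \<beta> n * (surv (S - {g}) \<beta> (R \<beta>) y - e) \<le> surv (S - {g}) \<beta> n y"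
        using surv_return_lower[OF b \<open>y \<in> S\<close>] by (meson order_trans)
    qed
    moreover have "f \<beta> n * (f \<beta> (m + R \<beta>) - e) \<le> f \<beta> n * (f \<beta> (m + R \<beta>) - e * f \<beta> m)"
      using f_bounds[OF b] e0 by (intro mult_left_mono) (auto intro: mult_left_le)
    ultimately show ?thesis by (simp add: f_def)
  qed
  \<comment> \<open>Going back \<open>R\<close> steps to time \<open>k\<close>: from the state there
    the chain returns to \<open>s\<close> within \<open>R\<close> steps, and from \<open>s\<close>
    it survives \<open>2 * R\<close> steps, up to small probability. Times below \<open>R\<close>
    are covered by survival from the start up to \<open>2 * R\<close>.\<close>
  have shift: "f \<beta> m - f \<beta> (m + R \<beta>) \<le> e" for m
  proof (cases "m \<ge> R \<beta>")
    case True
    define k where "k = m - R \<beta>"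
    have m: "m = k + R \<beta>" using True by (simp add: k_def)
    have "1 * (surv (S - {g}) \<beta> (k + R \<beta>) s - e * surv (S - {g}) \<beta> k s) \<le> surv (S - {g}) \<beta> (k + 2 * R \<beta>) s"
    proof (rule surv_prepend_ge[OF b sS])
      fix y assume y: "y \<in> S" "y \<in> S - {g}"
      let ?d = "surv (S - {g}) \<beta> (R \<beta>) y - surv (S - {s, g}) \<beta> (R \<beta>) y"
      have "?d \<le> 1" using surv_bounds[OF b y(1)] by (smt (verit))
      then have "(1 - f \<beta> (2 * R \<beta>)) * ?d \<le> (1 - f \<beta> (2 * R \<beta>)) * 1"
        using f_bounds(2)[OF b] by (intro mult_left_mono) auto
      then have "?d - (1 - f \<beta> (2 * R \<beta>)) \<le> f \<beta> (2 * R \<beta>) * ?d" by (simp add: algebra_simps)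
      also have "\<dots> \<le> surv (S - {g}) \<beta> (2 * R \<beta>) y" by (rule surv_return_lower[OF b y(1)])
      finally show "1 * (surv (S - {g}) \<beta> (R \<beta>) y - e) \<le> surv (S - {g}) \<beta> (2 * R \<beta>) y"
        using err[OF y(1)] by simp
    qed
    moreover have "e * f \<beta> k \<le> e" using f_bounds[OF b] e0 by (auto intro: mult_left_le)
    ultimately show ?thesis by (simp add: f_def m mult_2 add.assoc)
  next
    case False
    have "f \<beta> (2 * R \<beta>) \<le> f \<beta> (m + R \<beta>)" using False by (intro f_antimono[OF b]) auto
    moreover have "1 - f \<beta> (2 * R \<beta>) \<le> e" using err[OF sS] surv_bounds[OF b sS, of "S - {s, g}" "R \<beta>"] by linarith
    ultimately show ?thesis using f_bounds[OF b, of m] by linarith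
  qed
  have "f \<beta> (m + n) \<le> f \<beta> m * f \<beta> n + 2 * e"
  proof -
    have "f \<beta> (m + n) \<le> f \<beta> (m + n + R \<beta>) + e" using shift[of "m + n"] by simp
    also have "\<dots> \<le> f \<beta> m * (f \<beta> n + e) + e" using upper[of m n] by (simp add: add_ac)
    also have "\<dots> \<le> f \<beta> m * f \<beta> n + 2 * e"
      using mult_right_mono[OF f_bounds(2)[OF b, of m] e0] by (simp add: algebra_simps)
    finally show ?thesis .
  qed
  moreover have "f \<beta> m * f \<beta> n - 2 * e \<le> f \<beta> (m + n)"
  proof -
    have "f \<beta> n * (f \<beta> m - 2 * e) \<le> f \<beta> n * (f \<beta> (m + R \<beta>) - e)"
      using shift[of m] f_bounds[OF b] by (intro mult_left_mono) auto
    moreover have "f \<beta> n * (2 * e) \<le> 2 * e" using f_bounds[OF b] e0 by (intro mult_left_le_one_le) auto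
    ultimately show ?thesis using lower[of n m] by (simp add: algebra_simps)
  qed
  ultimately show "\<bar>f \<beta> (m + n) - f \<beta> m * f \<beta> n\<bar> \<le> 2 * e" by linarith
  show "f \<beta> (m + R \<beta> + n) \<le> f \<beta> m * (f \<beta> n + e)" "f \<beta> m - f \<beta> (m + R \<beta>) \<le> e"
    by (rule upper, rule shift)
qed

text \<open>The time scale of the theorem expressed through \<open>f\<close>, hence independent of
  the realization of the chain.\<close>

definition T :: "real \<Rightarrow> nat" where "T \<beta> = Inf {n. n \<ge> 1 \<and> f \<beta> n \<le> exp (-1)}"

lemma exp_lim_0: "a > 0 \<Longrightarrow> ((\<lambda>\<beta>::real. C * exp (- \<beta> * a)) \<longlongrightarrow> 0) at_top"
proof -
  assume "a > 0"
  then have "filterlim (\<lambda>\<beta>::real. \<beta> * a) at_top at_top"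
    by (intro filterlim_at_top_mult_tendsto_pos[OF tendsto_const _ filterlim_ident])
  then have "filterlim (\<lambda>\<beta>::real. - \<beta> * a) at_bot at_top"
    by (simp add: filterlim_uminus_at_bot)
  from tendsto_mult_left[OF filterlim_compose[OF exp_at_bot this], of C] show ?thesis by simp
qed

lemma f_summable:
  assumes "\<beta> > 0"
  shows "summable (f \<beta>)"
proof -
  obtain K where K: "\<And>n. (\<Sum>k<n. f \<beta> k) \<le> K * exp (\<beta> * \<Gamma>)" using f_sum_bound assms by blast
  show ?thesis
    by (rule bounded_imp_summable[of _ "K * exp (\<beta> * \<Gamma>)"])
      (use K[of "Suc _"] f_bounds[OF assms] in \<open>auto simp: lessThan_Suc_atMost\<close>)
qed

lemma T_props:
  assumes b: "\<beta> > 0"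
  shows "T \<beta> \<ge> 1" "f \<beta> (T \<beta>) \<le> exp (-1)" "exp (-1) < f \<beta> (T \<beta> - 1)"
    "(1 - exp (-1)) / F * exp (\<beta> * \<Gamma>) \<le> real (T \<beta>)"
proof -
  have "f \<beta> \<longlonglongrightarrow> 0" by (rule summable_LIMSEQ_zero[OF f_summable[OF b]])
  then have "\<forall>\<^sub>F n in sequentially. f \<beta> n < exp (-1)" by (rule order_tendstoD) simp
  then obtain N where "\<And>n. n \<ge> N \<Longrightarrow> f \<beta> n < exp (-1)" by (auto simp: eventually_sequentially)
  then have "Suc N \<in> {n. n \<ge> 1 \<and> f \<beta> n \<le> exp (-1)}" by (auto simp: less_imp_le)
  then have "T \<beta> \<in> {n. n \<ge> 1 \<and> f \<beta> n \<le> exp (-1)}" unfolding T_def by (intro Inf_nat_def1) blast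
  then show T1: "T \<beta> \<ge> 1" and T2: "f \<beta> (T \<beta>) \<le> exp (-1)" by auto
  show "exp (-1) < f \<beta> (T \<beta> - 1)"
  proof (cases "T \<beta> = 1")
    case True
    then show ?thesis by (simp add: f_0)
  next
    case False
    show ?thesis
    proof (rule ccontr)
      assume "\<not> ?thesis"
      then have "T \<beta> \<le> T \<beta> - 1" using T1 False
        unfolding T_def[of \<beta>] by (intro cInf_lower) (auto simp flip: T_def)
      then show False using T1 by simp
    qed
  qed
  have "1 - exp (-1) \<le> real (T \<beta>) * (F * exp (- \<beta> * \<Gamma>))" using f_lower[OF b, of "T \<beta>"] T2 by linarith
  then show "(1 - exp (-1)) / F * exp (\<beta> * \<Gamma>) \<le> real (T \<beta>)"
    using F_pos by (simp add: field_simps exp_minus)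
qed

lemma almost_memoryless_f: "\<exists>e. almost_memoryless f e R T \<and>
   (\<forall>\<^sub>F \<beta> in at_top. \<forall>m n. f \<beta> (m + R \<beta> + n) \<le> f \<beta> m * (f \<beta> n + e \<beta>)) \<and>
   (\<forall>\<^sub>F \<beta> in at_top. R \<beta> \<le> T \<beta>)"
proof -
  obtain K where K: "K > 0"
    "\<And>\<beta> x. \<beta> > 0 \<Longrightarrow> x \<in> S \<Longrightarrow> surv (S - {s, g}) \<beta> (R \<beta>) x + (1 - f \<beta> (2 * R \<beta>)) \<le> K * exp (- \<beta> * \<kappa>)"
    using error_bounds by blast
  \<comment> \<open>The doubling accommodates the multiplicativity bound of
    \<open>memory_loss\<close>.\<close>
  define e where "e \<beta> = 2 * (K * exp (- \<beta> * \<kappa>))" for \<beta>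
  have \<kappa>: "\<kappa> > 0" using V\<Gamma> by (simp add: \<kappa>_def)
  have elim: "(e \<longlongrightarrow> 0) at_top" unfolding e_def using exp_lim_0[OF \<kappa>, of "2 * K"] by (simp add: mult.assoc)
  have K0: "K * exp (- \<beta> * \<kappa>) \<ge> 0" for \<beta> using K(1) by simp
  have pos: "\<forall>\<^sub>F \<beta>::real in at_top. \<beta> > 0" by (rule eventually_gt_at_top)
  have expinf: "filterlim (\<lambda>\<beta>::real. exp (\<beta> * a)) at_top at_top" if "a > 0" for a
    using that by (intro filterlim_compose[OF exp_at_top]
      filterlim_at_top_mult_tendsto_pos[OF tendsto_const _ filterlim_ident])
  have RT: "\<forall>\<^sub>F \<beta> in at_top. R \<beta> \<le> T \<beta>"
  proof -
    let ?c = "(1 - exp (-1)) / F :: real"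
    have c: "?c > 0" using F_pos by simp
    have "\<forall>\<^sub>F \<beta> in at_top. 2 / ?c \<le> exp (\<beta> * \<kappa>)"
      using expinf[OF \<kappa>] unfolding filterlim_at_top by blast
    then show ?thesis using pos
    proof eventually_elim
      case (elim \<beta>)
      have "real (R \<beta>) \<le> 2 * exp (\<beta> * (V + \<kappa>))" by (rule R_bounds[OF elim(2)])
      also have "\<dots> \<le> ?c * exp (\<beta> * \<kappa>) * exp (\<beta> * (V + \<kappa>))"
      proof (rule mult_right_mono)
        show "2 \<le> ?c * exp (\<beta> * \<kappa>)"
          using elim(1) unfolding pos_divide_le_eq[OF c] by (simp only: mult.commute)
      qed simp
      also have "\<dots> = ?c * exp (\<beta> * \<Gamma>)"
        by (simp add: \<kappa>_def mult.assoc mult_exp_exp field_simps)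
      also have "\<dots> \<le> real (T \<beta>)" by (rule T_props[OF elim(2)])
      finally show ?case by simp
    qed
  qed
  have Rinf: "filterlim R at_top at_top"
    unfolding filterlim_at_top
  proof
    fix Z :: nat
    have "\<forall>\<^sub>F \<beta> in at_top. real Z \<le> exp (\<beta> * (V + \<kappa>))"
      using expinf[of "V + \<kappa>"] \<kappa> V0 unfolding filterlim_at_top by auto
    then show "\<forall>\<^sub>F \<beta> in at_top. Z \<le> R \<beta>" using pos
    proof eventually_elim
      case (elim \<beta>)
      then show ?case using R_bounds(1)[OF elim(2)] by linarith
    qed
  qed
  have Tinf: "filterlim T at_top at_top"
    by (rule filterlim_at_top_mono[OF Rinf RT])
  \<comment> \<open>\<open>f\<close> exceeds \<open>exp (-1)\<close> at time \<open>T - 1\<close>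
    and loses at most the error over the next \<open>R \<ge> 1\<close> steps.\<close>
  have fT: "((\<lambda>\<beta>. f \<beta> (T \<beta>)) \<longlongrightarrow> exp (-1)) at_top"
  proof (rule tendsto_sandwich)
    show "\<forall>\<^sub>F \<beta> in at_top. f \<beta> (T \<beta>) \<le> exp (-1)" using pos by eventually_elim (rule T_props)
    show "\<forall>\<^sub>F \<beta> in at_top. exp (-1) - e \<beta> \<le> f \<beta> (T \<beta>)" using pos
    proof eventually_elim
      case (elim \<beta>)
      have "f \<beta> (T \<beta> - 1 + R \<beta>) \<le> f \<beta> (T \<beta>)"
        using R_bounds(3)[OF elim] by (intro f_antimono[OF elim]) auto
      then show ?case
        using memory_loss(2)[OF elim K(2)[OF elim], of "T \<beta> - 1"] T_props(3)[OF elim] K0[of \<beta>]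
        unfolding e_def by linarith
    qed
    show "((\<lambda>\<beta>. exp (-1) - e \<beta>) \<longlongrightarrow> exp (-1)) at_top" using tendsto_diff[OF tendsto_const elim] by simp
  qed simp
  have "almost_memoryless f e R T"
  proof
    show "\<forall>\<^sub>F \<beta> in at_top. f \<beta> 0 = 1" by (simp add: f_0)
    show "\<forall>\<^sub>F \<beta> in at_top. \<forall>n. 0 \<le> f \<beta> n" using pos by eventually_elim (simp add: f_bounds)
    show "\<forall>\<^sub>F \<beta> in at_top. \<forall>m n. m \<le> n \<longrightarrow> f \<beta> n \<le> f \<beta> m" using pos by eventually_elim (simp add: f_antimono)
    show "\<forall>\<^sub>F \<beta> in at_top. \<forall>m n. \<bar>f \<beta> (m + n) - f \<beta> m * f \<beta> n\<bar> \<le> e \<beta>"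
      using pos by eventually_elim (use memory_loss(3)[OF _ K(2)] in \<open>simp add: e_def\<close>)
    show "\<forall>\<^sub>F \<beta> in at_top. \<forall>m. f \<beta> m - f \<beta> (m + R \<beta>) \<le> e \<beta>"
      using pos
    proof eventually_elim
      case (elim \<beta>)
      show ?case using memory_loss(2)[OF elim K(2)[OF elim]] K0[of \<beta>] unfolding e_def by (smt (verit))
    qed
  qed (fact elim Rinf Tinf fT)+
  moreover have "\<forall>\<^sub>F \<beta> in at_top. \<forall>m n. f \<beta> (m + R \<beta> + n) \<le> f \<beta> m * (f \<beta> n + e \<beta>)"
    using pos
  proof eventually_elim
    case (elim \<beta>)
    have "f \<beta> (m + R \<beta> + n) \<le> f \<beta> m * (f \<beta> n + e \<beta>)" for m n
    proof -
      have "f \<beta> m * (f \<beta> n + K * exp (- \<beta> * \<kappa>)) \<le> f \<beta> m * (f \<beta> n + e \<beta>)"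
        using K0[of \<beta>] f_bounds[OF elim] unfolding e_def by (intro mult_left_mono) auto
      then show ?thesis using memory_loss(1)[OF elim K(2)[OF elim], of m n] by linarith
    qed
    then show ?case by blast
  qed
  ultimately show ?thesis using RT by blast
qed

lemma f_limits:
  "t > 0 \<Longrightarrow> ((\<lambda>\<beta>. f \<beta> (nat \<lfloor>t * real (T \<beta>)\<rfloor>)) \<longlongrightarrow> exp (- t)) at_top"
  "((\<lambda>\<beta>. (\<Sum>n. f \<beta> n) / real (T \<beta>)) \<longlongrightarrow> 1) at_top"
proof -
  obtain e where e: "almost_memoryless f e R T"
    "\<forall>\<^sub>F \<beta> in at_top. \<forall>m n. f \<beta> (m + R \<beta> + n) \<le> f \<beta> m * (f \<beta> n + e \<beta>)"
    "\<forall>\<^sub>F \<beta> in at_top. R \<beta> \<le> T \<beta>"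
    using almost_memoryless_f by blast
  interpret almost_memoryless f e R T by (rule e)
  show "t > 0 \<Longrightarrow> ((\<lambda>\<beta>. f \<beta> (nat \<lfloor>t * real (T \<beta>)\<rfloor>)) \<longlongrightarrow> exp (- t)) at_top"
    by (rule f_exp_lim)
  show "((\<lambda>\<beta>. (\<Sum>n. f \<beta> n) / real (T \<beta>)) \<longlongrightarrow> 1) at_top"
  proof (rule f_sum_lim[OF f_halving[OF e(2,3)]])
    show "\<forall>\<^sub>F \<beta> in at_top. summable (f \<beta>)"
      using eventually_gt_at_top[of 0] by eventually_elim (rule f_summable)
  qed
qed


text \<open>All assertions on the hitting time are read off from its survival function \<open>f\<close>, because the
  hitting time takes values in the extended naturals.\<close>

context
  fixes M :: "real \<Rightarrow> 'w measure" and X :: "real \<Rightarrow> nat \<Rightarrow> 'w \<Rightarrow> 'a"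
  assumes chain: "\<And>\<beta>. \<beta> > 0 \<Longrightarrow> markov_chain S (p \<beta>) s (M \<beta>) (X \<beta>)"
begin

abbreviation \<tau> :: "real \<Rightarrow> 'w \<Rightarrow> ennreal" where
  "\<tau> \<beta> \<omega> \<equiv> ennreal_of_enat (hitting_time (X \<beta>) {g} \<omega>)"

lemma ennreal_less_of_enat_iff:
  assumes "y \<ge> 0"
  shows "ennreal y < ennreal_of_enat k \<longleftrightarrow> enat (nat \<lfloor>y\<rfloor>) < k"
proof (cases k)
  case (enat n)
  have "y < real n \<longleftrightarrow> nat \<lfloor>y\<rfloor> < n" using assms by linarith
  then show ?thesis using enat assms by (simp add: ennreal_of_nat_eq_real_of_nat ennreal_less_iff)
qed simp

lemma prob_gt:
  assumes b: "\<beta> > 0" and y: "y \<ge> 0"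
  shows "\<P>(\<omega> in M \<beta>. ennreal y < \<tau> \<beta> \<omega>) = f \<beta> (nat \<lfloor>y\<rfloor>)"
proof -
  have meas: "X \<beta> t \<in> M \<beta> \<rightarrow>\<^sub>M count_space S" for t using chain[OF b] by (simp add: markov_chain_def)
  have "{\<omega> \<in> space (M \<beta>). ennreal y < \<tau> \<beta> \<omega>} = {\<omega> \<in> space (M \<beta>). \<forall>i\<le>nat \<lfloor>y\<rfloor>. X \<beta> i \<omega> \<in> S - {g}}"
    using measurable_space[OF meas] y by (auto simp: ennreal_less_of_enat_iff hitting_time_gt_iff)
  also have "prob_space.prob (M \<beta>) \<dots> = f \<beta> (nat \<lfloor>y\<rfloor>)"
    unfolding f_def by (rule markov_chain_stay[OF chain[OF b] finite_S]) (use sS in auto)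
  finally show ?thesis .
qed

lemma tau_measurable: "\<beta> > 0 \<Longrightarrow> hitting_time (X \<beta>) {g} \<in> M \<beta> \<rightarrow>\<^sub>M count_space UNIV"
  by (rule hitting_time_measurable[of _ _ S]) (use chain in \<open>auto simp: markov_chain_def\<close>)

lemma tau_measurable': "\<beta> > 0 \<Longrightarrow> \<tau> \<beta> \<in> borel_measurable (M \<beta>)"
  by (rule measurable_compose[OF tau_measurable]) auto

lemma expectation_tau:
  assumes b: "\<beta> > 0"
  shows "(\<integral>\<^sup>+\<omega>. \<tau> \<beta> \<omega> \<partial>M \<beta>) = ennreal (\<Sum>n. f \<beta> n)"
proof -
  interpret prob_space "M \<beta>" using chain[OF b] by (simp add: markov_chain_def)
  have "(\<integral>\<^sup>+\<omega>. \<tau> \<beta> \<omega> \<partial>M \<beta>) = (\<Sum>t. emeasure (M \<beta>) {\<omega> \<in> space (M \<beta>). enat t < hitting_time (X \<beta>) {g} \<omega>})"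
    using nn_integral_enat_function[OF tau_measurable[OF b]] by simp
  also have "\<dots> = (\<Sum>t. ennreal (f \<beta> t))"
  proof (rule suminf_cong)
    fix t
    have "{\<omega> \<in> space (M \<beta>). enat t < hitting_time (X \<beta>) {g} \<omega>} = {\<omega> \<in> space (M \<beta>). ennreal (real t) < \<tau> \<beta> \<omega>}"
      by (auto simp: ennreal_less_of_enat_iff)
    then show "emeasure (M \<beta>) {\<omega> \<in> space (M \<beta>). enat t < hitting_time (X \<beta>) {g} \<omega>} = ennreal (f \<beta> t)"
      using prob_gt[OF b, of "real t"] by (simp add: emeasure_eq_measure)
  qed
  also have "\<dots> = ennreal (\<Sum>n. f \<beta> n)"
    using f_bounds[OF b] by (intro suminf_ennreal2 f_summable[OF b]) auto
  finally show ?thesis .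
qed

lemma T_eq:
  assumes b: "\<beta> > 0"
  shows "Inf {n::nat. n \<ge> 1 \<and> \<P>(\<omega> in M \<beta>. \<tau> \<beta> \<omega> \<le> of_nat n) \<ge> 1 - exp (-1)} = T \<beta>"
proof -
  interpret prob_space "M \<beta>" using chain[OF b] by (simp add: markov_chain_def)
  note [measurable] = tau_measurable'[OF b]
  have "\<P>(\<omega> in M \<beta>. \<tau> \<beta> \<omega> \<le> of_nat n) = 1 - f \<beta> n" for n
  proof -
    have "{\<omega> \<in> space (M \<beta>). \<tau> \<beta> \<omega> \<le> of_nat n} = space (M \<beta>) - {\<omega> \<in> space (M \<beta>). ennreal (real n) < \<tau> \<beta> \<omega>}"
      by (auto simp: ennreal_of_nat_eq_real_of_nat not_less)
    also have "prob \<dots> = 1 - prob {\<omega> \<in> space (M \<beta>). ennreal (real n) < \<tau> \<beta> \<omega>}"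
      by (rule prob_compl) measurable
    finally show ?thesis using prob_gt[OF b, of "real n"] by simp
  qed
  then have "1 - exp (-1) \<le> \<P>(\<omega> in M \<beta>. \<tau> \<beta> \<omega> \<le> of_nat n) \<longleftrightarrow> f \<beta> n \<le> exp (-1)" for n
    by simp
  then show ?thesis unfolding T_def by (simp only:)
qed

text \<open>Both ends of the first time window come from one-sided estimates: the flux bound below,
  the bound on the summed survival function above.\<close>

theorem metastable_exit:
  "(\<forall>\<epsilon>>0. ((\<lambda>\<beta>. \<P>(\<omega> in M \<beta>. ennreal (exp (\<beta> * (\<Gamma> - \<epsilon>))) < \<tau> \<beta> \<omega> \<and>
                                   \<tau> \<beta> \<omega> < ennreal (exp (\<beta> * (\<Gamma> + \<epsilon>))))) \<longlongrightarrow> 1) at_top)"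
  "\<forall>\<^sub>F \<beta> in at_top. (\<integral>\<^sup>+\<omega>. \<tau> \<beta> \<omega> \<partial>M \<beta>) < \<infinity>"
  "((\<lambda>\<beta>. 1 / \<beta> * ln (enn2real (\<integral>\<^sup>+\<omega>. \<tau> \<beta> \<omega> \<partial>M \<beta>))) \<longlongrightarrow> \<Gamma>) at_top"
  "\<forall>t>0. ((\<lambda>\<beta>. \<P>(\<omega> in M \<beta>. \<tau> \<beta> \<omega> > ennreal (t * real (T \<beta>)))) \<longlongrightarrow> exp (- t)) at_top"
  "((\<lambda>\<beta>. (\<integral>\<^sup>+\<omega>. \<tau> \<beta> \<omega> \<partial>M \<beta>) / of_nat (T \<beta>)) \<longlongrightarrow> 1) at_top"
proof -
  have pos: "\<forall>\<^sub>F \<beta>::real in at_top. \<beta> > 0" by (rule eventually_gt_at_top)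
  obtain K where K: "K > 0" "\<And>\<beta> n. \<beta> > 0 \<Longrightarrow> (\<Sum>k<n. f \<beta> k) \<le> K * exp (\<beta> * \<Gamma>)"
    using f_sum_bound by blast
  let ?E = "\<lambda>\<beta>. \<Sum>n. f \<beta> n"
  have E0: "?E \<beta> \<ge> 0" if "\<beta> > 0" for \<beta> using f_summable f_bounds that by (intro suminf_nonneg) auto
  show "\<forall>\<^sub>F \<beta> in at_top. (\<integral>\<^sup>+\<omega>. \<tau> \<beta> \<omega> \<partial>M \<beta>) < \<infinity>"
    using pos by eventually_elim (simp add: expectation_tau)
  show "\<forall>t>0. ((\<lambda>\<beta>. \<P>(\<omega> in M \<beta>. \<tau> \<beta> \<omega> > ennreal (t * real (T \<beta>)))) \<longlongrightarrow> exp (- t)) at_top"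
  proof (intro allI impI)
    fix t :: real assume t: "t > 0"
    have "\<forall>\<^sub>F \<beta> in at_top. f \<beta> (nat \<lfloor>t * real (T \<beta>)\<rfloor>) = \<P>(\<omega> in M \<beta>. \<tau> \<beta> \<omega> > ennreal (t * real (T \<beta>)))"
      using pos by eventually_elim (use t in \<open>simp add: prob_gt\<close>)
    then show "((\<lambda>\<beta>. \<P>(\<omega> in M \<beta>. \<tau> \<beta> \<omega> > ennreal (t * real (T \<beta>)))) \<longlongrightarrow> exp (- t)) at_top"
      by (rule Lim_transform_eventually[OF f_limits(1)[OF t]])
  qed
  have "\<forall>\<^sub>F \<beta> in at_top. ennreal (?E \<beta> / real (T \<beta>)) = (\<integral>\<^sup>+\<omega>. \<tau> \<beta> \<omega> \<partial>M \<beta>) / of_nat (T \<beta>)"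
    using pos
  proof eventually_elim
    case (elim \<beta>)
    have "real (T \<beta>) > 0" using T_props(1)[OF elim] by simp
    then show ?case
      by (simp add: expectation_tau[OF elim] ennreal_of_nat_eq_real_of_nat divide_ennreal E0[OF elim])
  qed
  then show "((\<lambda>\<beta>. (\<integral>\<^sup>+\<omega>. \<tau> \<beta> \<omega> \<partial>M \<beta>) / of_nat (T \<beta>)) \<longlongrightarrow> 1) at_top"
    using Lim_transform_eventually[OF tendsto_ennrealI[OF f_limits(2)]] by simp
  show "((\<lambda>\<beta>. 1 / \<beta> * ln (enn2real (\<integral>\<^sup>+\<omega>. \<tau> \<beta> \<omega> \<partial>M \<beta>))) \<longlongrightarrow> \<Gamma>) at_top"
  proof (rule tendsto_sandwich)
    \<comment> \<open>Half the constant in the lower bound for \<open>T\<close>, because the mean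
      eventually exceeds \<open>T / 2\<close>.\<close>
    let ?c = "(1 - exp (-1)) / F / 2 :: real"
    have c: "?c > 0" using F_pos by simp
    have half: "\<forall>\<^sub>F \<beta> in at_top. 1 / 2 < ?E \<beta> / real (T \<beta>)"
      by (rule order_tendstoD(1)[OF f_limits(2)]) simp
    have upper: "?E \<beta> \<le> K * exp (\<beta> * \<Gamma>)" if "\<beta> > 0" for \<beta>
      by (rule suminf_le_const[OF f_summable[OF that] K(2)[OF that]])
    show "\<forall>\<^sub>F \<beta> in at_top. \<Gamma> + ln ?c / \<beta> \<le> 1 / \<beta> * ln (enn2real (\<integral>\<^sup>+\<omega>. \<tau> \<beta> \<omega> \<partial>M \<beta>))"
      using half pos
    proof eventually_elim
      case (elim \<beta>)
      have "?c * exp (\<beta> * \<Gamma>) \<le> real (T \<beta>) / 2" using T_props(4)[OF elim(2)] by simp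
      also have "\<dots> \<le> ?E \<beta>" using elim(1) T_props(1)[OF elim(2)] by (simp add: field_simps)
      finally have "ln (?c * exp (\<beta> * \<Gamma>)) \<le> ln (?E \<beta>)"
        by (intro ln_mono mult_pos_pos c exp_gt_zero)
      then have "ln ?c + \<beta> * \<Gamma> \<le> ln (?E \<beta>)" using c by (simp only: ln_mult_pos exp_gt_zero ln_exp)
      then have "1 / \<beta> * (ln ?c + \<beta> * \<Gamma>) \<le> 1 / \<beta> * ln (?E \<beta>)"
        using elim(2) by (intro mult_left_mono) auto
      then show ?case
        using elim(2) E0[OF elim(2)] by (simp add: expectation_tau distrib_left)
    qed
    show "\<forall>\<^sub>F \<beta> in at_top. 1 / \<beta> * ln (enn2real (\<integral>\<^sup>+\<omega>. \<tau> \<beta> \<omega> \<partial>M \<beta>)) \<le> \<Gamma> + ln K / \<beta>"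
      using half pos
    proof eventually_elim
      case (elim \<beta>)
      have "?E \<beta> > 0" using elim(1) T_props(1)[OF elim(2)] by (simp add: field_simps)
      then have "ln (?E \<beta>) \<le> ln (K * exp (\<beta> * \<Gamma>))"
        using upper[OF elim(2)] by (intro ln_mono) auto
      then have "ln (?E \<beta>) \<le> ln K + \<beta> * \<Gamma>" using K(1) by (simp only: ln_mult_pos exp_gt_zero ln_exp)
      then show ?case
        using elim(2) E0[OF elim(2)] by (simp add: expectation_tau field_simps)
    qed
    have "((\<lambda>\<beta>. \<Gamma> + a / \<beta>) \<longlongrightarrow> \<Gamma>) at_top" for a :: real
      using tendsto_add[OF tendsto_const tendsto_divide_0[OF tendsto_const filterlim_at_top_imp_at_infinity[OF filterlim_ident]], of \<Gamma> a] by simp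
    then show "((\<lambda>\<beta>. \<Gamma> + ln ?c / \<beta>) \<longlongrightarrow> \<Gamma>) at_top" "((\<lambda>\<beta>. \<Gamma> + ln K / \<beta>) \<longlongrightarrow> \<Gamma>) at_top" by auto
  qed
  show "\<forall>\<epsilon>>0. ((\<lambda>\<beta>. \<P>(\<omega> in M \<beta>. ennreal (exp (\<beta> * (\<Gamma> - \<epsilon>))) < \<tau> \<beta> \<omega> \<and>
                                   \<tau> \<beta> \<omega> < ennreal (exp (\<beta> * (\<Gamma> + \<epsilon>))))) \<longlongrightarrow> 1) at_top"
  proof (intro allI impI)
    fix \<epsilon> :: real assume eps: "\<epsilon> > 0"
    let ?a = "\<lambda>\<beta>. exp (\<beta> * (\<Gamma> - \<epsilon>))" and ?b = "\<lambda>\<beta>. exp (\<beta> * (\<Gamma> + \<epsilon>))"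
    have inf: "filterlim ?b at_top at_top"
      using V0 V\<Gamma> eps by (intro filterlim_compose[OF exp_at_top]
        filterlim_at_top_mult_tendsto_pos[OF tendsto_const _ filterlim_ident]) auto
    then have b2: "\<forall>\<^sub>F \<beta> in at_top. 2 \<le> ?b \<beta>" unfolding filterlim_at_top by blast
    show "((\<lambda>\<beta>. \<P>(\<omega> in M \<beta>. ennreal (?a \<beta>) < \<tau> \<beta> \<omega> \<and> \<tau> \<beta> \<omega> < ennreal (?b \<beta>))) \<longlongrightarrow> 1) at_top"
    proof (rule tendsto_sandwich)
      show "\<forall>\<^sub>F \<beta> in at_top. 1 - (F + 2 * K) * exp (- \<beta> * \<epsilon>)
          \<le> \<P>(\<omega> in M \<beta>. ennreal (?a \<beta>) < \<tau> \<beta> \<omega> \<and> \<tau> \<beta> \<omega> < ennreal (?b \<beta>))"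
        using pos b2
      proof eventually_elim
        case (elim \<beta>)
        interpret prob_space "M \<beta>" using chain[OF elim(1)] by (simp add: markov_chain_def)
        note [measurable] = tau_measurable'[OF elim(1)]
        \<comment> \<open>The largest integer below \<open>?b \<beta>\<close>; as
          \<open>?b \<beta>\<close> is at least 2, it is at least half of it.\<close>
        let ?n = "nat \<lceil>?b \<beta>\<rceil> - 1"
        have n: "real ?n < ?b \<beta>" "?b \<beta> / 2 \<le> real ?n" using elim(2) by linarith+
        have "prob {\<omega> \<in> space (M \<beta>). ennreal (?a \<beta>) < \<tau> \<beta> \<omega>} \<le>
          prob ({\<omega> \<in> space (M \<beta>). ennreal (?a \<beta>) < \<tau> \<beta> \<omega> \<and> \<tau> \<beta> \<omega> < ennreal (?b \<beta>)}
            \<union> {\<omega> \<in> space (M \<beta>). ennreal (real ?n) < \<tau> \<beta> \<omega>})"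
        proof (rule finite_measure_mono)
          show "{\<omega> \<in> space (M \<beta>). ennreal (?a \<beta>) < \<tau> \<beta> \<omega>} \<subseteq>
            {\<omega> \<in> space (M \<beta>). ennreal (?a \<beta>) < \<tau> \<beta> \<omega> \<and> \<tau> \<beta> \<omega> < ennreal (?b \<beta>)}
            \<union> {\<omega> \<in> space (M \<beta>). ennreal (real ?n) < \<tau> \<beta> \<omega>}"
          proof safe
            fix \<omega> assume "\<not> ennreal (real ?n) < \<tau> \<beta> \<omega>"
            then have "\<tau> \<beta> \<omega> \<le> ennreal (real ?n)" by simp
            also have "\<dots> < ennreal (?b \<beta>)" using n by (simp add: ennreal_less_iff)
            finally show "\<tau> \<beta> \<omega> < ennreal (?b \<beta>)" .
          qed
        qed measurable
        also have "\<dots> \<le> prob {\<omega> \<in> space (M \<beta>). ennreal (?a \<beta>) < \<tau> \<beta> \<omega> \<and> \<tau> \<beta> \<omega> < ennreal (?b \<beta>)}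
            + prob {\<omega> \<in> space (M \<beta>). ennreal (real ?n) < \<tau> \<beta> \<omega>}"
          by (rule measure_Un_le) measurable
        finally have 1: "f \<beta> (nat \<lfloor>?a \<beta>\<rfloor>) \<le>
            prob {\<omega> \<in> space (M \<beta>). ennreal (?a \<beta>) < \<tau> \<beta> \<omega> \<and> \<tau> \<beta> \<omega> < ennreal (?b \<beta>)} + f \<beta> ?n"
          using prob_gt[OF elim(1), of "?a \<beta>"] prob_gt[OF elim(1), of "real ?n"] by simp
        have "1 - f \<beta> (nat \<lfloor>?a \<beta>\<rfloor>) \<le> real (nat \<lfloor>?a \<beta>\<rfloor>) * (F * exp (- \<beta> * \<Gamma>))" by (rule f_lower[OF elim(1)])
        also have "\<dots> \<le> ?a \<beta> * (F * exp (- \<beta> * \<Gamma>))"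
        proof (rule mult_right_mono)
          show "real (nat \<lfloor>?a \<beta>\<rfloor>) \<le> ?a \<beta>" using exp_ge_zero[of "\<beta> * (\<Gamma> - \<epsilon>)"] by linarith
        qed (use F_pos in simp)
        also have "\<dots> = F * exp (- \<beta> * \<epsilon>)" by (simp add: mult_exp_exp algebra_simps)
        finally have 2: "1 - f \<beta> (nat \<lfloor>?a \<beta>\<rfloor>) \<le> F * exp (- \<beta> * \<epsilon>)" .
        have "?b \<beta> / 2 * f \<beta> ?n \<le> real ?n * f \<beta> ?n"
          using n f_bounds[OF elim(1)] by (intro mult_right_mono) auto
        also have "\<dots> \<le> K * exp (\<beta> * \<Gamma>)"
          using surv_bound_time[OF elim(1) sS, of "S - {g}"] K(2)[OF elim(1)] by (simp add: f_def)
        also have "\<dots> = ?b \<beta> / 2 * (2 * K * exp (- \<beta> * \<epsilon>))"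
          by (simp add: distrib_left exp_add exp_minus)
        finally have 3: "f \<beta> ?n \<le> 2 * K * exp (- \<beta> * \<epsilon>)" by simp
        show ?case using 1 2 3 by (simp add: algebra_simps)
      qed
      show "\<forall>\<^sub>F \<beta> in at_top. \<P>(\<omega> in M \<beta>. ennreal (?a \<beta>) < \<tau> \<beta> \<omega> \<and> \<tau> \<beta> \<omega> < ennreal (?b \<beta>)) \<le> 1"
        using pos by eventually_elim (use chain in \<open>auto simp: markov_chain_def intro!: prob_space.prob_le_1\<close>)
      show "((\<lambda>\<beta>. 1 - (F + 2 * K) * exp (- \<beta> * \<epsilon>)) \<longlongrightarrow> 1) at_top"
        using tendsto_diff[OF tendsto_const exp_lim_0[OF eps, of "F + 2 * K"], of 1] by simp
    qed simp
  qed
qed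

end

end

section \<open>Isoperimetry on the hexagonal lattice\<close>

text \<open>The neighbour across the edge on which the coordinate \<open>a\<close>, \<open>b\<close>, respectively \<open>a + b\<close> is constant.\<close>

fun na :: "site \<Rightarrow> site" where
  "na (Up a b) = Down (a - 1) b" | "na (Down a b) = Up (a + 1) b"

fun nb :: "site \<Rightarrow> site" where
  "nb (Up a b) = Down a (b - 1)" | "nb (Down a b) = Up a (b + 1)"

fun nc :: "site \<Rightarrow> site" where
  "nc (Up a b) = Down a b" | "nc (Down a b) = Up a b"

lemma n_involution [simp]: "na (na x) = x" "nb (nb x) = x" "nc (nc x) = x"
  by (cases x; simp)+

lemma n_neq [simp]: "na x \<noteq> x" "nb x \<noteq> x" "nc x \<noteq> x" "x \<noteq> na x" "x \<noteq> nb x" "x \<noteq> nc x"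
  "na x \<noteq> nb x" "na x \<noteq> nc x" "nb x \<noteq> nc x"
  by (cases x; simp)+

lemma nn_iff: "nn x y \<longleftrightarrow> y = na x \<or> y = nb x \<or> y = nc x"
  by (cases x; cases y) (auto simp: nn_simps)

lemma nn_commute: "nn x y \<longleftrightarrow> nn y x"
  unfolding nn_iff by (metis n_involution)

text \<open>Every bond is counted from both ends, which keeps \<open>bonds2_perim\<close> free of
  halves.\<close>

definition bonds2 :: "site set \<Rightarrow> nat" where
  "bonds2 A = card {x\<in>A. na x \<in> A} + card {x\<in>A. nb x \<in> A} + card {x\<in>A. nc x \<in> A}"

definition perim :: "site set \<Rightarrow> nat" where
  "perim A = card {x\<in>A. na x \<notin> A} + card {x\<in>A. nb x \<notin> A} + card {x\<in>A. nc x \<notin> A}"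

lemma card_filter_split:
  assumes "finite A"
  shows "card {x\<in>A. P x} + card {x\<in>A. \<not> P x} = card A"
proof -
  have "A = {x\<in>A. P x} \<union> {x\<in>A. \<not> P x}" by blast
  then show ?thesis using card_Un_disjoint[of "{x\<in>A. P x}" "{x\<in>A. \<not> P x}"] assms by force
qed

lemma bonds2_perim:
  assumes "finite A"
  shows "bonds2 A + perim A = 3 * card A"
  using card_filter_split[OF assms, of "\<lambda>x. na x \<in> A"] card_filter_split[OF assms, of "\<lambda>x. nb x \<in> A"]
    card_filter_split[OF assms, of "\<lambda>x. nc x \<in> A"]
  by (simp add: bonds2_def perim_def)

text \<open>Index of the strip between consecutive parallel lattice lines. Upward faces satisfy
  \<open>strip_c = strip_a + strip_b\<close>, downward faces the same with an additional 1.\<close>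

fun strip_a :: "site \<Rightarrow> int" where "strip_a (Up a b) = a" | "strip_a (Down a b) = a"
fun strip_b :: "site \<Rightarrow> int" where "strip_b (Up a b) = b" | "strip_b (Down a b) = b"
fun strip_c :: "site \<Rightarrow> int" where "strip_c (Up a b) = a + b" | "strip_c (Down a b) = a + b + 1"

text \<open>The two ends of a finite set in a strip, along which the neighbours \<open>n\<close> and \<open>n'\<close> alternate,
  contribute two boundary edges.\<close>

lemma strip_boundary:
  fixes s pos :: "site \<Rightarrow> int"
  assumes fin: "finite A"
    and s: "\<And>x. s (n x) = s x" "\<And>x. s (n' x) = s x"
    and pos: "\<And>x. {pos (n x), pos (n' x)} = {pos x - 1, pos x + 1}"
  shows "2 * card (s ` A) \<le> card {x\<in>A. n x \<notin> A} + card {x\<in>A. n' x \<notin> A}"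
proof -
  let ?P = "{(x, b). x \<in> A \<and> (if b then n x else n' x) \<notin> A}"
  define Q where "Q i up = (SOME p. p \<in> ?P \<and> s (fst p) = i \<and>
    (pos (if snd p then n (fst p) else n' (fst p)) = pos (fst p) + (if up then 1 else - 1)))" for i up
  have ex: "\<exists>p. p \<in> ?P \<and> s (fst p) = i \<and>
    (pos (if snd p then n (fst p) else n' (fst p)) = pos (fst p) + (if up then 1 else - 1))"
    if i: "i \<in> s ` A" for i up
  proof -
    let ?B = "{x\<in>A. s x = i}"
    have B: "finite ?B" "?B \<noteq> {}" using fin i by auto
    define h where "h x = (if up then - pos x else pos x)" for x
    obtain x where "is_arg_min h (\<lambda>x. x \<in> ?B) x" using ex_is_arg_min_if_finite[OF B] by blast
    then have x: "x \<in> ?B" "\<And>y. y \<in> ?B \<Longrightarrow> h x \<le> h y" by (auto simp: is_arg_min_linorder)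
    obtain b where b: "pos (if b then n x else n' x) = pos x + (if up then 1 else - 1)"
    proof -
      have "pos x + (if up then 1 else - 1) \<in> {pos (n x), pos (n' x)}" unfolding pos by auto
      then show ?thesis using that[of True] that[of False] by auto
    qed
    have "(if b then n x else n' x) \<notin> A"
    proof
      assume "(if b then n x else n' x) \<in> A"
      then have "(if b then n x else n' x) \<in> ?B" using s x(1) by auto
      from x(2)[OF this] b show False by (auto simp: h_def split: if_splits)
    qed
    then show ?thesis using x(1) b by (intro exI[of _ "(x, b)"]) auto
  qed
  have Q: "Q i up \<in> ?P \<and> s (fst (Q i up)) = i \<and>
    (pos (if snd (Q i up) then n (fst (Q i up)) else n' (fst (Q i up))) = pos (fst (Q i up)) + (if up then 1 else - 1))"
    if "i \<in> s ` A" for i up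
    unfolding Q_def by (rule someI_ex, rule ex, rule that)
  have "inj_on (\<lambda>(i, up). Q i up) (s ` A \<times> UNIV)"
  proof (rule inj_onI, clarify)
    fix x y u v assume "x \<in> A" "y \<in> A" and eq: "Q (s x) u = Q (s y) v"
    then have "s x \<in> s ` A" "s y \<in> s ` A" by auto
    from Q[OF this(1), of u] Q[OF this(2), of v] eq show "s x = s y \<and> u = v"
      by (auto split: if_splits)
  qed
  moreover have Psub: "?P = (\<lambda>x. (x, True)) ` {x\<in>A. n x \<notin> A} \<union> (\<lambda>x. (x, False)) ` {x\<in>A. n' x \<notin> A}"
    by (auto simp: image_iff split: if_splits)
  then have finP: "finite ?P" using fin by simp
  moreover have "(\<lambda>(i, up). Q i up) ` (s ` A \<times> UNIV) \<subseteq> ?P"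
  proof (rule image_subsetI)
    fix z assume "z \<in> s ` A \<times> (UNIV :: bool set)"
    then obtain i up where z: "z = (i, up)" "i \<in> s ` A" by blast
    show "(\<lambda>(i, up). Q i up) z \<in> ?P" unfolding z(1) prod.case by (rule conjunct1[OF Q[OF z(2)]])
  qed
  ultimately have "card (s ` A \<times> (UNIV :: bool set)) \<le> card ?P"
    by (intro card_inj_on_le)
  also have "card ?P \<le> card {x\<in>A. n x \<notin> A} + card {x\<in>A. n' x \<notin> A}"
    unfolding Psub using card_Un_le[of "(\<lambda>x. (x, True)) ` {x\<in>A. n x \<notin> A}" "(\<lambda>x. (x, False)) ` {x\<in>A. n' x \<notin> A}"]
    by (simp add: card_image inj_on_def)
  finally show ?thesis by (simp add: card_cartesian_product)
qed

text \<open>Each edge is crossed by strips of exactly two of the three families, and each occupied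
  strip has at least two boundary edges, so the sum over the families counts every boundary edge
  twice.\<close>

lemma strips_le_perim:
  assumes "finite A"
  shows "card (strip_a ` A) + card (strip_b ` A) + card (strip_c ` A) \<le> perim A"
proof -
  define pa where "pa x = (case x of Up a b \<Rightarrow> 2 * b | Down a b \<Rightarrow> 2 * b + 1)" for x
  define pb where "pb x = (case x of Up a b \<Rightarrow> 2 * a | Down a b \<Rightarrow> 2 * a + 1)" for x
  have "2 * card (strip_a ` A) \<le> card {x\<in>A. nb x \<notin> A} + card {x\<in>A. nc x \<notin> A}"
  proof (rule strip_boundary[OF assms, where pos = pa])
    show "{pa (nb x), pa (nc x)} = {pa x - 1, pa x + 1}" for x by (cases x) (auto simp: pa_def)
    show "strip_a (nb x) = strip_a x" "strip_a (nc x) = strip_a x" for x by (cases x; simp)+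
  qed
  moreover have "2 * card (strip_b ` A) \<le> card {x\<in>A. na x \<notin> A} + card {x\<in>A. nc x \<notin> A}"
  proof (rule strip_boundary[OF assms, where pos = pb])
    show "{pb (na x), pb (nc x)} = {pb x - 1, pb x + 1}" for x by (cases x) (auto simp: pb_def)
    show "strip_b (na x) = strip_b x" "strip_b (nc x) = strip_b x" for x by (cases x; simp)+
  qed
  moreover have "2 * card (strip_c ` A) \<le> card {x\<in>A. na x \<notin> A} + card {x\<in>A. nb x \<notin> A}"
  proof (rule strip_boundary[OF assms, where pos = pb])
    show "{pb (na x), pb (nb x)} = {pb x - 1, pb x + 1}" for x by (cases x) (auto simp: pb_def)
    show "strip_c (na x) = strip_c x" "strip_c (nb x) = strip_c x" for x by (cases x; simp)+
  qed
  ultimately show ?thesis by (simp add: perim_def)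
qed

text \<open>The pairs \<open>(min A, _)\<close> and \<open>(_, max B)\<close> form a chain with strictly increasing sums; peeling it off
  is the induction step.\<close>

lemma sumset_count_triangle:
  fixes A B C :: "int set"
  assumes "finite A" "finite B" "finite C"
    and "card A \<le> card B + card C" "card B \<le> card A + card C" "card C \<le> card A + card B"
  shows "4 * int (card {(i, j). i \<in> A \<and> j \<in> B \<and> i + j \<in> C}) + (int (card A) + int (card B) - int (card C))\<^sup>2
    \<le> 4 * int (card A) * int (card B) + 1"
  using assms
proof (induction "card A" arbitrary: A B rule: less_induct)
  case less
  let ?N = "\<lambda>A B. {(i, j). i \<in> A \<and> j \<in> B \<and> i + j \<in> C}"
  have Nsub: "?N A B \<subseteq> A \<times> B" by auto
  then have Nle: "card (?N A B) \<le> card A * card B" if "finite A" "finite B" for A B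
    using card_mono[of "A \<times> B" "?N A B"] that by (auto simp: card_cartesian_product)
  show ?case
  proof (cases "card A + card B \<le> card C + 1")
    case True
    then have "int (card A) + int (card B) - int (card C) \<in> {0, 1}"
      using less.prems(6) by auto
    then have "(int (card A) + int (card B) - int (card C))\<^sup>2 \<le> 1"
      by auto
    moreover have "int (card (?N A B)) \<le> int (card A) * int (card B)"
      using of_nat_mono[OF Nle[OF less.prems(1,2)], where 'a = int] by simp
    ultimately show ?thesis by linarith
  next
    case False
    then have ne: "A \<noteq> {}" "B \<noteq> {}" using less.prems by auto
    define a b where "a = Min A" and "b = Max B"
    have a: "a \<in> A" "\<And>x. x \<in> A \<Longrightarrow> a \<le> x" and b: "b \<in> B" "\<And>x. x \<in> B \<Longrightarrow> x \<le> b"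
      using ne less.prems by (auto simp: a_def b_def)
    let ?A = "A - {a}" and ?B = "B - {b}"
    have cA: "card A = Suc (card ?A)" and cB: "card B = Suc (card ?B)"
      using card.remove[OF less.prems(1) a(1)] card.remove[OF less.prems(2) b(1)] by auto
    have IH: "4 * int (card (?N ?A ?B)) + (int (card ?A) + int (card ?B) - int (card C))\<^sup>2
      \<le> 4 * int (card ?A) * int (card ?B) + 1"
      by (rule less.hyps) (use less.prems False cA cB in auto)
    let ?H = "{(i, j). i \<in> A \<and> j \<in> B \<and> i + j \<in> C \<and> (i = a \<or> j = b)}"
    have "?N A B = ?N ?A ?B \<union> ?H" by auto
    moreover have "card ?H \<le> card C"
    proof (rule card_inj_on_le[where f = "\<lambda>(i, j). i + j"])
      show "inj_on (\<lambda>(i, j). i + j) ?H"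
      proof (rule inj_onI, clarify)
        fix i j k l
        assume H: "i \<in> A" "j \<in> B" "k \<in> A" "l \<in> B" and eq: "i + j = k + l"
          and c: "i = a \<or> j = b" "k = a \<or> l = b"
        have "a \<le> i" "a \<le> k" "j \<le> b" "l \<le> b" using H a b by auto
        then show "i = k \<and> j = l" using eq c by auto
      qed
    qed (use less.prems in auto)
    ultimately have "card (?N A B) \<le> card (?N ?A ?B) + card C"
      using card_Un_le[of "?N ?A ?B" ?H] by simp
    then have "int (card (?N A B)) \<le> int (card (?N ?A ?B)) + int (card C)" by linarith
    then show ?thesis using IH unfolding cA cB
      by (simp add: power2_eq_square algebra_simps)
  qed
qed

text \<open>In the triangle case the preceding bound reads
  \<open>4 N \<le> 2 (a b + b c + c a) - (a^2 + b^2 + c^2) + 1\<close>, and the right side without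
  the 1 is at most a third of \<open>(a + b + c)^2\<close>. Otherwise the product of the two smaller
  counts is small enough.\<close>

lemma sumset_count:
  fixes A B C :: "int set"
  assumes fin: "finite A" "finite B" "finite C"
  shows "12 * int (card {(i, j). i \<in> A \<and> j \<in> B \<and> i + j \<in> C}) \<le> (int (card A) + int (card B) + int (card C))\<^sup>2 + 3"
proof -
  let ?N = "{(i, j). i \<in> A \<and> j \<in> B \<and> i + j \<in> C}"
  let ?a = "int (card A)" and ?b = "int (card B)" and ?c = "int (card C)"
  have bound: "12 * (x * y) \<le> (x + y + z)\<^sup>2 + 3" if "x + y \<le> z" "0 \<le> x" "0 \<le> y" for x y z :: int
  proof -
    have "(2 * (x + y))\<^sup>2 \<le> (x + y + z)\<^sup>2" using that by (intro power_mono) auto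
    moreover have "0 \<le> (x - y)\<^sup>2" by simp
    moreover have "0 \<le> x * y" using that by simp
    ultimately show ?thesis by (simp add: power2_eq_square algebra_simps)
  qed
  have fN: "finite ?N" by (rule finite_subset[of _ "A \<times> B"]) (use fin in auto)
  have NAB: "card ?N \<le> card A * card B"
    using card_mono[of "A \<times> B" ?N] fin by (auto simp: card_cartesian_product)
  have NBC: "card ?N \<le> card B * card C"
  proof -
    have "card ?N \<le> card (B \<times> C)"
      by (rule card_inj_on_le[where f = "\<lambda>(i, j). (j, i + j)"]) (use fin in \<open>auto simp: inj_on_def\<close>)
    then show ?thesis by (simp add: card_cartesian_product)
  qed
  have NAC: "card ?N \<le> card A * card C"
  proof -
    have "card ?N \<le> card (A \<times> C)"
      by (rule card_inj_on_le[where f = "\<lambda>(i, j). (i, i + j)"]) (use fin in \<open>auto simp: inj_on_def\<close>)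
    then show ?thesis by (simp add: card_cartesian_product)
  qed
  consider "card A + card B \<le> card C" | "card B + card C \<le> card A" | "card A + card C \<le> card B"
    | "card A \<le> card B + card C" "card B \<le> card A + card C" "card C \<le> card A + card B"
    by linarith
  then show ?thesis
  proof cases
    case 1
    have "12 * int (card ?N) \<le> 12 * (?a * ?b)" using of_nat_mono[OF NAB, where 'a = int] by simp
    also have "\<dots> \<le> (?a + ?b + ?c)\<^sup>2 + 3" using bound[of ?a ?b ?c] 1 by linarith
    finally show ?thesis .
  next
    case 2
    have "12 * int (card ?N) \<le> 12 * (?b * ?c)" using of_nat_mono[OF NBC, where 'a = int] by simp
    also have "\<dots> \<le> (?a + ?b + ?c)\<^sup>2 + 3" using bound[of ?b ?c ?a] 2 by (simp add: add_ac)
    finally show ?thesis .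
  next
    case 3
    have "12 * int (card ?N) \<le> 12 * (?a * ?c)" using of_nat_mono[OF NAC, where 'a = int] by simp
    also have "\<dots> \<le> (?a + ?b + ?c)\<^sup>2 + 3" using bound[of ?a ?c ?b] 3 by (simp add: add_ac)
    finally show ?thesis .
  next
    case 4
    have "0 \<le> (?a - ?b)\<^sup>2 + (?b - ?c)\<^sup>2 + (?c - ?a)\<^sup>2" by simp
    then show ?thesis using sumset_count_triangle[OF fin 4]
      by (simp add: power2_eq_square algebra_simps)
  qed
qed

text \<open>Each neighbour map is an involution that exchanges upward and downward faces;
  \<open>?I\<close> characterises the upward ones.\<close>

lemma even_bonds2:
  assumes fin: "finite A"
  shows "even (bonds2 A)"
proof -
  let ?I = "\<lambda>x. strip_c x = strip_a x + strip_b x"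
  have ev: "even (card {x\<in>A. n x \<in> A})" if inv: "\<And>x. n (n x) = x" and up: "\<And>x. ?I (n x) \<longleftrightarrow> \<not> ?I x"
    for n :: "site \<Rightarrow> site"
  proof -
    let ?S = "{x\<in>A. n x \<in> A}"
    have "bij_betw n {x\<in>?S. ?I x} {x\<in>?S. \<not> ?I x}"
    proof (rule bij_betw_byWitness[of _ n])
      show "n ` {x\<in>?S. ?I x} \<subseteq> {x\<in>?S. \<not> ?I x}" "n ` {x\<in>?S. \<not> ?I x} \<subseteq> {x\<in>?S. ?I x}"
        by (rule image_subsetI, simp only: mem_Collect_eq inv up simp_thms)+
    qed (simp_all only: inv ball_triv simp_thms)
    then have "card {x\<in>?S. ?I x} = card {x\<in>?S. \<not> ?I x}" by (rule bij_betw_same_card)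
    moreover have "card ?S = card {x\<in>?S. ?I x} + card {x\<in>?S. \<not> ?I x}"
      using card_filter_split[of ?S ?I] fin by simp
    ultimately show ?thesis by simp
  qed
  have "?I (na x) \<longleftrightarrow> \<not> ?I x" "?I (nb x) \<longleftrightarrow> \<not> ?I x" "?I (nc x) \<longleftrightarrow> \<not> ?I x" for x
    by (cases x; simp)+
  then have "even (card {x\<in>A. na x \<in> A})" "even (card {x\<in>A. nb x \<in> A})" "even (card {x\<in>A. nc x \<in> A})"
    by (intro ev; simp)+
  then show ?thesis by (simp add: bonds2_def)
qed

lemma perim_parity: "finite A \<Longrightarrow> even (perim A) \<longleftrightarrow> even (card A)"
  using bonds2_perim[of A] even_bonds2[of A] by (metis even_add even_mult_iff odd_numeral)

text \<open>The strip indices of an upward face form a triple \<open>(i, j, i + j)\<close>, those of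
  a downward face \<open>(i, j, i + j + 1)\<close>, so \<open>sumset_count\<close> applies to both
  kinds. It leaves an excess of 3, which the equal parity of perimeter and area removes. Hexagons
  give equality.\<close>

theorem isoperimetric:
  assumes fin: "finite A"
  shows "6 * card A \<le> (perim A)\<^sup>2"
proof -
  define X Y Z where "X = strip_a ` A" and "Y = strip_b ` A" and "Z = strip_c ` A"
  have finXYZ: "finite X" "finite Y" "finite Z" using fin by (auto simp: X_def Y_def Z_def)
  let ?N = "\<lambda>Z. {(i, j). i \<in> X \<and> j \<in> Y \<and> i + j \<in> Z}"
  have finN: "finite (?N Z)" for Z by (rule finite_subset[of _ "X \<times> Y"]) (use finXYZ in auto)
  have "A \<subseteq> (\<lambda>(i, j). Up i j) ` ?N Z \<union> (\<lambda>(i, j). Down i j) ` ?N ((\<lambda>z. z - 1) ` Z)"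
  proof
    fix x assume x: "x \<in> A"
    then have "strip_a x \<in> X" "strip_b x \<in> Y" "strip_c x \<in> Z" by (auto simp: X_def Y_def Z_def)
    then show "x \<in> (\<lambda>(i, j). Up i j) ` ?N Z \<union> (\<lambda>(i, j). Down i j) ` ?N ((\<lambda>z. z - 1) ` Z)"
      by (cases x) (force simp: image_iff)+
  qed
  then have "card A \<le> card ((\<lambda>(i, j). Up i j) ` ?N Z \<union> (\<lambda>(i, j). Down i j) ` ?N ((\<lambda>z. z - 1) ` Z))"
    by (intro card_mono) (auto intro: finN)
  also have "\<dots> \<le> card (?N Z) + card (?N ((\<lambda>z. z - 1) ` Z))"
    by (intro order_trans[OF card_Un_le] add_mono card_image_le finN)
  finally have "card A \<le> card (?N Z) + card (?N ((\<lambda>z. z - 1) ` Z))" .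
  moreover have "card ((\<lambda>z. z - 1) ` Z) = card Z" by (rule card_image) (auto simp: inj_on_def)
  ultimately have "6 * int (card A) \<le> (int (card X) + int (card Y) + int (card Z))\<^sup>2 + 3"
    using sumset_count[of X Y Z] sumset_count[of X Y "(\<lambda>z. z - 1) ` Z"] finXYZ by simp
  also have "(int (card X) + int (card Y) + int (card Z))\<^sup>2 \<le> (int (perim A))\<^sup>2"
    using strips_le_perim[OF fin] by (intro power_mono) (auto simp: X_def Y_def Z_def)
  finally have main: "6 * int (card A) \<le> (int (perim A))\<^sup>2 + 3" by simp
  note par = perim_parity[OF fin]
  show ?thesis
  proof (rule ccontr)
    assume "\<not> 6 * card A \<le> (perim A)\<^sup>2"
    then have lt: "(int (perim A))\<^sup>2 < 6 * int (card A)" by (metis not_le of_nat_less_iff of_nat_mult of_nat_numeral of_nat_power)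
    \<comment> \<open>With perimeter \<open>6 * k + j\<close> the remaining range
      \<open>j * j < 6 * m \<le> j * j + 3\<close> is met only by \<open>j = 2, 3, 4\<close> with
      \<open>m = 1, 2, 3\<close>, where the parities of \<open>j\<close> and \<open>m\<close>
      differ.\<close>
    define k j where "k = int (perim A) div 6" and "j = int (perim A) mod 6"
    have kj: "int (perim A) = 6 * k + j" "0 \<le> j" "j < 6" by (auto simp: k_def j_def)
    define w where "w = 6 * k * k + 2 * k * j"
    have sq: "(int (perim A))\<^sup>2 = 6 * w + j * j"
      unfolding kj(1) w_def by (simp add: power2_eq_square algebra_simps)
    have par': "even j \<longleftrightarrow> even (int (card A))"
      using par kj(1) by (metis even_add even_mult_iff even_numeral even_of_nat)
    define m where "m = int (card A) - w"
    have "even w" by (simp add: w_def)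
    then have m: "even m \<longleftrightarrow> even j" using par' by (simp add: m_def)
    have "j * j < 6 * m" "6 * m \<le> j * j + 3" using lt main unfolding sq m_def by (simp_all add: algebra_simps)
    moreover have "j = 0 \<or> j = 1 \<or> j = 2 \<or> j = 3 \<or> j = 4 \<or> j = 5" using kj by linarith
    ultimately show False using m by (elim disjE) (simp_all, presburger+)
  qed
qed

section \<open>Hexagonal boxes and rows\<close>

definition deg :: "site set \<Rightarrow> site \<Rightarrow> nat" where
  "deg A x = of_bool (na x \<in> A) + of_bool (nb x \<in> A) + of_bool (nc x \<in> A)"

lemma bonds2_insert:
  assumes "finite A" "x \<notin> A"
  shows "bonds2 (insert x A) = bonds2 A + 2 * deg A x"
proof -
  have *: "card {y\<in>insert x A. n y \<in> insert x A} = card {y\<in>A. n y \<in> A} + 2 * of_bool (n x \<in> A)"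
    if inv: "\<And>x. n (n x) = x" and neq: "\<And>x. n x \<noteq> x" for n :: "site \<Rightarrow> site"
  proof (cases "n x \<in> A")
    case True
    have "{y\<in>insert x A. n y \<in> insert x A} = insert x (insert (n x) {y\<in>A. n y \<in> A})"
      using True inv by auto
    moreover have "n x \<notin> {y\<in>A. n y \<in> A}" "x \<notin> insert (n x) {y\<in>A. n y \<in> A}"
      using inv neq assms by (auto, metis neq)
    ultimately show ?thesis using True assms by simp
  next
    case False
    have "{y\<in>insert x A. n y \<in> insert x A} = {y\<in>A. n y \<in> A}"
      using False neq assms inv by auto
    then show ?thesis using False by simp
  qed
  show ?thesis
    unfolding bonds2_def deg_def *[of na, OF n_involution(1) n_neq(1)] *[of nb, OF n_involution(2) n_neq(2)]
      *[of nc, OF n_involution(3) n_neq(3)] by (simp only: add_mult_distrib2 add_ac)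
qed

text \<open>A bond inside either set lies inside the union, and a bond inside both lies inside the
  intersection.\<close>

lemma bonds2_supermodular:
  assumes "finite A" "finite B"
  shows "bonds2 A + bonds2 B \<le> bonds2 (A \<union> B) + bonds2 (A \<inter> B)"
proof -
  have *: "card {x\<in>A. n x \<in> A} + card {x\<in>B. n x \<in> B}
      \<le> card {x\<in>A \<union> B. n x \<in> A \<union> B} + card {x\<in>A \<inter> B. n x \<in> A \<inter> B}" for n :: "site \<Rightarrow> site"
  proof -
    let ?C = "{x\<in>A. n x \<in> A}" and ?D = "{x\<in>B. n x \<in> B}"
    have "card ?C + card ?D = card (?C \<union> ?D) + card (?C \<inter> ?D)"
      using assms by (intro card_Un_Int) auto
    moreover have "card (?C \<union> ?D) \<le> card {x\<in>A \<union> B. n x \<in> A \<union> B}"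
      using assms by (intro card_mono) auto
    moreover have "?C \<inter> ?D = {x\<in>A \<inter> B. n x \<in> A \<inter> B}" by auto
    ultimately show ?thesis by simp
  qed
  show ?thesis using *[of na] *[of nb] *[of nc] by (simp add: bonds2_def)
qed

text \<open>The rotation by 60 degrees, \<open>(a, b) \<mapsto> (- b, a + b)\<close> on the vertices.\<close>

fun rot :: "site \<Rightarrow> site" where
  "rot (Up a b) = Down (- b - 1) (a + b)" | "rot (Down a b) = Up (- b - 1) (a + b + 1)"

fun rot' :: "site \<Rightarrow> site" where
  "rot' (Down a b) = Up (a + b + 1) (- a - 1)" | "rot' (Up a b) = Down (a + b) (- a - 1)"

lemma rot_rot' [simp]: "rot (rot' x) = x" "rot' (rot x) = x"
  by (cases x; simp)+

lemma inj_rot: "inj rot" by (metis injI rot_rot'(2))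

lemma rot_n: "rot (na x) = nc (rot x)" "rot (nb x) = na (rot x)" "rot (nc x) = nb (rot x)"
  by (cases x; simp)+

lemma nn_rot: "nn (rot x) (rot y) \<longleftrightarrow> nn x y"
  unfolding nn_iff by (metis inj_rot inj_eq rot_n)

lemma card_rot [simp]: "card (rot ` A) = card A"
  using inj_rot by (intro card_image) (auto simp: inj_on_def)

lemma bonds2_rot [simp]: "bonds2 (rot ` A) = bonds2 A"
proof -
  have *: "card {x\<in>rot ` A. n' x \<in> rot ` A} = card {x\<in>A. n x \<in> A}" if "\<And>x. rot (n x) = n' (rot x)" for n n'
  proof -
    have "{x\<in>rot ` A. n' x \<in> rot ` A} = rot ` {x\<in>A. n x \<in> A}"
      using inj_rot by (auto simp: that[symmetric] inj_image_mem_iff inj_eq)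
    then show ?thesis by simp
  qed
  show ?thesis
    unfolding bonds2_def *[of na nc, OF rot_n(1)] *[of nb na, OF rot_n(2)] *[of nc nb, OF rot_n(3)] by simp
qed

definition hbox :: "int \<Rightarrow> int \<Rightarrow> int \<Rightarrow> int \<Rightarrow> int \<Rightarrow> int \<Rightarrow> site set" where
  "hbox a1 a2 b1 b2 c1 c2 = {x. \<forall>(a, b) \<in> corners x. a1 \<le> a \<and> a \<le> a2 \<and> b1 \<le> b \<and> b \<le> b2 \<and> c1 \<le> a + b \<and> a + b \<le> c2}"

lemma hbox_iff [simp]:
  "Up a b \<in> hbox a1 a2 b1 b2 c1 c2 \<longleftrightarrow> a1 \<le> a \<and> a + 1 \<le> a2 \<and> b1 \<le> b \<and> b + 1 \<le> b2 \<and> c1 \<le> a + b \<and> a + b + 1 \<le> c2"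
  "Down a b \<in> hbox a1 a2 b1 b2 c1 c2 \<longleftrightarrow> a1 \<le> a \<and> a + 1 \<le> a2 \<and> b1 \<le> b \<and> b + 1 \<le> b2 \<and> c1 \<le> a + b + 1 \<and> a + b + 2 \<le> c2"
  by (auto simp: hbox_def)

lemma site_set_eqI:
  assumes "\<And>a b. Up a b \<in> A \<longleftrightarrow> Up a b \<in> B" "\<And>a b. Down a b \<in> A \<longleftrightarrow> Down a b \<in> B"
  shows "A = B"
  by (rule set_eqI) (metis assms site.exhaust)

lemma site_subsetI:
  assumes "\<And>a b. Up a b \<in> A \<Longrightarrow> Up a b \<in> B" "\<And>a b. Down a b \<in> A \<Longrightarrow> Down a b \<in> B"
  shows "A \<subseteq> B"
  by (rule subsetI) (metis assms site.exhaust)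

lemma rot_image_iff: "x \<in> rot ` A \<longleftrightarrow> rot' x \<in> A"
  by (metis image_iff rot_rot')

lemma rot_box: "rot ` hbox a1 a2 b1 b2 c1 c2 = hbox (- b2) (- b1) c1 c2 a1 a2"
  by (rule site_set_eqI) (auto simp: rot_image_iff)

lemma hexagon_box: "hexagon L = hbox (- int L) (int L) (- int L) (int L) (- int L) (int L)"
  by (auto simp: hexagon_def hbox_def abs_le_iff)

lemma rot_hexagon: "rot ` hexagon L = hexagon L"
  by (simp add: hexagon_box rot_box)

lemma finite_hexagon: "finite (hexagon L)"
  by (rule finite_subset[OF _ finite_vol[of L]]) (auto simp: vol_def)

text \<open>The hexagon of radius \<rho> around the vertex \<open>(x, y)\<close>.\<close>

definition window :: "int \<Rightarrow> int \<Rightarrow> int \<Rightarrow> site set" where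
  "window x y \<rho> = hbox (x - \<rho>) (x + \<rho>) (y - \<rho>) (y + \<rho>) (x + y - \<rho>) (x + y + \<rho>)"

lemma hexagon_window: "hexagon L = window 0 0 (int L)"
  by (simp add: window_def hexagon_box)

lemma rot_window: "rot ` window x y \<rho> = window (- y) (x + y) \<rho>"
proof -
  have "- (y + \<rho>) = - y - \<rho>" "- (y - \<rho>) = - y + \<rho>" "- y + (x + y) = x" by auto
  then show ?thesis unfolding window_def rot_box by (simp only:)
qed

text \<open>\<open>zrow \<alpha> \<beta> l\<close> consists of the first \<open>2 l - 1\<close> sites of a zigzag in the strip
  \<open>\<alpha> \<le> a \<le> \<alpha> + 1\<close>; those with even index rest on the line \<open>a = \<alpha>\<close>.\<close>

definition zz :: "int \<Rightarrow> int \<Rightarrow> nat \<Rightarrow> site" where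
  "zz \<alpha> \<beta> k = (if even k then Up \<alpha> (\<beta> + int (k div 2)) else Down \<alpha> (\<beta> + int (k div 2)))"

definition zrow :: "int \<Rightarrow> int \<Rightarrow> nat \<Rightarrow> site set" where
  "zrow \<alpha> \<beta> l = zz \<alpha> \<beta> ` {..<2 * l - 1}"

lemma zz_even [simp]: "zz \<alpha> \<beta> (2 * j) = Up \<alpha> (\<beta> + int j)"
  and zz_odd [simp]: "zz \<alpha> \<beta> (Suc (2 * j)) = Down \<alpha> (\<beta> + int j)"
  by (simp_all add: zz_def)

lemma zz_inj [simp]: "zz \<alpha> \<beta> j = zz \<alpha> \<beta> k \<longleftrightarrow> j = k"
proof
  assume "zz \<alpha> \<beta> j = zz \<alpha> \<beta> k"
  then have "even j \<longleftrightarrow> even k" "j div 2 = k div 2" by (auto simp: zz_def split: if_splits)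
  then show "j = k" by (metis div_mult_mod_eq even_iff_mod_2_eq_zero odd_iff_mod_2_eq_one)
qed simp

lemma zrow_iff:
  "Up a b \<in> zrow \<alpha> \<beta> l \<longleftrightarrow> a = \<alpha> \<and> \<beta> \<le> b \<and> b < \<beta> + int l"
  "Down a b \<in> zrow \<alpha> \<beta> l \<longleftrightarrow> a = \<alpha> \<and> \<beta> \<le> b \<and> b + 1 < \<beta> + int l"
proof -
  have "Up a b \<in> zrow \<alpha> \<beta> l \<longleftrightarrow> (\<exists>j. 2 * j < 2 * l - 1 \<and> a = \<alpha> \<and> b = \<beta> + int j)"
    unfolding zrow_def image_iff by (auto simp: zz_def Bex_def elim!: evenE)
  also have "\<dots> \<longleftrightarrow> a = \<alpha> \<and> \<beta> \<le> b \<and> b < \<beta> + int l"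
    by (auto intro!: exI[of _ "nat (b - \<beta>)"])
  finally show "Up a b \<in> zrow \<alpha> \<beta> l \<longleftrightarrow> a = \<alpha> \<and> \<beta> \<le> b \<and> b < \<beta> + int l" .
  have "Down a b \<in> zrow \<alpha> \<beta> l \<longleftrightarrow> (\<exists>j. Suc (2 * j) < 2 * l - 1 \<and> a = \<alpha> \<and> b = \<beta> + int j)"
    unfolding zrow_def image_iff by (auto simp: zz_def Bex_def elim!: oddE) (metis dvd_triv_left even_Suc even_Suc_div_two nonzero_mult_div_cancel_left zero_neq_numeral)
  also have "\<dots> \<longleftrightarrow> a = \<alpha> \<and> \<beta> \<le> b \<and> b + 1 < \<beta> + int l"
    by (auto intro!: exI[of _ "nat (b - \<beta>)"])
  finally show "Down a b \<in> zrow \<alpha> \<beta> l \<longleftrightarrow> a = \<alpha> \<and> \<beta> \<le> b \<and> b + 1 < \<beta> + int l" .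
qed

lemma card_zrow: "card (zrow \<alpha> \<beta> l) = 2 * l - 1"
  unfolding zrow_def by (subst card_image) (auto simp: inj_on_def)

text \<open>\<open>extend l A B\<close>: the hexagonal box \<open>B\<close> arises from \<open>A\<close> by adding a full row of \<open>2 l - 1\<close> sites
  along a side of length \<open>l\<close>.\<close>

inductive extend :: "nat \<Rightarrow> site set \<Rightarrow> site set \<Rightarrow> bool" where
  extend_base: "a1 < a2 \<Longrightarrow> int l = c2 - a2 - b1 \<Longrightarrow> l \<ge> 1 \<Longrightarrow> c2 - a2 \<le> b2 \<Longrightarrow> c1 \<le> a2 + b1 \<Longrightarrow>
    extend l (hbox a1 a2 b1 b2 c1 c2) (hbox a1 (a2 + 1) b1 b2 c1 c2)"
| extend_rot: "extend l A B \<Longrightarrow> extend l (rot ` A) (rot ` B)"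

text \<open>The hypotheses say that the side on the line \<open>a = a2\<close> runs from
  \<open>b = b1\<close> to \<open>a + b = c2\<close>, so that \<open>l\<close> is its length. The
  row consists of \<open>l\<close> upward faces resting on this side and the \<open>l - 1\<close>
  downward faces between them.\<close>

lemma hbox_row:
  assumes "a1 < a2" "int l = c2 - a2 - b1" "l \<ge> 1" "c2 - a2 \<le> b2" "c1 \<le> a2 + b1"
  shows "hbox a1 (a2 + 1) b1 b2 c1 c2 = hbox a1 a2 b1 b2 c1 c2 \<union> zrow a2 b1 l"
    "\<And>b. b1 \<le> b \<Longrightarrow> b < b1 + int l \<Longrightarrow> Down (a2 - 1) b \<in> hbox a1 a2 b1 b2 c1 c2"
    "hbox a1 a2 b1 b2 c1 c2 \<inter> zrow a2 b1 l = {}"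
proof -
  show "hbox a1 (a2 + 1) b1 b2 c1 c2 = hbox a1 a2 b1 b2 c1 c2 \<union> zrow a2 b1 l"
    by (rule site_set_eqI) (use assms in \<open>auto simp: zrow_iff\<close>)
  show "Down (a2 - 1) b \<in> hbox a1 a2 b1 b2 c1 c2" if "b1 \<le> b" "b < b1 + int l" for b
    using assms that by auto
  have "hbox a1 a2 b1 b2 c1 c2 \<inter> zrow a2 b1 l \<subseteq> {}" by (rule site_subsetI) (auto simp: zrow_iff)
  then show "hbox a1 a2 b1 b2 c1 c2 \<inter> zrow a2 b1 l = {}" by simp
qed

lemma extend_a2: "a1 < a2 \<Longrightarrow> int l = c2 - a2 - b1 \<Longrightarrow> l \<ge> 1 \<Longrightarrow> c2 - a2 \<le> b2 \<Longrightarrow> c1 \<le> a2 + b1 \<Longrightarrow>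
    extend l (hbox a1 a2 b1 b2 c1 c2) (hbox a1 (a2 + 1) b1 b2 c1 c2)"
  by (rule extend_base)

text \<open>Each of the remaining five sides follows from the one before by the rotation.\<close>

lemma extend_c2: "c1 < c2 \<Longrightarrow> int l = a2 + b2 - c2 \<Longrightarrow> l \<ge> 1 \<Longrightarrow> a1 \<le> c2 - b2 \<Longrightarrow> b1 \<le> c2 - a2 \<Longrightarrow>
    extend l (hbox a1 a2 b1 b2 c1 c2) (hbox a1 a2 b1 b2 c1 (c2 + 1))"
  using extend_rot[OF extend_a2[of c1 c2 l b2 "- a2" "- a1" b1]] by (simp add: rot_box)

lemma extend_b2: "b1 < b2 \<Longrightarrow> int l = c2 - a1 - b2 \<Longrightarrow> l \<ge> 1 \<Longrightarrow> c1 \<le> b2 + a1 \<Longrightarrow> c2 - b2 \<le> a2 \<Longrightarrow>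
    extend l (hbox a1 a2 b1 b2 c1 c2) (hbox a1 a2 b1 (b2 + 1) c1 c2)"
  using extend_rot[OF extend_c2[of b1 b2 l c2 "- a1" c1 "- a2"]] by (simp add: rot_box)

lemma extend_a1: "a1 < a2 \<Longrightarrow> int l = a1 + b2 - c1 \<Longrightarrow> l \<ge> 1 \<Longrightarrow> b1 \<le> c1 - a1 \<Longrightarrow> a1 + b2 \<le> c2 \<Longrightarrow>
    extend l (hbox a1 a2 b1 b2 c1 c2) (hbox (a1 - 1) a2 b1 b2 c1 c2)"
  using extend_rot[OF extend_b2[of "- a2" "- a1" l b2 c1 b1 c2]] by (simp add: rot_box)

lemma extend_c1: "c1 < c2 \<Longrightarrow> int l = c1 - b1 - a1 \<Longrightarrow> l \<ge> 1 \<Longrightarrow> c1 - a1 \<le> b2 \<Longrightarrow> c1 - b1 \<le> a2 \<Longrightarrow>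
    extend l (hbox a1 a2 b1 b2 c1 c2) (hbox a1 a2 b1 b2 (c1 - 1) c2)"
  using extend_rot[OF extend_a1[of c1 c2 l "- a1" b1 "- a2" b2]] by (simp add: rot_box)

lemma extend_b1: "b1 < b2 \<Longrightarrow> int l = a2 + b1 - c1 \<Longrightarrow> l \<ge> 1 \<Longrightarrow> b1 + a2 \<le> c2 \<Longrightarrow> a1 \<le> c1 - b1 \<Longrightarrow>
    extend l (hbox a1 a2 b1 b2 c1 c2) (hbox a1 a2 (b1 - 1) b2 c1 c2)"
  using extend_rot[OF extend_c1[of b1 b2 l "- a2" c1 "- a1" c2]] by (simp add: rot_box)

text \<open>The sides are extended in cyclic order, so that each row after the first gains from its
  already extended neighbour.\<close>

lemma ring_concentric:
  assumes "\<rho> \<ge> 1"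
  obtains A1 A2 A3 A4 A5 where
    "extend \<rho> (window x y (int \<rho>)) A1" "extend (\<rho> + 1) A1 A2" "extend (\<rho> + 1) A2 A3"
    "extend (\<rho> + 1) A3 A4" "extend (\<rho> + 1) A4 A5" "extend (\<rho> + 2) A5 (window x y (int \<rho> + 1))"
proof -
  let ?r = "int \<rho>"
  show ?thesis
  proof (rule that)
    show "extend \<rho> (window x y ?r) (hbox (x - ?r) (x + ?r + 1) (y - ?r) (y + ?r) (x + y - ?r) (x + y + ?r))"
      unfolding window_def by (rule extend_a2) (use assms in auto)
    show "extend (\<rho> + 1) (hbox (x - ?r) (x + ?r + 1) (y - ?r) (y + ?r) (x + y - ?r) (x + y + ?r))
      (hbox (x - ?r) (x + ?r + 1) (y - ?r) (y + ?r) (x + y - ?r) (x + y + ?r + 1))"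
      by (rule extend_c2) (use assms in auto)
    show "extend (\<rho> + 1) (hbox (x - ?r) (x + ?r + 1) (y - ?r) (y + ?r) (x + y - ?r) (x + y + ?r + 1))
      (hbox (x - ?r) (x + ?r + 1) (y - ?r) (y + ?r + 1) (x + y - ?r) (x + y + ?r + 1))"
      by (rule extend_b2) (use assms in auto)
    show "extend (\<rho> + 1) (hbox (x - ?r) (x + ?r + 1) (y - ?r) (y + ?r + 1) (x + y - ?r) (x + y + ?r + 1))
      (hbox (x - ?r - 1) (x + ?r + 1) (y - ?r) (y + ?r + 1) (x + y - ?r) (x + y + ?r + 1))"
      by (rule extend_a1) (use assms in auto)
    show "extend (\<rho> + 1) (hbox (x - ?r - 1) (x + ?r + 1) (y - ?r) (y + ?r + 1) (x + y - ?r) (x + y + ?r + 1))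
      (hbox (x - ?r - 1) (x + ?r + 1) (y - ?r) (y + ?r + 1) (x + y - ?r - 1) (x + y + ?r + 1))"
      by (rule extend_c1) (use assms in auto)
    have "window x y (?r + 1) = hbox (x - ?r - 1) (x + ?r + 1) (y - ?r - 1) (y + ?r + 1) (x + y - ?r - 1) (x + y + ?r + 1)"
      by (simp add: window_def algebra_simps)
    then show "extend (\<rho> + 2) (hbox (x - ?r - 1) (x + ?r + 1) (y - ?r) (y + ?r + 1) (x + y - ?r - 1) (x + y + ?r + 1))
      (window x y (?r + 1))"
      by (simp only:) (rule extend_b1, use assms in auto)
  qed
qed

text \<open>Only the number of rows and a lower bound for their lengths are kept, which is what the
  estimates on top of arbitrary configurations use.\<close>

definition ring :: "nat \<Rightarrow> site set \<Rightarrow> site set \<Rightarrow> bool" where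
  "ring \<rho> = (\<lambda>A B. \<exists>l\<ge>\<rho>. extend l A B) ^^ 6"

lemma ringI:
  assumes "extend l1 A A1" "extend l2 A1 A2" "extend l3 A2 A3" "extend l4 A3 A4" "extend l5 A4 A5" "extend l6 A5 B"
    and "l1 \<ge> \<rho>" "l2 \<ge> \<rho>" "l3 \<ge> \<rho>" "l4 \<ge> \<rho>" "l5 \<ge> \<rho>" "l6 \<ge> \<rho>"
  shows "ring \<rho> A B"
proof -
  let ?R = "\<lambda>A B. \<exists>l\<ge>\<rho>. extend l A B"
  have "?R A A1" "?R A1 A2" "?R A2 A3" "?R A3 A4" "?R A4 A5" "?R A5 B" using assms by blast+
  then have "(?R ^^ Suc (Suc (Suc (Suc (Suc (Suc 0)))))) A B"
    by (intro relpowp_Suc_I[of _ ?R]) auto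
  then show ?thesis by (simp add: ring_def numeral_eq_Suc)
qed

lemma ring_rot:
  assumes "ring \<rho> A B"
  shows "ring \<rho> (rot ` A) (rot ` B)"
proof -
  have "((\<lambda>A B. \<exists>l\<ge>\<rho>. extend l A B) ^^ n) (rot ` A) (rot ` B)" if "((\<lambda>A B. \<exists>l\<ge>\<rho>. extend l A B) ^^ n) A B" for n
    using that
  proof (induction n arbitrary: B)
    case (Suc n)
    then obtain C l where "((\<lambda>A B. \<exists>l\<ge>\<rho>. extend l A B) ^^ n) A C" "l \<ge> \<rho>" "extend l C B" by auto
    then show ?case using Suc.IH extend_rot by (intro relpowp_Suc_I[of _ _ _ "rot ` C"]) auto
  qed simp
  then show ?thesis using assms by (simp add: ring_def)
qed

lemma ring_window: "\<rho> \<ge> 1 \<Longrightarrow> ring \<rho> (window x y (int \<rho>)) (window x y (int \<rho> + 1))"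
  by (rule ring_concentric[of \<rho> x y]) (auto intro: ringI)

text \<open>The sides on \<open>a1\<close> and \<open>c1\<close> stay in place while the opposite
  ones advance twice; in this way a droplet that touches the boundary of the volume can keep
  growing.\<close>

lemma ring_drift:
  assumes "\<rho> \<ge> 1"
  shows "ring \<rho> (window x y (int \<rho>)) (window (x + 1) y (int \<rho> + 1))"
proof -
  let ?r = "int \<rho>"
  have w: "window (x + 1) y (?r + 1) = hbox (x - ?r) (x + ?r + 1 + 1) (y - ?r - 1) (y + ?r + 1) (x + y - ?r) (x + y + ?r + 1 + 1)"
    by (simp add: window_def algebra_simps)
  show ?thesis
  proof (rule ringI)
    show "extend \<rho> (window x y ?r) (hbox (x - ?r) (x + ?r + 1) (y - ?r) (y + ?r) (x + y - ?r) (x + y + ?r))"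
      unfolding window_def by (rule extend_a2) (use assms in auto)
    show "extend (\<rho> + 1) (hbox (x - ?r) (x + ?r + 1) (y - ?r) (y + ?r) (x + y - ?r) (x + y + ?r))
      (hbox (x - ?r) (x + ?r + 1) (y - ?r) (y + ?r) (x + y - ?r) (x + y + ?r + 1))"
      by (rule extend_c2) (use assms in auto)
    show "extend \<rho> (hbox (x - ?r) (x + ?r + 1) (y - ?r) (y + ?r) (x + y - ?r) (x + y + ?r + 1))
      (hbox (x - ?r) (x + ?r + 1 + 1) (y - ?r) (y + ?r) (x + y - ?r) (x + y + ?r + 1))"
      by (rule extend_a2) (use assms in auto)
    show "extend (\<rho> + 1) (hbox (x - ?r) (x + ?r + 1 + 1) (y - ?r) (y + ?r) (x + y - ?r) (x + y + ?r + 1))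
      (hbox (x - ?r) (x + ?r + 1 + 1) (y - ?r) (y + ?r) (x + y - ?r) (x + y + ?r + 1 + 1))"
      by (rule extend_c2) (use assms in auto)
    show "extend (\<rho> + 2) (hbox (x - ?r) (x + ?r + 1 + 1) (y - ?r) (y + ?r) (x + y - ?r) (x + y + ?r + 1 + 1))
      (hbox (x - ?r) (x + ?r + 1 + 1) (y - ?r) (y + ?r + 1) (x + y - ?r) (x + y + ?r + 1 + 1))"
      by (rule extend_b2) (use assms in auto)
    show "extend (\<rho> + 2) (hbox (x - ?r) (x + ?r + 1 + 1) (y - ?r) (y + ?r + 1) (x + y - ?r) (x + y + ?r + 1 + 1))
      (window (x + 1) y (?r + 1))"
      unfolding w by (rule extend_b1) (use assms in auto)
  qed auto
qed

lemma ring_drifts: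
  assumes "\<rho> \<ge> 1" and "(dx, dy) \<in> {(0, 0), (1, 0), (0, 1), (- 1, 1), (- 1, 0), (0, - 1), (1, - 1)}"
  shows "ring \<rho> (window x y (int \<rho>)) (window (x + dx) (y + dy) (int \<rho> + 1))"
proof -
  have rotate: "\<And>x y. ring \<rho> (window x y (int \<rho>)) (window (x - b) (y + (a + b)) (int \<rho> + 1))"
    if *: "\<And>x y. ring \<rho> (window x y (int \<rho>)) (window (x + a) (y + b) (int \<rho> + 1))" for a b
  proof -
    fix x y
    show "ring \<rho> (window x y (int \<rho>)) (window (x - b) (y + (a + b)) (int \<rho> + 1))"
      using ring_rot[OF *[of "x + y" "- x"]] by (simp add: rot_window algebra_simps)
  qed
  have 1: "ring \<rho> (window x y (int \<rho>)) (window (x + 1) (y + 0) (int \<rho> + 1))" for x y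
    using ring_drift[OF assms(1)] by simp
  have 2: "ring \<rho> (window x y (int \<rho>)) (window (x + 0) (y + 1) (int \<rho> + 1))" for x y
    using rotate[of 1 0, OF 1, of x y] by simp
  have 3: "ring \<rho> (window x y (int \<rho>)) (window (x + (- 1)) (y + 1) (int \<rho> + 1))" for x y
    using rotate[of 0 1, OF 2, of x y] by simp
  have 4: "ring \<rho> (window x y (int \<rho>)) (window (x + (- 1)) (y + 0) (int \<rho> + 1))" for x y
    using rotate[of "- 1" 1, OF 3, of x y] by simp
  have 5: "ring \<rho> (window x y (int \<rho>)) (window (x + 0) (y + (- 1)) (int \<rho> + 1))" for x y
    using rotate[of "- 1" 0, OF 4, of x y] by simp
  have 6: "ring \<rho> (window x y (int \<rho>)) (window (x + 1) (y + (- 1)) (int \<rho> + 1))" for x y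
    using rotate[of 0 "- 1", OF 5, of x y] by simp
  show ?thesis
    using assms(2) ring_window[OF assms(1), of x y] 1[of x y] 2[of x y] 3[of x y] 4[of x y] 5[of x y] 6[of x y]
    by auto
qed

lemma extend_mono: "extend l A B \<Longrightarrow> A \<subseteq> B"
proof (induction rule: extend.induct)
  case (extend_base a1 a2 l c2 b1 b2 c1)
  show ?case by (rule site_subsetI) auto
qed auto

lemma finite_box: "finite (hbox a1 a2 b1 b2 c1 c2)"
proof (rule finite_subset)
  show "hbox a1 a2 b1 b2 c1 c2 \<subseteq> (\<lambda>(a, b). Up a b) ` ({a1..a2} \<times> {b1..b2}) \<union> (\<lambda>(a, b). Down a b) ` ({a1..a2} \<times> {b1..b2})"
    by (rule site_subsetI) (auto simp: image_iff)
qed auto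

lemma finite_window: "finite (window x y \<rho>)"
  by (simp add: window_def finite_box)

lemma extend_card: "extend l A B \<Longrightarrow> card B = card A + (2 * l - 1) \<and> l \<ge> 1"
proof (induction rule: extend.induct)
  case (extend_base a1 a2 l c2 b1 b2 c1)
  note zrow = hbox_row[OF extend_base]
  have "card (hbox a1 (a2 + 1) b1 b2 c1 c2) = card (hbox a1 a2 b1 b2 c1 c2) + card (zrow a2 b1 l)"
    unfolding zrow(1) by (intro card_Un_disjoint zrow(3) finite_box) (simp add: zrow_def)
  then show ?case using extend_base by (simp add: card_zrow)
qed auto

lemma card_window: "card (window x y (int \<rho>)) = 6 * \<rho>\<^sup>2"
proof (induction \<rho>)
  case 0
  have "window x y 0 = {}" by (rule site_set_eqI) (auto simp: window_def)
  then show ?case by simp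
next
  case (Suc \<rho>)
  show ?case
  proof (cases "\<rho> = 0")
    case True
    have "window x y 1 = {Up x y, Down (x - 1) y, Up (x - 1) y, Down (x - 1) (y - 1), Up x (y - 1), Down x (y - 1)}"
      by (rule site_set_eqI) (auto simp: window_def)
    then show ?thesis using True by simp
  next
    case False
    then obtain A1 A2 A3 A4 A5 where
    "extend \<rho> (window x y (int \<rho>)) A1" "extend (\<rho> + 1) A1 A2" "extend (\<rho> + 1) A2 A3"
    "extend (\<rho> + 1) A3 A4" "extend (\<rho> + 1) A4 A5" "extend (\<rho> + 2) A5 (window x y (int \<rho> + 1))"
      using ring_concentric[of \<rho> x y] by (metis One_nat_def Suc_leI neq0_conv)
    note this[THEN extend_card]
    then show ?thesis using Suc by (simp add: power2_eq_square algebra_simps)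
  qed
qed

section \<open>Energy of particle sets and the cost of adding a row\<close>

locale kawasaki_hex =
  fixes L :: nat and U \<Delta> :: real
  assumes U_pos: "U > 0" and \<Delta>_gt: "U < \<Delta>" and \<Delta>_lt: "\<Delta> < 3 / 2 * U"
    and small: "3 * U - 2 * \<Delta> \<le> U / 100"
    and r_arg: "r_arg U \<Delta> \<notin> \<int>"
    and \<delta>_half: "\<delta>_frac U \<Delta> \<noteq> 1 / 2"
    and L_large: "int L > 2 * r_star U \<Delta> + 3"
begin

definition \<epsilon> :: real where "\<epsilon> = 3 * U - 2 * \<Delta>"
definition r :: nat where "r = nat (r_star U \<Delta>)"
definition \<delta> :: real where "\<delta> = \<delta>_frac U \<Delta>"

lemma \<epsilon>_pos: "\<epsilon> > 0" and \<epsilon>_le: "100 * \<epsilon> \<le> U" and \<Delta>_eq: "\<Delta> = (3 * U - \<epsilon>) / 2"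
  using \<Delta>_lt small by (auto simp: \<epsilon>_def)

lemma r_arg_ge: "r_arg U \<Delta> \<ge> 49.5"
proof -
  have "50 \<le> U / (2 * \<epsilon>)" using \<epsilon>_pos \<epsilon>_le by (simp add: field_simps)
  then show ?thesis unfolding r_arg_def \<epsilon>_def[symmetric] by simp
qed

lemma r_ge: "r \<ge> 49" and r_star_eq: "r_star U \<Delta> = int r"
  using r_arg_ge by (auto simp: r_def r_star_def le_nat_iff le_floor_iff)

lemma \<delta>_pos: "\<delta> > 0" and \<delta>_less: "\<delta> < 1" and \<delta>_neq: "\<delta> \<noteq> 1 / 2"
  using r_arg \<delta>_half by (auto simp: \<delta>_def \<delta>_frac_def frac_lt_1 frac_gt_0_iff)

text \<open>The definition of the critical radius and its fractional part, solved for
  \<open>U\<close>; comparisons of \<open>U\<close> with multiples of \<open>\<epsilon>\<close> go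
  through it.\<close>

lemma U_eq: "U = (2 * real r + 1 + 2 * \<delta>) * \<epsilon>"
proof -
  have "real r + \<delta> = r_arg U \<Delta>"
    using r_star_eq by (simp add: \<delta>_def \<delta>_frac_def frac_def r_star_def)
  also have "\<dots> = U / (2 * \<epsilon>) - 1 / 2" by (simp add: r_arg_def \<epsilon>_def)
  finally show ?thesis using \<epsilon>_pos by (simp add: field_simps)
qed

lemma L_ge: "L \<ge> 2 * r + 4"
  using L_large unfolding r_star_eq by linarith

definition en :: "site set \<Rightarrow> real" where
  "en A = \<Delta> * real (card A) - U / 2 * real (bonds2 A)"

lemma en_empty [simp]: "en {} = 0"
  by (simp add: en_def bonds2_def)

text \<open>Each particle has three sides, and \<Delta> falls short of three half bonds by
  \<open>\<epsilon> / 2\<close>: a surface cost competes with a small bulk gain.\<close>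

lemma en_perim: "finite A \<Longrightarrow> en A = U / 2 * real (perim A) - \<epsilon> / 2 * real (card A)"
proof -
  assume "finite A"
  then have "real (bonds2 A) = 3 * real (card A) - real (perim A)" using bonds2_perim by fastforce
  then show ?thesis unfolding en_def \<epsilon>_def by (simp only:) (simp add: field_simps)
qed

lemma en_rot [simp]: "en (rot ` A) = en A"
  by (simp add: en_def)

lemma en_insert: "finite A \<Longrightarrow> x \<notin> A \<Longrightarrow> en (insert x A) = en A + \<Delta> - U * real (deg A x)"
  by (simp add: en_def bonds2_insert algebra_simps)

lemma en_insert_le:
  assumes "finite A" "d \<le> deg A x"
  shows "en (insert x A) \<le> en A + (if x \<in> A then 0 else \<Delta> - U * real d)"
  using assms en_insert[of A x] U_pos by (auto simp: insert_absorb)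

lemma en_submodular: "finite A \<Longrightarrow> finite B \<Longrightarrow> en (A \<union> B) + en (A \<inter> B) \<le> en A + en B"
proof -
  assume fin: "finite A" "finite B"
  have "real (card (A \<union> B)) + real (card (A \<inter> B)) = real (card A) + real (card B)"
    using card_Un_Int[OF fin] by linarith
  then have "\<Delta> * real (card (A \<union> B)) + \<Delta> * real (card (A \<inter> B)) = \<Delta> * real (card A) + \<Delta> * real (card B)"
    by (metis distrib_left)
  moreover have "real (bonds2 A) + real (bonds2 B) \<le> real (bonds2 (A \<union> B)) + real (bonds2 (A \<inter> B))"
    using bonds2_supermodular[OF fin] by linarith
  then have "U / 2 * (real (bonds2 A) + real (bonds2 B)) \<le> U / 2 * (real (bonds2 (A \<union> B)) + real (bonds2 (A \<inter> B)))"
    using U_pos by (intro mult_left_mono) auto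
  ultimately show ?thesis by (simp add: en_def algebra_simps)
qed

text \<open>The added site may already be present, so a prescribed order of sites can be followed on
  top of any configuration.\<close>

definition grow :: "(site set \<Rightarrow> site \<Rightarrow> bool) \<Rightarrow> site set \<Rightarrow> site set \<Rightarrow> bool" where
  "grow R = (\<lambda>X Y. \<exists>y. R X y \<and> Y = insert y X)\<^sup>*\<^sup>*"

lemma grow_refl [simp]: "grow R X X"
  by (simp add: grow_def)

lemma grow_trans: "grow R X Y \<Longrightarrow> grow R Y Z \<Longrightarrow> grow R X Z"
  unfolding grow_def by (rule rtranclp_trans)

lemma grow_mono: "grow R X Y \<Longrightarrow> (\<And>X y. R X y \<Longrightarrow> R' X y) \<Longrightarrow> grow R' X Y"
  unfolding grow_def by (rule rtranclp_mono[THEN predicate2D, rotated]) auto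

lemma grow_sequence:
  fixes m :: nat
  assumes "\<And>k. k < m \<Longrightarrow> R (X \<union> t ` {..<k}) (t k)"
  shows "grow R X (X \<union> t ` {..<m})"
  using assms
proof (induction m)
  case (Suc m)
  have "grow R X (X \<union> t ` {..<m})" using Suc by auto
  moreover have "grow R (X \<union> t ` {..<m}) (X \<union> t ` {..<Suc m})"
    unfolding grow_def using Suc.prems[of m] by (intro r_into_rtranclp exI[of _ "t m"]) (auto simp: lessThan_Suc)
  ultimately show ?case by (rule grow_trans)
qed simp

lemma grow_rot:
  assumes "grow R X Y" and R: "\<And>X y. R X y \<Longrightarrow> R (rot ` X) (rot y)"
  shows "grow R (rot ` X) (rot ` Y)"
proof -
  have "(\<lambda>X Y. \<exists>y. R X y \<and> Y = insert y X)\<^sup>*\<^sup>* (rot ` X) (rot ` Y)"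
    if "(\<lambda>X Y. \<exists>y. R X y \<and> Y = insert y X)\<^sup>*\<^sup>* X Y"
    using that
  proof (induction rule: rtranclp_induct)
    case (step Y Z)
    then obtain y where "R Y y" "Z = insert y Y" by blast
    then have "\<exists>y. R (rot ` Y) y \<and> rot ` Z = insert y (rot ` Y)" using R by auto
    then show ?case using step.IH by (auto intro: rtranclp.rtrancl_into_rtrancl)
  qed simp
  then show ?thesis using assms(1) by (simp add: grow_def)
qed

lemma zz_neighbours:
  "na (zz \<alpha> \<beta> (2 * j)) = Down (\<alpha> - 1) (\<beta> + int j)" "nc (zz \<alpha> \<beta> (2 * j)) = zz \<alpha> \<beta> (2 * j + 1)"
  "nb (zz \<alpha> \<beta> (2 * j + 2)) = zz \<alpha> \<beta> (2 * j + 1)"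
  "nc (zz \<alpha> \<beta> (2 * j + 1)) = zz \<alpha> \<beta> (2 * j)" "nb (zz \<alpha> \<beta> (2 * j + 1)) = zz \<alpha> \<beta> (2 * j + 2)"
  using zz_even[of \<alpha> \<beta> j] zz_even[of \<alpha> \<beta> "Suc j"] zz_odd[of \<alpha> \<beta> j] by auto

context
  fixes X :: "site set" and \<alpha> \<beta> :: int and l :: nat
  assumes finX: "finite X" and base: "\<And>b. \<beta> \<le> b \<Longrightarrow> b < \<beta> + int l \<Longrightarrow> Down (\<alpha> - 1) b \<in> X"
begin

abbreviation filled :: "nat \<Rightarrow> site set" where "filled k \<equiv> X \<union> zz \<alpha> \<beta> ` {..<k}"

lemma filled_Suc: "filled (Suc k) = insert (zz \<alpha> \<beta> k) (filled k)"
  by (auto simp: lessThan_Suc)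

lemma zz_in_filled: "zz \<alpha> \<beta> k \<in> filled k \<longleftrightarrow> zz \<alpha> \<beta> k \<in> X"
  by (auto simp: image_iff)

lemma finite_filled: "finite (filled k)"
  using finX by simp

lemma filled_inner_0:
  assumes "l \<ge> 1"
  shows "en (filled 1) \<le> en X + (if zz \<alpha> \<beta> 0 \<in> X then 0 else \<Delta> - U * real (1 + of_bool (zz \<alpha> \<beta> 1 \<in> X)))"
proof -
  have "1 + of_bool (zz \<alpha> \<beta> 1 \<in> X) \<le> deg X (zz \<alpha> \<beta> 0)"
    using zz_neighbours[of \<alpha> \<beta> 0] base[of \<beta>] assms by (simp add: deg_def)
  from en_insert_le[OF finX this] show ?thesis using filled_Suc[of 0] by simp
qed

lemma filled_outer:
  "en (filled (2 * j + 2)) \<le> en (filled (2 * j + 1)) + (if zz \<alpha> \<beta> (2 * j + 1) \<in> X then 0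
    else \<Delta> - U * real (1 + of_bool (zz \<alpha> \<beta> (2 * j + 2) \<in> X)))"
proof -
  have "zz \<alpha> \<beta> (2 * j) \<in> filled (2 * j + 1)" by (rule UnI2, rule imageI) simp
  then have "1 + of_bool (zz \<alpha> \<beta> (2 * j + 2) \<in> X) \<le> deg (filled (2 * j + 1)) (zz \<alpha> \<beta> (2 * j + 1))"
    unfolding deg_def zz_neighbours by auto
  from en_insert_le[OF finite_filled this]
  have "en (filled (Suc (2 * j + 1))) \<le> en (filled (2 * j + 1)) + (if zz \<alpha> \<beta> (2 * j + 1) \<in> X then 0
    else \<Delta> - U * real (1 + of_bool (zz \<alpha> \<beta> (2 * j + 2) \<in> X)))"
    unfolding filled_Suc zz_in_filled .
  moreover have "Suc (2 * j + 1) = 2 * j + 2" by simp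
  ultimately show ?thesis by (simp only:)
qed

lemma filled_inner:
  assumes "Suc j < l"
  shows "en (filled (2 * j + 3)) \<le> en (filled (2 * j + 2)) + (if zz \<alpha> \<beta> (2 * j + 2) \<in> X then 0
    else \<Delta> - U * real (2 + of_bool (zz \<alpha> \<beta> (2 * j + 3) \<in> X)))"
proof -
  have "zz \<alpha> \<beta> (2 * j + 1) \<in> filled (2 * j + 2)" by (rule UnI2, rule imageI) simp
  moreover have "Down (\<alpha> - 1) (\<beta> + int (Suc j)) \<in> filled (2 * j + 2)" using base assms by auto
  moreover have "na (zz \<alpha> \<beta> (2 * j + 2)) = Down (\<alpha> - 1) (\<beta> + int (Suc j))"
    "nc (zz \<alpha> \<beta> (2 * j + 2)) = zz \<alpha> \<beta> (2 * j + 3)"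
    using zz_neighbours[of \<alpha> \<beta> "Suc j"] by (simp_all add: numeral_3_eq_3)
  ultimately have "2 + of_bool (zz \<alpha> \<beta> (2 * j + 3) \<in> X) \<le> deg (filled (2 * j + 2)) (zz \<alpha> \<beta> (2 * j + 2))"
    unfolding deg_def zz_neighbours by auto
  from en_insert_le[OF finite_filled this]
  have "en (filled (Suc (2 * j + 2))) \<le> en (filled (2 * j + 2)) + (if zz \<alpha> \<beta> (2 * j + 2) \<in> X then 0
    else \<Delta> - U * real (2 + of_bool (zz \<alpha> \<beta> (2 * j + 3) \<in> X)))"
    unfolding filled_Suc zz_in_filled .
  moreover have "Suc (2 * j + 2) = 2 * j + 3" by simp
  ultimately show ?thesis by (simp only:)
qed

text \<open>An outer site costs at most \<open>\<Delta> - U\<close> and the next inner one at most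
  \<open>\<Delta> - 2 * U\<close>, together \<open>- \<epsilon>\<close>. A site already in
  \<open>X\<close> brings no gain, but then a newly added predecessor had one more bond, which takes
  the energy back to at most \<open>en X\<close>. This is why the second alternative records that
  the next site is vacant.\<close>

lemma filled_odd:
  assumes "j < l"
  shows "en (filled (2 * j + 1)) \<le> en X \<or>
    zz \<alpha> \<beta> (2 * j + 1) \<notin> X \<and> en (filled (2 * j + 1)) \<le> en X + \<Delta> - U - real j * \<epsilon>"
  using assms
proof (induction j)
  case 0
  then show ?case using filled_inner_0 \<Delta>_lt U_pos
    by (cases "zz \<alpha> \<beta> 0 \<in> X"; cases "zz \<alpha> \<beta> 1 \<in> X") auto
next
  case (Suc j)
  have eq: "2 * Suc j + 1 = 2 * j + 3" by simp
  define q where "q = real j * \<epsilon>"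
  have q: "q \<ge> 0" "real (Suc j) * \<epsilon> = q + \<epsilon>" using \<epsilon>_pos by (auto simp: q_def algebra_simps)
  let ?e = "\<lambda>k. en (filled k)" and ?P = "\<lambda>k. zz \<alpha> \<beta> k \<in> X"
  have "?P (2 * j + 1) \<Longrightarrow> ?e (2 * j + 2) \<le> ?e (2 * j + 1)"
    "\<not> ?P (2 * j + 1) \<Longrightarrow> ?P (2 * j + 2) \<Longrightarrow> ?e (2 * j + 2) \<le> ?e (2 * j + 1) + \<Delta> - 2 * U"
    "\<not> ?P (2 * j + 1) \<Longrightarrow> \<not> ?P (2 * j + 2) \<Longrightarrow> ?e (2 * j + 2) \<le> ?e (2 * j + 1) + \<Delta> - U"
    using filled_outer[of j] by simp_all
  moreover have "?P (2 * j + 2) \<Longrightarrow> ?e (2 * j + 3) \<le> ?e (2 * j + 2)"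
    "\<not> ?P (2 * j + 2) \<Longrightarrow> ?P (2 * j + 3) \<Longrightarrow> ?e (2 * j + 3) \<le> ?e (2 * j + 2) + \<Delta> - 3 * U"
    "\<not> ?P (2 * j + 2) \<Longrightarrow> \<not> ?P (2 * j + 3) \<Longrightarrow> ?e (2 * j + 3) \<le> ?e (2 * j + 2) + \<Delta> - 2 * U"
    using filled_inner[OF Suc.prems] by simp_all
  moreover have "?e (2 * j + 1) \<le> en X \<or> \<not> ?P (2 * j + 1) \<and> ?e (2 * j + 1) \<le> en X + \<Delta> - U - q"
    using Suc.IH Suc.prems by (simp add: q_def)
  moreover have "2 * \<Delta> = 3 * U - \<epsilon>" using \<Delta>_eq by simp
  ultimately show ?case
    unfolding eq q(2) using q(1) \<epsilon>_pos U_pos by (smt (verit))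
qed

text \<open>The bound is the cost of two sites with one bond each; afterwards the inner sites
  compensate the outer ones.\<close>

lemma filled_le:
  assumes "k \<le> 2 * l - 1"
  shows "en (filled k) \<le> en X + 2 * (\<Delta> - U)"
proof (cases k)
  case 0
  then show ?thesis using \<Delta>_gt by simp
next
  case (Suc k')
  have odd: "en (filled (2 * j + 1)) \<le> en X + (\<Delta> - U)" if "j < l" for j
  proof -
    have "real j * \<epsilon> \<ge> 0" using \<epsilon>_pos by simp
    then show ?thesis using filled_odd[OF that] \<Delta>_gt by linarith
  qed
  show ?thesis
  proof (cases "even k'")
    case True
    then obtain j where k: "k = 2 * j + 1" using Suc by (auto elim!: evenE)
    then have "j < l" using assms by auto
    then show ?thesis unfolding k using odd[of j] \<Delta>_gt by auto
  next
    case False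
    then obtain j where k: "k = 2 * j + 2" using Suc by (auto elim!: oddE)
    then have "j < l" using assms by auto
    then show ?thesis unfolding k using odd[of j] filled_outer[of j] \<Delta>_gt U_pos
      by (cases "zz \<alpha> \<beta> (2 * j + 1) \<in> X"; cases "zz \<alpha> \<beta> (2 * j + 2) \<in> X") simp_all
  qed
qed

lemma filled_row_le:
  assumes "l \<ge> 1"
  shows "en (X \<union> zrow \<alpha> \<beta> l) \<le> max (en X) (en X + \<Delta> - U - (real l - 1) * \<epsilon>)"
proof -
  have "2 * (l - 1) + 1 = 2 * l - 1" using assms by auto
  then have "X \<union> zrow \<alpha> \<beta> l = filled (2 * (l - 1) + 1)" by (simp add: zrow_def)
  then show ?thesis using filled_odd[of "l - 1"] assms by (auto simp: of_nat_diff)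
qed

text \<open>Every pair of sites now contributes its full gain. Unlike in
  \<open>filled_row_le\<close> the bound may lie below \<open>en X\<close>, as the energies of large
  hexagons require.\<close>

lemma filled_row_disjoint_le:
  assumes "l \<ge> 1" "X \<inter> zrow \<alpha> \<beta> l = {}"
  shows "en (X \<union> zrow \<alpha> \<beta> l) \<le> en X + \<Delta> - U - (real l - 1) * \<epsilon>"
proof -
  have notX: "zz \<alpha> \<beta> k \<notin> X" if "k < 2 * l - 1" for k using assms(2) that by (auto simp: zrow_def)
  have "en (filled (2 * j + 1)) \<le> en X + \<Delta> - U - real j * \<epsilon>" if "j < l" for j
    using that
  proof (induction j)
    case 0
    then show ?case using filled_inner_0 notX[of 0] U_pos by (cases "zz \<alpha> \<beta> 1 \<in> X") auto
  next
    case (Suc j)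
    let ?e = "\<lambda>k. en (filled k)"
    have "?e (2 * j + 2) \<le> ?e (2 * j + 1) + (\<Delta> - U)"
      using filled_outer[of j] notX[of "2 * j + 1"] Suc.prems U_pos
      by (cases "zz \<alpha> \<beta> (2 * j + 2) \<in> X") simp_all
    moreover have "?e (2 * j + 3) \<le> ?e (2 * j + 2) + (\<Delta> - 2 * U)"
      using filled_inner[OF Suc.prems] notX[of "2 * j + 2"] Suc.prems U_pos
      by (cases "zz \<alpha> \<beta> (2 * j + 3) \<in> X") simp_all
    moreover have "?e (2 * j + 1) \<le> en X + \<Delta> - U - real j * \<epsilon>" using Suc by simp
    moreover have "2 * \<Delta> = 3 * U - \<epsilon>" using \<Delta>_eq by simp
    ultimately have "?e (2 * j + 3) \<le> en X + \<Delta> - U - (real j * \<epsilon> + \<epsilon>)" by linarith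
    moreover have "2 * Suc j + 1 = 2 * j + 3" "real (Suc j) * \<epsilon> = real j * \<epsilon> + \<epsilon>" by (simp_all add: algebra_simps)
    ultimately show ?case by (simp only:)
  qed
  from this[of "l - 1"] have "en (filled (2 * (l - 1) + 1)) \<le> en X + \<Delta> - U - (real l - 1) * \<epsilon>"
    using assms(1) by (simp add: of_nat_diff)
  moreover have "2 * (l - 1) + 1 = 2 * l - 1" using assms(1) by auto
  ultimately show ?thesis by (simp add: zrow_def)
qed

end

definition G :: "real \<Rightarrow> site set \<Rightarrow> site \<Rightarrow> bool" where
  "G h X y \<longleftrightarrow> y \<in> hexagon L \<and> X \<subseteq> hexagon L \<and> en X \<le> h \<and> en (insert y X) \<le> h"

lemma G_mono: "G h X y \<Longrightarrow> h \<le> h' \<Longrightarrow> G h' X y"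
  by (auto simp: G_def)

lemma grow_G_mono: "grow (G h) X Y \<Longrightarrow> h \<le> h' \<Longrightarrow> grow (G h') X Y"
  by (erule grow_mono) (rule G_mono)

lemma rot_hexagon_iff: "rot x \<in> hexagon L \<longleftrightarrow> x \<in> hexagon L" "rot ` X \<subseteq> hexagon L \<longleftrightarrow> X \<subseteq> hexagon L"
proof -
  show 1: "rot x \<in> hexagon L \<longleftrightarrow> x \<in> hexagon L" for x
    using inj_image_mem_iff[OF inj_rot, of x "hexagon L"] by (simp add: rot_hexagon)
  show "rot ` X \<subseteq> hexagon L \<longleftrightarrow> X \<subseteq> hexagon L" using 1 by auto
qed

lemma G_rot: "G h X y \<Longrightarrow> G h (rot ` X) (rot y)"
  using en_rot[of "insert y X"] by (auto simp: G_def rot_hexagon_iff)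

text \<open>Only \<open>A\<close> has to be occupied beforehand; \<open>X\<close> may contain
  further sites anywhere, even in the new row. By rotation invariance the row lies on the line
  \<open>a = a2\<close>.\<close>

lemma extend_grow:
  assumes "extend l A B" "A \<subseteq> X" "X \<subseteq> hexagon L" "B \<subseteq> hexagon L"
  shows "grow (G (en X + 2 * (\<Delta> - U))) X (X \<union> B) \<and>
    en (X \<union> B) \<le> max (en X) (en X + \<Delta> - U - (real l - 1) * \<epsilon>)"
  using assms
proof (induction arbitrary: X rule: extend.induct)
  case (extend_base a1 a2 l c2 b1 b2 c1)
  have finX: "finite X" using extend_base.prems(2) finite_hexagon finite_subset by blast
  have XB: "X \<union> hbox a1 (a2 + 1) b1 b2 c1 c2 = X \<union> zrow a2 b1 l"
    using extend_base.prems(1) hbox_row(1)[OF extend_base.hyps] by blast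
  have base: "Down (a2 - 1) b \<in> X" if "b1 \<le> b" "b < b1 + int l" for b
    using hbox_row(2)[OF extend_base.hyps that] extend_base.prems(1) by blast
  have hex: "zz a2 b1 k \<in> hexagon L" if "k < 2 * l - 1" for k
    using extend_base.prems(3) hbox_row(1)[OF extend_base.hyps] that by (auto simp: zrow_def)
  have "grow (G (en X + 2 * (\<Delta> - U))) X (X \<union> zz a2 b1 ` {..<2 * l - 1})"
  proof (rule grow_sequence)
    fix k assume k: "k < 2 * l - 1"
    show "G (en X + 2 * (\<Delta> - U)) (X \<union> zz a2 b1 ` {..<k}) (zz a2 b1 k)"
      using filled_le[of X b1 l a2, OF finX base, of k] filled_le[of X b1 l a2, OF finX base, of "Suc k"] k
        filled_Suc[of X b1 l a2, OF finX base, of k] hex extend_base.prems(2)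
      by (auto simp: G_def)
  qed
  then show ?case using filled_row_le[of X b1 l a2, OF finX base extend_base.hyps(3)]
    by (simp add: XB) (simp add: zrow_def)
next
  case (extend_rot l A B)
  define Y where "Y = rot' ` X"
  have X: "X = rot ` Y" by (simp add: Y_def image_image)
  have "A \<subseteq> Y" using extend_rot.prems(1) inj_rot unfolding X by (simp add: inj_image_subset_iff)
  moreover have "Y \<subseteq> hexagon L" "B \<subseteq> hexagon L" using extend_rot.prems unfolding X by (simp_all only: rot_hexagon_iff)
  ultimately have "grow (G (en Y + 2 * (\<Delta> - U))) Y (Y \<union> B)"
    "en (Y \<union> B) \<le> max (en Y) (en Y + \<Delta> - U - (real l - 1) * \<epsilon>)"
    using extend_rot.IH by auto
  moreover from this(1) have "grow (G (en Y + 2 * (\<Delta> - U))) (rot ` Y) (rot ` (Y \<union> B))"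
    by (rule grow_rot) (rule G_rot)
  ultimately show ?case unfolding X image_Un[symmetric] en_rot by blast
qed

end

section \<open>Kawasaki moves\<close>

definition edges :: "site set \<Rightarrow> site set set" where
  "edges A = {{x, y} | x y. x \<in> A \<and> y \<in> A \<and> nn x y}"

lemma edges_insert: "edges (insert x A) = edges A \<union> (\<lambda>y. {x, y}) ` {y\<in>A. nn x y}"
proof -
  have "\<not> nn x x" by (simp add: nn_def)
  then show ?thesis unfolding edges_def using nn_commute by (auto simp: image_iff doubleton_eq_iff)
qed

lemma finite_edges: "finite A \<Longrightarrow> finite (edges A)"
  by (rule finite_subset[of _ "Pow A"]) (auto simp: edges_def)

lemma card_neighbours: "card {y\<in>A. nn x y} = deg A x"
proof -
  have "{y\<in>A. nn x y} = A \<inter> {na x, nb x, nc x}" by (auto simp: nn_iff)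
  then show ?thesis by (simp add: deg_def Int_insert_right)
qed

lemma card_edges: "finite A \<Longrightarrow> 2 * card (edges A) = bonds2 A"
proof (induction A rule: finite_induct)
  case empty
  then show ?case by (simp add: edges_def bonds2_def)
next
  case (insert x A)
  have "card (edges (insert x A)) = card (edges A) + card ((\<lambda>y. {x, y}) ` {y\<in>A. nn x y})"
    unfolding edges_insert using insert
    by (intro card_Un_disjoint finite_edges) (auto simp: edges_def doubleton_eq_iff)
  also have "card ((\<lambda>y. {x, y}) ` {y\<in>A. nn x y}) = deg A x"
    unfolding card_neighbours[symmetric] by (rule card_image) (auto simp: inj_on_def doubleton_eq_iff)
  finally show ?case using insert by (simp add: bonds2_insert)
qed

definition conf :: "nat \<Rightarrow> site set \<Rightarrow> config" where
  "conf L A = (\<lambda>x\<in>vol L. if x \<in> A then 1 else 0)"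

lemma conf_empty: "empty_config L = conf L {}"
  by (simp add: empty_config_def conf_def)

lemma conf_full: "full_config L = conf L (hexagon L)"
  by (simp add: full_config_def conf_def vol_minus_eq_hexagon)

lemma conf_in_configs: "conf L A \<in> configs L"
  by (auto simp: conf_def configs_def)

lemma configs_conf:
  assumes "\<eta> \<in> configs L"
  obtains A where "A \<subseteq> vol L" "\<eta> = conf L A"
proof (rule that)
  show "\<eta> = conf L {x\<in>vol L. \<eta> x = 1}"
  proof (rule ext)
    fix x
    show "\<eta> x = conf L {x\<in>vol L. \<eta> x = 1} x"
      using assms by (cases "x \<in> vol L") (auto simp: configs_def conf_def PiE_def Pi_def extensional_def)
  qed
qed auto

lemma conf_inj: "A \<subseteq> vol L \<Longrightarrow> B \<subseteq> vol L \<Longrightarrow> conf L A = conf L B \<longleftrightarrow> A = B"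
proof
  assume sub: "A \<subseteq> vol L" "B \<subseteq> vol L" and eq: "conf L A = conf L B"
  have "x \<in> A \<longleftrightarrow> x \<in> B" if "x \<in> vol L" for x
    using fun_cong[OF eq, of x] that by (auto simp: conf_def split: if_splits)
  then show "A = B" using sub by blast
qed simp

lemma hexagon_subset_vol: "hexagon L \<subseteq> vol L"
  by (auto simp: vol_def)

lemma inner_bdry_eq: "inner_bdry L = vol L - hexagon L"
  using vol_minus_eq_hexagon[of L] hexagon_subset_vol by (auto simp: vol_minus_def inner_bdry_def)

lemma neighbour_in_vol: "x \<in> hexagon L \<Longrightarrow> nn x y \<Longrightarrow> y \<in> vol L"
  unfolding vol_def using nn_commute by blast

lemma bond_move_create:
  assumes "y \<in> vol L" "y \<notin> hexagon L"
  shows "\<exists>b\<in>obonds L. conf L (insert y A) = bond_move L b (conf L A)"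
proof -
  have "y \<in> inner_bdry L" using assms by (simp add: inner_bdry_eq)
  then obtain x where x: "x \<notin> vol L" "nn x y" by (auto simp: inner_bdry_def)
  then have "(x, y) \<in> obonds L" using \<open>y \<in> inner_bdry L\<close> by (auto simp: obonds_def)
  moreover have "conf L (insert y A) = bond_move L (x, y) (conf L A)"
    using x assms by (auto simp: bond_move_def conf_def fun_eq_iff)
  ultimately show ?thesis by blast
qed

lemma bond_move_exchange:
  assumes "x \<in> vol L" "y \<in> vol L" "nn x y" "x \<notin> A" "y \<notin> A"
  shows "\<exists>b\<in>obonds L. conf L (insert y A) = bond_move L b (conf L (insert x A))"
proof -
  have "(x, y) \<in> obonds L" using assms by (auto simp: obonds_def)
  moreover have "conf L (insert y A) = bond_move L (x, y) (conf L (insert x A))"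
    using assms by (auto simp: bond_move_def conf_def fun_eq_iff)
  ultimately show ?thesis by blast
qed

lemma bond_move_cases:
  assumes "\<exists>b\<in>obonds L. \<eta> = bond_move L b (conf L A)" "A \<subseteq> vol L"
  obtains "\<eta> = conf L A"
  | x y where "x \<in> vol L" "y \<in> vol L" "nn x y" "x \<in> A" "y \<notin> A" "\<eta> = conf L (insert y (A - {x}))"
  | y where "y \<in> vol L" "y \<notin> hexagon L" "y \<notin> A" "\<eta> = conf L (insert y A)"
  | y where "y \<in> vol L" "y \<notin> hexagon L" "y \<in> A" "\<eta> = conf L (A - {y})"
proof -
  obtain x y where b: "(x, y) \<in> obonds L" "\<eta> = bond_move L (x, y) (conf L A)" using assms(1) by auto
  have n: "nn x y" "x \<noteq> y" using b(1) by (auto simp: obonds_def nn_def)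
  consider "x \<in> vol L" "y \<in> vol L" | "x \<in> inner_bdry L" "y \<notin> vol L" | "x \<notin> vol L" "y \<in> inner_bdry L"
    using b(1) by (auto simp: obonds_def)
  then show ?thesis
  proof cases
    case 1
    have \<eta>: "\<eta> = (conf L A)(x := conf L A y, y := conf L A x)" using 1 b(2) by (simp add: bond_move_def)
    consider "x \<in> A" "y \<notin> A" | "x \<notin> A" "y \<in> A" | "x \<in> A \<longleftrightarrow> y \<in> A" by blast
    then show ?thesis
    proof cases
      case 1
      then have "\<eta> = conf L (insert y (A - {x}))" unfolding \<eta> using \<open>x \<in> vol L\<close> \<open>y \<in> vol L\<close> n
        by (auto simp: conf_def fun_eq_iff)
      then show ?thesis using that(2) 1 \<open>x \<in> vol L\<close> \<open>y \<in> vol L\<close> n by blast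
    next
      case 2
      then have "\<eta> = conf L (insert x (A - {y}))" unfolding \<eta> using \<open>x \<in> vol L\<close> \<open>y \<in> vol L\<close> n
        by (auto simp: conf_def fun_eq_iff)
      then show ?thesis using that(2)[of y x] 2 \<open>x \<in> vol L\<close> \<open>y \<in> vol L\<close> n nn_commute by blast
    next
      case 3
      then have "\<eta> = conf L A" unfolding \<eta> using \<open>x \<in> vol L\<close> \<open>y \<in> vol L\<close> n
        by (auto simp: conf_def fun_eq_iff)
      then show ?thesis using that(1) by blast
    qed
  next
    case 2
    then have x: "x \<in> vol L" "x \<notin> hexagon L" by (auto simp: inner_bdry_eq)
    have \<eta>: "\<eta> = (conf L A)(x := 0)" using 2 x b(2) by (simp add: bond_move_def)
    then have "\<eta> = conf L (A - {x})" using x by (auto simp: conf_def fun_eq_iff)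
    then show ?thesis using that(4)[of x] that(1) x by (cases "x \<in> A") auto
  next
    case 3
    then have y: "y \<in> vol L" "y \<notin> hexagon L" by (auto simp: inner_bdry_eq)
    have \<eta>: "\<eta> = (conf L A)(y := 1)" using 3 y b(2) by (simp add: bond_move_def)
    then have "\<eta> = conf L (insert y A)" using y by (auto simp: conf_def fun_eq_iff)
    then show ?thesis using that(3)[of y] that(1) y by (cases "y \<in> A") (auto simp: insert_absorb)
  qed
qed

lemma bond_move_sym:
  assumes "\<eta> \<in> configs L" "\<eta>' \<in> configs L" "\<exists>b\<in>obonds L. \<eta>' = bond_move L b \<eta>"
  shows "\<exists>b\<in>obonds L. \<eta> = bond_move L b \<eta>'"
proof -
  obtain A where A: "A \<subseteq> vol L" "\<eta> = conf L A" using configs_conf[OF assms(1)] by blast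
  have remove: "\<exists>b\<in>obonds L. conf L A = bond_move L b (conf L (insert y A))"
    if y: "y \<in> vol L" "y \<notin> hexagon L" "y \<notin> A" for y and A :: "site set"
  proof -
    have "y \<in> inner_bdry L" using y by (simp add: inner_bdry_eq)
    then obtain x where x: "x \<notin> vol L" "nn x y" by (auto simp: inner_bdry_def)
    then have "(y, x) \<in> obonds L" using \<open>y \<in> inner_bdry L\<close> nn_commute[of x y] by (auto simp: obonds_def)
    moreover have "conf L A = bond_move L (y, x) (conf L (insert y A))"
      using x y by (auto simp: bond_move_def conf_def fun_eq_iff)
    ultimately show ?thesis by blast
  qed
  from bond_move_cases[OF assms(3)[unfolded A(2)] A(1)] show ?thesis
  proof cases
    case 1
    have "\<exists>b\<in>obonds L. \<eta>' = bond_move L b \<eta>'" using assms(3) 1 A(2) by simp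
    then show ?thesis using 1 A(2) by simp
  next
    case (2 x y)
    from bond_move_exchange[of y L x "A - {x}"] 2 nn_commute[of x y]
    show ?thesis unfolding A(2) 2(6) by (auto simp: insert_absorb)
  next
    case (3 y)
    then show ?thesis unfolding A(2) 3(4) using remove by blast
  next
    case (4 y)
    then show ?thesis unfolding A(2) 4(4) using bond_move_create[of y L "A - {y}"] by (simp add: insert_absorb)
  qed
qed

context kawasaki_hex
begin

text \<open>Bonds count only inside the hexagon, so each particle on the outer ring costs exactly
  \<Delta>.\<close>

lemma hamiltonian_conf:
  assumes "A \<subseteq> vol L"
  shows "hamiltonian L U \<Delta> (conf L A) = en (A \<inter> hexagon L) + \<Delta> * real (card (A - hexagon L))"
proof -
  let ?B = "A \<inter> hexagon L"
  have finA: "finite A" using assms finite_vol finite_subset by blast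
  have "(\<Sum>e \<in> {{x, y} | x y. x \<in> vol_minus L \<and> y \<in> vol_minus L \<and> nn x y}. \<Prod>z\<in>e. real (conf L A z))
      = (\<Sum>e \<in> edges (hexagon L). if e \<in> edges ?B then 1 else 0)"
  proof (rule sum.cong)
    show "{{x, y} | x y. x \<in> vol_minus L \<and> y \<in> vol_minus L \<and> nn x y} = edges (hexagon L)"
      by (simp add: edges_def vol_minus_eq_hexagon)
    fix e assume "e \<in> edges (hexagon L)"
    then obtain x y where e: "e = {x, y}" "x \<in> hexagon L" "y \<in> hexagon L" "nn x y" by (auto simp: edges_def)
    have "x \<noteq> y" using e(4) by (simp add: nn_def)
    moreover have "x \<in> vol L" "y \<in> vol L" using e hexagon_subset_vol by auto
    ultimately have "(\<Prod>z\<in>e. real (conf L A z)) = (if x \<in> A \<and> y \<in> A then 1 else 0)"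
      unfolding e(1) by (simp add: conf_def)
    moreover have "e \<in> edges ?B \<longleftrightarrow> x \<in> A \<and> y \<in> A"
      using e unfolding edges_def by (auto simp: doubleton_eq_iff)
    ultimately show "(\<Prod>z\<in>e. real (conf L A z)) = (if e \<in> edges ?B then 1 else 0)" by simp
  qed
  also have "\<dots> = real (card (edges ?B))"
  proof -
    have "edges ?B \<subseteq> edges (hexagon L)" by (auto simp: edges_def)
    then show ?thesis using finite_edges[OF finite_hexagon[of L]]
      by (simp add: sum.If_cases Int_absorb1)
  qed
  also have "\<dots> = real (bonds2 ?B) / 2"
    using card_edges[of ?B] finA by (simp flip: of_nat_mult)
  finally have 1: "(\<Sum>e \<in> {{x, y} | x y. x \<in> vol_minus L \<and> y \<in> vol_minus L \<and> nn x y}. \<Prod>z\<in>e. real (conf L A z)) = real (bonds2 ?B) / 2" .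
  have "(\<Sum>x\<in>vol L. real (conf L A x)) = (\<Sum>x\<in>vol L. if x \<in> A then 1 else 0)"
    by (intro sum.cong) (auto simp: conf_def)
  also have "\<dots> = real (card A)" using assms finite_vol by (simp add: sum.If_cases Int_absorb1)
  also have "card A = card ?B + card (A - hexagon L)"
    using finA by (metis Int_Diff_Un Int_Diff_disjoint card_Un_disjoint finite_Diff finite_Int)
  finally show ?thesis unfolding hamiltonian_def 1 en_def by (simp add: algebra_simps)
qed

lemma hamiltonian_hexagon:
  assumes "A \<subseteq> hexagon L"
  shows "hamiltonian L U \<Delta> (conf L A) = en A"
proof -
  have "card (A - hexagon L) = 0" "A \<inter> hexagon L = A" "A \<subseteq> vol L"
    using assms hexagon_subset_vol[of L] by (auto simp: Diff_eq_empty_iff[THEN iffD2])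
  then show ?thesis using hamiltonian_conf[of A] by simp
qed

lemma hamiltonian_boundary:
  assumes "A \<subseteq> hexagon L" "y \<in> vol L" "y \<notin> hexagon L"
  shows "hamiltonian L U \<Delta> (conf L (insert y A)) = en A + \<Delta>"
proof -
  have "insert y A \<inter> hexagon L = A" "insert y A - hexagon L = {y}" "insert y A \<subseteq> vol L"
    using assms hexagon_subset_vol[of L] by auto
  then show ?thesis using hamiltonian_conf[of "insert y A"] by simp
qed

abbreviation E where "E \<eta> \<eta>' \<equiv> \<exists>b\<in>obonds L. \<eta>' = bond_move L b \<eta>"

lemma card_obonds_pos: "card (obonds L) > 0"
proof -
  have "Up 0 0 \<in> hexagon L" "Down 0 0 \<in> hexagon L" using L_ge by (auto simp: hexagon_box)
  then have "(Up 0 0, Down 0 0) \<in> obonds L" using hexagon_subset_vol by (auto simp: obonds_def nn_iff)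
  then show ?thesis using finite_obonds by (auto simp: card_gt_0_iff)
qed

sublocale metropolis "configs L" "hamiltonian L U \<Delta>" E "1 / real (card (obonds L))" "kawasaki_P L U \<Delta>"
proof
  show "finite (configs L)" by (rule finite_configs)
  show "0 < 1 / real (card (obonds L))" using card_obonds_pos by simp
  show "E y x" if "x \<in> configs L" "y \<in> configs L" "E x y" for x y
    using bond_move_sym that by blast
  show "kawasaki_P L U \<Delta> \<beta> x y = (if E x y then 1 / real (card (obonds L)) * exp (- \<beta> * max 0 (hamiltonian L U \<Delta> y - hamiltonian L U \<Delta> x)) else 0)"
    if "x \<noteq> y" for \<beta> x y using that by (simp add: kawasaki_P_def kawasaki_rate_def)
qed (use kawasaki_P_stochastic in auto)

section \<open>Transport of particles from and to the boundary\<close>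

definition Kreach :: "real \<Rightarrow> site set \<Rightarrow> site set \<Rightarrow> bool" where
  "Kreach h A B = reach h (conf L A) (conf L B)"

lemma Kreach_refl [simp]: "Kreach h A A"
  by (simp add: Kreach_def reach_def)

lemma Kreach_trans: "Kreach h A B \<Longrightarrow> Kreach h B C \<Longrightarrow> Kreach h A C"
  unfolding Kreach_def reach_def by (rule rtranclp_trans)

lemma Kreach_mono: "Kreach h A B \<Longrightarrow> h \<le> h' \<Longrightarrow> Kreach h' A B"
  unfolding Kreach_def reach_def by (rule rtranclp_mono[THEN predicate2D, rotated]) auto

lemma Kreach_sym: "Kreach h A B \<Longrightarrow> Kreach h B A"
  unfolding Kreach_def reach_def
  by (rule sympD[OF symp_rtranclp]) (auto intro!: sympI dest: bond_move_sym)

lemma Kreach_create: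
  assumes "A \<subseteq> hexagon L" "y \<in> vol L" "y \<notin> hexagon L" "en A + \<Delta> \<le> h"
  shows "Kreach h A (insert y A)"
proof -
  have "hamiltonian L U \<Delta> (conf L A) = en A" "hamiltonian L U \<Delta> (conf L (insert y A)) = en A + \<Delta>"
    using hamiltonian_hexagon hamiltonian_boundary assms by auto
  then show ?thesis unfolding Kreach_def reach_def
    using bond_move_create[OF assms(2,3), of A] conf_in_configs assms \<Delta>_gt U_pos
    by (intro r_into_rtranclp) auto
qed

lemma hamiltonian_insert_le:
  assumes "A \<subseteq> hexagon L" "x \<in> vol L" "x \<notin> A"
  shows "hamiltonian L U \<Delta> (conf L (insert x A)) \<le> en A + \<Delta>"
proof (cases "x \<in> hexagon L")
  case True
  have finA: "finite A" using assms finite_hexagon finite_subset by blast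
  then have "hamiltonian L U \<Delta> (conf L (insert x A)) = en (insert x A)"
    using assms True by (intro hamiltonian_hexagon) auto
  also have "\<dots> \<le> en A + \<Delta>" using en_insert_le[OF finA, of 0 x] assms by auto
  finally show ?thesis .
next
  case False
  then show ?thesis using hamiltonian_boundary assms by simp
qed

lemma Kreach_move:
  assumes "A \<subseteq> hexagon L" "x \<in> vol L" "y \<in> vol L" "nn x y" "x \<notin> A" "y \<notin> A" "en A + \<Delta> \<le> h"
  shows "Kreach h (insert x A) (insert y A)"
  unfolding Kreach_def reach_def
  using bond_move_exchange[OF assms(2-6)] conf_in_configs hamiltonian_insert_le[of A] assms
  by (intro r_into_rtranclp) (auto intro: order_trans)

text \<open>\<open>path b n\<close> enumerates the zigzag in the strip \<open>b \<le> y \<le> b + 1\<close>, along which particles enter from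
  the boundary.\<close>

definition path :: "int \<Rightarrow> int \<Rightarrow> site" where
  "path b n = (if even n then Up (n div 2) b else Down (n div 2) b)"

lemma path_even [simp]: "path b (2 * a) = Up a b" and path_odd [simp]: "path b (2 * a + 1) = Down a b"
  by (simp_all add: path_def)

lemma path_inj [simp]: "path b m = path b' n \<longleftrightarrow> b = b' \<and> m = n"
proof
  assume eq: "path b m = path b' n"
  then have "b = b'" "even m \<longleftrightarrow> even n" "m div 2 = n div 2" by (auto simp: path_def split: if_splits)
  then show "b = b' \<and> m = n" by (metis div_mult_mod_eq even_iff_mod_2_eq_zero odd_iff_mod_2_eq_one)
qed simp

lemma nn_path: "nn (path b (n + 1)) (path b n)"
proof (cases "even n")
  case True
  then obtain a where "n = 2 * a" by (auto elim: evenE)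
  then show ?thesis by (simp add: nn_iff)
next
  case False
  then obtain a where n: "n = 2 * a + 1" by (auto elim: oddE)
  then have "n + 1 = 2 * (a + 1)" by simp
  then show ?thesis unfolding n by (simp only: path_even path_odd) (simp add: nn_iff)
qed

lemma site_path: "\<exists>b n. x = path b n"
  by (cases x) (metis path_even, metis path_odd)

lemma path_exit:
  assumes "path b n \<in> hexagon L"
  obtains k :: nat where "k \<ge> 1" "\<And>i::nat. i < k \<Longrightarrow> path b (n + int i) \<in> hexagon L"
    "path b (n + int k) \<notin> hexagon L" "\<And>i::nat. i \<le> k \<Longrightarrow> path b (n + int i) \<in> vol L"
proof -
  have "path b m \<notin> hexagon L" if "m \<ge> 2 * int L" for m
    using that unfolding path_def by (auto simp: hexagon_box)
  then have "path b (n + int (nat (2 * int L - n))) \<notin> hexagon L" by simp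
  define k where "k = (LEAST k. path b (n + int k) \<notin> hexagon L)"
  have k: "path b (n + int k) \<notin> hexagon L"
    unfolding k_def by (rule LeastI) fact
  have lt: "path b (n + int i) \<in> hexagon L" if "i < k" for i
    using not_less_Least[OF that[unfolded k_def]] by simp
  have k1: "k \<ge> 1" using k assms by (cases k) auto
  have "path b (n + int i) \<in> vol L" if "i \<le> k" for i
  proof (cases "i = k")
    case True
    have "path b (n + int (k - 1)) \<in> hexagon L" by (rule lt) (use k1 in simp)
    moreover have "n + int k = n + int (k - 1) + 1" using k1 by simp
    ultimately show ?thesis
      using neighbour_in_vol nn_path[of b "n + int (k - 1)"] nn_commute True by metis
  next
    case False
    then show ?thesis using that lt[of i] hexagon_subset_vol by auto
  qed
  then show ?thesis using that k1 lt k by blast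
qed

lemma Kreach_walk:
  assumes "A \<subseteq> hexagon L" "en A + \<Delta> \<le> h" "i \<le> j"
    and "\<And>m::nat. i \<le> m \<Longrightarrow> m \<le> j \<Longrightarrow> path b (n + int m) \<in> vol L - A"
  shows "Kreach h (insert (path b (n + int j)) A) (insert (path b (n + int i)) A)"
  using assms(3,4)
proof (induction j rule: dec_induct)
  case (step j)
  have "Kreach h (insert (path b (n + int (Suc j))) A) (insert (path b (n + int j)) A)"
  proof (rule Kreach_move[OF assms(1)])
    show "nn (path b (n + int (Suc j))) (path b (n + int j))"
      using nn_path[of b "n + int j"] by (simp add: algebra_simps)
  qed (use step.prems[of j] step.prems[of "Suc j"] step.hyps assms(2) in auto)
  then show ?case using step.IH step.prems by (auto intro: Kreach_trans)
qed simp

text \<open>A walk of vacant sites from \<open>y\<close> to the outer ring, along which one particle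
  can be brought in without touching \<open>X\<close>.\<close>

definition exposed :: "site set \<Rightarrow> site \<Rightarrow> bool" where
  "exposed X y \<longleftrightarrow> (\<exists>z. \<exists>k::nat. z 0 = y \<and> (\<forall>i<k. z i \<in> hexagon L \<and> nn (z (Suc i)) (z i)) \<and>
     (\<forall>i\<le>k. z i \<in> vol L - X) \<and> z k \<notin> hexagon L)"

lemma exposed_Kreach:
  assumes "exposed X y" "X \<subseteq> hexagon L" "en X + \<Delta> \<le> h"
  shows "Kreach h X (insert y X)"
proof -
  obtain z and k :: nat where z: "z 0 = y" "\<And>i. i < k \<Longrightarrow> z i \<in> hexagon L \<and> nn (z (Suc i)) (z i)"
    "\<And>i. i \<le> k \<Longrightarrow> z i \<in> vol L - X" "z k \<notin> hexagon L"
    using assms(1) by (auto simp: exposed_def)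
  have "Kreach h (insert (z i) X) (insert (z 0) X)" if "i \<le> k" for i
    using that
  proof (induction i)
    case (Suc i)
    have "Kreach h (insert (z (Suc i)) X) (insert (z i) X)"
      by (rule Kreach_move[OF assms(2)]) (use z(2)[of i] z(3)[of i] z(3)[of "Suc i"] Suc.prems assms(3) in auto)
    then show ?case using Suc by (auto intro: Kreach_trans)
  qed simp
  from this[of k] have "Kreach h (insert (z k) X) (insert y X)" using z(1) by simp
  moreover have "Kreach h X (insert (z k) X)"
    by (rule Kreach_create[OF assms(2)]) (use z(3)[of k] z(4) assms(3) in auto)
  ultimately show ?thesis by (blast intro: Kreach_trans)
qed

lemma en_remove_le:
  assumes "finite A"
  shows "en (A - {x}) \<le> en A + (3 * U - \<Delta>)"
proof (cases "x \<in> A")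
  case True
  have "en A = en (A - {x}) + \<Delta> - U * real (deg (A - {x}) x)"
    using en_insert[of "A - {x}" x] assms True by (simp add: insert_absorb)
  moreover have "real (deg (A - {x}) x) \<le> 3" by (simp add: deg_def)
  then have "U * real (deg (A - {x}) x) \<le> U * 3" using U_pos by (intro mult_left_mono) auto
  ultimately show ?thesis by linarith
next
  case False
  then show ?thesis using \<Delta>_lt U_pos by simp
qed

text \<open>A vacancy travels along a ray to the boundary: the next particle of the ray fills it, so that
  every configuration on the way differs from \<open>A\<close> in at most three sites.\<close>

lemma Kreach_fill:
  assumes A: "A \<subseteq> hexagon L" and v: "v \<in> A"
  shows "Kreach (en A + 5 * U) (A - {v}) A"
proof -
  have finA: "finite A" using A finite_hexagon finite_subset by blast
  obtain b n where bn: "v = path b n" using site_path by blast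
  obtain k :: nat where k: "k \<ge> 1" "\<And>i::nat. i < k \<Longrightarrow> path b (n + int i) \<in> hexagon L"
    "path b (n + int k) \<notin> hexagon L" "\<And>i::nat. i \<le> k \<Longrightarrow> path b (n + int i) \<in> vol L"
    using path_exit[of b n] A v bn by (metis subsetD)
  let ?z = "\<lambda>i::nat. path b (n + int i)"
  let ?h = "en A + 5 * U"
  have en1: "en (A - {x}) + \<Delta> \<le> ?h" for x
    using en_remove_le[OF finA, of x] U_pos by linarith
  \<comment> \<open>The origin of \<open>5 * U\<close>: two removed particles and a free one cost at
    most \<open>2 * (3 * U - \<Delta>) + \<Delta> = 6 * U - \<Delta>\<close>.\<close>
  have en2: "en (A - {x} - {y}) + \<Delta> \<le> ?h" for x y
    using en_remove_le[OF finA, of x] en_remove_le[of "A - {x}" y] finA \<Delta>_gt by simp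
  have "Kreach ?h (A - {?z i}) A" if "i < k" "?z i \<in> A" for i
    using that
  proof (induction "k - i" arbitrary: i rule: less_induct)
    case less
    \<comment> \<open>Either the next particle on the ray, which moves to \<open>i\<close> and
      leaves its vacancy at \<open>j\<close>, or the exit \<open>k\<close>.\<close>
    define j where "j = (LEAST j. i < j \<and> (?z j \<in> A \<or> j = k))"
    have j: "i < j \<and> (?z j \<in> A \<or> j = k)"
      unfolding j_def by (rule LeastI[of _ k]) (use less.prems in auto)
    have jk: "j \<le> k" unfolding j_def by (rule Least_le) (use less.prems in auto)
    have gap: "?z m \<notin> A" if "i < m" "m < j" for m
      using not_less_Least[OF that(2)[unfolded j_def]] that(1) by auto
    show ?case
    proof (cases "?z j \<in> A")
      case False
      then have "j = k" using j by blast
      let ?Y = "A - {?z i}"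
      have "Kreach ?h (insert (?z k) ?Y) (insert (?z i) ?Y)"
      proof (rule Kreach_walk)
        show "?z m \<in> vol L - ?Y" if "i \<le> m" "m \<le> k" for m
          using gap[of m] k(3) k(4)[of m] that \<open>j = k\<close> A by (cases "m = i"; cases "m = k") auto
      qed (use A en1 less.prems in auto)
      moreover have "Kreach ?h ?Y (insert (?z k) ?Y)"
        by (rule Kreach_create) (use A en1 k in auto)
      ultimately show ?thesis using less.prems by (simp add: insert_absorb) (blast intro: Kreach_trans)
    next
      case True
      then have "j < k" using jk k(3) A by (cases "j = k") auto
      let ?Y = "A - {?z i} - {?z j}"
      have "Kreach ?h (insert (?z j) ?Y) (insert (?z i) ?Y)"
      proof (rule Kreach_walk)
        show "?z m \<in> vol L - ?Y" if "i \<le> m" "m \<le> j" for m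
          using gap[of m] k(4)[of m] that jk by (cases "m = i"; cases "m = j") auto
      qed (use A en2 j in auto)
      moreover have "insert (?z j) ?Y = A - {?z i}" "insert (?z i) ?Y = A - {?z j}"
        using True less.prems j by auto
      ultimately show ?thesis using less.hyps[of j] \<open>j < k\<close> True j less.prems by (auto intro: Kreach_trans)
    qed
  qed
  from this[of 0] show ?thesis using k v bn by simp
qed

text \<open>Adding a site at a distance from the boundary is not a Kawasaki move;
  \<open>Kreach_fill\<close> realises it by a sequence of moves, whence the extra
  \<open>5 * U\<close>.\<close>

lemma grow_G_Kreach:
  assumes "grow (G h) X Y"
  shows "Kreach (h + 5 * U) X Y"
proof -
  have "Kreach (h + 5 * U) X Y" if "(\<lambda>X Y. \<exists>y. G h X y \<and> Y = insert y X)\<^sup>*\<^sup>* X Y"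
    using that
  proof (induction rule: rtranclp_induct)
    case (step Y Z)
    then obtain y where y: "G h Y y" "Z = insert y Y" by blast
    have "Kreach (h + 5 * U) Y Z"
    proof (cases "y \<in> Y")
      case True
      then show ?thesis using y by (simp add: insert_absorb)
    next
      case False
      have "Kreach (en Z + 5 * U) (Z - {y}) Z"
        by (rule Kreach_fill) (use y in \<open>auto simp: G_def\<close>)
      moreover have "Z - {y} = Y" using False y by auto
      moreover have "en Z \<le> h" using y by (auto simp: G_def)
      ultimately show ?thesis using Kreach_mono by fastforce
    qed
    then show ?case using step.IH by (blast intro: Kreach_trans)
  qed simp
  then show ?thesis using assms by (simp add: grow_def)
qed

end

section \<open>The communication height\<close>

text \<open>The left sides are droplet energies in terms of perimeter and number of sites. The first
  droplet is the hexagon of radius \<open>R\<close> with five full rows and two sites on the sixth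
  side, the second the hexagon of radius \<open>R + 1\<close> with one full row and two further
  sites.\<close>

lemma \<Gamma>_arith:
  fixes U R d e D :: real
  assumes "U = (2 * R + 1 + 2 * d) * e" "D = (3 * U - e) / 2"
  shows "U / 2 * (6 * R + 7) - e / 2 * (6 * R\<^sup>2 + 10 * R + 5) =
      3 * R * U - 3 * R\<^sup>2 * e + (1 + 5 * d) * e + 2 * (D - U)"
    "U / 2 * (6 * (R + 1) + 3) - e / 2 * (6 * (R + 1)\<^sup>2 + 2 * (R + 1) + 1) =
      3 * R * U - 3 * R\<^sup>2 * e + 7 * d * e + 2 * (D - U)"
  unfolding assms by (simp_all add: field_simps power2_eq_square)

context kawasaki_hex
begin

definition \<Gamma> :: real where "\<Gamma> = \<Gamma>_KHex U \<Delta>"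

text \<open>Energy of the hexagon of radius \<rho>, with perimeter \<open>6 * \<rho>\<close> and
  \<open>6 * \<rho>^2\<close> sites. The argument is real so that the parabola can be compared with
  its vertex.\<close>

definition hW :: "real \<Rightarrow> real" where "hW \<rho> = 3 * \<rho> * U - 3 * \<rho>\<^sup>2 * \<epsilon>"

lemma \<Gamma>_cases:
  obtains "\<Gamma> = hW (real r) + (1 + 5 * \<delta>) * \<epsilon> + 2 * (\<Delta> - U) + \<Delta>" "\<delta> < 1 / 2"
    "\<Gamma> - \<Delta> = U / 2 * (6 * real r + 7) - \<epsilon> / 2 * (6 * (real r)\<^sup>2 + 10 * real r + 5)"
  | "\<Gamma> = hW (real r) + 7 * \<delta> * \<epsilon> + 2 * (\<Delta> - U) + \<Delta>" "1 / 2 < \<delta>"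
    "\<Gamma> - \<Delta> = U / 2 * (6 * (real r + 1) + 3) - \<epsilon> / 2 * (6 * (real r + 1)\<^sup>2 + 2 * (real r + 1) + 1)"
proof (cases "\<delta> < 1 / 2")
  case True
  then have g: "\<Gamma> = \<Gamma>1 U \<Delta>" by (simp add: \<Gamma>_def \<Gamma>_KHex_def \<delta>_def)
  have "\<Gamma> - \<Delta> = U / 2 * (6 * real r + 7) - \<epsilon> / 2 * (6 * (real r)\<^sup>2 + 10 * real r + 5)"
    unfolding g \<Gamma>1_def Let_def r_star_eq \<epsilon>_def by (simp add: field_simps)
  moreover have "\<Gamma> = hW (real r) + (1 + 5 * \<delta>) * \<epsilon> + 2 * (\<Delta> - U) + \<Delta>"
    using calculation unfolding \<Gamma>_arith(1)[OF U_eq \<Delta>_eq] hW_def by (simp add: diff_eq_eq)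
  ultimately show ?thesis using that(1) True by blast
next
  case False
  then have g: "\<Gamma> = \<Gamma>2 U \<Delta>" by (simp add: \<Gamma>_def \<Gamma>_KHex_def \<delta>_def)
  have "\<Gamma> - \<Delta> = U / 2 * (6 * (real r + 1) + 3) - \<epsilon> / 2 * (6 * (real r + 1)\<^sup>2 + 2 * (real r + 1) + 1)"
    unfolding g \<Gamma>2_def Let_def r_star_eq \<epsilon>_def by (simp add: field_simps power2_eq_square)
  moreover have "\<Gamma> = hW (real r) + 7 * \<delta> * \<epsilon> + 2 * (\<Delta> - U) + \<Delta>"
    using calculation unfolding \<Gamma>_arith(2)[OF U_eq \<Delta>_eq] hW_def by (simp add: diff_eq_eq)
  ultimately show ?thesis using that(2) False \<delta>_neq by force
qed

text \<open>Isoperimetry excludes perimeters up to \<open>p - 1\<close>, and parity excludes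
  \<open>p\<close>.\<close>

lemma perim_ge:
  assumes fin: "finite A" and sq: "(p - 1)\<^sup>2 < 6 * card A" and par: "odd (card A)" "even p" "p \<ge> 1"
  shows "perim A \<ge> p + 1"
proof -
  have "(p - 1)\<^sup>2 < (perim A)\<^sup>2" using isoperimetric[OF fin] sq by linarith
  then have "p - 1 < perim A" by (rule power_less_imp_less_base) simp
  moreover have "perim A \<noteq> p" using perim_parity[OF fin] par by auto
  ultimately show ?thesis using par by linarith
qed

text \<open>The sizes are those of the two droplets in \<open>\<Gamma>_arith\<close>; they are odd,
  so parity improves the isoperimetric bound by one. The \<Delta> left out is the cost of the next
  particle.\<close>

lemma critical_size: "\<exists>n. n < 6 * L\<^sup>2 \<and> (\<forall>A. finite A \<longrightarrow> card A = n \<longrightarrow> \<Gamma> - \<Delta> \<le> en A)"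
proof (cases rule: \<Gamma>_cases)
  case 1
  let ?n = "6 * r\<^sup>2 + 10 * r + 5"
  have "\<Gamma> - \<Delta> \<le> en A" if A: "finite A" "card A = ?n" for A
  proof -
    have "perim A \<ge> (6 * r + 6) + 1"
      by (rule perim_ge[OF A(1)]) (use A(2) in \<open>auto simp: power2_eq_square algebra_simps\<close>)
    then have "real (6 * r + 7) \<le> real (perim A)" by (simp only: of_nat_le_iff)
    then have "U / 2 * (6 * real r + 7) \<le> U / 2 * real (perim A)"
      using U_pos by (intro mult_left_mono) auto
    moreover have "real (card A) = 6 * (real r)\<^sup>2 + 10 * real r + 5" by (simp add: A(2))
    ultimately show ?thesis unfolding 1(3) en_perim[OF A(1)] by simp
  qed
  moreover have "?n < 6 * L\<^sup>2"
  proof -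
    have "(2 * r + 4)\<^sup>2 \<le> L\<^sup>2" using L_ge by (intro power_mono) auto
    then show ?thesis by (simp add: power2_eq_square algebra_simps)
  qed
  ultimately show ?thesis by blast
next
  case 2
  let ?n = "6 * (r + 1)\<^sup>2 + 2 * (r + 1) + 1"
  have "\<Gamma> - \<Delta> \<le> en A" if A: "finite A" "card A = ?n" for A
  proof -
    have "perim A \<ge> (6 * (r + 1) + 2) + 1"
      by (rule perim_ge[OF A(1)]) (use A(2) in \<open>auto simp: power2_eq_square algebra_simps\<close>)
    then have "real (6 * (r + 1) + 3) \<le> real (perim A)" by (simp only: of_nat_le_iff)
    then have "U / 2 * (6 * (real r + 1) + 3) \<le> U / 2 * real (perim A)"
      using U_pos by (intro mult_left_mono) auto
    moreover have "real (card A) = 6 * (real r + 1)\<^sup>2 + 2 * (real r + 1) + 1" by (simp add: A(2))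
    ultimately show ?thesis unfolding 2(3) en_perim[OF A(1)] by simp
  qed
  moreover have "?n < 6 * L\<^sup>2"
  proof -
    have "(2 * r + 4)\<^sup>2 \<le> L\<^sup>2" using L_ge by (intro power_mono) auto
    then show ?thesis by (simp add: power2_eq_square algebra_simps)
  qed
  ultimately show ?thesis by blast
qed

lemma card_hexagon: "card (hexagon L) = 6 * L\<^sup>2"
  by (simp add: hexagon_window card_window)

text \<open>\<open>en\<close> also credits bonds with the outer ring, which the Hamiltonian does not
  reward.\<close>

lemma hamiltonian_ge_en:
  assumes "A \<subseteq> vol L"
  shows "en A \<le> hamiltonian L U \<Delta> (conf L A)"
proof -
  have finA: "finite A" using assms finite_vol finite_subset by blast
  have "card {x\<in>A \<inter> hexagon L. n x \<in> A \<inter> hexagon L} \<le> card {x\<in>A. n x \<in> A}" for n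
    using finA by (intro card_mono) auto
  from this[of na] this[of nb] this[of nc] have "bonds2 (A \<inter> hexagon L) \<le> bonds2 A"
    unfolding bonds2_def by linarith
  then have "U / 2 * real (bonds2 (A \<inter> hexagon L)) \<le> U / 2 * real (bonds2 A)"
    using U_pos by (intro mult_left_mono) auto
  moreover have "real (card A) = real (card (A \<inter> hexagon L)) + real (card (A - hexagon L))"
    using card_Un_disjoint[of "A \<inter> hexagon L" "A - hexagon L"] finA
    by (metis Diff_Diff_Int Diff_Int_distrib Int_Diff_Un Int_Diff_disjoint finite_Diff finite_Int of_nat_add)
  ultimately show ?thesis
    unfolding hamiltonian_conf[OF assms] en_def by (simp add: distrib_left)
qed

text \<open>The number of particles grows only by creations at the boundary, where the new particle has
  no bond; so the step past the critical size costs the whole of \<open>\<Delta>\<close>.\<close>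

lemma barrier_lower:
  assumes "reach h (empty_config L) (full_config L)"
  shows "\<Gamma> \<le> h"
proof (rule ccontr)
  assume "\<not> \<Gamma> \<le> h"
  obtain n where n: "n < 6 * L\<^sup>2" "\<And>A. finite A \<Longrightarrow> card A = n \<Longrightarrow> \<Gamma> - \<Delta> \<le> en A"
    using critical_size by blast
  have "\<exists>A. A \<subseteq> vol L \<and> \<zeta> = conf L A \<and> card A \<le> n" if "reach h (empty_config L) \<zeta>" for \<zeta>
    using that unfolding reach_def
  proof (induction rule: rtranclp_induct)
    case base
    then show ?case by (intro exI[of _ "{}"]) (auto simp: conf_empty)
  next
    case (step \<eta> \<zeta>)
    then obtain A where A: "A \<subseteq> vol L" "\<eta> = conf L A" "card A \<le> n" by blast
    have finA: "finite A" using A finite_vol finite_subset by blast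
    have E: "E (conf L A) \<zeta>" using step.hyps A by blast
    from bond_move_cases[OF E A(1)] show ?case
    proof cases
      case 1
      then show ?thesis using A by blast
    next
      case (2 x y)
      have "card (insert y (A - {x})) = card A" using 2 finA card.remove[OF finA 2(4)] by simp
      then show ?thesis using 2 A by (intro exI[of _ "insert y (A - {x})"]) auto
    next
      case (3 y)
      have "card A \<noteq> n"
      proof
        assume "card A = n"
        then have "\<Gamma> - \<Delta> \<le> hamiltonian L U \<Delta> (conf L A)"
          using n(2)[OF finA] hamiltonian_ge_en[OF A(1)] by linarith
        moreover have "insert y A \<inter> hexagon L = A \<inter> hexagon L" "insert y A - hexagon L = insert y (A - hexagon L)"
          "insert y A \<subseteq> vol L" using 3 A by auto
        then have "hamiltonian L U \<Delta> (conf L (insert y A)) = hamiltonian L U \<Delta> (conf L A) + \<Delta>"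
          using 3 finA A(1) by (simp add: hamiltonian_conf algebra_simps)
        moreover have "hamiltonian L U \<Delta> \<zeta> \<le> h" using step.hyps by blast
        ultimately show False using \<open>\<not> \<Gamma> \<le> h\<close> 3 by simp
      qed
      then have "card (insert y A) \<le> n" using A 3 finA by simp
      then show ?thesis using 3 A by (intro exI[of _ "insert y A"]) auto
    next
      case (4 y)
      have "card (A - {y}) \<le> n" using A finA by (meson card_Diff1_le order_trans)
      then show ?thesis using 4 A by (intro exI[of _ "A - {y}"]) auto
    qed
  qed
  from this[OF assms] obtain A where "A \<subseteq> vol L" "conf L (hexagon L) = conf L A" "card A \<le> n"
    by (auto simp: conf_full)
  then have "card (hexagon L) \<le> n" using conf_inj[of "hexagon L" L A] hexagon_subset_vol by auto
  then show False using n(1) by (simp add: card_hexagon)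
qed

lemma rot_vol: "rot x \<in> vol L" if "x \<in> vol L"
proof (cases "x \<in> hexagon L")
  case True
  then show ?thesis using rot_hexagon_iff hexagon_subset_vol by blast
next
  case False
  then obtain y where "y \<in> hexagon L" "nn x y" using \<open>x \<in> vol L\<close> by (auto simp: vol_def)
  then have "rot y \<in> hexagon L" "nn (rot y) (rot x)" using rot_hexagon_iff nn_rot nn_commute by blast+
  then show ?thesis by (rule neighbour_in_vol)
qed

lemma exposed_rot:
  assumes "exposed X y"
  shows "exposed (rot ` X) (rot y)"
proof -
  obtain z and k :: nat where z: "z 0 = y" "\<forall>i<k. z i \<in> hexagon L \<and> nn (z (Suc i)) (z i)"
    "\<forall>i\<le>k. z i \<in> vol L - X" "z k \<notin> hexagon L"
    using assms by (auto simp: exposed_def)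
  have "rot (z i) \<in> vol L - rot ` X" if "i \<le> k" for i
    using z(3) that rot_vol inj_image_mem_iff[OF inj_rot] by auto
  then show ?thesis
    unfolding exposed_def using z by (intro exI[of _ "rot \<circ> z"] exI[of _ k]) (auto simp: rot_hexagon_iff nn_rot)
qed

text \<open>The counterpart of \<open>G\<close> for the exact path: exposure of the new site makes
  the whole step cost only \<Delta> above the energy of \<open>X\<close>.\<close>

definition Kx :: "real \<Rightarrow> site set \<Rightarrow> site \<Rightarrow> bool" where
  "Kx h X y \<longleftrightarrow> X \<subseteq> hexagon L \<and> en X \<le> h \<and> exposed X y"

lemma Kx_rot: "Kx h X y \<Longrightarrow> Kx h (rot ` X) (rot y)"
  by (auto simp: Kx_def rot_hexagon_iff exposed_rot)

lemma grow_Kx_Kreach: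
  assumes "grow (Kx h) X Y"
  shows "Kreach (h + \<Delta>) X Y"
proof -
  have "Kreach (h + \<Delta>) X Y" if "(\<lambda>X Y. \<exists>y. Kx h X y \<and> Y = insert y X)\<^sup>*\<^sup>* X Y"
    using that
  proof (induction rule: rtranclp_induct)
    case (step Y Z)
    then obtain y where "Kx h Y y" "Z = insert y Y" by blast
    then have "Kreach (h + \<Delta>) Y Z" by (auto simp: Kx_def intro: exposed_Kreach)
    then show ?case using step.IH by (blast intro: Kreach_trans)
  qed simp
  then show ?thesis using assms by (simp add: grow_def)
qed

lemma zz_path: "zz \<alpha> \<beta> k = path (\<beta> + int (k div 2)) (2 * \<alpha> + int (k mod 2))"
  by (cases "even k") (auto simp: zz_def path_def odd_iff_mod_2_eq_one)

text \<open>The walk goes in the direction of increasing \<open>a\<close>, away from the box; the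
  sites laid before either lie in other strips or behind it.\<close>

lemma exposed_zz:
  assumes "zz a2 b1 k \<in> hexagon L"
  shows "exposed (hbox a1 a2 b1 b2 c1 c2 \<union> zz a2 b1 ` {..<k}) (zz a2 b1 k)"
proof -
  let ?b = "b1 + int (k div 2)" and ?n = "2 * a2 + int (k mod 2)"
  obtain K :: nat where K: "\<And>i::nat. i < K \<Longrightarrow> path ?b (?n + int i) \<in> hexagon L"
    "path ?b (?n + int K) \<notin> hexagon L" "\<And>i::nat. i \<le> K \<Longrightarrow> path ?b (?n + int i) \<in> vol L"
    using path_exit[of ?b ?n] assms unfolding zz_path by metis
  have out: "path ?b (?n + int i) \<notin> hbox a1 a2 b1 b2 c1 c2 \<union> zz a2 b1 ` {..<k}" for i
  proof -
    define q where "q = (?n + int i) div 2"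
    have "a2 \<le> q" unfolding q_def by linarith
    then have "path ?b (?n + int i) \<notin> hbox a1 a2 b1 b2 c1 c2"
      unfolding path_def q_def[symmetric] by auto
    moreover have "path ?b (?n + int i) \<noteq> zz a2 b1 j" if "j < k" for j
    proof
      assume "path ?b (?n + int i) = zz a2 b1 j"
      then have "k div 2 = j div 2" "k mod 2 + i = j mod 2" unfolding zz_path by auto
      then show False using that div_mult_mod_eq[of k 2] div_mult_mod_eq[of j 2] by linarith
    qed
    ultimately show ?thesis by auto
  qed
  have "nn (path ?b (?n + int (Suc i))) (path ?b (?n + int i))" for i
    using nn_path[of ?b "?n + int i"] by (simp add: algebra_simps)
  then show ?thesis
    unfolding exposed_def using K out
    by (intro exI[of _ "\<lambda>i. path ?b (?n + int i)"] exI[of _ K]) (auto simp: zz_path)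
qed

lemma extend_exact:
  assumes "extend l A B" "B \<subseteq> hexagon L"
  shows "grow (Kx (en A + 2 * (\<Delta> - U))) A B \<and> en B \<le> en A + \<Delta> - U - (real l - 1) * \<epsilon>"
  using assms
proof (induction rule: extend.induct)
  case (extend_base a1 a2 l c2 b1 b2 c1)
  let ?X = "hbox a1 a2 b1 b2 c1 c2"
  note row = hbox_row[OF extend_base.hyps]
  have hex: "zz a2 b1 k \<in> hexagon L" if "k < 2 * l - 1" for k
    using extend_base.prems row(1) that by (auto simp: zrow_def)
  have "grow (Kx (en ?X + 2 * (\<Delta> - U))) ?X (?X \<union> zz a2 b1 ` {..<2 * l - 1})"
  proof (rule grow_sequence)
    fix k assume k: "k < 2 * l - 1"
    have "?X \<subseteq> hexagon L" using extend_base.prems row(1) by blast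
    then show "Kx (en ?X + 2 * (\<Delta> - U)) (?X \<union> zz a2 b1 ` {..<k}) (zz a2 b1 k)"
      unfolding Kx_def
      using filled_le[of ?X b1 l a2, OF finite_box row(2), of k] k hex exposed_zz[OF hex[OF k]]
      by auto
  qed
  moreover have "en (?X \<union> zrow a2 b1 l) \<le> en ?X + \<Delta> - U - (real l - 1) * \<epsilon>"
    by (rule filled_row_disjoint_le[of ?X b1 l a2, OF finite_box row(2) extend_base.hyps(3) row(3)])
  ultimately show ?case unfolding row(1) by (simp add: zrow_def)
next
  case (extend_rot l A B)
  have "B \<subseteq> hexagon L" using extend_rot.prems by (simp only: rot_hexagon_iff)
  then have IH: "grow (Kx (en A + 2 * (\<Delta> - U))) A B" "en B \<le> en A + \<Delta> - U - (real l - 1) * \<epsilon>"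
    using extend_rot.IH by auto
  from IH(1) have "grow (Kx (en A + 2 * (\<Delta> - U))) (rot ` A) (rot ` B)"
    by (rule grow_rot) (rule Kx_rot)
  then show ?case using IH(2) by simp
qed

lemma window_mono: "\<rho> \<le> \<rho>' \<Longrightarrow> window x y \<rho> \<subseteq> window x y \<rho>'"
  by (rule site_subsetI) (auto simp: window_def)

lemma window_1: "window x y 1 = {Up x y, Down (x - 1) y, Up (x - 1) y, Down (x - 1) (y - 1), Up x (y - 1), Down x (y - 1)}"
  by (rule site_set_eqI) (auto simp: window_def)

lemma en_window_1: "en (window x y 1) = 3 * U - 3 * \<epsilon>"
proof -
  have "bonds2 (window x y 1) = 12"
    unfolding window_1
    by (subst bonds2_insert; (simp add: deg_def)?)+ (simp add: bonds2_def)
  moreover have "card (window x y 1) = 6" using card_window[of x y 1] by simp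
  ultimately show ?thesis by (simp add: en_def \<epsilon>_def)
qed

end

text \<open>Here \<open>d\<close> is the current radius minus the critical one, \<open>t\<close>
  stands for \<open>\<delta>\<close>, \<open>k + 1\<close> rows of the ring are complete, and
  energies are in units of \<open>\<epsilon>\<close>. The two values in the maximum are attained at
  \<open>d = 0\<close>, \<open>k = 4\<close> and at \<open>d = 1\<close>, \<open>k = 0\<close>,
  which are the two critical droplets.\<close>

lemma core_arith:
  fixes d :: int and t k :: real
  assumes t: "0 < t" "t < 1" and k: "0 \<le> k" "k \<le> 4"
  shows "3 * real_of_int d * (1 + 2 * t - real_of_int d) + (t - real_of_int d) * (k + 1) + 1 \<le> max (1 + 5 * t) (7 * t)"
    "3 * real_of_int d * (1 + 2 * t - real_of_int d) \<le> max (1 + 5 * t) (7 * t)"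
proof -
  consider "d \<le> - 1" | "d = 0" | "d = 1" | "d = 2" | "d \<ge> 3" by linarith
  then have "3 * real_of_int d * (1 + 2 * t - real_of_int d) + (t - real_of_int d) * (k + 1) + 1 \<le> max (1 + 5 * t) (7 * t) \<and>
    3 * real_of_int d * (1 + 2 * t - real_of_int d) \<le> max (1 + 5 * t) (7 * t)"
  proof cases
    case 1
    define m where "m = - real_of_int d"
    have m: "m \<ge> 1" "real_of_int d = - m" using 1 by (auto simp: m_def)
    define v w where "v = m * m" and "w = m * t"
    have vw: "m \<le> v" "t \<le> w"
      using m(1) t mult_right_mono[of 1 m m] mult_right_mono[of 1 m t] by (auto simp: v_def w_def)
    have 1: "(t - - m) * (k + 1) \<le> 5 * t + 5 * m"
      using mult_left_mono[of "k + 1" 5 "t + m"] m t k by simp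
    have 2: "3 * - m * (1 + 2 * t - - m) = - (3 * m + 6 * w + 3 * v)"
      by (simp add: v_def w_def algebra_simps)
    have "3 * - m * (1 + 2 * t - - m) + (t - - m) * (k + 1) + 1 \<le> 1 + 5 * t"
      "3 * - m * (1 + 2 * t - - m) \<le> 1 + 5 * t"
      unfolding 2 using 1 vw m(1) t by linarith+
    then show ?thesis unfolding m(2) by (auto simp only: le_max_iff_disj)
  next
    case 2
    have "t * (k + 1) \<le> t * 5" using t k by (intro mult_left_mono) auto
    then show ?thesis using 2 t by (simp add: le_max_iff_disj)
  next
    case 3
    define w where "w = (t - 1) * (k + 1)"
    have w: "w \<le> t - 1" unfolding w_def using mult_left_mono_neg[of 1 "k + 1" "t - 1"] k t by simp
    have d: "real_of_int d = 1" using 3 by simp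
    show ?thesis unfolding d w_def[symmetric] le_max_iff_disj using w t by argo
  next
    case 4
    define w where "w = (t - 2) * (k + 1)"
    have w: "w \<le> t - 2" unfolding w_def using mult_left_mono_neg[of 1 "k + 1" "t - 2"] k t by simp
    have d: "real_of_int d = 2" using 4 by simp
    show ?thesis unfolding d w_def[symmetric] le_max_iff_disj using w t by argo
  next
    case 5
    then have d: "real_of_int d \<ge> 3" by linarith
    define v w where "v = 3 * real_of_int d * (1 + 2 * t - real_of_int d)" and "w = (t - real_of_int d) * (k + 1)"
    have "w \<le> t - real_of_int d"
      unfolding w_def using mult_left_mono_neg[of 1 "k + 1" "t - real_of_int d"] k t d by simp
    moreover have "v \<le> 0" unfolding v_def using d t by (intro mult_nonneg_nonpos) auto
    ultimately show ?thesis unfolding v_def[symmetric] w_def[symmetric] le_max_iff_disj using d t by argo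
  qed
  then show "3 * real_of_int d * (1 + 2 * t - real_of_int d) + (t - real_of_int d) * (k + 1) + 1 \<le> max (1 + 5 * t) (7 * t)"
    "3 * real_of_int d * (1 + 2 * t - real_of_int d) \<le> max (1 + 5 * t) (7 * t)" by auto
qed

lemma hW_arith:
  fixes U R d t e :: real
  assumes "U = (2 * R + 1 + 2 * t) * e"
  shows "3 * (R + d) * U - 3 * (R + d)\<^sup>2 * e = 3 * R * U - 3 * R\<^sup>2 * e + 3 * d * (1 + 2 * t - d) * e"
  unfolding assms by (simp add: algebra_simps power2_eq_square)

context kawasaki_hex
begin

lemma \<Gamma>_eq: "\<Gamma> = hW (real r) + max (1 + 5 * \<delta>) (7 * \<delta>) * \<epsilon> + 2 * (\<Delta> - U) + \<Delta>"
  by (cases rule: \<Gamma>_cases) (auto simp: max_def)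

lemma hW_r: "hW (real \<rho>) = hW (real r) + 3 * real_of_int (int \<rho> - int r) * (1 + 2 * \<delta> - real_of_int (int \<rho> - int r)) * \<epsilon>"
  using hW_arith[OF U_eq, of "real_of_int (int \<rho> - int r)"] by (simp add: hW_def)

text \<open>Here the critical radius enters the energetics: a row along a side of length
  \<open>l\<close> pays off exactly when \<open>l - 1\<close> exceeds
  \<open>r + \<delta>\<close>.\<close>

lemma \<Delta>_U: "\<Delta> - U = (real r + \<delta>) * \<epsilon>"
proof -
  have "\<Delta> - U = (U - \<epsilon>) / 2" using \<Delta>_eq by simp
  also have "\<dots> = ((2 * real r + 1 + 2 * \<delta>) * \<epsilon> - \<epsilon>) / 2" using U_eq by metis
  finally show ?thesis by (simp add: algebra_simps)
qed

lemma hW_row_le: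
  assumes "0 \<le> k" "k \<le> 4"
  shows "hW (real \<rho>) + (real r + \<delta> - real \<rho>) * (k + 1) * \<epsilon> + \<epsilon> + 2 * (\<Delta> - U) + \<Delta> \<le> \<Gamma>"
    "hW (real \<rho>) + 2 * (\<Delta> - U) + \<Delta> \<le> \<Gamma>"
proof -
  let ?d = "int \<rho> - int r"
  have e: "real r + \<delta> - real \<rho> = \<delta> - real_of_int ?d" by simp
  from mult_right_mono[OF core_arith(1)[OF \<delta>_pos \<delta>_less assms, of ?d], of \<epsilon>]
  show "hW (real \<rho>) + (real r + \<delta> - real \<rho>) * (k + 1) * \<epsilon> + \<epsilon> + 2 * (\<Delta> - U) + \<Delta> \<le> \<Gamma>"
    unfolding \<Gamma>_eq hW_r[of \<rho>] e using \<epsilon>_pos by (simp add: distrib_right)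
  from mult_right_mono[OF core_arith(2)[OF \<delta>_pos \<delta>_less assms, of ?d], of \<epsilon>]
  show "hW (real \<rho>) + 2 * (\<Delta> - U) + \<Delta> \<le> \<Gamma>"
    unfolding \<Gamma>_eq hW_r[of \<rho>] using \<epsilon>_pos by simp
qed

lemma extend_en: "extend l A B \<Longrightarrow> en B \<le> en A + \<Delta> - U - (real l - 1) * \<epsilon>"
proof (induction rule: extend.induct)
  case (extend_base a1 a2 l c2 b1 b2 c1)
  note row = hbox_row[OF extend_base]
  show ?case unfolding row(1)
    by (rule filled_row_disjoint_le[OF finite_box row(2) extend_base(3) row(3)])
qed simp

lemma en_window_le: "\<rho> \<ge> 1 \<Longrightarrow> en (window x y (int \<rho>)) \<le> hW (real \<rho>)"
proof (induction \<rho> rule: dec_induct)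
  case base
  then show ?case by (simp add: en_window_1 hW_def)
next
  case (step \<rho>)
  obtain A1 A2 A3 A4 A5 where
    "extend \<rho> (window x y (int \<rho>)) A1" "extend (\<rho> + 1) A1 A2" "extend (\<rho> + 1) A2 A3"
    "extend (\<rho> + 1) A3 A4" "extend (\<rho> + 1) A4 A5" "extend (\<rho> + 2) A5 (window x y (int \<rho> + 1))"
    using ring_concentric[OF step.hyps(1), of x y] by blast
  note inc = this[THEN extend_en]
  have c: "(real (\<rho> + 1) - 1) * \<epsilon> = real \<rho> * \<epsilon>" "(real \<rho> - 1) * \<epsilon> = real \<rho> * \<epsilon> - \<epsilon>"
    "(real (\<rho> + 2) - 1) * \<epsilon> = real \<rho> * \<epsilon> + \<epsilon>" by (simp_all add: algebra_simps)
  have "en (window x y (int \<rho> + 1)) \<le> hW (real \<rho>) + (6 * (\<Delta> - U) - 6 * (real \<rho> * \<epsilon>))"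
    using step.IH inc unfolding c by argo
  also have "6 * (\<Delta> - U) = 3 * U - 3 * \<epsilon>" using \<Delta>_eq by simp
  also have "hW (real \<rho>) + (3 * U - 3 * \<epsilon> - 6 * (real \<rho> * \<epsilon>)) = hW (real (Suc \<rho>))"
    by (simp add: hW_def algebra_simps power2_eq_square)
  finally show ?case by (simp add: add.commute)
qed

definition inL :: "int \<Rightarrow> int \<Rightarrow> int \<Rightarrow> bool" where
  "inL x y \<rho> \<longleftrightarrow> \<bar>x\<bar> \<le> int L - \<rho> \<and> \<bar>y\<bar> \<le> int L - \<rho> \<and> \<bar>x + y\<bar> \<le> int L - \<rho>"

lemma inL_window: "inL x y \<rho> \<Longrightarrow> window x y \<rho> \<subseteq> hexagon L"
  by (rule site_subsetI) (auto simp: inL_def window_def hexagon_box)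

text \<open>Six sites cost at most \<open>9 * U\<close> in any order and at any intermediate stage,
  which is far below \<Gamma>.\<close>

lemma grow_G_window_1:
  assumes "inL x y 1"
  shows "grow (\<lambda>X z. {} \<subseteq> X \<and> insert z X \<subseteq> window x y 1 \<and> en X \<le> 9 * U \<and> en (insert z X) \<le> 9 * U) {} (window x y 1)"
proof -
  have small: "en A \<le> 9 * U" if "A \<subseteq> window x y 1" for A
  proof -
    have "card A \<le> 6" using card_mono[OF finite_window that] card_window[of x y 1] by simp
    then have "\<Delta> * real (card A) \<le> (3 / 2 * U) * 6" using \<Delta>_lt \<Delta>_gt U_pos by (intro mult_mono) auto
    moreover have "U / 2 * real (bonds2 A) \<ge> 0" using U_pos by simp
    ultimately show ?thesis by (simp add: en_def)
  qed
  have "grow (\<lambda>X z. insert z X \<subseteq> B) {} B" if "finite B" for B :: "site set"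
  proof -
    have "grow (\<lambda>X z. insert z X \<subseteq> B) {} C" if "C \<subseteq> B" for C
      using finite_subset[OF that \<open>finite B\<close>] that
    proof (induction C rule: finite_induct)
      case (insert z C)
      then have "grow (\<lambda>X z. insert z X \<subseteq> B) {} C" by auto
      moreover have "grow (\<lambda>X z. insert z X \<subseteq> B) C (insert z C)"
        unfolding grow_def using insert.prems by (intro r_into_rtranclp) auto
      ultimately show ?case by (rule grow_trans)
    qed simp
    then show ?thesis by blast
  qed
  from this[OF finite_window[of x y 1]] show ?thesis
    by (rule grow_mono) (use small in \<open>auto intro!: small\<close>)
qed

text \<open>The first term is the value of the parabola \<open>hW\<close> at its vertex
  \<open>U / (2 * \<epsilon>)\<close>. The critical radius is within 3/2 of the vertex, so
  \<open>hW\<close> there is less by at most \<open>7 * \<epsilon>\<close>; the remaining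
  \<open>3 * \<Delta> - 2 * U\<close> is nearly \<open>2.5 * U\<close>.\<close>

lemma \<Gamma>_ge: "\<Gamma> \<ge> 3 * U\<^sup>2 / (4 * \<epsilon>) + 2.4 * U"
proof -
  have "hW (real r) = 3 * U\<^sup>2 / (4 * \<epsilon>) - 3 * \<epsilon> * (U / (2 * \<epsilon>) - real r)\<^sup>2"
    using \<epsilon>_pos by (simp add: hW_def power2_eq_square field_simps)
  moreover have "U / (2 * \<epsilon>) - real r = 1 / 2 + \<delta>"
  proof -
    have "U / (2 * \<epsilon>) = ((2 * real r + 1 + 2 * \<delta>) * \<epsilon>) / (2 * \<epsilon>)" using U_eq by metis
    then show ?thesis using \<epsilon>_pos by (simp add: field_simps)
  qed
  moreover have "3 * \<epsilon> * (1 / 2 + \<delta>)\<^sup>2 \<le> 3 * \<epsilon> * (3 / 2)\<^sup>2"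
    using \<epsilon>_pos \<delta>_pos \<delta>_less by (intro mult_left_mono power_mono) auto
  ultimately have "hW (real r) \<ge> 3 * U\<^sup>2 / (4 * \<epsilon>) - 7 * \<epsilon>" using \<epsilon>_pos by (simp add: power2_eq_square)
  moreover have "max (1 + 5 * \<delta>) (7 * \<delta>) * \<epsilon> \<ge> 0" using \<delta>_pos \<epsilon>_pos by (intro mult_nonneg_nonneg) auto
  moreover have "2 * (\<Delta> - U) + \<Delta> = 2.5 * U - 1.5 * \<epsilon>" using \<Delta>_eq by simp
  ultimately show ?thesis unfolding \<Gamma>_eq using \<epsilon>_le \<epsilon>_pos by linarith
qed

lemma M_ge: "3 * U\<^sup>2 / (4 * \<epsilon>) \<ge> 75 * U"
proof -
  have "75 * U * (4 * \<epsilon>) \<le> 3 * U * U" using mult_left_mono[OF \<epsilon>_le, of U] U_pos by simp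
  then show ?thesis using \<epsilon>_pos by (simp add: field_simps power2_eq_square)
qed

text \<open>Above the energy of the rows completed before, the peak of a row consists of
  \<open>2 * (\<Delta> - U)\<close> for its first two sites and \<Delta> for the free particle;
  \<open>hW_row_le\<close> compares all these peaks with \<Gamma>. The hexagon of radius 1 is built
  crudely at cost \<open>14 * U\<close>.\<close>

theorem Kreach_full: "Kreach \<Gamma> {} (hexagon L)"
proof -
  have "Kreach \<Gamma> {} (window 0 0 (int \<rho>))" if "1 \<le> \<rho>" "\<rho> \<le> L" for \<rho>
    using that
  proof (induction \<rho> rule: dec_induct)
    case base
    have "inL 0 0 1" using base by (simp add: inL_def)
    from grow_G_window_1[OF this] have "grow (G (9 * U)) {} (window 0 0 1)"
      by (rule grow_mono) (use inL_window[OF \<open>inL 0 0 1\<close>] in \<open>auto simp: G_def\<close>)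
    then have "Kreach (9 * U + 5 * U) {} (window 0 0 1)" by (rule grow_G_Kreach)
    then show ?case using \<Gamma>_ge M_ge U_pos by (auto elim!: Kreach_mono)
  next
    case (step \<rho>)
    obtain A1 A2 A3 A4 A5 where A:
      "extend \<rho> (window 0 0 (int \<rho>)) A1" "extend (\<rho> + 1) A1 A2" "extend (\<rho> + 1) A2 A3"
      "extend (\<rho> + 1) A3 A4" "extend (\<rho> + 1) A4 A5" "extend (\<rho> + 2) A5 (window 0 0 (int \<rho> + 1))"
      using ring_concentric[OF step.hyps(1), of 0 0] by blast
    have W: "window 0 0 (int \<rho> + 1) \<subseteq> hexagon L"
      by (rule inL_window) (use step.prems in \<open>auto simp: inL_def\<close>)
    note sub = A[THEN extend_mono]
    have ex: "Kreach (en X + 2 * (\<Delta> - U) + \<Delta>) X Y" "en Y \<le> en X + \<Delta> - U - (real l - 1) * \<epsilon>"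
      if "extend l X Y" "Y \<subseteq> hexagon L" for l X Y
      using extend_exact[OF that] by (blast intro: grow_Kx_Kreach, blast)
    have s5: "A5 \<subseteq> hexagon L" using sub(6) W by blast
    have s4: "A4 \<subseteq> hexagon L" using sub(5) s5 by blast
    have s3: "A3 \<subseteq> hexagon L" using sub(4) s4 by blast
    have s2: "A2 \<subseteq> hexagon L" using sub(3) s3 by blast
    have s1: "A1 \<subseteq> hexagon L" using sub(2) s2 by blast
    \<comment> \<open>Energy change by a row along a side of length \<open>\<rho> + 1\<close>; the
      shorter first row gains \<open>\<epsilon>\<close> less.\<close>
    define q where "q = (real r + \<delta> - real \<rho>) * \<epsilon>"
    have inc: "\<Delta> - U - (real (\<rho> + 1) - 1) * \<epsilon> = q" "\<Delta> - U - (real \<rho> - 1) * \<epsilon> = q + \<epsilon>"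
      unfolding q_def \<Delta>_U by (simp_all add: algebra_simps)
    have e0: "en (window 0 0 (int \<rho>)) \<le> hW (real \<rho>)" by (rule en_window_le[OF step.hyps(1)])
    have e1: "en A1 \<le> hW (real \<rho>) + q + \<epsilon>" using ex(2)[OF A(1) s1] e0 inc(2) by linarith
    have e2: "en A2 \<le> hW (real \<rho>) + 2 * q + \<epsilon>" using ex(2)[OF A(2) s2] e1 inc(1) by linarith
    have e3: "en A3 \<le> hW (real \<rho>) + 3 * q + \<epsilon>" using ex(2)[OF A(3) s3] e2 inc(1) by linarith
    have e4: "en A4 \<le> hW (real \<rho>) + 4 * q + \<epsilon>" using ex(2)[OF A(4) s4] e3 inc(1) by linarith
    have e5: "en A5 \<le> hW (real \<rho>) + 5 * q + \<epsilon>" using ex(2)[OF A(5) s5] e4 inc(1) by linarith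
    have le: "hW (real \<rho>) + (k + 1) * q + \<epsilon> + 2 * (\<Delta> - U) + \<Delta> \<le> \<Gamma>" if "0 \<le> k" "k \<le> 4" for k
      using hW_row_le(1)[OF that, of \<rho>] by (simp add: q_def mult_ac)
    have "Kreach \<Gamma> (window 0 0 (int \<rho>)) A1"
      by (rule Kreach_mono[OF ex(1)[OF A(1) s1]]) (use e0 hW_row_le(2)[of 0 \<rho>] in simp)
    moreover have "Kreach \<Gamma> A1 A2"
      by (rule Kreach_mono[OF ex(1)[OF A(2) s2]]) (use e1 le[of 0] in simp)
    moreover have "Kreach \<Gamma> A2 A3"
      by (rule Kreach_mono[OF ex(1)[OF A(3) s3]]) (use e2 le[of 1] in simp)
    moreover have "Kreach \<Gamma> A3 A4"
      by (rule Kreach_mono[OF ex(1)[OF A(4) s4]]) (use e3 le[of 2] in simp)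
    moreover have "Kreach \<Gamma> A4 A5"
      by (rule Kreach_mono[OF ex(1)[OF A(5) s5]]) (use e4 le[of 3] in simp)
    moreover have "Kreach \<Gamma> A5 (window 0 0 (int \<rho> + 1))"
      by (rule Kreach_mono[OF ex(1)[OF A(6) W]]) (use e5 le[of 4] in simp)
    moreover have "Kreach \<Gamma> {} (window 0 0 (int \<rho>))" using step by simp
    moreover have "int (Suc \<rho>) = int \<rho> + 1" by simp
    ultimately show ?case by (metis Kreach_trans)
  qed
  from this[of L] show ?thesis using L_ge by (simp add: hexagon_window)
qed

end

section \<open>Escape from the other configurations\<close>

context kawasaki_hex
begin

text \<open>The lower bound on the energy at perimeter \<open>p\<close> that the isoperimetric
  inequality provides; it is concave in \<open>p\<close>.\<close>

definition \<phi> :: "real \<Rightarrow> real" where "\<phi> p = U / 2 * p - \<epsilon> / 12 * p\<^sup>2"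

lemma en_ge_\<phi>: "finite A \<Longrightarrow> \<phi> (real (perim A)) \<le> en A"
proof -
  assume "finite A"
  then have "real (6 * card A) \<le> real ((perim A)\<^sup>2)" using isoperimetric by (simp only: of_nat_le_iff)
  then have "\<epsilon> / 12 * real (6 * card A) \<le> \<epsilon> / 12 * real ((perim A)\<^sup>2)"
    using \<epsilon>_pos by (intro mult_left_mono) auto
  then show ?thesis unfolding en_perim[OF \<open>finite A\<close>] \<phi>_def by simp
qed

lemma \<phi>_6: "\<phi> (6 * x) = hW x"
  by (simp add: \<phi>_def hW_def power2_eq_square)

lemma \<phi>_ge:
  assumes "a \<le> p" "p \<le> b"
  shows "min (\<phi> a) (\<phi> b) \<le> \<phi> p"
proof (cases "a = b")
  case True
  then show ?thesis using assms by simp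
next
  case False
  then have ab: "a < b" using assms by simp
  have "0 \<le> \<epsilon> / 12 * ((p - a) * (b - p) * (b - a))" using assms \<epsilon>_pos ab by (intro mult_nonneg_nonneg) auto
  also have "\<dots> = (b - a) * \<phi> p - ((b - p) * \<phi> a + (p - a) * \<phi> b)"
    by (simp add: \<phi>_def field_simps power2_eq_square)
  finally have "(b - p) * \<phi> a + (p - a) * \<phi> b \<le> (b - a) * \<phi> p" by simp
  moreover have "(b - p) * min (\<phi> a) (\<phi> b) \<le> (b - p) * \<phi> a" "(p - a) * min (\<phi> a) (\<phi> b) \<le> (p - a) * \<phi> b"
    using assms by (intro mult_left_mono; simp)+
  ultimately have "(b - p) * min (\<phi> a) (\<phi> b) + (p - a) * min (\<phi> a) (\<phi> b) \<le> (b - a) * \<phi> p" by linarith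
  then have "(b - a) * min (\<phi> a) (\<phi> b) \<le> (b - a) * \<phi> p" by (simp flip: distrib_right)
  then show ?thesis using ab by simp
qed

text \<open>Up to perimeter \<open>6 * \<rho>\<close> concavity of \<open>\<phi>\<close> applies;
  beyond it the surface term alone outweighs the bulk term of at most \<open>6 * \<rho>^2\<close>
  particles.\<close>

lemma en_ge_hW:
  assumes "finite A" "card A \<le> 6 * \<rho>\<^sup>2" "a \<le> real (perim A)"
  shows "min (\<phi> a) (hW (real \<rho>)) \<le> en A"
proof (cases "real (perim A) \<le> 6 * real \<rho>")
  case True
  then show ?thesis using \<phi>_ge[OF assms(3) True] en_ge_\<phi>[OF assms(1)] by (simp add: \<phi>_6)
next
  case False
  then have "U / 2 * (6 * real \<rho>) \<le> U / 2 * real (perim A)" using U_pos by (intro mult_left_mono) auto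
  moreover have "real (card A) \<le> real (6 * \<rho>\<^sup>2)" using assms(2) by (simp only: of_nat_le_iff)
  then have "\<epsilon> / 2 * real (card A) \<le> \<epsilon> / 2 * (6 * (real \<rho>)\<^sup>2)" using \<epsilon>_pos by (intro mult_left_mono) auto
  moreover have "hW (real \<rho>) = U / 2 * (6 * real \<rho>) - \<epsilon> / 2 * (6 * (real \<rho>)\<^sup>2)" by (simp add: hW_def)
  ultimately have "hW (real \<rho>) \<le> en A" unfolding en_perim[OF assms(1)] by linarith
  then show ?thesis by simp
qed

lemma U_bounds: "real (2 * r + 1) * \<epsilon> < U" "U < real (2 * r + 3) * \<epsilon>"
proof -
  have "U = real (2 * r + 1) * \<epsilon> + 2 * \<delta> * \<epsilon>" using U_eq by (simp add: algebra_simps)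
  moreover have "2 * \<delta> * \<epsilon> < 2 * \<epsilon>" "0 < 2 * \<delta> * \<epsilon>" using \<delta>_pos \<delta>_less \<epsilon>_pos by auto
  ultimately show "real (2 * r + 1) * \<epsilon> < U" "U < real (2 * r + 3) * \<epsilon>" by (auto simp: algebra_simps)
qed

text \<open>The size of the volume enters here, through
  \<open>U < real L * \<epsilon>\<close>.\<close>

lemma hW_L_neg: "hW (real L) < 0"
proof -
  have "U < real (2 * r + 3) * \<epsilon>" by (rule U_bounds)
  also have "\<dots> \<le> real L * \<epsilon>" using L_ge \<epsilon>_pos by (intro mult_right_mono) auto
  finally have "3 * real L * (U - real L * \<epsilon>) < 0" using L_ge by (intro mult_pos_neg) auto
  then show ?thesis by (simp add: hW_def algebra_simps power2_eq_square)
qed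

lemma en_hexagon: "en (hexagon L) \<le> hW (real L)"
  using en_window_le[of L 0 0] L_ge by (simp add: hexagon_window)

text \<open>From perimeter \<open>6 * L\<close> on the full hexagon wins by its larger number of
  particles. Below it, concavity with \<open>\<phi> 0 = 0\<close> bounds \<open>\<phi> p\<close>
  from below by the chord to \<open>\<phi> (6 * L)\<close>, which is negative.\<close>

lemma en_hexagon_less:
  assumes "A \<subset> hexagon L"
  shows "en (hexagon L) < en A"
proof -
  have finA: "finite A" using assms finite_hexagon finite_subset by blast
  have cA: "card A < 6 * L\<^sup>2" using psubset_card_mono[OF finite_hexagon assms] by (simp add: card_hexagon)
  have "hW (real L) < en A"
  proof (cases "real (perim A) \<ge> 6 * real L")
    case True
    then have "U / 2 * (6 * real L) \<le> U / 2 * real (perim A)" using U_pos by (intro mult_left_mono) auto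
    moreover have "real (card A) < real (6 * L\<^sup>2)" using cA by (simp only: of_nat_less_iff)
    then have "\<epsilon> / 2 * real (card A) < \<epsilon> / 2 * (6 * (real L)\<^sup>2)" using \<epsilon>_pos by (intro mult_strict_left_mono) auto
    moreover have "hW (real L) = U / 2 * (6 * real L) - \<epsilon> / 2 * (6 * (real L)\<^sup>2)" by (simp add: hW_def)
    ultimately show ?thesis unfolding en_perim[OF finA] by linarith
  next
    case False
    define p q where "p = real (perim A)" and "q = 6 * real L"
    have pq: "0 \<le> p" "p < q" "q > 0" using False by (auto simp: p_def q_def)
    have \<phi>q: "\<phi> q < 0" using hW_L_neg by (simp add: q_def \<phi>_6)
    have "q * \<phi> p - p * \<phi> q = \<epsilon> / 12 * (p * q * (q - p))" by (simp add: \<phi>_def algebra_simps power2_eq_square)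
    moreover have "\<epsilon> / 12 * (p * q * (q - p)) \<ge> 0" using pq \<epsilon>_pos by (intro mult_nonneg_nonneg) auto
    moreover have "q * \<phi> q < p * \<phi> q" using pq \<phi>q by (intro mult_strict_right_mono_neg) auto
    ultimately have "q * \<phi> q < q * \<phi> p" by linarith
    then have "\<phi> q < \<phi> p" using pq by simp
    then show ?thesis using en_ge_\<phi>[OF finA] by (simp add: q_def p_def \<phi>_6)
  qed
  then show ?thesis using en_hexagon by linarith
qed

text \<open>The cost is bounded both in terms of the sites already removed and of the sites still to be
  removed.\<close>

lemma remove_small:
  assumes "A \<subseteq> hexagon L" "B \<subseteq> A" "card B \<le> 63" "en (A - B) \<le> en A"
  shows "Kreach (en A + 53 * U) A (A - B)"
proof -
  have finA: "finite A" using assms(1) finite_hexagon finite_subset by blast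
  have finB: "finite B" using assms(2) finA finite_subset by blast
  have bound: "en (A - D) \<le> en A + 48 * U" if D: "D \<subseteq> B" for D
  proof -
    have finD: "finite D" using D finB finite_subset by blast
    have "en (A - D) \<le> en A + (3 * U - \<Delta>) * real (card D)"
      using finD
    proof (induction D rule: finite_induct)
      case (insert x D)
      have "A - insert x D = (A - D) - {x}" by blast
      then show ?case using insert en_remove_le[of "A - D" x] finA by (simp add: algebra_simps)
    qed simp
    moreover have "en (A - D) \<le> en (A - B) + \<Delta> * (real (card B) - real (card D))"
    proof -
      have "card {x\<in>A - B. n x \<in> A - B} \<le> card {x\<in>A - D. n x \<in> A - D}" for n
        using D finA by (intro card_mono) auto
      from this[of na] this[of nb] this[of nc] have "bonds2 (A - B) \<le> bonds2 (A - D)"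
        unfolding bonds2_def by linarith
      then have "U / 2 * real (bonds2 (A - B)) \<le> U / 2 * real (bonds2 (A - D))"
        using U_pos by (intro mult_left_mono) auto
      moreover have "real (card (A - D)) = real (card A) - real (card D)"
        using D assms(2) finD card_mono[OF finA, of D] by (subst card_Diff_subset) (auto simp: of_nat_diff)
      moreover have "real (card (A - B)) = real (card A) - real (card B)"
        using assms(2) finB card_mono[OF finA, of B] by (subst card_Diff_subset) (auto simp: of_nat_diff)
      ultimately show ?thesis unfolding en_def by (simp only: right_diff_distrib)
    qed
    \<comment> \<open>Adding the two bounds almost cancels the dependence on \<open>card D\<close>.
      For 63 sites the sum is at most \<open>95.13 * U\<close>, half of which is below
      \<open>48 * U\<close>.\<close>
    ultimately have "2 * en (A - D) \<le> 2 * en A + ((3 * U - \<Delta>) * real (card D) + \<Delta> * (real (card B) - real (card D)))"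
      using assms(4) by linarith
    also have "(3 * U - \<Delta>) * real (card D) + \<Delta> * (real (card B) - real (card D)) = \<Delta> * real (card B) + \<epsilon> * real (card D)"
      by (simp add: \<epsilon>_def algebra_simps)
    also have "\<Delta> * real (card B) \<le> (3 / 2 * U) * 63"
      using \<Delta>_lt U_pos assms(3) \<Delta>_gt by (intro mult_mono) auto
    also have "\<epsilon> * real (card D) \<le> (U / 100) * 63"
      using \<epsilon>_le U_pos card_mono[OF finB D] assms(3) by (intro mult_mono) auto
    finally show ?thesis using U_pos by linarith
  qed
  have "grow (G (en A + 48 * U)) (A - B) (A - B \<union> C)" if "C \<subseteq> B" for C
    using finite_subset[OF that finB] that
  proof (induction C rule: finite_induct)
    case (insert y C)
    have "A - B \<union> C = A - (B - C)" "insert y (A - B \<union> C) = A - (B - C - {y})"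
      using insert assms(2) by auto
    then have "G (en A + 48 * U) (A - B \<union> C) y"
      using bound[of "B - C"] bound[of "B - C - {y}"] insert.prems assms(1,2) by (auto simp: G_def)
    then have "grow (G (en A + 48 * U)) (A - B \<union> C) (A - B \<union> insert y C)"
      unfolding grow_def by (intro r_into_rtranclp) auto
    then show ?case using insert by (blast intro: grow_trans)
  qed simp
  moreover have "A - B \<union> B = A" using assms(2) by blast
  ultimately have "grow (G (en A + 48 * U)) (A - B) A" by (metis order_refl)
  from Kreach_sym[OF grow_G_Kreach[OF this]] show ?thesis by (rule Kreach_mono) simp
qed

text \<open>Hence distinct bonds between the window and its complement end at distinct sites outside.\<close>

lemma window_neighbour:
  assumes "w \<notin> window x y \<rho>"
  shows "\<not> (na w \<in> window x y \<rho> \<and> nb w \<in> window x y \<rho>)" "\<not> (na w \<in> window x y \<rho> \<and> nc w \<in> window x y \<rho>)"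
    "\<not> (nb w \<in> window x y \<rho> \<and> nc w \<in> window x y \<rho>)"
  using assms by (cases w; auto simp: window_def)+

lemma window_neighbour_Suc:
  assumes "w \<in> window x y \<rho>"
  shows "na w \<in> window x y (\<rho> + 1)" "nb w \<in> window x y (\<rho> + 1)" "nc w \<in> window x y (\<rho> + 1)"
  using assms by (cases w; auto simp: window_def)+

text \<open>If discarding the particles in the window brings no gain, the number \<open>c\<close> of
  bonds leading out of it is at least half their perimeter. Isoperimetry bounds \<open>c\<close>
  from below, and the outer ends of these bonds are new particles in the next window.\<close>

lemma window_growth:
  assumes A: "A \<subseteq> hexagon L" and le: "en A \<le> en (A - window x y \<rho>)" and small: "card (A \<inter> window x y \<rho>) \<le> 63"
  shows "\<exists>c. 6 * card (A \<inter> window x y \<rho>) \<le> (2 * c)\<^sup>2 \<and>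
    card (A \<inter> window x y \<rho>) + c \<le> card (A \<inter> window x y (\<rho> + 1))"
proof -
  have finA: "finite A" using A finite_hexagon finite_subset by blast
  let ?W = "window x y \<rho>"
  define B where "B = A \<inter> ?W"
  have fB: "finite B" using finA by (simp add: B_def)
  have AB: "A - ?W = A - B" by (auto simp: B_def)
  define O' where "O' n = {w\<in>A - B. n w \<in> B}" for n :: "site \<Rightarrow> site"
  define c where "c = card (O' na) + card (O' nb) + card (O' nc)"
  have split: "card {u\<in>A. n u \<in> A} = card {u\<in>B. n u \<in> B} + card {u\<in>A - B. n u \<in> A - B} + 2 * card (O' n)"
    if inv: "\<And>x. n (n x) = x" for n
  proof -
    have "{u\<in>A. n u \<in> A} = ({u\<in>B. n u \<in> B} \<union> {u\<in>A - B. n u \<in> A - B}) \<union> (O' n \<union> n ` O' n)"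
    proof (intro equalityI subsetI)
      fix u assume u: "u \<in> {u\<in>A. n u \<in> A}"
      show "u \<in> ({u\<in>B. n u \<in> B} \<union> {u\<in>A - B. n u \<in> A - B}) \<union> (O' n \<union> n ` O' n)"
      proof (cases "u \<in> B \<and> n u \<notin> B")
        case True
        then have "n u \<in> O' n" using u inv by (simp add: O'_def)
        then have "n (n u) \<in> n ` O' n" by (rule imageI)
        then show ?thesis using inv by simp
      next
        case False
        then show ?thesis using u by (auto simp: O'_def)
      qed
    next
      fix u assume "u \<in> ({u\<in>B. n u \<in> B} \<union> {u\<in>A - B. n u \<in> A - B}) \<union> (O' n \<union> n ` O' n)"
      then show "u \<in> {u\<in>A. n u \<in> A}" using inv by (auto simp: O'_def B_def)
    qed
    moreover have "card (n ` O' n) = card (O' n)" by (rule card_image) (metis inj_onI inv)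
    moreover have "card (O' n \<union> n ` O' n) = card (O' n) + card (n ` O' n)"
      by (rule card_Un_disjoint) (use finA in \<open>auto simp: O'_def\<close>)
    moreover have "card ({u\<in>B. n u \<in> B} \<union> {u\<in>A - B. n u \<in> A - B}) = card {u\<in>B. n u \<in> B} + card {u\<in>A - B. n u \<in> A - B}"
      by (rule card_Un_disjoint) (use finA fB in auto)
    moreover have "card (({u\<in>B. n u \<in> B} \<union> {u\<in>A - B. n u \<in> A - B}) \<union> (O' n \<union> n ` O' n)) =
        card ({u\<in>B. n u \<in> B} \<union> {u\<in>A - B. n u \<in> A - B}) + card (O' n \<union> n ` O' n)"
      by (rule card_Un_disjoint) (use finA fB inv in \<open>auto simp: O'_def\<close>)
    ultimately show ?thesis by simp
  qed
  have "bonds2 A = bonds2 B + bonds2 (A - B) + 2 * c"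
    unfolding bonds2_def c_def using split[of na] split[of nb] split[of nc] by simp
  then have "real (bonds2 A) = real (bonds2 B) + real (bonds2 (A - B)) + 2 * real c" by simp
  moreover have "card A = card B + card (A - B)"
    using card_Un_disjoint[of B "A - B"] finA fB by (simp add: B_def Un_Diff_Int Int_commute Un_commute)
  then have "real (card A) = real (card B) + real (card (A - B))" by simp
  ultimately have "en A = en B + en (A - B) - U * real c" by (simp add: en_def algebra_simps)
  then have "en B \<le> U * real c" using le AB by simp
  then have "U / 2 * real (perim B) \<le> U * real c + \<epsilon> / 2 * real (card B)" unfolding en_perim[OF fB] by simp
  \<comment> \<open>For at most 63 particles the bulk term is below \<open>U / 2\<close>, too small
    to affect the comparison of integers.\<close>
  moreover have "\<epsilon> / 2 * real (card B) \<le> U / 200 * 63"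
    using \<epsilon>_le U_pos small unfolding B_def[symmetric] by (intro mult_mono) auto
  ultimately have "U / 2 * real (perim B) < U / 2 * (2 * real c + 1)" using U_pos by (simp add: algebra_simps)
  then have "real (perim B) < 2 * real c + 1" using U_pos by simp
  then have "perim B \<le> 2 * c" by linarith
  then have "6 * card B \<le> (2 * c)\<^sup>2" using isoperimetric[OF fB] power_mono[of "perim B" "2 * c" 2] by linarith
  moreover have "card B + c \<le> card (A \<inter> window x y (\<rho> + 1))"
  proof -
    have out: "w \<notin> ?W" if "w \<in> O' n" for w n using that by (auto simp: O'_def B_def)
    have "O' na \<inter> O' nb = {}" "O' na \<inter> O' nc = {}" "O' nb \<inter> O' nc = {}"
      using window_neighbour[of _ x y \<rho>] by (auto simp: O'_def B_def)
    then have "card (O' na \<union> O' nb \<union> O' nc) = c"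
      unfolding c_def using finA
      by (subst card_Un_disjoint; (subst card_Un_disjoint)?; auto simp: O'_def)
    moreover have "B \<inter> (O' na \<union> O' nb \<union> O' nc) = {}" by (auto simp: O'_def)
    moreover have "finite (O' na \<union> O' nb \<union> O' nc)" using finA by (auto simp: O'_def)
    ultimately have "card (B \<union> (O' na \<union> O' nb \<union> O' nc)) = card B + c"
      using fB by (simp add: card_Un_disjoint)
    moreover have "B \<union> (O' na \<union> O' nb \<union> O' nc) \<subseteq> A \<inter> window x y (\<rho> + 1)"
    proof -
      have "w \<in> window x y (\<rho> + 1)" if "w \<in> O' na \<union> O' nb \<union> O' nc" for w
        using that window_neighbour_Suc[of "na w" x y \<rho>] window_neighbour_Suc[of "nb w" x y \<rho>]
          window_neighbour_Suc[of "nc w" x y \<rho>] by (auto simp: O'_def B_def)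
      then show ?thesis using window_mono[of \<rho> "\<rho> + 1" x y] by (auto simp: B_def O'_def)
    qed
    ultimately show ?thesis using card_mono[of "A \<inter> window x y (\<rho> + 1)"] finA by (metis finite_Int)
  qed
  ultimately show ?thesis unfolding B_def by blast
qed

text \<open>The increment at each radius is of the order of the square root of the mass, so the mass
  grows quadratically, \<open>\<rho>^2 \<le> 4 * m \<rho>\<close>; radius 16 is where this gives
  64.\<close>

lemma window_mass:
  assumes A: "A \<subseteq> hexagon L" and start: "A \<inter> window x y 1 \<noteq> {}"
    and stuck: "\<And>\<rho>::nat. 1 \<le> \<rho> \<Longrightarrow> \<rho> < 16 \<Longrightarrow> card (A \<inter> window x y (int \<rho>)) \<le> 63 \<Longrightarrow> en A \<le> en (A - window x y (int \<rho>))"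
  shows "card (A \<inter> window x y 16) \<ge> 64"
proof -
  define m where "m \<rho> = card (A \<inter> window x y (int \<rho>))" for \<rho>
  have finA: "finite A" using A finite_hexagon finite_subset by blast
  have mono: "m \<rho> \<le> m (Suc \<rho>)" for \<rho>
    unfolding m_def using finA window_mono[of "int \<rho>" "int (Suc \<rho>)" x y] by (intro card_mono) auto
  have step: "m \<rho> \<ge> 64 \<or> (\<exists>c. 6 * m \<rho> \<le> (2 * c)\<^sup>2 \<and> m \<rho> + c \<le> m (Suc \<rho>))" if "1 \<le> \<rho>" "\<rho> < 16" for \<rho>
    using window_growth[OF A stuck[OF that]] unfolding m_def by (force simp: add.commute)
  have m1: "m 1 \<ge> 1" using start finA by (simp add: m_def Suc_le_eq card_gt_0_iff)
  have claim: "m \<rho> \<ge> 64 \<or> (m \<rho> \<ge> 3 \<and> \<rho>\<^sup>2 \<le> 4 * m \<rho>)" if "2 \<le> \<rho>" "\<rho> \<le> 16" for \<rho>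
    using that
  proof (induction \<rho> rule: dec_induct)
    case base
    have "m 1 \<ge> 64 \<or> (\<exists>c. 6 * m 1 \<le> (2 * c)\<^sup>2 \<and> m 1 + c \<le> m (Suc 1))" by (rule step) auto
    then show ?case
    proof
      assume "64 \<le> m 1"
      then show ?thesis using mono[of 1] by (simp add: numeral_2_eq_2)
    next
      assume "\<exists>c. 6 * m 1 \<le> (2 * c)\<^sup>2 \<and> m 1 + c \<le> m (Suc 1)"
      then obtain c where c: "6 * m 1 \<le> (2 * c)\<^sup>2" "m 1 + c \<le> m 2" by (auto simp: numeral_2_eq_2)
      have "c \<ge> 2"
      proof (rule ccontr)
        assume "\<not> 2 \<le> c"
        then have "c = 0 \<or> c = 1" by linarith
        then show False using c(1) m1 by auto
      qed
      then show ?thesis using c m1 by auto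
    qed
  next
    case (step \<rho>)
    show ?case
    proof (cases "m \<rho> \<ge> 64")
      case True
      then show ?thesis using mono[of \<rho>] by linarith
    next
      case False
      then have IH: "m \<rho> \<ge> 3" "\<rho>\<^sup>2 \<le> 4 * m \<rho>" using step by auto
      obtain c where c: "6 * m \<rho> \<le> (2 * c)\<^sup>2" "m \<rho> + c \<le> m (Suc \<rho>)" using \<open>\<not> 64 \<le> m \<rho>\<close> \<open>\<And>\<rho>. 1 \<le> \<rho> \<Longrightarrow> \<rho> < 16 \<Longrightarrow> 64 \<le> m \<rho> \<or> (\<exists>c. 6 * m \<rho> \<le> (2 * c)\<^sup>2 \<and> m \<rho> + c \<le> m (Suc \<rho>))\<close>[of \<rho>] step by auto
      show ?thesis
      proof (cases "\<rho> = 2")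
        case True
        then show ?thesis using IH c by auto
      next
        case False
        \<comment> \<open>The inequality \<open>(2 * \<rho> + 1)^2 \<le> 6 * \<rho>^2\<close> below
          fails at 2, hence the separate case and the additional claim
          \<open>m \<rho> \<ge> 3\<close>.\<close>
        then have r3: "\<rho> \<ge> 3" using step by linarith
        then obtain j where "\<rho> = 3 + j" using le_Suc_ex by blast
        then have "(2 * \<rho> + 1)\<^sup>2 \<le> 6 * \<rho>\<^sup>2"
          by (simp add: power2_eq_square algebra_simps)
        also have "\<dots> \<le> 24 * m \<rho>" using IH by linarith
        also have "\<dots> \<le> (4 * c)\<^sup>2" using c(1) by (simp add: power_mult_distrib)
        finally have "2 * \<rho> + 1 \<le> 4 * c" by (simp only: power2_nat_le_eq_le)
        then show ?thesis using IH c(2) by (simp add: power2_eq_square)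
      qed
    qed
  qed
  show ?thesis using claim[of 16] by (auto simp: m_def power2_eq_square)
qed

end

section \<open>Placing and enlarging droplets inside the volume\<close>

text \<open>Each of the three coordinates is confined to an interval such as
  \<open>cl (a - 16)\<close> to \<open>cl (a + 16)\<close>; \<open>x\<close> and then
  \<open>y\<close> are chosen as small as these constraints permit. The second alternatives in the
  conclusion describe a window of radius 32 that already reaches the boundary of the volume.\<close>

lemma clamped_point:
  fixes K a b c :: int
  assumes "K \<ge> 0" "\<bar>a\<bar> \<le> K + 32" "\<bar>b\<bar> \<le> K + 32" "\<bar>c\<bar> \<le> K + 32" "c = a + b"
  shows "\<exists>x y. \<bar>x\<bar> \<le> K \<and> \<bar>y\<bar> \<le> K \<and> \<bar>x + y\<bar> \<le> K \<and>
    (x \<le> a + 16 \<or> x \<le> - K) \<and> (a - 16 \<le> x \<or> K \<le> x) \<and>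
    (y \<le> b + 16 \<or> y \<le> - K) \<and> (b - 16 \<le> y \<or> K \<le> y) \<and>
    (x + y \<le> c + 16 \<or> x + y \<le> - K) \<and> (c - 16 \<le> x + y \<or> K \<le> x + y)"
proof -
  define cl where "cl t = max (- K) (min K t)" for t
  define x where "x = max (cl (a - 16)) (cl (c - 16) - cl (b + 16))"
  define y where "y = max (cl (b - 16)) (cl (c - 16) - x)"
  have cl: "- K \<le> cl t" "cl t \<le> K" "cl t = t \<or> cl t = K \<and> K \<le> t \<or> cl t = - K \<and> t \<le> - K" for t
    using assms(1) by (auto simp: cl_def max_def min_def)
  have x: "x \<ge> cl (a - 16)" "x \<ge> cl (c - 16) - cl (b + 16)" "x = cl (a - 16) \<or> x = cl (c - 16) - cl (b + 16)"
    by (auto simp: x_def max_def)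
  have y: "y \<ge> cl (b - 16)" "y \<ge> cl (c - 16) - x" "y = cl (b - 16) \<or> y = cl (c - 16) - x"
    by (auto simp: y_def max_def)
  have 1: "cl (a - 16) \<le> cl (a + 16)" "cl (b - 16) \<le> cl (b + 16)" "cl (c - 16) \<le> cl (c + 16)"
    by (auto simp: cl_def)
  have 2: "cl (c - 16) - cl (b + 16) \<le> cl (a + 16)"
    using cl[of "c - 16"] cl[of "b + 16"] cl[of "a + 16"] assms by (smt (verit))
  have 3: "cl (a - 16) + cl (b - 16) \<le> cl (c + 16)"
    using cl[of "c + 16"] cl[of "b - 16"] cl[of "a - 16"] assms by (smt (verit))
  have 4: "cl (c - 16) - cl (b + 16) + cl (b - 16) \<le> cl (c + 16)"
    using 1 by linarith
  have xa: "x \<le> cl (a + 16)" using x(3) 1 2 by auto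
  have yb: "y \<le> cl (b + 16)" using y(3) 1 x(2) by linarith
  have xy: "x + y \<le> cl (c + 16)" using x(3) y(3) 1 3 4 by linarith
  have up: "t \<le> s \<or> t \<le> - K" if "t \<le> cl s" for t s using that cl(3)[of s] by linarith
  have lo: "s \<le> t \<or> K \<le> t" if "cl s \<le> t" for t s using that cl(3)[of s] by linarith
  have xyc: "cl (c - 16) \<le> x + y" using y(2) by linarith
  have abs: "\<bar>t\<bar> \<le> K" if "cl s \<le> t" "t \<le> cl s'" for t s s'
    using that cl(1)[of s] cl(2)[of s'] by linarith
  show ?thesis
    by (intro exI[of _ x] exI[of _ y] conjI abs[OF x(1) xa] abs[OF y(1) yb] abs[OF xyc xy]
      up[OF xa] up[OF yb] up[OF xy] lo[OF x(1)] lo[OF y(1)] lo[OF xyc])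
qed

context kawasaki_hex
begin

text \<open>A window that sticks out is replaced by one of twice the radius inside the volume; the
  particles lie in the volume, so none is lost.\<close>

lemma capture:
  assumes "\<bar>a\<bar> \<le> int L" "\<bar>b\<bar> \<le> int L" "\<bar>a + b\<bar> \<le> int L"
  obtains x y where "inL x y 32" "window a b 16 \<inter> hexagon L \<subseteq> window x y 32"
proof -
  have L: "int L \<ge> 102" using L_ge r_ge by linarith
  obtain x y where xy: "\<bar>x\<bar> \<le> int L - 32" "\<bar>y\<bar> \<le> int L - 32" "\<bar>x + y\<bar> \<le> int L - 32"
    "x \<le> a + 16 \<or> x \<le> - (int L - 32)" "a - 16 \<le> x \<or> int L - 32 \<le> x"
    "y \<le> b + 16 \<or> y \<le> - (int L - 32)" "b - 16 \<le> y \<or> int L - 32 \<le> y"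
    "x + y \<le> a + b + 16 \<or> x + y \<le> - (int L - 32)" "a + b - 16 \<le> x + y \<or> int L - 32 \<le> x + y"
    using clamped_point[of "int L - 32" a b "a + b"] assms L by auto
  have x: "a - 16 \<le> t \<Longrightarrow> - int L \<le> t \<Longrightarrow> x - 32 \<le> t" "t \<le> a + 16 \<Longrightarrow> t \<le> int L \<Longrightarrow> t \<le> x + 32" for t
    using xy(4,5) by linarith+
  have y: "b - 16 \<le> t \<Longrightarrow> - int L \<le> t \<Longrightarrow> y - 32 \<le> t" "t \<le> b + 16 \<Longrightarrow> t \<le> int L \<Longrightarrow> t \<le> y + 32" for t
    using xy(6,7) by linarith+
  have z: "a + b - 16 \<le> t \<Longrightarrow> - int L \<le> t \<Longrightarrow> x + y - 32 \<le> t"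
    "t \<le> a + b + 16 \<Longrightarrow> t \<le> int L \<Longrightarrow> t \<le> x + y + 32" for t
    using xy(8,9) by linarith+
  have "window a b 16 \<inter> hexagon L \<subseteq> window x y 32"
    unfolding window_def hexagon_box
    by (rule site_subsetI; simp only: Int_iff hbox_iff; elim conjE; intro conjI x y z; assumption)
  then show ?thesis using that xy by (auto simp: inL_def)
qed

text \<open>The admissible centres form a hexagon of radius \<open>L - \<rho>\<close>, which shrinks
  by one; a centre on its boundary is moved inwards by one of the six unit vectors.\<close>

lemma drift_step:
  assumes "inL x y (int \<rho>)" "\<rho> < L"
  obtains dx dy where "(dx, dy) \<in> {(0, 0), (1, 0), (0, 1), (- 1, 1), (- 1, 0), (0, - 1), (1, - 1 :: int)}"
    "inL (x + dx) (y + dy) (int \<rho> + 1)"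
proof -
  define m where "m = int L - int \<rho>"
  have m: "m \<ge> 1" "\<bar>x\<bar> \<le> m" "\<bar>y\<bar> \<le> m" "\<bar>x + y\<bar> \<le> m" using assms by (auto simp: m_def inL_def)
  have inL: "inL x' y' (int \<rho> + 1) \<longleftrightarrow> \<bar>x'\<bar> \<le> m - 1 \<and> \<bar>y'\<bar> \<le> m - 1 \<and> \<bar>x' + y'\<bar> \<le> m - 1" for x' y'
    by (auto simp: inL_def m_def)
  consider "\<bar>x\<bar> < m" "\<bar>y\<bar> < m" "\<bar>x + y\<bar> < m"
    | "x = m" "y > - m" | "y = - m" "x > 0" | "x + y = - m" "y < 0" | "x = - m" "y < m" | "y = m" "x < 0"
    | "x + y = m" "y > 0"
    using m by linarith
  then show ?thesis
  proof cases
    case 1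
    then show ?thesis using that[of 0 0] by (auto simp: inL)
  next
    case 2
    then show ?thesis using that[of "- 1" 0] m by (auto simp: inL)
  next
    case 3
    then show ?thesis using that[of "- 1" 1] m by (auto simp: inL)
  next
    case 4
    then show ?thesis using that[of 0 1] m by (auto simp: inL)
  next
    case 5
    then show ?thesis using that[of 1 0] m by (auto simp: inL)
  next
    case 6
    then show ?thesis using that[of 1 "- 1"] m by (auto simp: inL)
  next
    case 7
    then show ?thesis using that[of 0 "- 1"] m by (auto simp: inL)
  qed
qed

lemma grow_between:
  assumes "grow R X Y"
  shows "grow (\<lambda>Z y. R Z y \<and> X \<subseteq> Z \<and> insert y Z \<subseteq> Y) X Y \<and> X \<subseteq> Y"
proof -
  have "(\<lambda>Z W. \<exists>y. (R Z y \<and> X \<subseteq> Z \<and> insert y Z \<subseteq> Y) \<and> W = insert y Z)\<^sup>*\<^sup>* X Y \<and> X \<subseteq> Y"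
    if "(\<lambda>X Y. \<exists>y. R X y \<and> Y = insert y X)\<^sup>*\<^sup>* X Y"
    using that
  proof (induction rule: rtranclp_induct)
    case (step Y Z)
    then obtain y where y: "R Y y" "Z = insert y Y" by blast
    have "(\<lambda>Z W. \<exists>y. (R Z y \<and> X \<subseteq> Z \<and> insert y Z \<subseteq> Y) \<and> W = insert y Z)\<^sup>*\<^sup>* X Y" using step by blast
    then have "(\<lambda>V W. \<exists>y. (R V y \<and> X \<subseteq> V \<and> insert y V \<subseteq> Z) \<and> W = insert y V)\<^sup>*\<^sup>* X Y"
      by (rule rtranclp_mono[THEN predicate2D, rotated]) (use y in blast)
    moreover have "\<exists>w. (R Y w \<and> X \<subseteq> Y \<and> insert w Y \<subseteq> Z) \<and> Z = insert w Y" using step y by blast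
    ultimately show ?case using step y by (auto intro: rtranclp.rtrancl_into_rtrancl)
  qed simp
  then show ?thesis using assms by (simp add: grow_def)
qed

text \<open>Whatever the radius, a row raises the energy by at most \<open>U / 2\<close> and peaks
  below \<open>U\<close>, so six rows stay within \<open>3 * U + U\<close>.\<close>

lemma ring_grow:
  assumes "ring \<rho> A B" "B \<subseteq> hexagon L"
  shows "grow (\<lambda>X y. A \<subseteq> X \<and> insert y X \<subseteq> B \<and> en X \<le> en A + 4 * U \<and> en (insert y X) \<le> en A + 4 * U) A B"
    "A \<subseteq> B"
proof -
  have "grow (G (en A + (real n / 2 + 1) * U)) A C \<and> en C \<le> en A + real n / 2 * U"
    if "((\<lambda>A B. \<exists>l\<ge>\<rho>. extend l A B) ^^ n) A C" "C \<subseteq> hexagon L" for n C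
    using that
  proof (induction n arbitrary: C)
    case (Suc n)
    then obtain D l where D: "((\<lambda>A B. \<exists>l\<ge>\<rho>. extend l A B) ^^ n) A D" "extend l D C" by auto
    have sub: "D \<subseteq> C" by (rule extend_mono[OF D(2)])
    then have IH: "grow (G (en A + (real n / 2 + 1) * U)) A D" "en D \<le> en A + real n / 2 * U"
      using Suc.IH[OF D(1)] Suc.prems by auto
    have DC: "D \<union> C = C" using sub by blast
    have "(real l - 1) * \<epsilon> \<ge> 0" using extend_card[OF D(2)] \<epsilon>_pos by simp
    then have "max (en D) (en D + \<Delta> - U - (real l - 1) * \<epsilon>) \<le> en D + 1 / 2 * U" using \<Delta>_lt U_pos by simp
    moreover have "grow (G (en D + 2 * (\<Delta> - U))) D C \<and>
        en C \<le> max (en D) (en D + \<Delta> - U - (real l - 1) * \<epsilon>)"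
      using extend_grow[OF D(2) subset_refl] sub Suc.prems(2) unfolding DC by blast
    ultimately have C: "grow (G (en D + 2 * (\<Delta> - U))) D C" "en C \<le> en D + 1 / 2 * U"
      by linarith+
    have "en D + 2 * (\<Delta> - U) \<le> en A + (real (Suc n) / 2 + 1) * U"
      using IH(2) \<Delta>_lt U_pos by (simp add: algebra_simps add_divide_distrib)
    from grow_G_mono[OF C(1) this] have "grow (G (en A + (real (Suc n) / 2 + 1) * U)) D C" .
    moreover have "grow (G (en A + (real (Suc n) / 2 + 1) * U)) A D"
      by (rule grow_G_mono[OF IH(1)]) (use U_pos in \<open>simp add: mult_right_mono\<close>)
    ultimately show ?case using C(2) IH(2) by (auto intro: grow_trans simp: add_divide_distrib distrib_right)
  qed (use U_pos in simp)
  from this[of 6 B] assms have "grow (G (en A + 4 * U)) A B" by (simp add: ring_def)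
  from grow_between[OF this]
  show "grow (\<lambda>X y. A \<subseteq> X \<and> insert y X \<subseteq> B \<and> en X \<le> en A + 4 * U \<and> en (insert y X) \<le> en A + 4 * U) A B" "A \<subseteq> B"
    by (auto simp: G_def elim!: grow_mono)
qed

text \<open>From side length \<open>r + 2\<close> on, \<open>\<Delta>_U\<close> shows that a
  completed row never raises the energy, even if parts of it are already present.\<close>

lemma ring_grow_supercritical:
  assumes "ring \<rho> A B" "B \<subseteq> hexagon L" "A \<subseteq> X" "X \<subseteq> hexagon L" "r + 2 \<le> \<rho>"
  shows "grow (G (en X + U)) X (X \<union> B) \<and> en (X \<union> B) \<le> en X"
proof -
  have "grow (G (en X + U)) X (X \<union> C) \<and> en (X \<union> C) \<le> en X"
    if "((\<lambda>A B. \<exists>l\<ge>\<rho>. extend l A B) ^^ n) A C" "C \<subseteq> hexagon L" for n C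
    using that
  proof (induction n arbitrary: C)
    case 0
    then show ?case using assms(3) by (auto simp: Un_absorb2)
  next
    case (Suc n)
    then obtain D l where D: "((\<lambda>A B. \<exists>l\<ge>\<rho>. extend l A B) ^^ n) A D" "extend l D C" "\<rho> \<le> l" by auto
    have sub: "D \<subseteq> C" by (rule extend_mono[OF D(2)])
    then have IH: "grow (G (en X + U)) X (X \<union> D)" "en (X \<union> D) \<le> en X"
      using Suc.IH[OF D(1)] Suc.prems by auto
    have XC: "X \<union> D \<union> C = X \<union> C" using sub by blast
    have "(real r + \<delta>) * \<epsilon> \<le> (real l - 1) * \<epsilon>"
      using D(3) assms(5) \<epsilon>_pos \<delta>_less by (intro mult_right_mono) auto
    then have "max (en (X \<union> D)) (en (X \<union> D) + \<Delta> - U - (real l - 1) * \<epsilon>) \<le> en (X \<union> D)" using \<Delta>_U by simp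
    then have C: "grow (G (en (X \<union> D) + 2 * (\<Delta> - U))) (X \<union> D) (X \<union> C)" "en (X \<union> C) \<le> en (X \<union> D)"
      using extend_grow[OF D(2), of "X \<union> D"] sub Suc.prems(2) assms(4) unfolding XC by auto
    have "grow (G (en X + U)) (X \<union> D) (X \<union> C)"
      by (rule grow_G_mono[OF C(1)]) (use IH(2) \<Delta>_lt in simp)
    then show ?case using C(2) IH by (auto intro: grow_trans)
  qed
  then show ?thesis using assms(1,2) by (auto simp: ring_def)
qed

lemma fill_supercritical:
  assumes "r + 2 \<le> \<rho>" "\<rho> \<le> L" "inL x y (int \<rho>)" "window x y (int \<rho>) \<subseteq> X" "X \<subseteq> hexagon L"
  shows "grow (G (en X + U)) X (hexagon L)"
  using assms
proof (induction "L - \<rho>" arbitrary: \<rho> x y X)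
  case 0
  have \<rho>: "\<rho> = L" using 0 by linarith
  moreover have "x = 0" "y = 0" using "0.prems"(3) unfolding inL_def \<rho> by auto
  ultimately have "hexagon L \<subseteq> X" using "0.prems"(4) by (simp add: hexagon_window)
  then show ?case using "0.prems"(5) by (simp add: subset_antisym)
next
  case (Suc k)
  then have "\<rho> < L" by linarith
  then obtain dx dy where d: "(dx, dy) \<in> {(0, 0), (1, 0), (0, 1), (- 1, 1), (- 1, 0), (0, - 1), (1, - 1)}"
    "inL (x + dx) (y + dy) (int \<rho> + 1)" using drift_step[OF Suc.prems(3)] by metis
  let ?W = "window (x + dx) (y + dy) (int \<rho> + 1)"
  have W: "?W \<subseteq> hexagon L" by (rule inL_window[OF d(2)])
  have "ring \<rho> (window x y (int \<rho>)) ?W" using ring_drifts[OF _ d(1)] Suc.prems(1) by simp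
  from ring_grow_supercritical[OF this W Suc.prems(4,5,1)]
  have g: "grow (G (en X + U)) X (X \<union> ?W)" "en (X \<union> ?W) \<le> en X" by auto
  have "grow (G (en (X \<union> ?W) + U)) (X \<union> ?W) (hexagon L)"
    by (rule Suc.hyps(1)[of "Suc \<rho>" "x + dx" "y + dy"])
      (use Suc.hyps(2) Suc.prems \<open>\<rho> < L\<close> d(2) W in \<open>auto simp: add.commute\<close>)
  then have "grow (G (en X + U)) (X \<union> ?W) (hexagon L)" by (rule grow_G_mono) (use g(2) in simp)
  with g(1) show ?case by (rule grow_trans)
qed

text \<open>By submodularity, adding a droplet to \<open>A\<close> costs no more than the droplet minus its overlap with \<open>A\<close>.\<close>

lemma grow_union:
  assumes "grow R X Y" "A \<subseteq> hexagon L" and R: "\<And>X y. R X y \<Longrightarrow> insert y X \<subseteq> hexagon L \<and>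
      en X - en (A \<inter> X) \<le> v \<and> en (insert y X) - en (A \<inter> insert y X) \<le> v"
  shows "grow (G (en A + v)) (A \<union> X) (A \<union> Y)"
proof -
  have finA: "finite A" using assms(2) finite_hexagon finite_subset by blast
  have "(\<lambda>X Y. \<exists>y. G (en A + v) X y \<and> Y = insert y X)\<^sup>*\<^sup>* (A \<union> X) (A \<union> Y)"
    if "(\<lambda>X Y. \<exists>y. R X y \<and> Y = insert y X)\<^sup>*\<^sup>* X Y"
    using that
  proof (induction rule: rtranclp_induct)
    case (step Y Z)
    then obtain y where y: "R Y y" "Z = insert y Y" by blast
    have fin: "finite Y" "finite (insert y Y)"
      using R[OF y(1)] finite_hexagon finite_subset by auto
    have "en (A \<union> Y) \<le> en A + v" "en (A \<union> insert y Y) \<le> en A + v"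
      using R[OF y(1)] en_submodular[OF finA fin(1)] en_submodular[OF finA fin(2)] by linarith+
    then have "G (en A + v) (A \<union> Y) y" using R[OF y(1)] assms(2) by (auto simp: G_def)
    then show ?case using step.IH y(2) by (auto intro: rtranclp.rtrancl_into_rtrancl)
  qed simp
  then show ?thesis using assms(1) by (simp add: grow_def)
qed

section \<open>Nucleation on a captured cluster and descent of energy\<close>

lemma hW_nonneg: "\<rho> \<le> r + 2 \<Longrightarrow> 0 \<le> hW (real \<rho>)"
proof -
  assume "\<rho> \<le> r + 2"
  then have "real \<rho> * \<epsilon> \<le> real (2 * r + 1) * \<epsilon>" using r_ge \<epsilon>_pos by (intro mult_right_mono) auto
  then have "0 \<le> 3 * real \<rho> * (U - real \<rho> * \<epsilon>)" using U_bounds by (intro mult_nonneg_nonneg) auto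
  then show ?thesis by (simp add: hW_def algebra_simps power2_eq_square)
qed

abbreviation M where "M \<equiv> 3 * U\<^sup>2 / (4 * \<epsilon>)"

lemma hW_le_M: "hW x \<le> M - 3 * \<epsilon> * (U / (2 * \<epsilon>) - x)\<^sup>2"
  using \<epsilon>_pos by (simp add: hW_def power2_eq_square field_simps)

lemma hW_decrease: "\<rho> \<le> r + 1 \<Longrightarrow> hW (real \<rho>) \<le> hW (real (Suc \<rho>)) + 6 * \<epsilon>"
proof -
  assume "\<rho> \<le> r + 1"
  then have "(2 * real \<rho> + 1) * \<epsilon> \<le> real (2 * r + 3) * \<epsilon>" using \<epsilon>_pos by (intro mult_right_mono) auto
  also have "\<dots> = real (2 * r + 1) * \<epsilon> + 2 * \<epsilon>" by (simp add: algebra_simps)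
  also have "\<dots> \<le> U + 2 * \<epsilon>" using U_bounds(1) by simp
  finally have "3 * ((2 * real \<rho> + 1) * \<epsilon>) \<le> 3 * (U + 2 * \<epsilon>)" by simp
  then show ?thesis by (simp add: hW_def algebra_simps power2_eq_square)
qed

text \<open>With the \<open>5 * U\<close> of \<open>grow_G_Kreach\<close> this becomes
  \<open>M + 2.3 * U\<close>, which is at most \<open>\<Gamma> - U / 10\<close> by
  \<open>\<Gamma>_ge\<close>.\<close>

definition V where "V = M - 2.7 * U"

text \<open>With the excess \<open>4 * U\<close> inside a ring, \<open>7.7 * U\<close> has to be
  saved against \<open>M\<close>. For radii below 32 the parabola \<open>hW\<close> is at least
  \<open>7.8 * U\<close> below its vertex. Otherwise the overlap has at least 64 particles, so
  perimeter at least 20 and energy at least \<open>\<phi> 20\<close> or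
  \<open>hW (Suc \<rho>)\<close>; the first is at least \<open>9.66 * U\<close>, and the second
  nearly cancels \<open>hW \<rho>\<close>.\<close>

lemma nucleation_bound:
  assumes A: "A \<subseteq> hexagon L" and X: "finite X" "card X \<le> 6 * (Suc \<rho>)\<^sup>2" "en X \<le> hW (real \<rho>) + 4 * U"
    and \<rho>: "\<rho> \<le> r + 1" and mass: "\<rho> < 32 \<or> card (A \<inter> X) \<ge> 64"
  shows "en X - en (A \<inter> X) \<le> V - U"
proof -
  have fin: "finite (A \<inter> X)" using X by simp
  have cAX: "card (A \<inter> X) \<le> 6 * (Suc \<rho>)\<^sup>2" using X card_mono[of X "A \<inter> X"] by auto
  show ?thesis
  proof (cases "\<rho> < 32")
    case True
    have "0 \<le> min (\<phi> 0) (hW (real (Suc \<rho>)))" using hW_nonneg[of "Suc \<rho>"] \<rho> by (simp add: \<phi>_def)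
    also have "\<dots> \<le> en (A \<inter> X)" by (rule en_ge_hW[OF fin cAX]) simp
    finally have 1: "0 \<le> en (A \<inter> X)" .
    define u where "u = U / (2 * \<epsilon>)"
    have u: "u \<ge> 50" "U = 2 * u * \<epsilon>" using \<epsilon>_pos \<epsilon>_le by (auto simp: u_def field_simps)
    have "(u - 31)\<^sup>2 \<le> (u - real \<rho>)\<^sup>2" using True u by (intro power_mono) auto
    moreover have "(u - 31)\<^sup>2 \<ge> 5.2 * u"
    proof -
      have "0 \<le> (u - 50) * (u - 17.2)" using u by (intro mult_nonneg_nonneg) auto
      also have "(u - 50) * (u - 17.2) = (u - 31)\<^sup>2 - 5.2 * u - 101" by (simp add: power2_eq_square field_simps)
      finally show ?thesis by simp
    qed
    ultimately have "3 * \<epsilon> * (5.2 * u) \<le> 3 * \<epsilon> * (u - real \<rho>)\<^sup>2" using \<epsilon>_pos by (intro mult_left_mono) auto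
    then have "7.8 * U \<le> 3 * \<epsilon> * (u - real \<rho>)\<^sup>2" using u(2) by simp
    then have "hW (real \<rho>) \<le> M - 7.8 * U" using hW_le_M[of "real \<rho>"] by (simp add: u_def)
    then show ?thesis using 1 X(3) U_pos unfolding V_def by linarith
  next
    case False
    then have "6 * 64 \<le> (perim (A \<inter> X))\<^sup>2" using mass isoperimetric[OF fin] by linarith
    then have "19\<^sup>2 < (perim (A \<inter> X))\<^sup>2" by simp
    then have "19 < perim (A \<inter> X)" by (rule power_less_imp_less_base) simp
    then have p: "20 \<le> real (perim (A \<inter> X))" by simp
    have \<phi>20: "\<phi> 20 \<ge> 9.66 * U" using \<epsilon>_le U_pos by (simp add: \<phi>_def)
    have "min (\<phi> 20) (hW (real (Suc \<rho>))) \<le> en (A \<inter> X)" by (rule en_ge_hW[OF fin cAX p])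
    moreover have "0 \<le> 3 * \<epsilon> * (U / (2 * \<epsilon>) - real \<rho>)\<^sup>2" using \<epsilon>_pos by simp
    then have "hW (real \<rho>) \<le> M" using hW_le_M[of "real \<rho>"] by linarith
    moreover have "hW (real \<rho>) \<le> hW (real (Suc \<rho>)) + 6 * \<epsilon>" by (rule hW_decrease[OF \<rho>])
    ultimately show ?thesis using X(3) \<phi>20 M_ge U_pos \<epsilon>_le unfolding V_def min_def by (auto split: if_splits)
  qed
qed

lemma grow_last:
  assumes "grow R X Y"
  shows "Y = X \<or> (\<exists>Z y. R Z y \<and> Y = insert y Z)"
  using assms unfolding grow_def by (cases rule: rtranclp.cases) auto

lemma ring_union:
  assumes A: "A \<subseteq> hexagon L" and ring: "ring \<rho> (window x y (int \<rho>)) (window x' y' (int \<rho> + 1))"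
    and W': "window x' y' (int \<rho> + 1) \<subseteq> hexagon L" and \<rho>: "1 \<le> \<rho>" "\<rho> \<le> r + 1"
    and mass: "\<rho> < 32 \<or> card (A \<inter> window x y (int \<rho>)) \<ge> 64"
  shows "grow (G (en A + (V - U))) (A \<union> window x y (int \<rho>)) (A \<union> window x' y' (int \<rho> + 1))"
    "en (A \<union> window x' y' (int \<rho> + 1)) \<le> en A + (V - U)"
    "card (A \<inter> window x y (int \<rho>)) \<le> card (A \<inter> window x' y' (int \<rho> + 1))"
proof -
  let ?W = "window x y (int \<rho>)" and ?W' = "window x' y' (int \<rho> + 1)"
  have finA: "finite A" using A finite_hexagon finite_subset by blast
  have W: "en ?W \<le> hW (real \<rho>)" by (rule en_window_le[OF \<rho>(1)])
  note g = ring_grow[OF ring W']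
  have card_mono': "card (A \<inter> ?W) \<le> card (A \<inter> X)" if "?W \<subseteq> X" for X
    using finA that by (intro card_mono) auto
  have bound: "en X - en (A \<inter> X) \<le> V - U" if X: "?W \<subseteq> X" "X \<subseteq> ?W'" "en X \<le> en ?W + 4 * U" for X
  proof (rule nucleation_bound[OF A _ _ _ \<rho>(2)])
    show "finite X" using X(2) finite_window finite_subset by blast
    have "card ?W' = 6 * (Suc \<rho>)\<^sup>2" using card_window[of x' y' "Suc \<rho>"] by (simp add: add.commute)
    then show "card X \<le> 6 * (Suc \<rho>)\<^sup>2" using card_mono[OF finite_window X(2)] by simp
    show "en X \<le> hW (real \<rho>) + 4 * U" using X(3) W by simp
    show "\<rho> < 32 \<or> card (A \<inter> X) \<ge> 64" using mass card_mono'[OF X(1)] by linarith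
  qed
  show "grow (G (en A + (V - U))) (A \<union> ?W) (A \<union> ?W')"
    by (rule grow_union[OF g(1) A]) (use W' in \<open>blast intro: bound\<close>)
  have "en ?W' \<le> en ?W + 4 * U" using grow_last[OF g(1)] U_pos by auto
  from bound[OF g(2) subset_refl this] show "en (A \<union> ?W') \<le> en A + (V - U)"
    using en_submodular[OF finA finite_window[of x' y' "int \<rho> + 1"]] by linarith
  show "card (A \<inter> ?W) \<le> card (A \<inter> ?W')" by (rule card_mono'[OF g(2)])
qed

text \<open>Up to radius 32 the centre stays fixed, so that the 64 particles end up inside the
  window; from then on it may drift, since windows only grow. Stopping at \<open>V - U\<close> at
  radius \<open>r + 2\<close> leaves the \<open>U\<close> for the supercritical filling.\<close>

lemma nucleation:
  assumes A: "A \<subseteq> hexagon L" and xy: "inL x y 32" and mass: "card (A \<inter> window x y 32) \<ge> 64"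
  shows "grow (G (en A + V)) A (hexagon L)"
proof -
  have r: "r \<ge> 40" "r + 2 \<le> L" using r_ge L_ge by linarith+
  have V_mono: "grow (G (en A + V)) X Y" if "grow (G (en A + (V - U))) X Y" for X Y
    by (rule grow_G_mono[OF that]) (use U_pos in simp)
  have concentric: "grow (G (en A + V)) A (A \<union> window x y (int \<rho>))" if "1 \<le> \<rho>" "\<rho> \<le> 32" for \<rho>
    using that
  proof (induction \<rho> rule: dec_induct)
    case base
    have "inL x y 1" using xy by (auto simp: inL_def)
    from grow_G_window_1[OF this]
    have "grow (G (en A + V)) (A \<union> {}) (A \<union> window x y 1)"
    proof (rule grow_union[OF _ A])
      have pos: "0 \<le> en (A \<inter> X)" if "X \<subseteq> window x y 1" for X
      proof -
        have fin: "finite (A \<inter> X)" using that finite_window finite_subset by blast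
        have "card (A \<inter> X) \<le> 6 * 1\<^sup>2" using card_mono[OF finite_window, of "A \<inter> X" x y 1] that card_window[of x y 1] by auto
        from en_ge_hW[OF fin this, of 0] show ?thesis using hW_nonneg[of 1] by (simp add: \<phi>_def)
      qed
      have "9 * U \<le> V" using M_ge U_pos by (simp add: V_def)
      then show "insert z X \<subseteq> hexagon L \<and> en X - en (A \<inter> X) \<le> V \<and> en (insert z X) - en (A \<inter> insert z X) \<le> V"
        if "{} \<subseteq> X \<and> insert z X \<subseteq> window x y 1 \<and> en X \<le> 9 * U \<and> en (insert z X) \<le> 9 * U" for X z
        using that pos[of X] pos[of "insert z X"] inL_window[OF \<open>inL x y 1\<close>] by auto
    qed
    then show ?case by simp
  next
    case (step \<rho>)
    have W: "window x y (int \<rho> + 1) \<subseteq> hexagon L"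
      by (rule inL_window) (use xy step in \<open>auto simp: inL_def\<close>)
    from ring_union(1)[OF A ring_window[OF step.hyps(1)] W step.hyps(1)] step r
    have "grow (G (en A + V)) (A \<union> window x y (int \<rho>)) (A \<union> window x y (int \<rho> + 1))" by (intro V_mono) auto
    then show ?case using step by (auto intro: grow_trans simp: add.commute)
  qed
  \<comment> \<open>The energy bound is an outcome of a ring step, so it is not claimed at the
    starting radius 32.\<close>
  have "\<exists>x y. inL x y (int \<rho>) \<and> card (A \<inter> window x y (int \<rho>)) \<ge> 64 \<and>
      grow (G (en A + V)) A (A \<union> window x y (int \<rho>)) \<and> (\<rho> \<noteq> 32 \<longrightarrow> en (A \<union> window x y (int \<rho>)) \<le> en A + (V - U))"
    if "32 \<le> \<rho>" "\<rho> \<le> r + 2" for \<rho>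
    using that
  proof (induction \<rho> rule: dec_induct)
    case base
    then show ?case using xy mass concentric[of 32] by auto
  next
    case (step \<rho>)
    then obtain x y where IH: "inL x y (int \<rho>)" "card (A \<inter> window x y (int \<rho>)) \<ge> 64"
      "grow (G (en A + V)) A (A \<union> window x y (int \<rho>))" by auto
    have "\<rho> < L" using step.prems r by linarith
    obtain dx dy where d: "(dx, dy) \<in> {(0, 0), (1, 0), (0, 1), (- 1, 1), (- 1, 0), (0, - 1), (1, - 1)}"
      "inL (x + dx) (y + dy) (int \<rho> + 1)" using drift_step[OF IH(1) \<open>\<rho> < L\<close>] by metis
    have \<rho>: "1 \<le> \<rho>" "\<rho> \<le> r + 1" using step by auto
    note u = ring_union[OF A ring_drifts[OF \<rho>(1) d(1)] inL_window[OF d(2)] \<rho> disjI2[OF IH(2)]]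
    have "grow (G (en A + V)) A (A \<union> window (x + dx) (y + dy) (int \<rho> + 1))"
      by (rule grow_trans[OF IH(3) V_mono[OF u(1)]])
    moreover have "card (A \<inter> window (x + dx) (y + dy) (int \<rho> + 1)) \<ge> 64" using u(3) IH(2) by linarith
    moreover have "int (Suc \<rho>) = int \<rho> + 1" by simp
    ultimately show ?case using d(2) u(2) by metis
  qed
  from this[of "r + 2"] r obtain x y where X: "inL x y (int (r + 2))"
    "grow (G (en A + V)) A (A \<union> window x y (int (r + 2)))" "en (A \<union> window x y (int (r + 2))) \<le> en A + (V - U)"
    by auto
  have "grow (G (en (A \<union> window x y (int (r + 2))) + U)) (A \<union> window x y (int (r + 2))) (hexagon L)"
    by (rule fill_supercritical[OF order_refl r(2) X(1)]) (use A inL_window[OF X(1)] in auto)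
  from grow_G_mono[OF this, of "en A + V"] X(3)
  have "grow (G (en A + V)) (A \<union> window x y (int (r + 2))) (hexagon L)" by simp
  with X(2) show ?thesis by (rule grow_trans)
qed

lemma site_in_window_1:
  assumes "s \<in> hexagon L"
  obtains a b where "\<bar>a\<bar> \<le> int L" "\<bar>b\<bar> \<le> int L" "\<bar>a + b\<bar> \<le> int L" "s \<in> window a b 1"
proof -
  have "\<exists>a b. \<bar>a\<bar> \<le> int L \<and> \<bar>b\<bar> \<le> int L \<and> \<bar>a + b\<bar> \<le> int L \<and> s \<in> window a b 1"
  proof (cases s)
    case (Up a b)
    then have "\<bar>a\<bar> \<le> int L" "\<bar>b\<bar> \<le> int L" "\<bar>a + b\<bar> \<le> int L" using assms by (auto simp: hexagon_box)
    moreover have "s \<in> window a b 1" using Up by (simp add: window_1)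
    ultimately show ?thesis by blast
  next
    case (Down a b)
    then have "\<bar>a + 1\<bar> \<le> int L" "\<bar>b\<bar> \<le> int L" "\<bar>a + 1 + b\<bar> \<le> int L" using assms by (auto simp: hexagon_box)
    moreover have "s \<in> window (a + 1) b 1" using Down by (simp add: window_1)
    ultimately show ?thesis by blast
  qed
  then show ?thesis using that by blast
qed

text \<open>Unless emptying some small window around a particle lowers the energy,
  \<open>window_mass\<close> provides the 64 particles on which a droplet nucleates.\<close>

lemma hexagon_descent:
  assumes A: "A \<subseteq> hexagon L" "A \<noteq> {}" "A \<noteq> hexagon L"
  shows "\<exists>B\<subseteq>hexagon L. Kreach (en A + (\<Gamma> - U / 10)) A B \<and> en B < en A"
proof -
  obtain s where s: "s \<in> A" using A by blast
  obtain a b where ab: "\<bar>a\<bar> \<le> int L" "\<bar>b\<bar> \<le> int L" "\<bar>a + b\<bar> \<le> int L" "s \<in> window a b 1"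
    using site_in_window_1[of s] s A by blast
  have finA: "finite A" using A finite_hexagon finite_subset by blast
  show ?thesis
  proof (cases "\<exists>\<rho>::nat. 1 \<le> \<rho> \<and> \<rho> < 16 \<and> card (A \<inter> window a b (int \<rho>)) \<le> 63 \<and> en (A - window a b (int \<rho>)) < en A")
    case True
    then obtain \<rho> :: nat where \<rho>: "card (A \<inter> window a b (int \<rho>)) \<le> 63" "en (A - window a b (int \<rho>)) < en A" by blast
    have "A - A \<inter> window a b (int \<rho>) = A - window a b (int \<rho>)" by blast
    then have "Kreach (en A + 53 * U) A (A - window a b (int \<rho>))"
      using remove_small[OF A(1) _ \<rho>(1)] \<rho>(2) by simp
    then have "Kreach (en A + (\<Gamma> - U / 10)) A (A - window a b (int \<rho>))"
      by (rule Kreach_mono) (use \<Gamma>_ge M_ge U_pos in linarith)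
    then show ?thesis using \<rho>(2) A(1) by blast
  next
    case False
    have "A \<inter> window a b 1 \<noteq> {}" using s ab(4) by blast
    from window_mass[OF A(1) this] False have m: "card (A \<inter> window a b 16) \<ge> 64" by force
    obtain x y where xy: "inL x y 32" "window a b 16 \<inter> hexagon L \<subseteq> window x y 32"
      using capture[OF ab(1-3)] by blast
    have "card (A \<inter> window a b 16) \<le> card (A \<inter> window x y 32)"
      using xy(2) A(1) finA by (intro card_mono) auto
    with m have "card (A \<inter> window x y 32) \<ge> 64" by linarith
    from grow_G_Kreach[OF nucleation[OF A(1) xy(1) this]]
    have "Kreach (en A + (\<Gamma> - U / 10)) A (hexagon L)"
      by (rule Kreach_mono) (use \<Gamma>_ge U_pos in \<open>simp add: V_def\<close>)
    then show ?thesis using en_hexagon_less A by blast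
  qed
qed

lemma boundary_descent:
  assumes "A \<subseteq> vol L" "\<not> A \<subseteq> hexagon L"
  shows "\<exists>B\<subseteq>vol L. reach (hamiltonian L U \<Delta> (conf L A)) (conf L A) (conf L B) \<and>
    hamiltonian L U \<Delta> (conf L B) < hamiltonian L U \<Delta> (conf L A)"
proof -
  obtain y where y: "y \<in> A" "y \<in> vol L" "y \<notin> hexagon L" using assms by blast
  have finA: "finite A" using assms(1) finite_vol finite_subset by blast
  let ?B = "A - {y}"
  have B: "?B \<subseteq> vol L" "?B \<inter> hexagon L = A \<inter> hexagon L" "?B - hexagon L = (A - hexagon L) - {y}"
    using assms(1) y by auto
  have "card (A - hexagon L) = Suc (card ((A - hexagon L) - {y}))"
    using y finA by (intro card.remove) auto
  then have less: "hamiltonian L U \<Delta> (conf L ?B) < hamiltonian L U \<Delta> (conf L A)"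
    unfolding hamiltonian_conf[OF B(1)] hamiltonian_conf[OF assms(1)] B(2,3) using \<Delta>_gt U_pos
    by (simp add: algebra_simps)
  have "E (conf L ?B) (conf L (insert y ?B))" by (rule bond_move_create[OF y(2,3)])
  then have "E (conf L A) (conf L ?B)"
    using bond_move_sym[OF conf_in_configs conf_in_configs] y(1) by (simp add: insert_absorb)
  then have "reach (hamiltonian L U \<Delta> (conf L A)) (conf L A) (conf L ?B)"
    unfolding reach_def using less conf_in_configs by (intro r_into_rtranclp) auto
  then show ?thesis using less B(1) by blast
qed

lemma reach_descent:
  assumes x: "x \<in> configs L" "x \<noteq> empty_config L" "x \<noteq> full_config L"
  shows "\<exists>y\<in>configs L. reach (hamiltonian L U \<Delta> x + (\<Gamma> - U / 10)) x y \<and> hamiltonian L U \<Delta> y < hamiltonian L U \<Delta> x"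
proof -
  obtain A where A: "A \<subseteq> vol L" "x = conf L A" using configs_conf[OF x(1)] by blast
  show ?thesis
  proof (cases "A \<subseteq> hexagon L")
    case True
    have "A \<noteq> {}" "A \<noteq> hexagon L" using x A by (auto simp: conf_empty conf_full)
    from hexagon_descent[OF True this] obtain B where B: "B \<subseteq> hexagon L"
      "Kreach (en A + (\<Gamma> - U / 10)) A B" "en B < en A" by blast
    show ?thesis
      by (intro bexI[of _ "conf L B"]) (use B True A in \<open>auto simp: Kreach_def hamiltonian_hexagon conf_in_configs\<close>)
  next
    case False
    have "0 \<le> \<Gamma> - U / 10" using \<Gamma>_ge M_ge U_pos by linarith
    moreover obtain B where B: "reach (hamiltonian L U \<Delta> (conf L A)) (conf L A) (conf L B)"
      "hamiltonian L U \<Delta> (conf L B) < hamiltonian L U \<Delta> (conf L A)"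
      using boundary_descent[OF A(1) False] by blast
    ultimately have "reach (hamiltonian L U \<Delta> x + (\<Gamma> - U / 10)) x (conf L B)"
      using Kreach_mono[of "hamiltonian L U \<Delta> (conf L A)" A B] unfolding A(2) Kreach_def by auto
    then show ?thesis using B A(2) conf_in_configs by blast
  qed
qed

text \<open>Only the empty configuration uses the full height \<Gamma> to descend; the margin
  \<open>U / 10\<close> of \<open>reach_descent\<close> serves all states other than the two
  minima.\<close>

lemma metastable_kawasaki:
  "metastable (configs L) (hamiltonian L U \<Delta>) E (1 / real (card (obonds L))) (kawasaki_P L U \<Delta>)
    (empty_config L) (full_config L) \<Gamma> (\<Gamma> - U / 10)"
proof unfold_locales
  show "empty_config L \<in> configs L" "full_config L \<in> configs L"
    by (simp_all add: conf_empty conf_full conf_in_configs)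
  have ne: "hexagon L \<noteq> {}" using card_hexagon L_ge by auto
  then show "empty_config L \<noteq> full_config L"
    using conf_inj[of "{}" L "hexagon L"] hexagon_subset_vol by (auto simp: conf_empty conf_full)
  show s0: "hamiltonian L U \<Delta> (empty_config L) = 0" by (simp add: conf_empty hamiltonian_hexagon)
  show V0: "0 \<le> \<Gamma> - U / 10" and "\<Gamma> - U / 10 < \<Gamma>" using \<Gamma>_ge M_ge U_pos by linarith+
  show "\<Gamma> \<le> h" if "reach h (empty_config L) (full_config L)" for h using that by (rule barrier_lower)
  show "\<exists>y\<in>configs L. reach (hamiltonian L U \<Delta> x + (\<Gamma> - U / 10)) x y \<and>
      (y = empty_config L \<or> y = full_config L \<or> hamiltonian L U \<Delta> y < hamiltonian L U \<Delta> x)"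
    if "x \<in> configs L" "x \<noteq> empty_config L" "x \<noteq> full_config L" for x
    using reach_descent[OF that] by blast
  show "\<exists>y\<in>configs L. reach (hamiltonian L U \<Delta> x + \<Gamma>) x y \<and>
      (y = full_config L \<or> hamiltonian L U \<Delta> y < hamiltonian L U \<Delta> x)"
    if x: "x \<in> configs L" "x \<noteq> full_config L" for x
  proof (cases "x = empty_config L")
    case True
    have "reach (hamiltonian L U \<Delta> x + \<Gamma>) x (full_config L)"
      using Kreach_full True s0 by (simp add: Kreach_def conf_empty conf_full)
    then show ?thesis using conf_full conf_in_configs by metis
  next
    case False
    obtain y where y: "y \<in> configs L" "reach (hamiltonian L U \<Delta> x + (\<Gamma> - U / 10)) x y"
      "hamiltonian L U \<Delta> y < hamiltonian L U \<Delta> x" using reach_descent[OF x(1) False x(2)] by blast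
    from configs_conf[OF x(1)] configs_conf[OF y(1)] obtain A B where "x = conf L A" "y = conf L B" by metis
    then have "reach (hamiltonian L U \<Delta> x + \<Gamma>) x y"
      using y(2) Kreach_mono[of _ A B "hamiltonian L U \<Delta> x + \<Gamma>"] U_pos by (simp add: Kreach_def)
    then show ?thesis using y by blast
  qed
qed

end

theorem theorem2p3:
  fixes L :: nat and U \<Delta> :: real
    and M :: "real \<Rightarrow> 'w measure" and \<eta> :: "real \<Rightarrow> nat \<Rightarrow> 'w \<Rightarrow> config"
  assumes "L \<ge> 1"
    and "U > 0" and "U < \<Delta>" and "\<Delta> < 3 / 2 * U"
    and "3 * U - 2 * \<Delta> \<le> U / 100"
    and "r_arg U \<Delta> \<notin> \<int>"
    and "\<delta>_frac U \<Delta> \<noteq> 1 / 2"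
    and "int L > 2 * r_star U \<Delta> + 3"
    and "\<And>\<beta>. \<beta> > 0 \<Longrightarrow>
           markov_chain (configs L) (kawasaki_P L U \<Delta> \<beta>) (empty_config L) (M \<beta>) (\<eta> \<beta>)"
  shows "let \<tau> = (\<lambda>\<beta> \<omega>. ennreal_of_enat (hitting_time (\<eta> \<beta>) {full_config L} \<omega>));
             E\<tau> = (\<lambda>\<beta>. \<integral>\<^sup>+ \<omega>. \<tau> \<beta> \<omega> \<partial>M \<beta>);
             T = (\<lambda>\<beta>. Inf {n::nat. n \<ge> 1 \<and> \<P>(\<omega> in M \<beta>. \<tau> \<beta> \<omega> \<le> of_nat n) \<ge> 1 - exp (-1)});
             \<Gamma> = \<Gamma>_KHex U \<Delta>
         in (\<forall>\<epsilon>>0. ((\<lambda>\<beta>. \<P>(\<omega> in M \<beta>. ennreal (exp (\<beta> * (\<Gamma> - \<epsilon>))) < \<tau> \<beta> \<omega> \<and>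
                                          \<tau> \<beta> \<omega> < ennreal (exp (\<beta> * (\<Gamma> + \<epsilon>))))) \<longlongrightarrow> 1) at_top)
          \<and> (\<forall>\<^sub>F \<beta> in at_top. E\<tau> \<beta> < \<infinity>)
          \<and> ((\<lambda>\<beta>. 1 / \<beta> * ln (enn2real (E\<tau> \<beta>))) \<longlongrightarrow> \<Gamma>) at_top
          \<and> (\<forall>t>0. ((\<lambda>\<beta>. \<P>(\<omega> in M \<beta>. \<tau> \<beta> \<omega> > ennreal (t * real (T \<beta>)))) \<longlongrightarrow> exp (- t)) at_top)
          \<and> ((\<lambda>\<beta>. E\<tau> \<beta> / of_nat (T \<beta>)) \<longlongrightarrow> 1) at_top"
proof -
  interpret kawasaki_hex L U \<Delta> using assms by unfold_locales
  interpret metastable "configs L" "hamiltonian L U \<Delta>" E "1 / real (card (obonds L))" "kawasaki_P L U \<Delta>"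
    "empty_config L" "full_config L" "\<Gamma>_KHex U \<Delta>" "\<Gamma>_KHex U \<Delta> - U / 10"
    by (rule metastable_kawasaki[unfolded \<Gamma>_def])
  let ?\<tau> = "\<lambda>\<beta> \<omega>. ennreal_of_enat (hitting_time (\<eta> \<beta>) {full_config L} \<omega>)"
  let ?T = "\<lambda>\<beta>. Inf {n::nat. n \<ge> 1 \<and> \<P>(\<omega> in M \<beta>. ?\<tau> \<beta> \<omega> \<le> of_nat n) \<ge> 1 - exp (-1)}"
  \<comment> \<open>The two time scales are identified for \<open>\<beta> > 0\<close>, so the limits
    are transferred along eventual equality.\<close>
  have T: "\<forall>\<^sub>F \<beta> in at_top. T \<beta> = ?T \<beta>"
    using eventually_gt_at_top[of 0] by eventually_elim (rule T_eq[OF assms(9), symmetric])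
  have "\<forall>t>0. ((\<lambda>\<beta>. \<P>(\<omega> in M \<beta>. ?\<tau> \<beta> \<omega> > ennreal (t * real (?T \<beta>)))) \<longlongrightarrow> exp (- t)) at_top"
  proof (intro allI impI, rule Lim_transform_eventually)
    fix t :: real assume "t > 0"
    then show "((\<lambda>\<beta>. \<P>(\<omega> in M \<beta>. ?\<tau> \<beta> \<omega> > ennreal (t * real (T \<beta>)))) \<longlongrightarrow> exp (- t)) at_top"
      using metastable_exit(4)[OF assms(9)] by blast
    show "\<forall>\<^sub>F \<beta> in at_top. \<P>(\<omega> in M \<beta>. ?\<tau> \<beta> \<omega> > ennreal (t * real (T \<beta>))) = \<P>(\<omega> in M \<beta>. ?\<tau> \<beta> \<omega> > ennreal (t * real (?T \<beta>)))"
      using T by eventually_elim (simp only:)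
  qed
  moreover have "((\<lambda>\<beta>. (\<integral>\<^sup>+ \<omega>. ?\<tau> \<beta> \<omega> \<partial>M \<beta>) / of_nat (?T \<beta>)) \<longlongrightarrow> 1) at_top"
  proof (rule Lim_transform_eventually)
    show "((\<lambda>\<beta>. (\<integral>\<^sup>+ \<omega>. ?\<tau> \<beta> \<omega> \<partial>M \<beta>) / of_nat (T \<beta>)) \<longlongrightarrow> 1) at_top"
      by (rule metastable_exit(5)[OF assms(9)])
    show "\<forall>\<^sub>F \<beta> in at_top. (\<integral>\<^sup>+ \<omega>. ?\<tau> \<beta> \<omega> \<partial>M \<beta>) / of_nat (T \<beta>) = (\<integral>\<^sup>+ \<omega>. ?\<tau> \<beta> \<omega> \<partial>M \<beta>) / of_nat (?T \<beta>)"
      using T by eventually_elim (simp only:)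
  qed
  moreover note metastable_exit(1-3)[OF assms(9)]
  ultimately show ?thesis unfolding Let_def by blast
qed

end
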